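(* Let $E$ be a site. The classes of bicovering maps (as weak equivalences) and isofibrations (as fibrations) make $\mathrm{Fib}(E)$ a category of fibrant objects in the sense of K. S. Brown.
   Context: Sizes are handled with Grothendieck universes, left implicit; the axiom of choice is used. A site is a category $E$ with a Grothendieck topology; covering sieves of $S\in Ob(E)$ are called refinements of $S$ and are regarded as full subcategories $R\subset E_{/S}$. $\mathrm{Fib}(E)$: objects are Grothendieck fibrations $F\to E$; arrows are cartesian functors (functors over $E$ preserving cartesian arrows). $F_S$ is the fibre category over $S$. A map of $\mathrm{Fib}(E)$ is an isofibration if its underlying functor $p\colon A\to B$ is one: for every object $a$ of $A$ and isomorphism $\beta\colon p(a)\to b$ there is an isomorphism $\alpha\colon a\to a'$ with $p(\alpha)=\beta$. A map $u\colon F\to G$ of $\mathrm{Fib}(E)$ is bicovering if (i) for all $S\in Ob(E)$ and $x,x'\in Ob(F_S)$ the map of presheaves on $E_{/S}$, $\mathrm{Hom}_S(x,x')\to\mathrm{Hom}_S(u(x),u(x'))$, given on $f\colon T\to S$ by $F_T(f^*x,f^*x')\to G_T(f^*u(x),f^*u(x'))$, becomes an isomorphism after sheafification for the induced topology on $E_{/S}$; and (ii) for all $S\in Ob(E)$ and $y\in Ob(G_S)$ the set of maps $f\colon T\to S$ for which there is $x\in Ob(F_T)$ with $u(x)\cong f^*y$ in $G_T$ is a refinement of $S$. Equivalently (Giraud), $\mathbf{Cart}_E(u,X)\colon \mathbf{Cart}_E(G,X)\to\mathbf{Cart}_E(F,X)$ is an equivalence for every stack $X$, where $\mathbf{Cart}_E(F,G)$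 is the category of cartesian functors and natural transformations with components over identities, and $X$ is a stack if $\mathbf{Cart}_E(E_{/S},X)\to\mathbf{Cart}_E(R,X)$ is an equivalence for every $S$ and every refinement $R$ of $S$. A category of fibrant objects (Brown) is a category with finite products and a terminal object, with classes of weak equivalences and fibrations (trivial fibration = both) such that: isomorphisms are weak equivalences and weak equivalences have the two out of three property; fibrations are closed under composition and contain isomorphisms; pullbacks of fibrations along any map exist, and fibrations and trivial fibrations are stable under pullback; for every object $B$ the diagonal $B\to B\times B$ factors as a weak equivalence followed by a fibration; for every object $B$ the map to the terminal object is a fibration. *)

theory Defs
  imports "HOL-Library.FuncSet" "HOL-Library.Infinite_Typeclass"
begin

section \<open>Categories and functors\<close>

text \<open>The composite of \<open>f : a \<rightarrow> b\<close> and \<open>g : b \<rightarrow> c\<close> is written \<open>g \<cdot> f\<close>. Only the values of the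
  operations on the carriers matter; elsewhere they are unconstrained.\<close>

record ('o, 'm) precategory =
  Obj :: "'o set"
  Arr :: "'m set"
  Dom :: "'m \<Rightarrow> 'o"
  Cod :: "'m \<Rightarrow> 'o"
  Idt :: "'o \<Rightarrow> 'm"
  Comp :: "'m \<Rightarrow> 'm \<Rightarrow> 'm" (infixl "\<cdot>\<index>" 70)

definition hom :: "('o, 'm) precategory \<Rightarrow> 'o \<Rightarrow> 'o \<Rightarrow> 'm set" where
  "hom C a b = {f \<in> Arr C. Dom C f = a \<and> Cod C f = b}"

locale category =
  fixes C :: "('o, 'm) precategory" (structure)
  assumes Dom_in_Obj: "f \<in> Arr C \<Longrightarrow> Dom C f \<in> Obj C"
    and Cod_in_Obj: "f \<in> Arr C \<Longrightarrow> Cod C f \<in> Obj C"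
    and Idt_in_hom: "a \<in> Obj C \<Longrightarrow> Idt C a \<in> hom C a a"
    and Comp_in_hom: "\<lbrakk>f \<in> hom C a b; g \<in> hom C b c\<rbrakk> \<Longrightarrow> g \<cdot> f \<in> hom C a c"
    and Comp_Idt_right: "f \<in> hom C a b \<Longrightarrow> f \<cdot> Idt C a = f"
    and Comp_Idt_left: "f \<in> hom C a b \<Longrightarrow> Idt C b \<cdot> f = f"
    and Comp_assoc: "\<lbrakk>f \<in> hom C a b; g \<in> hom C b c; h \<in> hom C c d\<rbrakk>
      \<Longrightarrow> (h \<cdot> g) \<cdot> f = h \<cdot> (g \<cdot> f)"

definition is_iso :: "('o, 'm) precategory \<Rightarrow> 'm \<Rightarrow> bool" where
  "is_iso C f \<longleftrightarrow> f \<in> Arr C \<and>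
    (\<exists>g\<in>hom C (Cod C f) (Dom C f).
       g \<cdot>\<^bsub>C\<^esub> f = Idt C (Dom C f) \<and> f \<cdot>\<^bsub>C\<^esub> g = Idt C (Cod C f))"

definition isomorphic :: "('o, 'm) precategory \<Rightarrow> 'o \<Rightarrow> 'o \<Rightarrow> bool" where
  "isomorphic C a b \<longleftrightarrow> (\<exists>f\<in>hom C a b. is_iso C f)"

record ('o, 'm, 'p, 'n) functor_data =
  on_obj :: "'o \<Rightarrow> 'p"
  on_arr :: "'m \<Rightarrow> 'n"

definition is_functor ::
  "('o, 'm) precategory \<Rightarrow> ('p, 'n) precategory \<Rightarrow> ('o, 'm, 'p, 'n) functor_data \<Rightarrow> bool" where
  "is_functor A B u \<longleftrightarrow>
    (\<forall>a\<in>Obj A. on_obj u a \<in> Obj B) \<and>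
    (\<forall>a b. \<forall>f\<in>hom A a b. on_arr u f \<in> hom B (on_obj u a) (on_obj u b)) \<and>
    (\<forall>a\<in>Obj A. on_arr u (Idt A a) = Idt B (on_obj u a)) \<and>
    (\<forall>a b c. \<forall>f\<in>hom A a b. \<forall>g\<in>hom A b c.
       on_arr u (g \<cdot>\<^bsub>A\<^esub> f) = on_arr u g \<cdot>\<^bsub>B\<^esub> on_arr u f)"

section \<open>Limits and categories of fibrant objects\<close>

definition is_terminal :: "('o, 'm) precategory \<Rightarrow> 'o \<Rightarrow> bool" where
  "is_terminal C t \<longleftrightarrow> t \<in> Obj C \<and> (\<forall>a\<in>Obj C. \<exists>!f. f \<in> hom C a t)"

definition is_product ::
  "('o, 'm) precategory \<Rightarrow> 'i set \<Rightarrow> ('i \<Rightarrow> 'o) \<Rightarrow> 'o \<Rightarrow> ('i \<Rightarrow> 'm) \<Rightarrow> bool" where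
  "is_product C I X P \<pi> \<longleftrightarrow> P \<in> Obj C \<and> (\<forall>i\<in>I. \<pi> i \<in> hom C P (X i)) \<and>
    (\<forall>a\<in>Obj C. \<forall>f. (\<forall>i\<in>I. f i \<in> hom C a (X i)) \<longrightarrow>
       (\<exists>!k. k \<in> hom C a P \<and> (\<forall>i\<in>I. \<pi> i \<cdot>\<^bsub>C\<^esub> k = f i)))"

text \<open>\<open>is_pullback C p v v' p'\<close>: the square \<open>p \<cdot> v' = v \<cdot> p'\<close> is a pullback, so \<open>p'\<close> is the
  pullback of \<open>p\<close> along \<open>v\<close>.\<close>

definition is_pullback :: "('o, 'm) precategory \<Rightarrow> 'm \<Rightarrow> 'm \<Rightarrow> 'm \<Rightarrow> 'm \<Rightarrow> bool" where
  "is_pullback C p v v' p' \<longleftrightarrow>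
    p \<in> Arr C \<and> v \<in> Arr C \<and> v' \<in> Arr C \<and> p' \<in> Arr C \<and>
    Cod C p = Cod C v \<and> Cod C v' = Dom C p \<and> Cod C p' = Dom C v \<and> Dom C v' = Dom C p' \<and>
    p \<cdot>\<^bsub>C\<^esub> v' = v \<cdot>\<^bsub>C\<^esub> p' \<and>
    (\<forall>x. \<forall>f\<in>hom C x (Dom C p). \<forall>g\<in>hom C x (Dom C v). p \<cdot>\<^bsub>C\<^esub> f = v \<cdot>\<^bsub>C\<^esub> g \<longrightarrow>
       (\<exists>!k. k \<in> hom C x (Dom C v') \<and> v' \<cdot>\<^bsub>C\<^esub> k = f \<and> p' \<cdot>\<^bsub>C\<^esub> k = g))"

locale category_of_fibrant_objects = category C
  for C :: "('o, 'm) precategory" (structure) +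
  fixes W :: "'m set" and Fb :: "'m set"
  assumes W_subset: "W \<subseteq> Arr C"
    and Fb_subset: "Fb \<subseteq> Arr C"
    and terminal_exists: "\<exists>t. is_terminal C t"
    and finite_products_exist:
      "(\<And>i. i < n \<Longrightarrow> X i \<in> Obj C) \<Longrightarrow> \<exists>P \<pi>. is_product C {..<n::nat} X P \<pi>"
    and iso_in_W: "is_iso C f \<Longrightarrow> f \<in> W"
    and W_comp: "\<lbrakk>f \<in> hom C a b; g \<in> hom C b c; f \<in> W; g \<in> W\<rbrakk> \<Longrightarrow> g \<cdot> f \<in> W"
    and W_cancel_left: "\<lbrakk>f \<in> hom C a b; g \<in> hom C b c; g \<in> W; g \<cdot> f \<in> W\<rbrakk> \<Longrightarrow> f \<in> W"
    and W_cancel_right: "\<lbrakk>f \<in> hom C a b; g \<in> hom C b c; f \<in> W; g \<cdot> f \<in> W\<rbrakk> \<Longrightarrow> g \<in> W"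
    and iso_in_Fb: "is_iso C f \<Longrightarrow> f \<in> Fb"
    and Fb_comp: "\<lbrakk>f \<in> hom C a b; g \<in> hom C b c; f \<in> Fb; g \<in> Fb\<rbrakk> \<Longrightarrow> g \<cdot> f \<in> Fb"
    and Fb_pullback_exists:
      "\<lbrakk>p \<in> Fb; v \<in> Arr C; Cod C v = Cod C p\<rbrakk> \<Longrightarrow> \<exists>v' p'. is_pullback C p v v' p'"
    and Fb_pullback: "\<lbrakk>is_pullback C p v v' p'; p \<in> Fb\<rbrakk> \<Longrightarrow> p' \<in> Fb"
    and trivial_Fb_pullback: "\<lbrakk>is_pullback C p v v' p'; p \<in> W \<inter> Fb\<rbrakk> \<Longrightarrow> p' \<in> W \<inter> Fb"
    and diagonal_factors:
      "\<lbrakk>b \<in> Obj C; is_product C {..<2::nat} (\<lambda>_. b) P \<pi>;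
        d \<in> hom C b P; \<And>i. i < 2 \<Longrightarrow> \<pi> i \<cdot> d = Idt C b\<rbrakk>
       \<Longrightarrow> \<exists>b' s q. s \<in> hom C b b' \<and> q \<in> hom C b' P \<and> s \<in> W \<and> q \<in> Fb \<and> q \<cdot> s = d"
    and to_terminal_in_Fb: "\<lbrakk>is_terminal C t; f \<in> hom C b t\<rbrakk> \<Longrightarrow> f \<in> Fb"

section \<open>Sites\<close>

definition is_sieve :: "('o, 'm) precategory \<Rightarrow> 'o \<Rightarrow> 'm set \<Rightarrow> bool" where
  "is_sieve C S R \<longleftrightarrow> R \<subseteq> {f \<in> Arr C. Cod C f = S} \<and>
    (\<forall>f\<in>R. \<forall>h\<in>Arr C. Cod C h = Dom C f \<longrightarrow> f \<cdot>\<^bsub>C\<^esub> h \<in> R)"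

definition pull_sieve :: "('o, 'm) precategory \<Rightarrow> 'm \<Rightarrow> 'm set \<Rightarrow> 'm set" where
  "pull_sieve C f R = {h \<in> Arr C. Cod C h = Dom C f \<and> f \<cdot>\<^bsub>C\<^esub> h \<in> R}"

text \<open>\<open>J S\<close> is the set of refinements (covering sieves) of \<open>S\<close>.\<close>

locale site = category E
  for E :: "('o, 'm) precategory" +
  fixes J :: "'o \<Rightarrow> 'm set set"
  assumes covering_is_sieve: "\<lbrakk>S \<in> Obj E; R \<in> J S\<rbrakk> \<Longrightarrow> is_sieve E S R"
    and maximal_covering: "S \<in> Obj E \<Longrightarrow> {f \<in> Arr E. Cod E f = S} \<in> J S"
    and pull_covering:
      "\<lbrakk>f \<in> Arr E; R \<in> J (Cod E f)\<rbrakk> \<Longrightarrow> pull_sieve E f R \<in> J (Dom E f)"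
    and local_covering:
      "\<lbrakk>S \<in> Obj E; R \<in> J S; is_sieve E S R'; \<And>f. f \<in> R \<Longrightarrow> pull_sieve E f R' \<in> J (Dom E f)\<rbrakk>
       \<Longrightarrow> R' \<in> J S"

text \<open>In the slice over \<open>S\<close> the pair \<open>(f, h)\<close> stands for \<open>h\<close> viewed as an arrow from \<open>f \<cdot> h\<close>
  to \<open>f\<close>.\<close>

definition slice :: "('o, 'm) precategory \<Rightarrow> 'o \<Rightarrow> ('m, 'm \<times> 'm) precategory" where
  "slice E S =
    \<lparr>Obj = {f \<in> Arr E. Cod E f = S},
     Arr = {(f, h). f \<in> Arr E \<and> Cod E f = S \<and> h \<in> Arr E \<and> Cod E h = Dom E f},
     Dom = (\<lambda>(f, h). f \<cdot>\<^bsub>E\<^esub> h),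
     Cod = fst,
     Idt = (\<lambda>f. (f, Idt E (Dom E f))),
     Comp = (\<lambda>(f, h) (f', h'). (f, h \<cdot>\<^bsub>E\<^esub> h'))\<rparr>"

text \<open>The induced topology: a sieve of the slice covers iff its image under the forgetful functor
  covers.\<close>

definition slice_topology ::
  "('o, 'm) precategory \<Rightarrow> ('o \<Rightarrow> 'm set set) \<Rightarrow> 'o \<Rightarrow> 'm \<Rightarrow> ('m \<times> 'm) set set" where
  "slice_topology E J S f = {R. is_sieve (slice E S) f R \<and> snd ` R \<in> J (Dom E f)}"

section \<open>Presheaves and sheafification\<close>

text \<open>For \<open>h : a \<rightarrow> b\<close>, the restriction \<open>Res P h\<close> maps \<open>Sec P b\<close> to \<open>Sec P a\<close>.\<close>

record ('o, 'm, 'p) presheaf =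
  Sec :: "'o \<Rightarrow> 'p set"
  Res :: "'m \<Rightarrow> 'p \<Rightarrow> 'p"

text \<open>The plus construction: the sections over \<open>S\<close> are the elements of the colimit of
  \<open>Hom(R, P)\<close> over the refinements \<open>R\<close> of \<open>S\<close>, that is, classes of matching families modulo
  agreement on a common refinement. Sheafification is the plus construction applied twice.\<close>

definition matching_families ::
  "('o, 'm) precategory \<Rightarrow> ('o \<Rightarrow> 'm set set) \<Rightarrow> ('o, 'm, 'p) presheaf \<Rightarrow> 'o
   \<Rightarrow> ('m set \<times> ('m \<Rightarrow> 'p)) set" where
  "matching_families C J P S =
    {(R, s). R \<in> J S \<and> s \<in> (\<Pi>\<^sub>E f\<in>R. Sec P (Dom C f)) \<and>
      (\<forall>f\<in>R. \<forall>h\<in>Arr C. Cod C h = Dom C f \<longrightarrow> s (f \<cdot>\<^bsub>C\<^esub> h) = Res P h (s f))}"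

definition plus_rel ::
  "('o, 'm) precategory \<Rightarrow> ('o \<Rightarrow> 'm set set) \<Rightarrow> ('o, 'm, 'p) presheaf \<Rightarrow> 'o
   \<Rightarrow> (('m set \<times> ('m \<Rightarrow> 'p)) \<times> ('m set \<times> ('m \<Rightarrow> 'p))) set" where
  "plus_rel C J P S =
    {((R, s), (R', s')). (R, s) \<in> matching_families C J P S \<and>
      (R', s') \<in> matching_families C J P S \<and>
      (\<exists>R''\<in>J S. R'' \<subseteq> R \<inter> R' \<and> (\<forall>f\<in>R''. s f = s' f))}"

definition plus ::
  "('o, 'm) precategory \<Rightarrow> ('o \<Rightarrow> 'm set set) \<Rightarrow> ('o, 'm, 'p) presheaf
   \<Rightarrow> ('o, 'm, ('m set \<times> ('m \<Rightarrow> 'p)) set) presheaf" where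
  "plus C J P =
    \<lparr>Sec = (\<lambda>S. matching_families C J P S // plus_rel C J P S),
     Res = (\<lambda>h X. plus_rel C J P (Dom C h) ``
       ((\<lambda>(R, s). (pull_sieve C h R, \<lambda>g\<in>pull_sieve C h R. s (h \<cdot>\<^bsub>C\<^esub> g))) ` X))\<rparr>"

definition plus_map ::
  "('o, 'm) precategory \<Rightarrow> ('o \<Rightarrow> 'm set set) \<Rightarrow> ('o, 'm, 'q) presheaf \<Rightarrow> ('o \<Rightarrow> 'p \<Rightarrow> 'q)
   \<Rightarrow> 'o \<Rightarrow> ('m set \<times> ('m \<Rightarrow> 'p)) set \<Rightarrow> ('m set \<times> ('m \<Rightarrow> 'q)) set" where
  "plus_map C J Q \<alpha> S X =
    plus_rel C J Q S `` ((\<lambda>(R, s). (R, \<lambda>f\<in>R. \<alpha> (Dom C f) (s f))) ` X)"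

definition sheafification where
  "sheafification C J P = plus C J (plus C J P)"

definition sheafification_map where
  "sheafification_map C J Q \<alpha> = plus_map C J (plus C J Q) (plus_map C J Q \<alpha>)"

definition iso_after_sheafification ::
  "('o, 'm) precategory \<Rightarrow> ('o \<Rightarrow> 'm set set) \<Rightarrow> ('o, 'm, 'p) presheaf \<Rightarrow> ('o, 'm, 'q) presheaf
   \<Rightarrow> ('o \<Rightarrow> 'p \<Rightarrow> 'q) \<Rightarrow> bool" where
  "iso_after_sheafification C J P Q \<alpha> \<longleftrightarrow>
    (\<forall>S\<in>Obj C. bij_betw (sheafification_map C J Q \<alpha> S)
       (Sec (sheafification C J P) S) (Sec (sheafification C J Q) S))"

section \<open>Fibrations\<close>

record ('o, 'm, 'x, 'y) fibration =
  Total :: "('x, 'y) precategory"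
  Proj :: "('x, 'y, 'o, 'm) functor_data"

definition is_cartesian ::
  "('o, 'm) precategory \<Rightarrow> ('o, 'm, 'x, 'y) fibration \<Rightarrow> 'y \<Rightarrow> bool" where
  "is_cartesian E F c \<longleftrightarrow> c \<in> Arr (Total F) \<and>
    (\<forall>z. \<forall>g\<in>hom (Total F) z (Cod (Total F) c).
     \<forall>h\<in>hom E (on_obj (Proj F) z) (on_obj (Proj F) (Dom (Total F) c)).
       on_arr (Proj F) g = on_arr (Proj F) c \<cdot>\<^bsub>E\<^esub> h \<longrightarrow>
       (\<exists>!k. k \<in> hom (Total F) z (Dom (Total F) c) \<and>
          on_arr (Proj F) k = h \<and> c \<cdot>\<^bsub>Total F\<^esub> k = g))"

definition is_fibration ::
  "('o, 'm) precategory \<Rightarrow> ('o, 'm, 'x, 'y) fibration \<Rightarrow> bool" where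
  "is_fibration E F \<longleftrightarrow> category (Total F) \<and> is_functor (Total F) E (Proj F) \<and>
    (\<forall>x\<in>Obj (Total F). \<forall>f\<in>Arr E. Cod E f = on_obj (Proj F) x \<longrightarrow>
       (\<exists>c. is_cartesian E F c \<and> Cod (Total F) c = x \<and> on_arr (Proj F) c = f))"

definition fibre ::
  "('o, 'm) precategory \<Rightarrow> ('o, 'm, 'x, 'y) fibration \<Rightarrow> 'o \<Rightarrow> ('x, 'y) precategory" where
  "fibre E F S =
    (Total F)\<lparr>Obj := {x \<in> Obj (Total F). on_obj (Proj F) x = S},
              Arr := {a \<in> Arr (Total F). on_arr (Proj F) a = Idt E S}\<rparr>"

definition is_cartesian_functor ::
  "('o, 'm) precategory \<Rightarrow> ('o, 'm, 'x, 'y) fibration \<Rightarrow> ('o, 'm, 'v, 'w) fibration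
   \<Rightarrow> ('x, 'y, 'v, 'w) functor_data \<Rightarrow> bool" where
  "is_cartesian_functor E F G u \<longleftrightarrow> is_functor (Total F) (Total G) u \<and>
    (\<forall>x\<in>Obj (Total F). on_obj (Proj G) (on_obj u x) = on_obj (Proj F) x) \<and>
    (\<forall>a\<in>Arr (Total F). on_arr (Proj G) (on_arr u a) = on_arr (Proj F) a) \<and>
    (\<forall>c. is_cartesian E F c \<longrightarrow> is_cartesian E G (on_arr u c))"

text \<open>The category of fibrations over \<open>E\<close>. The type \<open>'u\<close> plays the role of the universe: the
  objects and arrows of \<open>E\<close> and of all the total categories are taken from it. Underlying functors
  of arrows are required to be \<open>undefined\<close> off the carriers, so that equality of arrows is equality
  of functors.\<close>

record ('o, 'm, 'x, 'y) fibration_arrow =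
  Src :: "('o, 'm, 'x, 'y) fibration"
  Tgt :: "('o, 'm, 'x, 'y) fibration"
  Fun :: "('x, 'y, 'x, 'y) functor_data"

definition Fib :: "('u, 'u) precategory
    \<Rightarrow> (('u, 'u, 'u, 'u) fibration, ('u, 'u, 'u, 'u) fibration_arrow) precategory" where
  "Fib E =
    \<lparr>Obj = {F. is_fibration E F},
     Arr = {u. is_fibration E (Src u) \<and> is_fibration E (Tgt u) \<and>
       is_cartesian_functor E (Src u) (Tgt u) (Fun u) \<and>
       on_obj (Fun u) \<in> extensional (Obj (Total (Src u))) \<and>
       on_arr (Fun u) \<in> extensional (Arr (Total (Src u)))},
     Dom = Src,
     Cod = Tgt,
     Idt = (\<lambda>F. \<lparr>Src = F, Tgt = F,
       Fun = \<lparr>on_obj = (\<lambda>x\<in>Obj (Total F). x), on_arr = (\<lambda>a\<in>Arr (Total F). a)\<rparr>\<rparr>),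
     Comp = (\<lambda>v u. \<lparr>Src = Src u, Tgt = Tgt v,
       Fun = \<lparr>on_obj = (\<lambda>x\<in>Obj (Total (Src u)). on_obj (Fun v) (on_obj (Fun u) x)),
              on_arr = (\<lambda>a\<in>Arr (Total (Src u)). on_arr (Fun v) (on_arr (Fun u) a))\<rparr>\<rparr>)\<rparr>"

definition is_isofibration ::
  "('x, 'y) precategory \<Rightarrow> ('v, 'w) precategory \<Rightarrow> ('x, 'y, 'v, 'w) functor_data \<Rightarrow> bool" where
  "is_isofibration A B p \<longleftrightarrow>
    (\<forall>a\<in>Obj A. \<forall>\<beta>. is_iso B \<beta> \<and> Dom B \<beta> = on_obj p a \<longrightarrow>
       (\<exists>\<alpha>. is_iso A \<alpha> \<and> Dom A \<alpha> = a \<and> on_arr p \<alpha> = \<beta>))"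

definition isofibrations :: "('u, 'u) precategory \<Rightarrow> ('u, 'u, 'u, 'u) fibration_arrow set" where
  "isofibrations E = {p \<in> Arr (Fib E). is_isofibration (Total (Src p)) (Total (Tgt p)) (Fun p)}"

section \<open>Bicovering maps\<close>

text \<open>A chosen cartesian arrow over \<open>f\<close> with codomain \<open>x\<close>; its domain is the inverse image
  \<open>f\<^sup>*x\<close>.\<close>

definition lift :: "('o, 'm) precategory \<Rightarrow> ('o, 'm, 'x, 'y) fibration \<Rightarrow> 'm \<Rightarrow> 'x \<Rightarrow> 'y" where
  "lift E F f x =
    (SOME c. is_cartesian E F c \<and> Cod (Total F) c = x \<and> on_arr (Proj F) c = f)"

definition inverse_image ::
  "('o, 'm) precategory \<Rightarrow> ('o, 'm, 'x, 'y) fibration \<Rightarrow> 'm \<Rightarrow> 'x \<Rightarrow> 'x" where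
  "inverse_image E F f x = Dom (Total F) (lift E F f x)"

text \<open>The canonical arrow \<open>(f \<cdot> h)\<^sup>*x \<rightarrow> f\<^sup>*x\<close> over \<open>h\<close>.\<close>

definition transition ::
  "('o, 'm) precategory \<Rightarrow> ('o, 'm, 'x, 'y) fibration \<Rightarrow> 'm \<Rightarrow> 'm \<Rightarrow> 'x \<Rightarrow> 'y" where
  "transition E F f h x =
    (THE k. k \<in> hom (Total F) (inverse_image E F (f \<cdot>\<^bsub>E\<^esub> h) x) (inverse_image E F f x) \<and>
       on_arr (Proj F) k = h \<and>
       lift E F f x \<cdot>\<^bsub>Total F\<^esub> k = lift E F (f \<cdot>\<^bsub>E\<^esub> h) x)"

text \<open>The presheaf \<open>Hom\<^sub>S(x, x')\<close> on the slice over \<open>S\<close>. Restriction along \<open>h\<close> is \<open>h\<^sup>*\<close>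
  composed with the canonical isomorphisms between \<open>h\<^sup>*f\<^sup>*\<close> and \<open>(f \<cdot> h)\<^sup>*\<close>.\<close>

definition Hom_presheaf ::
  "('o, 'm) precategory \<Rightarrow> ('o, 'm, 'x, 'y) fibration \<Rightarrow> 'x \<Rightarrow> 'x
   \<Rightarrow> ('m, 'm \<times> 'm, 'y) presheaf" where
  "Hom_presheaf E F x x' =
    \<lparr>Sec = (\<lambda>f. hom (fibre E F (Dom E f)) (inverse_image E F f x) (inverse_image E F f x')),
     Res = (\<lambda>(f, h) \<phi>. THE \<psi>.
       \<psi> \<in> hom (fibre E F (Dom E h))
             (inverse_image E F (f \<cdot>\<^bsub>E\<^esub> h) x) (inverse_image E F (f \<cdot>\<^bsub>E\<^esub> h) x') \<and>
       transition E F f h x' \<cdot>\<^bsub>Total F\<^esub> \<psi> = \<phi> \<cdot>\<^bsub>Total F\<^esub> transition E F f h x)\<rparr>"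

text \<open>The canonical isomorphism \<open>u(f\<^sup>*x) \<rightarrow> f\<^sup>*u(x)\<close>.\<close>

definition comparison ::
  "('o, 'm) precategory \<Rightarrow> ('o, 'm, 'x, 'y) fibration \<Rightarrow> ('o, 'm, 'v, 'w) fibration
   \<Rightarrow> ('x, 'y, 'v, 'w) functor_data \<Rightarrow> 'm \<Rightarrow> 'x \<Rightarrow> 'w" where
  "comparison E F G u f x =
    (THE k. k \<in> hom (fibre E G (Dom E f))
                  (on_obj u (inverse_image E F f x)) (inverse_image E G f (on_obj u x)) \<and>
       lift E G f (on_obj u x) \<cdot>\<^bsub>Total G\<^esub> k = on_arr u (lift E F f x))"

definition Hom_presheaf_map ::
  "('o, 'm) precategory \<Rightarrow> ('o, 'm, 'x, 'y) fibration \<Rightarrow> ('o, 'm, 'v, 'w) fibration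
   \<Rightarrow> ('x, 'y, 'v, 'w) functor_data \<Rightarrow> 'x \<Rightarrow> 'x \<Rightarrow> 'm \<Rightarrow> 'y \<Rightarrow> 'w" where
  "Hom_presheaf_map E F G u x x' f \<phi> =
    (THE \<psi>. \<psi> \<in> hom (fibre E G (Dom E f))
                   (inverse_image E G f (on_obj u x)) (inverse_image E G f (on_obj u x')) \<and>
       \<psi> \<cdot>\<^bsub>Total G\<^esub> comparison E F G u f x = comparison E F G u f x' \<cdot>\<^bsub>Total G\<^esub> on_arr u \<phi>)"

definition is_bicovering ::
  "('o, 'm) precategory \<Rightarrow> ('o \<Rightarrow> 'm set set) \<Rightarrow> ('o, 'm, 'x, 'y) fibration
   \<Rightarrow> ('o, 'm, 'v, 'w) fibration \<Rightarrow> ('x, 'y, 'v, 'w) functor_data \<Rightarrow> bool" where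
  "is_bicovering E J F G u \<longleftrightarrow>
    (\<forall>S\<in>Obj E. \<forall>x\<in>Obj (fibre E F S). \<forall>x'\<in>Obj (fibre E F S).
       iso_after_sheafification (slice E S) (slice_topology E J S)
         (Hom_presheaf E F x x') (Hom_presheaf E G (on_obj u x) (on_obj u x'))
         (Hom_presheaf_map E F G u x x')) \<and>
    (\<forall>S\<in>Obj E. \<forall>y\<in>Obj (fibre E G S).
       {f \<in> Arr E. Cod E f = S \<and>
          (\<exists>x\<in>Obj (fibre E F (Dom E f)).
             isomorphic (fibre E G (Dom E f)) (on_obj u x) (inverse_image E G f y))} \<in> J S)"

definition bicovering_maps ::
  "('u, 'u) precategory \<Rightarrow> ('u \<Rightarrow> 'u set set) \<Rightarrow> ('u, 'u, 'u, 'u) fibration_arrow set" where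
  "bicovering_maps E J = {u \<in> Arr (Fib E). is_bicovering E J (Src u) (Tgt u) (Fun u)}"

end

theory Submission
  imports Defs
begin

text \<open>A map of presheaves becomes an isomorphism after two plus constructions iff it is locally
  injective and locally surjective. Since inverse images are determined by cartesian arrows up to a
  vertical isomorphism, a map of fibrations is therefore bicovering iff, locally on \<open>E\<close>, it is
  faithful, full and essentially surjective, which can be said with cartesian arrows alone, without
  choosing inverse images and for arrows that need not be vertical. In this form the two out of three
  property and the stability under pullback are diagram chases.

  Along an isofibration the strict fibre product of the total categories is again a fibration. The
  path object of \<open>B\<close> is the category of vertical isomorphisms of \<open>B\<close>: its source functor is an
  equivalence with section the constant paths, and source and target together form an isofibration.
  The terminal object is \<open>E\<close> itself, so finite products are iterated pullbacks.\<close>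

section \<open>Categories\<close>

text \<open>Sheafification is tractable through local bijectivity because the unit of the plus
  construction is itself locally injective and locally surjective, so a map and its plus
  construction have these properties together. In two out of three the delicate case is the
  cancellation of \<open>v\<close> from a composite \<open>v u\<close>: a cartesian arrow lifts
  locally through \<open>v\<close>, but the lift need not be cartesian, and only local faithfulness
  and fullness of \<open>v\<close> make it so after a further refinement. Isofibrations matter
  because cartesian functors preserve inverse images only up to isomorphism, while pullbacks in
  \<open>Fib E\<close> are strict: cartesian lifts in the two factors have isomorphic, not equal,
  images, and to correct one of them that isomorphism has to be lifted. Paths are vertical because
  the product of \<open>B\<close> with itself is formed over \<open>E\<close>, so that both ends
  must lie over the same object, and both sides of a square over the same arrow. Brown's axioms
  speak of arbitrary pullbacks and products, whence the comparison of the constructed ones with any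
  others.\<close>

lemma homD:
  assumes "f \<in> hom C a b"
  shows "f \<in> Arr C" "Dom C f = a" "Cod C f = b"
  using assms by (simp_all add: hom_def)

context category
begin

text \<open>The axioms mention the endpoints of hom sets, which do not occur in the composites. With
  side conditions on \<open>Dom\<close> and \<open>Cod\<close> they become rewrite rules whose
  premises the simplifier can solve.\<close>

lemma Comp_Arr [simp]:
    "\<lbrakk>f \<in> Arr C; g \<in> Arr C; Cod C f = Dom C g\<rbrakk> \<Longrightarrow> g \<cdot> f \<in> Arr C"
  and Dom_Comp [simp]:
    "\<lbrakk>f \<in> Arr C; g \<in> Arr C; Cod C f = Dom C g\<rbrakk> \<Longrightarrow> Dom C (g \<cdot> f) = Dom C f"
  and Cod_Comp [simp]:
    "\<lbrakk>f \<in> Arr C; g \<in> Arr C; Cod C f = Dom C g\<rbrakk> \<Longrightarrow> Cod C (g \<cdot> f) = Cod C g"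
  using Comp_in_hom[of f "Dom C f" "Cod C f" g "Cod C g"] by (auto simp: hom_def)

lemma Idt_Arr [simp]: "a \<in> Obj C \<Longrightarrow> Idt C a \<in> Arr C"
  and Dom_Idt [simp]: "a \<in> Obj C \<Longrightarrow> Dom C (Idt C a) = a"
  and Cod_Idt [simp]: "a \<in> Obj C \<Longrightarrow> Cod C (Idt C a) = a"
  using Idt_in_hom[of a] by (auto simp: hom_def)

lemma Comp_Idt_Dom [simp]: "\<lbrakk>f \<in> Arr C; Dom C f = a\<rbrakk> \<Longrightarrow> f \<cdot> Idt C a = f"
  and Comp_Idt_Cod [simp]: "\<lbrakk>f \<in> Arr C; Cod C f = a\<rbrakk> \<Longrightarrow> Idt C a \<cdot> f = f"
  using Comp_Idt_right Comp_Idt_left by (auto simp: hom_def)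

lemma Comp_assoc_Arr [simp]:
  "\<lbrakk>f \<in> Arr C; g \<in> Arr C; h \<in> Arr C; Cod C f = Dom C g; Cod C g = Dom C h\<rbrakk>
   \<Longrightarrow> (h \<cdot> g) \<cdot> f = h \<cdot> (g \<cdot> f)"
  using Comp_assoc by (auto simp: hom_def)

declare Dom_in_Obj [simp] Cod_in_Obj [simp]

lemma hom_Obj: "f \<in> hom C a b \<Longrightarrow> a \<in> Obj C" "f \<in> hom C a b \<Longrightarrow> b \<in> Obj C"
  by (auto simp: hom_def)

lemma is_isoI:
  assumes "f \<in> Arr C" "g \<in> Arr C" "Dom C g = Cod C f" "Cod C g = Dom C f"
    "g \<cdot> f = Idt C (Dom C f)" "f \<cdot> g = Idt C (Cod C f)"
  shows "is_iso C f"
  using assms by (auto simp: is_iso_def hom_def)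

lemma is_isoE:
  assumes "is_iso C f"
  obtains g where "f \<in> Arr C" "g \<in> Arr C" "Dom C g = Cod C f" "Cod C g = Dom C f"
    "g \<cdot> f = Idt C (Dom C f)" "f \<cdot> g = Idt C (Cod C f)" "is_iso C g"
  using assms by (auto simp: is_iso_def hom_def)

lemma is_iso_Idt: "a \<in> Obj C \<Longrightarrow> is_iso C (Idt C a)"
  by (rule is_isoI[of _ "Idt C a"]) auto

lemma is_iso_Comp:
  assumes "is_iso C f" "is_iso C g" "Cod C f = Dom C g"
  shows "is_iso C (g \<cdot> f)"
proof -
  obtain f' where f: "f \<in> Arr C" "f' \<in> Arr C" "Dom C f' = Cod C f" "Cod C f' = Dom C f"
    "f' \<cdot> f = Idt C (Dom C f)" "f \<cdot> f' = Idt C (Cod C f)" using is_isoE[OF assms(1)] .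
  obtain g' where g: "g \<in> Arr C" "g' \<in> Arr C" "Dom C g' = Cod C g" "Cod C g' = Dom C g"
    "g' \<cdot> g = Idt C (Dom C g)" "g \<cdot> g' = Idt C (Cod C g)" using is_isoE[OF assms(2)] .
  have "(f' \<cdot> g') \<cdot> (g \<cdot> f) = f' \<cdot> ((g' \<cdot> g) \<cdot> f)"
    using f(1-4) g(1-4) assms(3) by simp
  moreover have "(g \<cdot> f) \<cdot> (f' \<cdot> g') = g \<cdot> ((f \<cdot> f') \<cdot> g')"
    using f(1-4) g(1-4) assms(3) by simp
  ultimately show ?thesis
    using f g assms(3) by (intro is_isoI[of _ "f' \<cdot> g'"]) auto
qed

lemma iso_cancel_left:
  assumes "is_iso C g" "a \<in> Arr C" "b \<in> Arr C" "Cod C a = Dom C g" "Cod C b = Dom C g"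
    "g \<cdot> a = g \<cdot> b"
  shows "a = b"
proof -
  obtain g' where g: "g \<in> Arr C" "g' \<in> Arr C" "Dom C g' = Cod C g" "Cod C g' = Dom C g"
    "g' \<cdot> g = Idt C (Dom C g)" "g \<cdot> g' = Idt C (Cod C g)" using is_isoE[OF assms(1)] .
  have "a = (g' \<cdot> g) \<cdot> a" "b = (g' \<cdot> g) \<cdot> b" using g assms by simp_all
  then show ?thesis using g(1-4) assms by simp
qed

lemma iso_cancel_right:
  assumes "is_iso C g" "a \<in> Arr C" "b \<in> Arr C" "Dom C a = Cod C g" "Dom C b = Cod C g"
    "a \<cdot> g = b \<cdot> g"
  shows "a = b"
proof -
  obtain g' where g: "g \<in> Arr C" "g' \<in> Arr C" "Dom C g' = Cod C g" "Cod C g' = Dom C g"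
    "g' \<cdot> g = Idt C (Dom C g)" "g \<cdot> g' = Idt C (Cod C g)" using is_isoE[OF assms(1)] .
  have "a = a \<cdot> (g \<cdot> g')" "b = b \<cdot> (g \<cdot> g')" using g assms by simp_all
  moreover have "a \<cdot> (g \<cdot> g') = (a \<cdot> g) \<cdot> g'" "b \<cdot> (g \<cdot> g') = (b \<cdot> g) \<cdot> g'"
    using g(1-4) assms(1-5) by simp_all
  ultimately show ?thesis using assms(6) by metis
qed

end

section \<open>Properties holding locally on a site\<close>

text \<open>Coverings are handled through predicates: the arrows satisfying \<open>Q\<close> must
  themselves form a refinement, not merely contain one. The two agree when \<open>Q\<close> is
  closed under precomposition (\<open>locally_mono\<close>).\<close>

definition locally ::
  "('o, 'm) precategory \<Rightarrow> ('o \<Rightarrow> 'm set set) \<Rightarrow> 'o \<Rightarrow> ('m \<Rightarrow> bool) \<Rightarrow> bool" where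
  "locally C J S Q \<longleftrightarrow> {f \<in> Arr C. Cod C f = S \<and> Q f} \<in> J S"

text \<open>The part of \<open>is_sieve\<close> that does not hold by construction for the arrows
  into \<open>S\<close> satisfying \<open>Q\<close>; it has to be checked before a local property
  may be enlarged.\<close>

definition precomp_closed :: "('o, 'm) precategory \<Rightarrow> 'o \<Rightarrow> ('m \<Rightarrow> bool) \<Rightarrow> bool" where
  "precomp_closed C S Q \<longleftrightarrow> (\<forall>f\<in>Arr C. \<forall>h\<in>Arr C. Cod C f = S \<and> Q f \<and> Cod C h = Dom C f \<longrightarrow>
     Q (f \<cdot>\<^bsub>C\<^esub> h))"

lemma precomp_closedI:
  "(\<And>f h. \<lbrakk>f \<in> Arr C; Cod C f = S; Q f; h \<in> Arr C; Cod C h = Dom C f\<rbrakk> \<Longrightarrow> Q (f \<cdot>\<^bsub>C\<^esub> h))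
   \<Longrightarrow> precomp_closed C S Q"
  by (auto simp: precomp_closed_def)

lemma precomp_closedD:
  "\<lbrakk>precomp_closed C S Q; f \<in> Arr C; Cod C f = S; Q f; h \<in> Arr C; Cod C h = Dom C f\<rbrakk>
   \<Longrightarrow> Q (f \<cdot>\<^bsub>C\<^esub> h)"
  by (auto simp: precomp_closed_def)

context site
begin

lemma locally_stable: "\<lbrakk>locally E J S Q; S \<in> Obj E\<rbrakk> \<Longrightarrow> precomp_closed E S Q"
  using covering_is_sieve[of S "{f \<in> Arr E. Cod E f = S \<and> Q f}"]
  by (auto simp: locally_def precomp_closed_def is_sieve_def)

lemma locally_sieve: "\<lbrakk>S \<in> Obj E; R \<in> J S\<rbrakk> \<Longrightarrow> locally E J S (\<lambda>f. f \<in> R)"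
proof -
  assume *: "S \<in> Obj E" "R \<in> J S"
  then have "{f \<in> Arr E. Cod E f = S \<and> f \<in> R} = R"
    using covering_is_sieve[OF *] by (auto simp: is_sieve_def)
  then show ?thesis using * by (simp add: locally_def)
qed

lemma locally_pull:
  assumes "locally E J (Cod E f) Q" "f \<in> Arr E"
  shows "locally E J (Dom E f) (\<lambda>h. Q (f \<cdot>\<^bsub>E\<^esub> h))"
proof -
  have "pull_sieve E f {g \<in> Arr E. Cod E g = Cod E f \<and> Q g} =
      {h \<in> Arr E. Cod E h = Dom E f \<and> Q (f \<cdot>\<^bsub>E\<^esub> h)}"
    using assms(2) by (auto simp: pull_sieve_def)
  then show ?thesis
    using pull_covering[OF assms(2) assms(1)[unfolded locally_def]] by (simp add: locally_def)
qed

lemma locally_all: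
  assumes "S \<in> Obj E" "\<And>f. \<lbrakk>f \<in> Arr E; Cod E f = S\<rbrakk> \<Longrightarrow> Q f"
  shows "locally E J S Q"
proof -
  have "{f \<in> Arr E. Cod E f = S \<and> Q f} = {f \<in> Arr E. Cod E f = S}" using assms by auto
  then show ?thesis using maximal_covering[OF assms(1)] by (simp add: locally_def)
qed

lemma locally_cong:
  assumes "\<And>f. \<lbrakk>f \<in> Arr E; Cod E f = S\<rbrakk> \<Longrightarrow> Q f = Q' f"
  shows "locally E J S Q = locally E J S Q'"
proof -
  have "{f \<in> Arr E. Cod E f = S \<and> Q f} = {f \<in> Arr E. Cod E f = S \<and> Q' f}" using assms by auto
  then show ?thesis by (simp add: locally_def)
qed

text \<open>The axiom of local character: pulled back along an arrow \<open>f\<close> of the first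
  covering, the sieve of \<open>Q'\<close> consists of the \<open>h\<close> with \<open>Q'\<close>
  at \<open>f h\<close>, and these cover by assumption.\<close>

lemma locally_trans:
  assumes S: "S \<in> Obj E" and Q: "locally E J S Q" and Q': "precomp_closed E S Q'"
    and step: "\<And>f. \<lbrakk>f \<in> Arr E; Cod E f = S; Q f\<rbrakk>
      \<Longrightarrow> locally E J (Dom E f) (\<lambda>h. Q' (f \<cdot>\<^bsub>E\<^esub> h))"
  shows "locally E J S Q'"
  unfolding locally_def
proof (rule local_covering[OF S Q[unfolded locally_def]])
  show "is_sieve E S {f \<in> Arr E. Cod E f = S \<and> Q' f}"
    using Q' by (auto simp: is_sieve_def precomp_closed_def)
  fix f assume f: "f \<in> {f \<in> Arr E. Cod E f = S \<and> Q f}"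
  then have "pull_sieve E f {f \<in> Arr E. Cod E f = S \<and> Q' f} =
      {h \<in> Arr E. Cod E h = Dom E f \<and> Q' (f \<cdot>\<^bsub>E\<^esub> h)}"
    by (auto simp: pull_sieve_def)
  then show "pull_sieve E f {f \<in> Arr E. Cod E f = S \<and> Q' f} \<in> J (Dom E f)"
    using step f by (simp add: locally_def)
qed

lemma stable_pull:
  assumes "precomp_closed E (Cod E f) Q" "f \<in> Arr E"
  shows "precomp_closed E (Dom E f) (\<lambda>h. Q (f \<cdot>\<^bsub>E\<^esub> h))"
proof (rule precomp_closedI)
  fix g h assume "g \<in> Arr E" "Cod E g = Dom E f" "Q (f \<cdot>\<^bsub>E\<^esub> g)" "h \<in> Arr E" "Cod E h = Dom E g"
  then show "Q (f \<cdot>\<^bsub>E\<^esub> (g \<cdot>\<^bsub>E\<^esub> h))"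
    using assms precomp_closedD[OF assms(1), of "f \<cdot>\<^bsub>E\<^esub> g" h] by simp
qed

text \<open>Along an arrow of the smaller sieve, the larger one pulls back to the maximal
  sieve.\<close>

lemma locally_mono:
  assumes S: "S \<in> Obj E" and Q: "locally E J S Q" and Q': "precomp_closed E S Q'"
    and imp: "\<And>f. \<lbrakk>f \<in> Arr E; Cod E f = S; Q f\<rbrakk> \<Longrightarrow> Q' f"
  shows "locally E J S Q'"
proof (rule locally_trans[OF S Q Q'])
  fix f assume f: "f \<in> Arr E" "Cod E f = S" "Q f"
  then have "Q' f" by (rule imp)
  then show "locally E J (Dom E f) (\<lambda>h. Q' (f \<cdot>\<^bsub>E\<^esub> h))"
    using f precomp_closedD[OF Q'] by (intro locally_all) auto
qed

text \<open>Along an arrow of the first covering, the intersection pulls back to the pullback of the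
  second covering.\<close>

lemma locally_conj:
  assumes S: "S \<in> Obj E" and Q: "locally E J S Q" and Q': "locally E J S Q'"
  shows "locally E J S (\<lambda>f. Q f \<and> Q' f)"
proof (rule locally_trans[OF S Q])
  show "precomp_closed E S (\<lambda>f. Q f \<and> Q' f)"
    using locally_stable[OF Q S] locally_stable[OF Q' S] by (auto simp: precomp_closed_def)
  fix f assume f: "f \<in> Arr E" "Cod E f = S" "Q f"
  show "locally E J (Dom E f) (\<lambda>h. Q (f \<cdot>\<^bsub>E\<^esub> h) \<and> Q' (f \<cdot>\<^bsub>E\<^esub> h))"
  proof (subst locally_cong)
    show "locally E J (Dom E f) (\<lambda>h. Q' (f \<cdot>\<^bsub>E\<^esub> h))" using locally_pull f Q' by auto
  qed (use f precomp_closedD[OF locally_stable[OF Q S]] in auto)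
qed

end

section \<open>Local bijections and sheafification\<close>

text \<open>The record \<open>presheaf\<close> carries data only; functoriality is imposed here, and
  only on sections and arrows of the carriers.\<close>

definition is_presheaf :: "('o, 'm) precategory \<Rightarrow> ('o, 'm, 'p) presheaf \<Rightarrow> bool" where
  "is_presheaf C P \<longleftrightarrow>
    (\<forall>h\<in>Arr C. \<forall>s\<in>Sec P (Cod C h). Res P h s \<in> Sec P (Dom C h)) \<and>
    (\<forall>S\<in>Obj C. \<forall>s\<in>Sec P S. Res P (Idt C S) s = s) \<and>
    (\<forall>g\<in>Arr C. \<forall>h\<in>Arr C. Cod C h = Dom C g \<longrightarrow>
       (\<forall>s\<in>Sec P (Cod C g). Res P (g \<cdot>\<^bsub>C\<^esub> h) s = Res P h (Res P g s)))"

lemma is_presheafD: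
  assumes "is_presheaf C P"
  shows "\<lbrakk>h \<in> Arr C; s \<in> Sec P (Cod C h)\<rbrakk> \<Longrightarrow> Res P h s \<in> Sec P (Dom C h)"
    "\<lbrakk>S \<in> Obj C; s \<in> Sec P S\<rbrakk> \<Longrightarrow> Res P (Idt C S) s = s"
    "\<lbrakk>g \<in> Arr C; h \<in> Arr C; Cod C h = Dom C g; s \<in> Sec P (Cod C g)\<rbrakk>
      \<Longrightarrow> Res P (g \<cdot>\<^bsub>C\<^esub> h) s = Res P h (Res P g s)"
  using assms by (auto simp: is_presheaf_def)

definition is_presheaf_map ::
  "('o, 'm) precategory \<Rightarrow> ('o, 'm, 'p) presheaf \<Rightarrow> ('o, 'm, 'q) presheaf
   \<Rightarrow> ('o \<Rightarrow> 'p \<Rightarrow> 'q) \<Rightarrow> bool" where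
  "is_presheaf_map C P Q \<alpha> \<longleftrightarrow>
    (\<forall>S\<in>Obj C. \<forall>s\<in>Sec P S. \<alpha> S s \<in> Sec Q S) \<and>
    (\<forall>h\<in>Arr C. \<forall>s\<in>Sec P (Cod C h). \<alpha> (Dom C h) (Res P h s) = Res Q h (\<alpha> (Cod C h) s))"

lemma is_presheaf_mapD:
  assumes "is_presheaf_map C P Q \<alpha>"
  shows "\<lbrakk>S \<in> Obj C; s \<in> Sec P S\<rbrakk> \<Longrightarrow> \<alpha> S s \<in> Sec Q S"
    "\<lbrakk>h \<in> Arr C; s \<in> Sec P (Cod C h)\<rbrakk> \<Longrightarrow> \<alpha> (Dom C h) (Res P h s) = Res Q h (\<alpha> (Cod C h) s)"
  using assms by (auto simp: is_presheaf_map_def)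

definition locally_injective ::
  "('o, 'm) precategory \<Rightarrow> ('o \<Rightarrow> 'm set set) \<Rightarrow> ('o, 'm, 'p) presheaf
   \<Rightarrow> ('o \<Rightarrow> 'p \<Rightarrow> 'q) \<Rightarrow> bool" where
  "locally_injective C J P \<alpha> \<longleftrightarrow>
    (\<forall>S\<in>Obj C. \<forall>s\<in>Sec P S. \<forall>t\<in>Sec P S. \<alpha> S s = \<alpha> S t \<longrightarrow>
       locally C J S (\<lambda>f. Res P f s = Res P f t))"

definition locally_surjective ::
  "('o, 'm) precategory \<Rightarrow> ('o \<Rightarrow> 'm set set) \<Rightarrow> ('o, 'm, 'p) presheaf \<Rightarrow> ('o, 'm, 'q) presheaf
   \<Rightarrow> ('o \<Rightarrow> 'p \<Rightarrow> 'q) \<Rightarrow> bool" where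
  "locally_surjective C J P Q \<alpha> \<longleftrightarrow>
    (\<forall>S\<in>Obj C. \<forall>q\<in>Sec Q S. locally C J S (\<lambda>f. \<exists>p\<in>Sec P (Dom C f). \<alpha> (Dom C f) p = Res Q f q))"

context site
begin

lemma stable_Res_eq:
  assumes "is_presheaf E P" "s \<in> Sec P S" "t \<in> Sec P S"
  shows "precomp_closed E S (\<lambda>f. Res P f s = Res P f t)"
  using assms by (auto simp: precomp_closed_def is_presheafD)

lemma stable_Res_image:
  assumes "is_presheaf E P" "is_presheaf E Q" "is_presheaf_map E P Q \<alpha>" "q \<in> Sec Q S"
  shows "precomp_closed E S (\<lambda>f. \<exists>p\<in>Sec P (Dom E f). \<alpha> (Dom E f) p = Res Q f q)"
proof (rule precomp_closedI)
  fix f h assume f: "f \<in> Arr E" "Cod E f = S" "h \<in> Arr E" "Cod E h = Dom E f"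
    and "\<exists>p\<in>Sec P (Dom E f). \<alpha> (Dom E f) p = Res Q f q"
  then obtain p where p: "p \<in> Sec P (Dom E f)" "\<alpha> (Dom E f) p = Res Q f q" by auto
  then have "Res P h p \<in> Sec P (Dom E h)" "\<alpha> (Dom E h) (Res P h p) = Res Q (f \<cdot>\<^bsub>E\<^esub> h) q"
    using f assms is_presheaf_mapD(2)[OF assms(3), of h p] by (auto simp: is_presheafD)
  then show "\<exists>p\<in>Sec P (Dom E (f \<cdot>\<^bsub>E\<^esub> h)). \<alpha> (Dom E (f \<cdot>\<^bsub>E\<^esub> h)) p = Res Q (f \<cdot>\<^bsub>E\<^esub> h) q"
    using f by auto
qed

text \<open>Sections identified by the composite have images under \<alpha> that agree on a
  covering; over each of its arrows the local injectivity of \<alpha> refines once more.\<close>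

lemma locally_injective_comp:
  assumes P: "is_presheaf E P" and Q: "is_presheaf E Q" and \<alpha>: "is_presheaf_map E P Q \<alpha>"
    and "locally_injective E J P \<alpha>" "locally_injective E J Q \<beta>"
  shows "locally_injective E J P (\<lambda>S s. \<beta> S (\<alpha> S s))"
  unfolding locally_injective_def
proof (intro ballI impI)
  fix S s t assume st: "S \<in> Obj E" "s \<in> Sec P S" "t \<in> Sec P S" "\<beta> S (\<alpha> S s) = \<beta> S (\<alpha> S t)"
  then have "locally E J S (\<lambda>f. Res Q f (\<alpha> S s) = Res Q f (\<alpha> S t))"
    using assms(5) is_presheaf_mapD(1)[OF \<alpha>] by (auto simp: locally_injective_def)
  then show "locally E J S (\<lambda>f. Res P f s = Res P f t)"
  proof (rule locally_trans[OF st(1)])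
    show "precomp_closed E S (\<lambda>f. Res P f s = Res P f t)" by (rule stable_Res_eq) (use P st in auto)
    fix f assume f: "f \<in> Arr E" "Cod E f = S" "Res Q f (\<alpha> S s) = Res Q f (\<alpha> S t)"
    then have "\<alpha> (Dom E f) (Res P f s) = \<alpha> (Dom E f) (Res P f t)"
      using st is_presheaf_mapD(2)[OF \<alpha>, of f] by auto
    moreover have "Res P f s \<in> Sec P (Dom E f)" "Res P f t \<in> Sec P (Dom E f)"
      using is_presheafD(1)[OF P] f st by auto
    ultimately have "locally E J (Dom E f) (\<lambda>h. Res P h (Res P f s) = Res P h (Res P f t))"
      using assms(4) f by (auto simp: locally_injective_def)
    then show "locally E J (Dom E f) (\<lambda>h. Res P (f \<cdot>\<^bsub>E\<^esub> h) s = Res P (f \<cdot>\<^bsub>E\<^esub> h) t)"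
      by (subst locally_cong) (use P f st in \<open>auto simp: is_presheafD\<close>)
  qed
qed

lemma locally_surjective_comp:
  assumes P: "is_presheaf E P" and Q: "is_presheaf E Q" and R: "is_presheaf E R"
    and \<alpha>: "is_presheaf_map E P Q \<alpha>" and \<beta>: "is_presheaf_map E Q R \<beta>"
    and "locally_surjective E J P Q \<alpha>" "locally_surjective E J Q R \<beta>"
  shows "locally_surjective E J P R (\<lambda>S s. \<beta> S (\<alpha> S s))"
  unfolding locally_surjective_def
proof (intro ballI)
  fix S r assume r: "S \<in> Obj E" "r \<in> Sec R S"
  have "is_presheaf_map E P R (\<lambda>S s. \<beta> S (\<alpha> S s))"
    using \<alpha> \<beta> by (auto simp: is_presheaf_map_def)
  note stable = stable_Res_image[OF P R this r(2)]
  have "locally E J S (\<lambda>f. \<exists>q\<in>Sec Q (Dom E f). \<beta> (Dom E f) q = Res R f r)"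
    using assms(7) r by (auto simp: locally_surjective_def)
  then show "locally E J S (\<lambda>f. \<exists>p\<in>Sec P (Dom E f). \<beta> (Dom E f) (\<alpha> (Dom E f) p) = Res R f r)"
  proof (rule locally_trans[OF r(1) _ stable])
    fix f assume f: "f \<in> Arr E" "Cod E f = S" "\<exists>q\<in>Sec Q (Dom E f). \<beta> (Dom E f) q = Res R f r"
    then obtain q where q: "q \<in> Sec Q (Dom E f)" "\<beta> (Dom E f) q = Res R f r" by auto
    have st: "precomp_closed E (Dom E f)
      (\<lambda>h. \<exists>p\<in>Sec P (Dom E (f \<cdot>\<^bsub>E\<^esub> h)). \<beta> (Dom E (f \<cdot>\<^bsub>E\<^esub> h)) (\<alpha> (Dom E (f \<cdot>\<^bsub>E\<^esub> h)) p) = Res R (f \<cdot>\<^bsub>E\<^esub> h) r)"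
      using stable_pull[of f, unfolded f(2), OF stable] f by simp
    show "locally E J (Dom E f)
      (\<lambda>h. \<exists>p\<in>Sec P (Dom E (f \<cdot>\<^bsub>E\<^esub> h)). \<beta> (Dom E (f \<cdot>\<^bsub>E\<^esub> h)) (\<alpha> (Dom E (f \<cdot>\<^bsub>E\<^esub> h)) p) = Res R (f \<cdot>\<^bsub>E\<^esub> h) r)"
    proof (rule locally_mono[OF _ _ st])
      show "locally E J (Dom E f) (\<lambda>h. \<exists>p\<in>Sec P (Dom E h). \<alpha> (Dom E h) p = Res Q h q)"
        using assms(6) f q by (auto simp: locally_surjective_def)
      fix h assume h: "h \<in> Arr E" "Cod E h = Dom E f"
        "\<exists>p\<in>Sec P (Dom E h). \<alpha> (Dom E h) p = Res Q h q"
      then obtain p where p: "p \<in> Sec P (Dom E h)" "\<alpha> (Dom E h) p = Res Q h q" by auto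
      have "\<beta> (Dom E h) (Res Q h q) = Res R (f \<cdot>\<^bsub>E\<^esub> h) r"
        using is_presheaf_mapD(2)[OF \<beta>, of h q] h f q r is_presheafD(3)[OF R] by simp
      then show "\<exists>p\<in>Sec P (Dom E (f \<cdot>\<^bsub>E\<^esub> h)). \<beta> (Dom E (f \<cdot>\<^bsub>E\<^esub> h)) (\<alpha> (Dom E (f \<cdot>\<^bsub>E\<^esub> h)) p) = Res R (f \<cdot>\<^bsub>E\<^esub> h) r"
        using p(1) p(2)[symmetric] h(1,2) f(1) by (intro bexI[of _ p]) simp_all
    qed (use f in auto)
  qed
qed

lemma locally_injective_cancel:
  assumes "locally_injective E J P (\<lambda>S s. \<beta> S (\<alpha> S s))"
  shows "locally_injective E J P \<alpha>"
  using assms by (auto simp: locally_injective_def)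

lemma locally_surjective_cancel:
  assumes P: "is_presheaf E P" and Q: "is_presheaf E Q" and R: "is_presheaf E R"
    and \<alpha>: "is_presheaf_map E P Q \<alpha>" and \<beta>: "is_presheaf_map E Q R \<beta>"
    and "locally_surjective E J P R (\<lambda>S s. \<beta> S (\<alpha> S s))"
  shows "locally_surjective E J Q R \<beta>"
  unfolding locally_surjective_def
proof (intro ballI)
  fix S r assume r: "S \<in> Obj E" "r \<in> Sec R S"
  then have "locally E J S (\<lambda>f. \<exists>p\<in>Sec P (Dom E f). \<beta> (Dom E f) (\<alpha> (Dom E f) p) = Res R f r)"
    using assms(6) by (auto simp: locally_surjective_def)
  then show "locally E J S (\<lambda>f. \<exists>q\<in>Sec Q (Dom E f). \<beta> (Dom E f) q = Res R f r)"
    by (rule locally_mono[OF r(1) _ stable_Res_image[OF Q R \<beta> r(2)]])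
      (use is_presheaf_mapD(1)[OF \<alpha>] in fastforce)
qed

text \<open>Locally both sections of \<open>Q\<close> come from sections of \<open>P\<close>, and
  those are identified by the composite, which is locally injective.\<close>

lemma locally_injective_cancel_surjective:
  assumes P: "is_presheaf E P" and Q: "is_presheaf E Q" and R: "is_presheaf E R"
    and \<alpha>: "is_presheaf_map E P Q \<alpha>" and \<beta>: "is_presheaf_map E Q R \<beta>"
    and inj: "locally_injective E J P (\<lambda>S s. \<beta> S (\<alpha> S s))"
    and surj: "locally_surjective E J P Q \<alpha>"
  shows "locally_injective E J Q \<beta>"
  unfolding locally_injective_def
proof (intro ballI impI)
  fix S s t assume st: "S \<in> Obj E" "s \<in> Sec Q S" "t \<in> Sec Q S" "\<beta> S s = \<beta> S t"
  have "locally E J S (\<lambda>f. \<exists>p\<in>Sec P (Dom E f). \<alpha> (Dom E f) p = Res Q f s)"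
    "locally E J S (\<lambda>f. \<exists>p\<in>Sec P (Dom E f). \<alpha> (Dom E f) p = Res Q f t)"
    using surj st by (auto simp: locally_surjective_def)
  note both = locally_conj[OF st(1) this]
  show "locally E J S (\<lambda>f. Res Q f s = Res Q f t)"
  proof (rule locally_trans[OF st(1) both stable_Res_eq[OF Q st(2,3)]])
    fix f assume f: "f \<in> Arr E" "Cod E f = S" and
      "(\<exists>p\<in>Sec P (Dom E f). \<alpha> (Dom E f) p = Res Q f s) \<and> (\<exists>p\<in>Sec P (Dom E f). \<alpha> (Dom E f) p = Res Q f t)"
    then obtain p p' where p: "p \<in> Sec P (Dom E f)" "\<alpha> (Dom E f) p = Res Q f s"
      "p' \<in> Sec P (Dom E f)" "\<alpha> (Dom E f) p' = Res Q f t" by auto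
    then have "\<beta> (Dom E f) (\<alpha> (Dom E f) p) = \<beta> (Dom E f) (\<alpha> (Dom E f) p')"
      using f st is_presheaf_mapD(2)[OF \<beta>, of f] by auto
    then have "locally E J (Dom E f) (\<lambda>h. Res P h p = Res P h p')"
      using inj f p by (auto simp: locally_injective_def)
    moreover have "precomp_closed E (Dom E f) (\<lambda>h. Res Q (f \<cdot>\<^bsub>E\<^esub> h) s = Res Q (f \<cdot>\<^bsub>E\<^esub> h) t)"
      using stable_pull[of f, unfolded f(2), OF stable_Res_eq[OF Q st(2,3)]] f by simp
    ultimately show "locally E J (Dom E f) (\<lambda>h. Res Q (f \<cdot>\<^bsub>E\<^esub> h) s = Res Q (f \<cdot>\<^bsub>E\<^esub> h) t)"
    proof (rule locally_mono[rotated])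
      fix h assume h: "h \<in> Arr E" "Cod E h = Dom E f" "Res P h p = Res P h p'"
      then have "Res Q h (\<alpha> (Dom E f) p) = Res Q h (\<alpha> (Dom E f) p')"
        using is_presheaf_mapD(2)[OF \<alpha>, of h p] is_presheaf_mapD(2)[OF \<alpha>, of h p'] p(1,3) by simp
      then show "Res Q (f \<cdot>\<^bsub>E\<^esub> h) s = Res Q (f \<cdot>\<^bsub>E\<^esub> h) t"
        using p h f st by (simp add: is_presheafD(3)[OF Q])
    qed (use f in auto)
  qed
qed

text \<open>A section \<open>q\<close> is lifted by lifting its image under \<beta> through the
  composite: the image of the lift under \<alpha> and \<open>q\<close> then agree after \<beta>,
  hence agree on a refinement.\<close>

lemma locally_surjective_cancel_injective:
  assumes P: "is_presheaf E P" and Q: "is_presheaf E Q" and R: "is_presheaf E R"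
    and \<alpha>: "is_presheaf_map E P Q \<alpha>" and \<beta>: "is_presheaf_map E Q R \<beta>"
    and surj: "locally_surjective E J P R (\<lambda>S s. \<beta> S (\<alpha> S s))"
    and inj: "locally_injective E J Q \<beta>"
  shows "locally_surjective E J P Q \<alpha>"
  unfolding locally_surjective_def
proof (intro ballI)
  fix S q assume q: "S \<in> Obj E" "q \<in> Sec Q S"
  note stable = stable_Res_image[OF P Q \<alpha> q(2)]
  have "locally E J S (\<lambda>f. \<exists>p\<in>Sec P (Dom E f). \<beta> (Dom E f) (\<alpha> (Dom E f) p) = Res R f (\<beta> S q))"
    using surj q is_presheaf_mapD(1)[OF \<beta>] by (auto simp: locally_surjective_def)
  then show "locally E J S (\<lambda>f. \<exists>p\<in>Sec P (Dom E f). \<alpha> (Dom E f) p = Res Q f q)"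
  proof (rule locally_trans[OF q(1) _ stable])
    fix f assume f: "f \<in> Arr E" "Cod E f = S" and
      "\<exists>p\<in>Sec P (Dom E f). \<beta> (Dom E f) (\<alpha> (Dom E f) p) = Res R f (\<beta> S q)"
    then obtain p where p: "p \<in> Sec P (Dom E f)"
      "\<beta> (Dom E f) (\<alpha> (Dom E f) p) = Res R f (\<beta> S q)" by auto
    then have "\<beta> (Dom E f) (\<alpha> (Dom E f) p) = \<beta> (Dom E f) (Res Q f q)"
      using f q is_presheaf_mapD(2)[OF \<beta>, of f q] by simp
    moreover have "\<alpha> (Dom E f) p \<in> Sec Q (Dom E f)" "Res Q f q \<in> Sec Q (Dom E f)"
      using f q p is_presheaf_mapD(1)[OF \<alpha>] is_presheafD(1)[OF Q] by auto
    ultimately have loc: "locally E J (Dom E f) (\<lambda>h. Res Q h (\<alpha> (Dom E f) p) = Res Q h (Res Q f q))"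
      using inj f by (auto simp: locally_injective_def)
    have "precomp_closed E (Dom E f)
      (\<lambda>h. \<exists>p\<in>Sec P (Dom E (f \<cdot>\<^bsub>E\<^esub> h)). \<alpha> (Dom E (f \<cdot>\<^bsub>E\<^esub> h)) p = Res Q (f \<cdot>\<^bsub>E\<^esub> h) q)"
      using stable_pull[of f, unfolded f(2), OF stable] f by simp
    then show "locally E J (Dom E f)
      (\<lambda>h. \<exists>p\<in>Sec P (Dom E (f \<cdot>\<^bsub>E\<^esub> h)). \<alpha> (Dom E (f \<cdot>\<^bsub>E\<^esub> h)) p = Res Q (f \<cdot>\<^bsub>E\<^esub> h) q)"
    proof (rule locally_mono[OF _ loc, rotated])
      fix h assume h: "h \<in> Arr E" "Cod E h = Dom E f"
        "Res Q h (\<alpha> (Dom E f) p) = Res Q h (Res Q f q)"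
      then have "\<alpha> (Dom E h) (Res P h p) = Res Q (f \<cdot>\<^bsub>E\<^esub> h) q"
        using p f q is_presheaf_mapD(2)[OF \<alpha>, of h p] is_presheafD(3)[OF Q] by simp
      then show "\<exists>p\<in>Sec P (Dom E (f \<cdot>\<^bsub>E\<^esub> h)). \<alpha> (Dom E (f \<cdot>\<^bsub>E\<^esub> h)) p = Res Q (f \<cdot>\<^bsub>E\<^esub> h) q"
        using p h f is_presheafD(1)[OF P, of h p] by auto
    qed (use f in auto)
  qed
qed

end

section \<open>The plus construction and its unit\<close>

definition matching_class ::
  "('o, 'm) precategory \<Rightarrow> ('o \<Rightarrow> 'm set set) \<Rightarrow> ('o, 'm, 'p) presheaf \<Rightarrow> 'o
   \<Rightarrow> 'm set \<Rightarrow> ('m \<Rightarrow> 'p) \<Rightarrow> ('m set \<times> ('m \<Rightarrow> 'p)) set" where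
  "matching_class C J P S R s = plus_rel C J P S `` {(R, s)}"

text \<open>The canonical map from \<open>P\<close> to its plus construction: a section becomes the
  family of all its restrictions.\<close>

definition plus_unit ::
  "('o, 'm) precategory \<Rightarrow> ('o \<Rightarrow> 'm set set) \<Rightarrow> ('o, 'm, 'p) presheaf
   \<Rightarrow> 'o \<Rightarrow> 'p \<Rightarrow> ('m set \<times> ('m \<Rightarrow> 'p)) set" where
  "plus_unit C J P S p = matching_class C J P S {f \<in> Arr C. Cod C f = S}
     (\<lambda>f\<in>{f \<in> Arr C. Cod C f = S}. Res P f p)"

lemma matching_familiesD:
  assumes "(R, s) \<in> matching_families C J P S"
  shows "R \<in> J S" "s \<in> extensional R" "f \<in> R \<Longrightarrow> s f \<in> Sec P (Dom C f)"
    "\<lbrakk>f \<in> R; h \<in> Arr C; Cod C h = Dom C f\<rbrakk> \<Longrightarrow> s (f \<cdot>\<^bsub>C\<^esub> h) = Res P h (s f)"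
  using assms by (auto simp: matching_families_def PiE_def)

lemma matching_familiesI:
  assumes "R \<in> J S" "s \<in> extensional R" "\<And>f. f \<in> R \<Longrightarrow> s f \<in> Sec P (Dom C f)"
    "\<And>f h. \<lbrakk>f \<in> R; h \<in> Arr C; Cod C h = Dom C f\<rbrakk> \<Longrightarrow> s (f \<cdot>\<^bsub>C\<^esub> h) = Res P h (s f)"
  shows "(R, s) \<in> matching_families C J P S"
  using assms by (auto simp: matching_families_def PiE_def)

context site
begin

lemma sieveD:
  assumes "S \<in> Obj E" "R \<in> J S" "f \<in> R"
  shows "f \<in> Arr E" "Cod E f = S" "\<lbrakk>h \<in> Arr E; Cod E h = Dom E f\<rbrakk> \<Longrightarrow> f \<cdot>\<^bsub>E\<^esub> h \<in> R"
  using covering_is_sieve[OF assms(1,2)] assms(3) by (auto simp: is_sieve_def)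

lemma precomp_closed_agree:
  assumes "S \<in> Obj E" "(R, s) \<in> matching_families E J P S" "(R', s') \<in> matching_families E J P S"
  shows "precomp_closed E S (\<lambda>f. f \<in> R \<and> f \<in> R' \<and> s f = s' f)"
proof (rule precomp_closedI)
  fix f h assume f: "f \<in> Arr E" "Cod E f = S" "f \<in> R \<and> f \<in> R' \<and> s f = s' f"
    and h: "h \<in> Arr E" "Cod E h = Dom E f"
  show "f \<cdot>\<^bsub>E\<^esub> h \<in> R \<and> f \<cdot>\<^bsub>E\<^esub> h \<in> R' \<and> s (f \<cdot>\<^bsub>E\<^esub> h) = s' (f \<cdot>\<^bsub>E\<^esub> h)"
    using f h matching_familiesD[OF assms(2)] matching_familiesD[OF assms(3)] sieveD[OF assms(1)]
    by auto
qed

text \<open>The arrows of both sieves on which the two families agree form a sieve, because the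
  families match. This is the largest candidate for a common refinement, so no refinement has to be
  chosen.\<close>

lemma plus_rel_iff:
  assumes S: "S \<in> Obj E"
  shows "((R, s), (R', s')) \<in> plus_rel E J P S \<longleftrightarrow>
    (R, s) \<in> matching_families E J P S \<and> (R', s') \<in> matching_families E J P S \<and>
    locally E J S (\<lambda>f. f \<in> R \<and> f \<in> R' \<and> s f = s' f)"
proof
  assume "((R, s), (R', s')) \<in> plus_rel E J P S"
  then obtain K where *: "(R, s) \<in> matching_families E J P S" "(R', s') \<in> matching_families E J P S"
    "K \<in> J S" "K \<subseteq> R \<inter> R'" "\<forall>f\<in>K. s f = s' f"
    by (auto simp: plus_rel_def)
  then show "(R, s) \<in> matching_families E J P S \<and> (R', s') \<in> matching_families E J P S \<and>
    locally E J S (\<lambda>f. f \<in> R \<and> f \<in> R' \<and> s f = s' f)"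
    using locally_mono[OF S locally_sieve[OF S *(3)] precomp_closed_agree[OF S *(1,2)]] by blast
next
  assume *: "(R, s) \<in> matching_families E J P S \<and> (R', s') \<in> matching_families E J P S \<and>
    locally E J S (\<lambda>f. f \<in> R \<and> f \<in> R' \<and> s f = s' f)"
  then show "((R, s), (R', s')) \<in> plus_rel E J P S"
    by (simp add: plus_rel_def locally_def)
      (rule bexI[of _ "{f \<in> Arr E. Cod E f = S \<and> f \<in> R \<and> f \<in> R' \<and> s f = s' f}"], auto)
qed

lemma plus_rel_equiv:
  assumes S: "S \<in> Obj E"
  shows "equiv (matching_families E J P S) (plus_rel E J P S)"
proof -
  have "refl_on (matching_families E J P S) (plus_rel E J P S)"
  proof (unfold refl_on_def, intro ballI)
    fix x assume x: "x \<in> matching_families E J P S"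
    obtain R s where [simp]: "x = (R, s)" by (cases x)
    show "(x, x) \<in> plus_rel E J P S"
      using x matching_familiesD(1) locally_sieve[OF S] by (force simp: plus_rel_iff[OF S])
  qed
  moreover have "plus_rel E J P S \<subseteq> matching_families E J P S \<times> matching_families E J P S"
    by (auto simp: plus_rel_def)
  moreover have "sym (plus_rel E J P S)"
  proof (rule symI)
    fix x y assume xy: "(x, y) \<in> plus_rel E J P S"
    obtain R s R' s' where [simp]: "x = (R, s)" "y = (R', s')" by (cases x, cases y)
    have "locally E J S (\<lambda>f. f \<in> R' \<and> f \<in> R \<and> s' f = s f)"
      using xy by (subst locally_cong[where Q' = "\<lambda>f. f \<in> R \<and> f \<in> R' \<and> s f = s' f"])
        (auto simp: plus_rel_iff[OF S])
    then show "(y, x) \<in> plus_rel E J P S" using xy by (simp add: plus_rel_iff[OF S])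
  qed
  moreover have "trans (plus_rel E J P S)"
  proof (rule transI)
    fix x y z assume xyz: "(x, y) \<in> plus_rel E J P S" "(y, z) \<in> plus_rel E J P S"
    obtain R s R' s' R'' s'' where [simp]: "x = (R, s)" "y = (R', s')" "z = (R'', s'')"
      by (cases x, cases y, cases z)
    note * = xyz[simplified, unfolded plus_rel_iff[OF S]]
    have "locally E J S (\<lambda>f. (f \<in> R \<and> f \<in> R' \<and> s f = s' f) \<and> (f \<in> R' \<and> f \<in> R'' \<and> s' f = s'' f))"
      by (rule locally_conj[OF S]) (use * in auto)
    then have "locally E J S (\<lambda>f. f \<in> R \<and> f \<in> R'' \<and> s f = s'' f)"
      by (rule locally_mono[OF S]) (use * precomp_closed_agree[OF S] in auto)
    then show "(x, z) \<in> plus_rel E J P S" using * by (simp add: plus_rel_iff[OF S])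
  qed
  ultimately show ?thesis unfolding equiv_def by auto
qed

lemma matching_class_eq:
  assumes "S \<in> Obj E" "(R, s) \<in> matching_families E J P S" "(R', s') \<in> matching_families E J P S"
  shows "matching_class E J P S R s = matching_class E J P S R' s' \<longleftrightarrow>
    locally E J S (\<lambda>f. f \<in> R \<and> f \<in> R' \<and> s f = s' f)"
  unfolding matching_class_def
  using eq_equiv_class_iff[OF plus_rel_equiv[OF assms(1)] assms(2,3)] assms
  by (simp add: plus_rel_iff)

lemma plus_SecE:
  assumes "X \<in> Sec (plus E J P) S"
  obtains R s where "(R, s) \<in> matching_families E J P S" "X = matching_class E J P S R s"
  using assms by (auto simp: plus_def matching_class_def quotient_def)

lemma matching_class_in_Sec:
  "(R, s) \<in> matching_families E J P S \<Longrightarrow> matching_class E J P S R s \<in> Sec (plus E J P) S"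
  by (auto simp: plus_def matching_class_def quotient_def)

text \<open>The maps on classes are defined by transforming all representatives and saturating the
  result. If the transformation respects the relation, a single representative suffices.\<close>

lemma plus_rel_image:
  assumes "S \<in> Obj E" "T \<in> Obj E" "x \<in> matching_families E J P S"
    and resp: "\<And>y. (x, y) \<in> plus_rel E J P S \<Longrightarrow> (F x, F y) \<in> plus_rel E J Q T"
  shows "plus_rel E J Q T `` (F ` (plus_rel E J P S `` {x})) = plus_rel E J Q T `` {F x}"
proof -
  note eS = plus_rel_equiv[OF assms(1)] and eT = plus_rel_equiv[OF assms(2)]
  have "(x, x) \<in> plus_rel E J P S" using eS assms(3) by (auto simp: equiv_def refl_on_def)
  moreover have "plus_rel E J Q T `` {F y} = plus_rel E J Q T `` {F x}"
    if "(x, y) \<in> plus_rel E J P S" for y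
    using equiv_class_eq[OF eT resp[OF that]] by simp
  ultimately show ?thesis by blast
qed

lemma matching_families_pull:
  assumes P: "is_presheaf E P" and h: "h \<in> Arr E"
    and m: "(R, s) \<in> matching_families E J P (Cod E h)"
  shows "(pull_sieve E h R, \<lambda>g\<in>pull_sieve E h R. s (h \<cdot>\<^bsub>E\<^esub> g)) \<in> matching_families E J P (Dom E h)"
proof (rule matching_familiesI)
  show "pull_sieve E h R \<in> J (Dom E h)" using pull_covering h matching_familiesD(1)[OF m] by auto
  fix f assume f: "f \<in> pull_sieve E h R"
  then have f': "f \<in> Arr E" "Cod E f = Dom E h" "h \<cdot>\<^bsub>E\<^esub> f \<in> R" by (auto simp: pull_sieve_def)
  show "(\<lambda>g\<in>pull_sieve E h R. s (h \<cdot>\<^bsub>E\<^esub> g)) f \<in> Sec P (Dom E f)"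
    using f f' h matching_familiesD(3)[OF m, of "h \<cdot>\<^bsub>E\<^esub> f"] by simp
  fix k assume k: "k \<in> Arr E" "Cod E k = Dom E f"
  then have "(h \<cdot>\<^bsub>E\<^esub> f) \<cdot>\<^bsub>E\<^esub> k \<in> R"
    using f' h sieveD(3)[OF _ matching_familiesD(1)[OF m] f'(3)] by simp
  then have "f \<cdot>\<^bsub>E\<^esub> k \<in> pull_sieve E h R" using f' h k by (simp add: pull_sieve_def)
  moreover have "s ((h \<cdot>\<^bsub>E\<^esub> f) \<cdot>\<^bsub>E\<^esub> k) = Res P k (s (h \<cdot>\<^bsub>E\<^esub> f))"
    using matching_familiesD(4)[OF m f'(3), of k] f' h k by simp
  ultimately show "(\<lambda>g\<in>pull_sieve E h R. s (h \<cdot>\<^bsub>E\<^esub> g)) (f \<cdot>\<^bsub>E\<^esub> k) =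
      Res P k ((\<lambda>g\<in>pull_sieve E h R. s (h \<cdot>\<^bsub>E\<^esub> g)) f)"
    using f f' h k by simp
qed simp

lemma plus_Res:
  assumes P: "is_presheaf E P" and h: "h \<in> Arr E"
    and m: "(R, s) \<in> matching_families E J P (Cod E h)"
  shows "Res (plus E J P) h (matching_class E J P (Cod E h) R s) =
    matching_class E J P (Dom E h) (pull_sieve E h R) (\<lambda>g\<in>pull_sieve E h R. s (h \<cdot>\<^bsub>E\<^esub> g))"
proof -
  let ?F = "\<lambda>(R, s). (pull_sieve E h R, \<lambda>g\<in>pull_sieve E h R. s (h \<cdot>\<^bsub>E\<^esub> g))"
  have "plus_rel E J P (Dom E h) `` (?F ` (plus_rel E J P (Cod E h) `` {(R, s)})) =
      plus_rel E J P (Dom E h) `` {?F (R, s)}"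
  proof (rule plus_rel_image[OF _ _ m])
    fix y assume y: "((R, s), y) \<in> plus_rel E J P (Cod E h)"
    obtain R' s' where [simp]: "y = (R', s')" by (cases y)
    have C: "Cod E h \<in> Obj E" and D: "Dom E h \<in> Obj E" using h by auto
    have m': "(R', s') \<in> matching_families E J P (Cod E h)"
      and "locally E J (Cod E h) (\<lambda>f. f \<in> R \<and> f \<in> R' \<and> s f = s' f)"
      using y by (auto simp: plus_rel_iff[OF C])
    from locally_pull[OF this(2) h]
    have "locally E J (Dom E h) (\<lambda>g. g \<in> pull_sieve E h R \<and> g \<in> pull_sieve E h R' \<and>
        (\<lambda>g\<in>pull_sieve E h R. s (h \<cdot>\<^bsub>E\<^esub> g)) g = (\<lambda>g\<in>pull_sieve E h R'. s' (h \<cdot>\<^bsub>E\<^esub> g)) g)"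
      by (subst (asm) locally_cong) (auto simp: pull_sieve_def)
    then show "(?F (R, s), ?F y) \<in> plus_rel E J P (Dom E h)"
      using matching_families_pull[OF P h m] matching_families_pull[OF P h m']
      by (simp add: plus_rel_iff[OF D])
  qed (use h in auto)
  then show ?thesis by (simp add: plus_def matching_class_def)
qed

lemma matching_families_map:
  assumes S: "S \<in> Obj E" and \<alpha>: "is_presheaf_map E P Q \<alpha>"
    and m: "(R, s) \<in> matching_families E J P S"
  shows "(R, \<lambda>f\<in>R. \<alpha> (Dom E f) (s f)) \<in> matching_families E J Q S"
proof (rule matching_familiesI)
  show "R \<in> J S" using matching_familiesD(1)[OF m] .
  fix f assume f: "f \<in> R"
  note f' = sieveD[OF S matching_familiesD(1)[OF m] f]
  show "(\<lambda>f\<in>R. \<alpha> (Dom E f) (s f)) f \<in> Sec Q (Dom E f)"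
    using f f' matching_familiesD(3)[OF m f] is_presheaf_mapD(1)[OF \<alpha>] by simp
  fix h assume h: "h \<in> Arr E" "Cod E h = Dom E f"
  then show "(\<lambda>f\<in>R. \<alpha> (Dom E f) (s f)) (f \<cdot>\<^bsub>E\<^esub> h) = Res Q h ((\<lambda>f\<in>R. \<alpha> (Dom E f) (s f)) f)"
    using f f' matching_familiesD(3,4)[OF m f] is_presheaf_mapD(2)[OF \<alpha>, of h "s f"] by simp
qed simp

lemma plus_map_class:
  assumes S: "S \<in> Obj E" and \<alpha>: "is_presheaf_map E P Q \<alpha>"
    and m: "(R, s) \<in> matching_families E J P S"
  shows "plus_map E J Q \<alpha> S (matching_class E J P S R s) =
    matching_class E J Q S R (\<lambda>f\<in>R. \<alpha> (Dom E f) (s f))"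
proof -
  let ?F = "\<lambda>(R, s). (R, \<lambda>f\<in>R. \<alpha> (Dom E f) (s f))"
  have "plus_rel E J Q S `` (?F ` (plus_rel E J P S `` {(R, s)})) = plus_rel E J Q S `` {?F (R, s)}"
  proof (rule plus_rel_image[OF S S m])
    fix y assume y: "((R, s), y) \<in> plus_rel E J P S"
    obtain R' s' where [simp]: "y = (R', s')" by (cases y)
    have m': "(R', s') \<in> matching_families E J P S"
      and loc: "locally E J S (\<lambda>f. f \<in> R \<and> f \<in> R' \<and> s f = s' f)"
      using y by (auto simp: plus_rel_iff[OF S])
    have "locally E J S (\<lambda>f. f \<in> R \<and> f \<in> R' \<and>
        (\<lambda>f\<in>R. \<alpha> (Dom E f) (s f)) f = (\<lambda>f\<in>R'. \<alpha> (Dom E f) (s' f)) f)"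
      by (rule locally_mono[OF S loc precomp_closed_agree[OF S matching_families_map[OF S \<alpha> m]
            matching_families_map[OF S \<alpha> m']]]) auto
    then show "(?F (R, s), ?F y) \<in> plus_rel E J Q S"
      using matching_families_map[OF S \<alpha> m] matching_families_map[OF S \<alpha> m']
      by (simp add: plus_rel_iff[OF S])
  qed
  then show ?thesis by (simp add: plus_map_def matching_class_def)
qed

lemma plus_is_presheaf:
  assumes P: "is_presheaf E P"
  shows "is_presheaf E (plus E J P)"
  unfolding is_presheaf_def
proof (intro conjI ballI impI)
  fix h X assume h: "h \<in> Arr E" and X: "X \<in> Sec (plus E J P) (Cod E h)"
  obtain R s where m: "(R, s) \<in> matching_families E J P (Cod E h)" and
    [simp]: "X = matching_class E J P (Cod E h) R s" using plus_SecE[OF X] .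
  show "Res (plus E J P) h X \<in> Sec (plus E J P) (Dom E h)"
    using plus_Res[OF P h m] matching_class_in_Sec[OF matching_families_pull[OF P h m]] by simp
next
  fix S X assume S: "S \<in> Obj E" and X: "X \<in> Sec (plus E J P) S"
  obtain R s where m: "(R, s) \<in> matching_families E J P S" and
    [simp]: "X = matching_class E J P S R s" using plus_SecE[OF X] .
  have R: "pull_sieve E (Idt E S) R = R"
  proof (intro set_eqI iffI)
    fix f assume "f \<in> pull_sieve E (Idt E S) R"
    then show "f \<in> R" using S by (auto simp: pull_sieve_def)
  next
    fix f assume f: "f \<in> R"
    then have "f \<in> Arr E" "Cod E f = S" using sieveD(1,2)[OF S matching_familiesD(1)[OF m]] by blast+
    then show "f \<in> pull_sieve E (Idt E S) R" using S f by (simp add: pull_sieve_def)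
  qed
  have "(\<lambda>g\<in>R. s (Idt E S \<cdot>\<^bsub>E\<^esub> g)) = s"
    by (rule extensionalityI[of _ R])
      (use matching_familiesD(2)[OF m] sieveD(1,2)[OF S matching_familiesD(1)[OF m]] in simp_all)
  then show "Res (plus E J P) (Idt E S) X = X"
    using plus_Res[OF P, of "Idt E S"] m S R by simp
next
  fix g h X assume g: "g \<in> Arr E" and h: "h \<in> Arr E" "Cod E h = Dom E g"
    and X: "X \<in> Sec (plus E J P) (Cod E g)"
  obtain R s where m: "(R, s) \<in> matching_families E J P (Cod E g)" and
    [simp]: "X = matching_class E J P (Cod E g) R s" using plus_SecE[OF X] .
  have gh: "g \<cdot>\<^bsub>E\<^esub> h \<in> Arr E" "Cod E (g \<cdot>\<^bsub>E\<^esub> h) = Cod E g" "Dom E (g \<cdot>\<^bsub>E\<^esub> h) = Dom E h" using g h by auto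
  have 1: "Res (plus E J P) (g \<cdot>\<^bsub>E\<^esub> h) X = matching_class E J P (Dom E h) (pull_sieve E (g \<cdot>\<^bsub>E\<^esub> h) R)
      (\<lambda>k\<in>pull_sieve E (g \<cdot>\<^bsub>E\<^esub> h) R. s ((g \<cdot>\<^bsub>E\<^esub> h) \<cdot>\<^bsub>E\<^esub> k))"
    using plus_Res[OF P gh(1), of R s] m gh by simp
  have 2: "Res (plus E J P) h (Res (plus E J P) g X) =
      matching_class E J P (Dom E h) (pull_sieve E h (pull_sieve E g R))
      (\<lambda>k\<in>pull_sieve E h (pull_sieve E g R). (\<lambda>k\<in>pull_sieve E g R. s (g \<cdot>\<^bsub>E\<^esub> k)) (h \<cdot>\<^bsub>E\<^esub> k))"
    using plus_Res[OF P g m] plus_Res[OF P h(1)] matching_families_pull[OF P g m] h by simp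
  have 3: "pull_sieve E h (pull_sieve E g R) = pull_sieve E (g \<cdot>\<^bsub>E\<^esub> h) R"
    using g h by (auto simp: pull_sieve_def)
  have "(\<lambda>k\<in>pull_sieve E h (pull_sieve E g R). (\<lambda>k\<in>pull_sieve E g R. s (g \<cdot>\<^bsub>E\<^esub> k)) (h \<cdot>\<^bsub>E\<^esub> k)) =
      (\<lambda>k\<in>pull_sieve E (g \<cdot>\<^bsub>E\<^esub> h) R. s ((g \<cdot>\<^bsub>E\<^esub> h) \<cdot>\<^bsub>E\<^esub> k))"
    unfolding 3 by (rule restrict_ext) (use g h in \<open>auto simp: pull_sieve_def\<close>)
  then show "Res (plus E J P) (g \<cdot>\<^bsub>E\<^esub> h) X = Res (plus E J P) h (Res (plus E J P) g X)"
    unfolding 1 2 3 by simp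
qed

lemma plus_map_is_presheaf_map:
  assumes P: "is_presheaf E P" and Q: "is_presheaf E Q" and \<alpha>: "is_presheaf_map E P Q \<alpha>"
  shows "is_presheaf_map E (plus E J P) (plus E J Q) (plus_map E J Q \<alpha>)"
  unfolding is_presheaf_map_def
proof (intro conjI ballI)
  fix S X assume S: "S \<in> Obj E" and X: "X \<in> Sec (plus E J P) S"
  obtain R s where m: "(R, s) \<in> matching_families E J P S" and
    [simp]: "X = matching_class E J P S R s" using plus_SecE[OF X] .
  show "plus_map E J Q \<alpha> S X \<in> Sec (plus E J Q) S"
    using plus_map_class[OF S \<alpha> m] matching_class_in_Sec[OF matching_families_map[OF S \<alpha> m]] by simp
next
  fix h X assume h: "h \<in> Arr E" and X: "X \<in> Sec (plus E J P) (Cod E h)"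
  have C: "Cod E h \<in> Obj E" and D: "Dom E h \<in> Obj E" using h by auto
  obtain R s where m: "(R, s) \<in> matching_families E J P (Cod E h)" and
    [simp]: "X = matching_class E J P (Cod E h) R s" using plus_SecE[OF X] .
  note m' = matching_families_map[OF C \<alpha> m]
  have "(\<lambda>g\<in>pull_sieve E h R. \<alpha> (Dom E g) ((\<lambda>g\<in>pull_sieve E h R. s (h \<cdot>\<^bsub>E\<^esub> g)) g)) =
      (\<lambda>g\<in>pull_sieve E h R. (\<lambda>f\<in>R. \<alpha> (Dom E f) (s f)) (h \<cdot>\<^bsub>E\<^esub> g))"
    by (rule restrict_ext) (use h in \<open>auto simp: pull_sieve_def\<close>)
  then show "plus_map E J Q \<alpha> (Dom E h) (Res (plus E J P) h X) =
      Res (plus E J Q) h (plus_map E J Q \<alpha> (Cod E h) X)"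
    using plus_Res[OF P h m] plus_map_class[OF D \<alpha> matching_families_pull[OF P h m]]
      plus_map_class[OF C \<alpha> m] plus_Res[OF Q h m'] by simp
qed

lemma plus_unit_matching:
  assumes "is_presheaf E P" "S \<in> Obj E" "p \<in> Sec P S"
  shows "({f \<in> Arr E. Cod E f = S}, \<lambda>f\<in>{f \<in> Arr E. Cod E f = S}. Res P f p)
    \<in> matching_families E J P S"
  using assms maximal_covering by (intro matching_familiesI) (auto simp: is_presheafD)

text \<open>Along a member \<open>f\<close> of the sieve the pulled back sieve is maximal, and the
  matching condition turns the pulled back family into the restrictions of
  \<open>s f\<close>.\<close>

lemma plus_Res_unit:
  assumes P: "is_presheaf E P" and S: "S \<in> Obj E" and m: "(R, s) \<in> matching_families E J P S"
    and f: "f \<in> R"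
  shows "Res (plus E J P) f (matching_class E J P S R s) = plus_unit E J P (Dom E f) (s f)"
proof -
  note f' = sieveD[OF S matching_familiesD(1)[OF m] f]
  have R: "pull_sieve E f R = {g \<in> Arr E. Cod E g = Dom E f}"
    using f'(3) by (auto simp: pull_sieve_def)
  have "(\<lambda>g\<in>pull_sieve E f R. s (f \<cdot>\<^bsub>E\<^esub> g)) = (\<lambda>g\<in>pull_sieve E f R. Res P g (s f))"
    by (rule restrict_ext) (use matching_familiesD(4)[OF m f] in \<open>auto simp: pull_sieve_def\<close>)
  then show ?thesis
    using plus_Res[OF P f'(1), of R s] m f'(2) R by (simp add: plus_unit_def)
qed

lemma plus_unit_is_presheaf_map:
  assumes P: "is_presheaf E P"
  shows "is_presheaf_map E P (plus E J P) (plus_unit E J P)"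
  unfolding is_presheaf_map_def
proof (intro conjI ballI)
  fix S p assume "S \<in> Obj E" "p \<in> Sec P S"
  then show "plus_unit E J P S p \<in> Sec (plus E J P) S"
    unfolding plus_unit_def by (intro matching_class_in_Sec plus_unit_matching[OF P])
next
  fix h p assume h: "h \<in> Arr E" "p \<in> Sec P (Cod E h)"
  then have C: "Cod E h \<in> Obj E" by simp
  show "plus_unit E J P (Dom E h) (Res P h p) = Res (plus E J P) h (plus_unit E J P (Cod E h) p)"
    using plus_Res_unit[OF P C plus_unit_matching[OF P C h(2)], of h] h
    by (simp add: plus_unit_def[of E J P "Cod E h"])
qed

lemma plus_unit_locally_injective:
  assumes P: "is_presheaf E P"
  shows "locally_injective E J P (plus_unit E J P)"
  unfolding locally_injective_def
proof (intro ballI impI)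
  fix S s t assume st: "S \<in> Obj E" "s \<in> Sec P S" "t \<in> Sec P S"
    "plus_unit E J P S s = plus_unit E J P S t"
  have "locally E J S (\<lambda>f. f \<in> {f \<in> Arr E. Cod E f = S} \<and> f \<in> {f \<in> Arr E. Cod E f = S} \<and>
      (\<lambda>f\<in>{f \<in> Arr E. Cod E f = S}. Res P f s) f = (\<lambda>f\<in>{f \<in> Arr E. Cod E f = S}. Res P f t) f)"
    using st(4) matching_class_eq[OF st(1) plus_unit_matching[OF P st(1,2)] plus_unit_matching[OF P st(1,3)]]
    by (simp add: plus_unit_def)
  then show "locally E J S (\<lambda>f. Res P f s = Res P f t)"
    by (subst (asm) locally_cong) auto
qed

text \<open>A class is represented by a family over some sieve, and over that very sieve its
  restrictions are units, by \<open>plus_Res_unit\<close>.\<close>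

lemma plus_unit_locally_surjective:
  assumes P: "is_presheaf E P"
  shows "locally_surjective E J P (plus E J P) (plus_unit E J P)"
  unfolding locally_surjective_def
proof (intro ballI)
  fix S X assume S: "S \<in> Obj E" and X: "X \<in> Sec (plus E J P) S"
  obtain R s where m: "(R, s) \<in> matching_families E J P S" and
    [simp]: "X = matching_class E J P S R s" using plus_SecE[OF X] .
  show "locally E J S (\<lambda>f. \<exists>p\<in>Sec P (Dom E f). plus_unit E J P (Dom E f) p = Res (plus E J P) f X)"
    by (rule locally_mono[OF S locally_sieve[OF S matching_familiesD(1)[OF m]]
          stable_Res_image[OF P plus_is_presheaf[OF P] plus_unit_is_presheaf_map[OF P] X]])
      (use plus_Res_unit[OF P S m] matching_familiesD(3)[OF m] in force)
qed

text \<open>Naturality of the unit. It is the square along which local properties pass between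
  \<alpha> and \<open>plus_map E J Q \<alpha>\<close>.\<close>

lemma plus_map_unit:
  assumes P: "is_presheaf E P" and \<alpha>: "is_presheaf_map E P Q \<alpha>" and S: "S \<in> Obj E" "p \<in> Sec P S"
  shows "plus_map E J Q \<alpha> S (plus_unit E J P S p) = plus_unit E J Q S (\<alpha> S p)"
proof -
  have "(\<lambda>f\<in>{f \<in> Arr E. Cod E f = S}. \<alpha> (Dom E f) ((\<lambda>f\<in>{f \<in> Arr E. Cod E f = S}. Res P f p) f)) =
    (\<lambda>f\<in>{f \<in> Arr E. Cod E f = S}. Res Q f (\<alpha> S p))"
    by (rule restrict_ext) (use S is_presheaf_mapD(2)[OF \<alpha>] in auto)
  then show ?thesis
    unfolding plus_unit_def plus_map_class[OF S(1) \<alpha> plus_unit_matching[OF P S]] by simp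
qed

text \<open>Where the restrictions of two classes agree, the units of the members \<open>s f\<close>
  and \<open>s' f\<close> agree, so these members agree locally; by transitivity the two families
  agree on a covering, which is equality of their classes.\<close>

lemma plus_separated:
  assumes P: "is_presheaf E P" and S: "S \<in> Obj E"
    and X: "X \<in> Sec (plus E J P) S" and Y: "Y \<in> Sec (plus E J P) S"
    and loc: "locally E J S (\<lambda>f. Res (plus E J P) f X = Res (plus E J P) f Y)"
  shows "X = Y"
proof -
  obtain R s where m: "(R, s) \<in> matching_families E J P S" and
    [simp]: "X = matching_class E J P S R s" using plus_SecE[OF X] .
  obtain R' s' where m': "(R', s') \<in> matching_families E J P S" and
    [simp]: "Y = matching_class E J P S R' s'" using plus_SecE[OF Y] .
  note both = locally_conj[OF S locally_sieve[OF S matching_familiesD(1)[OF m]]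
      locally_conj[OF S locally_sieve[OF S matching_familiesD(1)[OF m']] loc]]
  note closed = precomp_closed_agree[OF S m m']
  have "locally E J S (\<lambda>f. f \<in> R \<and> f \<in> R' \<and> s f = s' f)"
  proof (rule locally_trans[OF S both closed])
    fix f assume f: "f \<in> Arr E" "Cod E f = S"
      "f \<in> R \<and> f \<in> R' \<and> Res (plus E J P) f X = Res (plus E J P) f Y"
    then have "plus_unit E J P (Dom E f) (s f) = plus_unit E J P (Dom E f) (s' f)"
      using plus_Res_unit[OF P S m, of f] plus_Res_unit[OF P S m', of f] by simp
    then have loc: "locally E J (Dom E f) (\<lambda>h. Res P h (s f) = Res P h (s' f))"
      using plus_unit_locally_injective[OF P] f matching_familiesD(3)[OF m] matching_familiesD(3)[OF m']
      by (auto simp: locally_injective_def)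
    show "locally E J (Dom E f) (\<lambda>h. f \<cdot>\<^bsub>E\<^esub> h \<in> R \<and> f \<cdot>\<^bsub>E\<^esub> h \<in> R' \<and> s (f \<cdot>\<^bsub>E\<^esub> h) = s' (f \<cdot>\<^bsub>E\<^esub> h))"
    proof (rule locally_mono[OF _ loc])
      show "precomp_closed E (Dom E f)
        (\<lambda>h. f \<cdot>\<^bsub>E\<^esub> h \<in> R \<and> f \<cdot>\<^bsub>E\<^esub> h \<in> R' \<and> s (f \<cdot>\<^bsub>E\<^esub> h) = s' (f \<cdot>\<^bsub>E\<^esub> h))"
        using stable_pull[of f, unfolded f(2), OF closed] f by simp
      fix h assume h: "h \<in> Arr E" "Cod E h = Dom E f" "Res P h (s f) = Res P h (s' f)"
      then show "f \<cdot>\<^bsub>E\<^esub> h \<in> R \<and> f \<cdot>\<^bsub>E\<^esub> h \<in> R' \<and> s (f \<cdot>\<^bsub>E\<^esub> h) = s' (f \<cdot>\<^bsub>E\<^esub> h)"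
        using f matching_familiesD(1,4)[OF m] matching_familiesD(1,4)[OF m'] sieveD(3)[OF S] by simp
    qed (use f in auto)
  qed
  then show ?thesis by (simp add: matching_class_eq[OF S m m'])
qed

text \<open>In the naturality square of the unit both vertical maps are locally injective and
  locally surjective. Composition and cancellation along the two sides of the square give all four
  implications.\<close>

lemma plus_map_locally_bijective:
  assumes P: "is_presheaf E P" and Q: "is_presheaf E Q" and \<alpha>: "is_presheaf_map E P Q \<alpha>"
  shows "locally_injective E J (plus E J P) (plus_map E J Q \<alpha>) \<longleftrightarrow> locally_injective E J P \<alpha>"
    and "locally_injective E J P \<alpha> \<Longrightarrow>
      locally_surjective E J (plus E J P) (plus E J Q) (plus_map E J Q \<alpha>) \<longleftrightarrow>
      locally_surjective E J P Q \<alpha>"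
proof -
  note P' = plus_is_presheaf[OF P] and Q' = plus_is_presheaf[OF Q]
    and \<alpha>' = plus_map_is_presheaf_map[OF P Q \<alpha>]
    and \<eta>P = plus_unit_is_presheaf_map[OF P] and \<eta>Q = plus_unit_is_presheaf_map[OF Q]
  have inj: "locally_injective E J P (\<lambda>S s. plus_map E J Q \<alpha> S (plus_unit E J P S s)) \<longleftrightarrow>
      locally_injective E J P (\<lambda>S s. plus_unit E J Q S (\<alpha> S s))"
    unfolding locally_injective_def by (simp add: plus_map_unit[OF P \<alpha>])
  have surj: "locally_surjective E J P (plus E J Q) (\<lambda>S s. plus_map E J Q \<alpha> S (plus_unit E J P S s)) \<longleftrightarrow>
      locally_surjective E J P (plus E J Q) (\<lambda>S s. plus_unit E J Q S (\<alpha> S s))"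
    unfolding locally_surjective_def
    by (intro ball_cong refl locally_cong) (auto simp: plus_map_unit[OF P \<alpha>])
  show "locally_injective E J (plus E J P) (plus_map E J Q \<alpha>) \<longleftrightarrow> locally_injective E J P \<alpha>"
  proof
    assume "locally_injective E J (plus E J P) (plus_map E J Q \<alpha>)"
    from locally_injective_comp[OF P P' \<eta>P plus_unit_locally_injective[OF P] this]
    show "locally_injective E J P \<alpha>" unfolding inj by (rule locally_injective_cancel)
  next
    assume "locally_injective E J P \<alpha>"
    from locally_injective_comp[OF P Q \<alpha> this plus_unit_locally_injective[OF Q]]
    show "locally_injective E J (plus E J P) (plus_map E J Q \<alpha>)"
      unfolding inj[symmetric]
      by (rule locally_injective_cancel_surjective[OF P P' Q' \<eta>P \<alpha>' _ plus_unit_locally_surjective[OF P]])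
  qed
  show "locally_surjective E J (plus E J P) (plus E J Q) (plus_map E J Q \<alpha>) \<longleftrightarrow>
      locally_surjective E J P Q \<alpha>"
  proof
    assume "locally_surjective E J (plus E J P) (plus E J Q) (plus_map E J Q \<alpha>)"
    from locally_surjective_comp[OF P P' Q' \<eta>P \<alpha>' plus_unit_locally_surjective[OF P] this]
    show "locally_surjective E J P Q \<alpha>"
      unfolding surj
      by (rule locally_surjective_cancel_injective[OF P Q Q' \<alpha> \<eta>Q _ plus_unit_locally_injective[OF Q]])
  next
    assume "locally_surjective E J P Q \<alpha>"
    from locally_surjective_comp[OF P Q Q' \<alpha> \<eta>Q this plus_unit_locally_surjective[OF Q]]
    show "locally_surjective E J (plus E J P) (plus E J Q) (plus_map E J Q \<alpha>)"
      unfolding surj[symmetric]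
      by (rule locally_surjective_cancel[OF P P' Q' \<eta>P \<alpha>'])
  qed
qed

section \<open>From local bijections to bijections of sheafifications\<close>

text \<open>The plus construction of \<open>P\<close> is separated, and on a separated presheaf a
  locally injective map is injective.\<close>

lemma plus_map_injective:
  assumes P: "is_presheaf E P" and Q: "is_presheaf E Q" and \<alpha>: "is_presheaf_map E P Q \<alpha>"
    and inj: "locally_injective E J P \<alpha>" and S: "S \<in> Obj E"
  shows "inj_on (plus_map E J Q \<alpha> S) (Sec (plus E J P) S)"
proof (rule inj_onI)
  fix X Y assume "X \<in> Sec (plus E J P) S" "Y \<in> Sec (plus E J P) S"
    "plus_map E J Q \<alpha> S X = plus_map E J Q \<alpha> S Y"
  then show "X = Y"
    using plus_map_locally_bijective(1)[OF P Q \<alpha>] inj S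
    by (intro plus_separated[OF P S]) (auto simp: locally_injective_def)
qed

text \<open>Local surjectivity yields preimages of a matching family only on a covering. Injectivity
  of \<alpha> makes them unique, so they match without further refinement and define a preimage of
  the class.\<close>

lemma plus_map_bijective:
  assumes P: "is_presheaf E P" and Q: "is_presheaf E Q" and \<alpha>: "is_presheaf_map E P Q \<alpha>"
    and inj: "\<And>S. S \<in> Obj E \<Longrightarrow> inj_on (\<alpha> S) (Sec P S)"
    and surj: "locally_surjective E J P Q \<alpha>" and S: "S \<in> Obj E"
  shows "bij_betw (plus_map E J Q \<alpha> S) (Sec (plus E J P) S) (Sec (plus E J Q) S)"
  unfolding bij_betw_def
proof
  have "locally_injective E J P \<alpha>"
    unfolding locally_injective_def using inj by (auto dest: inj_onD intro!: locally_all)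
  then show "inj_on (plus_map E J Q \<alpha> S) (Sec (plus E J P) S)"
    by (rule plus_map_injective[OF P Q \<alpha> _ S])
  have "Y \<in> plus_map E J Q \<alpha> S ` Sec (plus E J P) S" if Y: "Y \<in> Sec (plus E J Q) S" for Y
  proof -
    obtain R t where m: "(R, t) \<in> matching_families E J Q S" and
      Y_eq: "Y = matching_class E J Q S R t" using plus_SecE[OF Y] .
    note R = sieveD[OF S matching_familiesD(1)[OF m]]
    \<comment> \<open>The members of \<open>R\<close> at which \<open>t\<close> has a preimage; they
      will be shown to form a refinement of \<open>S\<close>.\<close>
    define K where "K = {f \<in> Arr E. Cod E f = S \<and> f \<in> R \<and> t f \<in> \<alpha> (Dom E f) ` Sec P (Dom E f)}"
    define s where "s = (\<lambda>f\<in>K. the_inv_into (Sec P (Dom E f)) (\<alpha> (Dom E f)) (t f))"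
    have s: "s f \<in> Sec P (Dom E f)" "\<alpha> (Dom E f) (s f) = t f" if "f \<in> K" for f
    proof -
      have "inj_on (\<alpha> (Dom E f)) (Sec P (Dom E f))" "t f \<in> \<alpha> (Dom E f) ` Sec P (Dom E f)"
        using that inj by (auto simp: K_def)
      then show "s f \<in> Sec P (Dom E f)" "\<alpha> (Dom E f) (s f) = t f"
        using that by (simp_all add: s_def the_inv_into_into f_the_inv_into_f)
    qed
    \<comment> \<open>The restriction of the preimage of \<open>t f\<close> is a preimage of
      \<open>t\<close> at \<open>f h\<close>. So \<open>K\<close> is closed under precomposition,
      and by uniqueness \<open>s\<close> is matching.\<close>
    have step: "f \<cdot>\<^bsub>E\<^esub> h \<in> K \<and> s (f \<cdot>\<^bsub>E\<^esub> h) = Res P h (s f)"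
      if "f \<in> K" "h \<in> Arr E" "Cod E h = Dom E f" for f h
    proof -
      have f: "f \<in> Arr E" "Cod E f = S" "f \<in> R" using that by (auto simp: K_def)
      have sh: "Res P h (s f) \<in> Sec P (Dom E h)"
        using is_presheafD(1)[OF P that(2)] s(1)[OF that(1)] that(3) by simp
      have th: "\<alpha> (Dom E h) (Res P h (s f)) = t (f \<cdot>\<^bsub>E\<^esub> h)"
        using is_presheaf_mapD(2)[OF \<alpha> that(2), of "s f"] s[OF that(1)] that(2,3)
          matching_familiesD(4)[OF m f(3)] by simp
      have *: "f \<cdot>\<^bsub>E\<^esub> h \<in> K"
        using f that R(3) sh th[symmetric] by (auto simp: K_def)
      have "inj_on (\<alpha> (Dom E h)) (Sec P (Dom E h))" using inj that by simp
      then have "s (f \<cdot>\<^bsub>E\<^esub> h) = Res P h (s f)"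
        using s[OF *] sh th f that by (intro inj_onD[of "\<alpha> (Dom E h)"]) auto
      with * show ?thesis ..
    qed
    have closed: "precomp_closed E S (\<lambda>f. f \<in> R \<and> t f \<in> \<alpha> (Dom E f) ` Sec P (Dom E f))"
      using step by (intro precomp_closedI) (auto simp: K_def)
    have "locally E J S (\<lambda>f. f \<in> R \<and> t f \<in> \<alpha> (Dom E f) ` Sec P (Dom E f))"
    proof (rule locally_trans[OF S locally_sieve[OF S matching_familiesD(1)[OF m]] closed])
      fix f assume f: "f \<in> Arr E" "Cod E f = S" "f \<in> R"
      then have "locally E J (Dom E f) (\<lambda>h. \<exists>p\<in>Sec P (Dom E h). \<alpha> (Dom E h) p = Res Q h (t f))"
        using surj matching_familiesD(3)[OF m] by (auto simp: locally_surjective_def)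
      then show "locally E J (Dom E f) (\<lambda>h. f \<cdot>\<^bsub>E\<^esub> h \<in> R \<and>
          t (f \<cdot>\<^bsub>E\<^esub> h) \<in> \<alpha> (Dom E (f \<cdot>\<^bsub>E\<^esub> h)) ` Sec P (Dom E (f \<cdot>\<^bsub>E\<^esub> h)))"
        using f R(3) matching_familiesD(4)[OF m]
        by (subst locally_cong[where Q' = "\<lambda>h. \<exists>p\<in>Sec P (Dom E h). \<alpha> (Dom E h) p = Res Q h (t f)"])
          (auto simp: image_iff eq_commute)
    qed
    then have K: "K \<in> J S" by (simp add: locally_def K_def)
    have s_ext: "s \<in> extensional K" by (simp add: s_def)
    have mK: "(K, s) \<in> matching_families E J P S"
      using K s step by (intro matching_familiesI) (auto simp: s_ext)
    note mK' = matching_families_map[OF S \<alpha> mK]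
    have "locally E J S (\<lambda>f. f \<in> K \<and> f \<in> R \<and> (\<lambda>f\<in>K. \<alpha> (Dom E f) (s f)) f = t f)"
      by (rule locally_mono[OF S locally_sieve[OF S K] precomp_closed_agree[OF S mK' m]])
        (use s(2) in \<open>auto simp: K_def\<close>)
    then have "matching_class E J Q S K (\<lambda>f\<in>K. \<alpha> (Dom E f) (s f)) = matching_class E J Q S R t"
      by (simp only: matching_class_eq[OF S mK' m])
    then have "plus_map E J Q \<alpha> S (matching_class E J P S K s) = Y"
      by (simp add: plus_map_class[OF S \<alpha> mK] Y_eq)
    then show ?thesis using matching_class_in_Sec[OF mK] by blast
  qed
  then show "plus_map E J Q \<alpha> S ` Sec (plus E J P) S = Sec (plus E J Q) S"
    using is_presheaf_mapD(1)[OF plus_map_is_presheaf_map[OF P Q \<alpha>] S] by auto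
qed

text \<open>The first plus construction turns local injectivity into injectivity, the second turns
  an injective and locally surjective map into a bijection. Conversely a bijection is locally
  bijective, and this descends through both plus constructions.\<close>

theorem iso_after_sheafification_iff:
  assumes P: "is_presheaf E P" and Q: "is_presheaf E Q" and \<alpha>: "is_presheaf_map E P Q \<alpha>"
  shows "iso_after_sheafification E J P Q \<alpha> \<longleftrightarrow>
    locally_injective E J P \<alpha> \<and> locally_surjective E J P Q \<alpha>"
proof -
  note P1 = plus_is_presheaf[OF P] and Q1 = plus_is_presheaf[OF Q]
  note \<alpha>1 = plus_map_is_presheaf_map[OF P Q \<alpha>]
  note P2 = plus_is_presheaf[OF P1] and Q2 = plus_is_presheaf[OF Q1]
  note \<alpha>2 = plus_map_is_presheaf_map[OF P1 Q1 \<alpha>1]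
  note bij = plus_map_locally_bijective[OF P Q \<alpha>] plus_map_locally_bijective[OF P1 Q1 \<alpha>1]
  show ?thesis
  proof
    assume *: "iso_after_sheafification E J P Q \<alpha>"
    have b: "bij_betw (plus_map E J (plus E J Q) (plus_map E J Q \<alpha>) S)
        (Sec (plus E J (plus E J P)) S) (Sec (plus E J (plus E J Q)) S)" if "S \<in> Obj E" for S
      using * that
      by (simp add: iso_after_sheafification_def sheafification_map_def sheafification_def)
    have "locally_injective E J (plus E J (plus E J P)) (plus_map E J (plus E J Q) (plus_map E J Q \<alpha>))"
      unfolding locally_injective_def
      using b by (auto simp: bij_betw_def dest: inj_onD intro!: locally_all)
    moreover have "locally_surjective E J (plus E J (plus E J P)) (plus E J (plus E J Q))
        (plus_map E J (plus E J Q) (plus_map E J Q \<alpha>))"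
      unfolding locally_surjective_def
    proof (intro ballI locally_all)
      fix S q f assume q: "S \<in> Obj E" "q \<in> Sec (plus E J (plus E J Q)) S" "f \<in> Arr E" "Cod E f = S"
      then have "Res (plus E J (plus E J Q)) f q \<in> Sec (plus E J (plus E J Q)) (Dom E f)"
        using is_presheafD(1)[OF Q2] by simp
      then show "\<exists>p\<in>Sec (plus E J (plus E J P)) (Dom E f).
          plus_map E J (plus E J Q) (plus_map E J Q \<alpha>) (Dom E f) p = Res (plus E J (plus E J Q)) f q"
        using b[of "Dom E f"] q(3) by (auto simp: bij_betw_def image_iff eq_commute set_eq_iff)
    qed
    ultimately show "locally_injective E J P \<alpha> \<and> locally_surjective E J P Q \<alpha>"
      using bij by auto
  next
    assume "locally_injective E J P \<alpha> \<and> locally_surjective E J P Q \<alpha>"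
    then have *: "locally_injective E J P \<alpha>"
      "locally_surjective E J (plus E J P) (plus E J Q) (plus_map E J Q \<alpha>)"
      using bij by auto
    show "iso_after_sheafification E J P Q \<alpha>"
      unfolding iso_after_sheafification_def sheafification_map_def sheafification_def
      using plus_map_bijective[OF P1 Q1 \<alpha>1 plus_map_injective[OF P Q \<alpha> *(1)] *(2)] by blast
  qed
qed

end

section \<open>Slices of a site\<close>

lemma slice_simps [simp]:
  "Obj (slice E S) = {f \<in> Arr E. Cod E f = S}"
  "Arr (slice E S) = {(f, h). f \<in> Arr E \<and> Cod E f = S \<and> h \<in> Arr E \<and> Cod E h = Dom E f}"
  "Dom (slice E S) (f, h) = f \<cdot>\<^bsub>E\<^esub> h"
  "Cod (slice E S) a = fst a"
  "Idt (slice E S) f = (f, Idt E (Dom E f))"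
  "(f, h) \<cdot>\<^bsub>slice E S\<^esub> (f', h') = (f, h \<cdot>\<^bsub>E\<^esub> h')"
  by (simp_all add: slice_def)

context category
begin

lemma category_slice: "category (slice C S)"
proof
  fix f assume "f \<in> Arr (slice C S)" then show "Dom (slice C S) f \<in> Obj (slice C S)"
    by (clarsimp)
next
  fix f assume "f \<in> Arr (slice C S)" then show "Cod (slice C S) f \<in> Obj (slice C S)"
    by (clarsimp)
next
  fix f assume "f \<in> Obj (slice C S)" then show "Idt (slice C S) f \<in> hom (slice C S) f f"
    by (clarsimp simp: hom_def)
next
  fix f a b g c assume "f \<in> hom (slice C S) a b" "g \<in> hom (slice C S) b c"
  then show "g \<cdot>\<^bsub>slice C S\<^esub> f \<in> hom (slice C S) a c"
  proof -
    obtain p h q k where fg: "f = (p, h)" "g = (q, k)" by (cases f, cases g)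
    have *: "q \<in> Arr C" "Cod C q = S" "k \<in> Arr C" "Cod C k = Dom C q" "h \<in> Arr C" "p = q \<cdot> k" "a = p \<cdot> h" "c = q"
        "Cod C h = Dom C p"
      using \<open>f \<in> _\<close> \<open>g \<in> _\<close> by (auto simp: hom_def fg)
    then have "Cod C h = Dom C k" by simp
    with * show ?thesis by (simp add: hom_def fg)
  qed
next
  fix f a b assume "f \<in> hom (slice C S) a b"
  then show "f \<cdot>\<^bsub>slice C S\<^esub> Idt (slice C S) a = f"
    by (cases f) (clarsimp simp: hom_def)
next
  fix f a b assume "f \<in> hom (slice C S) a b"
  then show "Idt (slice C S) b \<cdot>\<^bsub>slice C S\<^esub> f = f"
    by (cases f) (clarsimp simp: hom_def)
next
  fix f a b g c h d assume fg: "f \<in> hom (slice C S) a b" "g \<in> hom (slice C S) b c" "h \<in> hom (slice C S) c d"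
  then show "(h \<cdot>\<^bsub>slice C S\<^esub> g) \<cdot>\<^bsub>slice C S\<^esub> f = h \<cdot>\<^bsub>slice C S\<^esub> (g \<cdot>\<^bsub>slice C S\<^esub> f)"
  proof -
    obtain p m q k r l where fgh: "f = (p, m)" "g = (q, k)" "h = (r, l)"
      by (cases f, cases g, cases h)
    have "p = q \<cdot> k" "q = r \<cdot> l" "r \<in> Arr C" "l \<in> Arr C" "Cod C l = Dom C r"
      "k \<in> Arr C" "Cod C k = Dom C q" "m \<in> Arr C" "Cod C m = Dom C p"
      using fg by (auto simp: hom_def fgh)
    then have "m \<in> Arr C" "k \<in> Arr C" "l \<in> Arr C" "Cod C m = Dom C k" "Cod C k = Dom C l"
      by simp_all
    then show ?thesis by (simp add: fgh)
  qed
qed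
end

context site
begin

text \<open>Every arrow of the slice into \<open>f\<close> has first component \<open>f\<close>.
  Hence sets of such arrows, in particular sieves, correspond to sets of arrows of \<open>E\<close>
  into the domain of \<open>f\<close>.\<close>

lemma slice_arrows_over:
  assumes "f \<in> Arr E" "Cod E f = S"
  shows "{a \<in> Arr (slice E S). Cod (slice E S) a = f \<and> Q a} =
    {f} \<times> {h \<in> Arr E. Cod E h = Dom E f \<and> Q (f, h)}"
proof (rule set_eqI)
  fix a
  show "a \<in> {a \<in> Arr (slice E S). Cod (slice E S) a = f \<and> Q a} \<longleftrightarrow>
      a \<in> {f} \<times> {h \<in> Arr E. Cod E h = Dom E f \<and> Q (f, h)}"
    using assms by (cases a) force
qed

lemma is_sieve_slice:
  assumes "f \<in> Arr E" "Cod E f = S"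
  shows "is_sieve (slice E S) f R \<longleftrightarrow> (\<exists>R'. is_sieve E (Dom E f) R' \<and> R = {f} \<times> R')"
proof
  assume R: "is_sieve (slice E S) f R"
  then have "R = {f} \<times> snd ` R" by (force simp: is_sieve_def)
  moreover have "is_sieve E (Dom E f) (snd ` R)"
    unfolding is_sieve_def
  proof (intro conjI ballI impI)
    show "snd ` R \<subseteq> {g \<in> Arr E. Cod E g = Dom E f}" using R by (auto simp: is_sieve_def)
    fix h k assume h: "h \<in> snd ` R" and k: "k \<in> Arr E" "Cod E k = Dom E h"
    then have fh: "(f, h) \<in> R" using R by (force simp: is_sieve_def)
    then have h': "h \<in> Arr E" "Cod E h = Dom E f" using R by (auto simp: is_sieve_def)
    have "(f, h) \<cdot>\<^bsub>slice E S\<^esub> (f \<cdot>\<^bsub>E\<^esub> h, k) \<in> R"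
      using R fh k h' assms unfolding is_sieve_def by (auto simp del: slice_simps(6))
    then show "h \<cdot>\<^bsub>E\<^esub> k \<in> snd ` R" by force
  qed
  ultimately show "\<exists>R'. is_sieve E (Dom E f) R' \<and> R = {f} \<times> R'" by blast
next
  assume "\<exists>R'. is_sieve E (Dom E f) R' \<and> R = {f} \<times> R'"
  then show "is_sieve (slice E S) f R" using assms by (auto simp: is_sieve_def)
qed

lemma slice_topology_iff:
  assumes "f \<in> Arr E" "Cod E f = S"
  shows "R \<in> slice_topology E J S f \<longleftrightarrow> (\<exists>R'\<in>J (Dom E f). R = {f} \<times> R')"
proof
  assume "R \<in> slice_topology E J S f"
  then obtain R' where "is_sieve E (Dom E f) R'" "R = {f} \<times> R'" "snd ` R \<in> J (Dom E f)"
    using is_sieve_slice[OF assms] by (auto simp: slice_topology_def)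
  then show "\<exists>R'\<in>J (Dom E f). R = {f} \<times> R'" by auto
next
  assume "\<exists>R'\<in>J (Dom E f). R = {f} \<times> R'"
  then show "R \<in> slice_topology E J S f"
    using is_sieve_slice[OF assms, of R] covering_is_sieve[of "Dom E f"] assms
    by (force simp: slice_topology_def)
qed

lemma Times_in_slice_topology:
  assumes "f \<in> Arr E" "Cod E f = S"
  shows "{f} \<times> R \<in> slice_topology E J S f \<longleftrightarrow> R \<in> J (Dom E f)"
proof -
  have "{f} \<times> R = {f} \<times> R' \<longleftrightarrow> R = R'" for R' by auto
  then show ?thesis using slice_topology_iff[OF assms] by simp
qed

lemma pull_sieve_slice:
  assumes "f \<in> Arr E" "Cod E f = S" "h \<in> Arr E" "Cod E h = Dom E f"
  shows "pull_sieve (slice E S) (f, h) ({f} \<times> R) = {f \<cdot>\<^bsub>E\<^esub> h} \<times> pull_sieve E h R"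
proof (rule set_eqI)
  fix a
  show "a \<in> pull_sieve (slice E S) (f, h) ({f} \<times> R) \<longleftrightarrow> a \<in> {f \<cdot>\<^bsub>E\<^esub> h} \<times> pull_sieve E h R"
    using assms by (cases a) (force simp: pull_sieve_def)
qed

text \<open>Sieves on \<open>f\<close> have the form \<open>{f} \<times> R\<close> and pulling back
  acts on \<open>R\<close> alone, so each axiom reduces to the same axiom of \<open>E\<close> at the
  domain of \<open>f\<close>.\<close>

lemma site_slice: "site (slice E S) (slice_topology E J S)"
proof -
  have "site_axioms (slice E S) (slice_topology E J S)"
  proof (rule site_axioms.intro)
    show "is_sieve (slice E S) f R" if "R \<in> slice_topology E J S f" for f R
      using that by (simp add: slice_topology_def)
  next
    fix f assume "f \<in> Obj (slice E S)"
    then have f: "f \<in> Arr E" "Cod E f = S" by auto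
    have "{a \<in> Arr (slice E S). Cod (slice E S) a = f} = {f} \<times> {h \<in> Arr E. Cod E h = Dom E f}"
      using slice_arrows_over[OF f, of "\<lambda>_. True"] by simp
    then show "{a \<in> Arr (slice E S). Cod (slice E S) a = f} \<in> slice_topology E J S f"
      using Times_in_slice_topology[OF f] maximal_covering f by simp
  next
    fix a R assume a: "a \<in> Arr (slice E S)" and R: "R \<in> slice_topology E J S (Cod (slice E S) a)"
    obtain f h where a_eq: "a = (f, h)" by (cases a)
    then have f: "f \<in> Arr E" "Cod E f = S" "h \<in> Arr E" "Cod E h = Dom E f" using a by auto
    then obtain R' where R': "R' \<in> J (Dom E f)" "R = {f} \<times> R'"
      using R slice_topology_iff[OF f(1,2)] a_eq by auto
    have "pull_sieve (slice E S) a R = {f \<cdot>\<^bsub>E\<^esub> h} \<times> pull_sieve E h R'"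
      unfolding a_eq R'(2) by (rule pull_sieve_slice[OF f])
    moreover have "pull_sieve E h R' \<in> J (Dom E h)" using pull_covering f R' by simp
    ultimately show "pull_sieve (slice E S) a R \<in> slice_topology E J S (Dom (slice E S) a)"
      using Times_in_slice_topology[of "f \<cdot>\<^bsub>E\<^esub> h" S] f a_eq by simp
  next
    fix f R K assume "f \<in> Obj (slice E S)" and R: "R \<in> slice_topology E J S f"
      and K: "is_sieve (slice E S) f K"
      and step: "\<And>a. a \<in> R \<Longrightarrow> pull_sieve (slice E S) a K \<in> slice_topology E J S (Dom (slice E S) a)"
    then have f: "f \<in> Arr E" "Cod E f = S" by auto
    obtain R' where R': "R' \<in> J (Dom E f)" "R = {f} \<times> R'" using R slice_topology_iff[OF f] by auto
    obtain K' where K': "is_sieve E (Dom E f) K'" "K = {f} \<times> K'" using K is_sieve_slice[OF f] by auto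
    have "K' \<in> J (Dom E f)"
    proof (rule local_covering[OF _ R'(1) K'(1)])
      fix h assume "h \<in> R'"
      then have h: "h \<in> Arr E" "Cod E h = Dom E f" "(f, h) \<in> R"
        using sieveD(1,2)[OF _ R'(1)] f R' by auto
      have "pull_sieve (slice E S) (f, h) K = {f \<cdot>\<^bsub>E\<^esub> h} \<times> pull_sieve E h K'"
        unfolding K'(2) by (rule pull_sieve_slice[OF f h(1,2)])
      then show "pull_sieve E h K' \<in> J (Dom E h)"
        using step[OF h(3)] Times_in_slice_topology[of "f \<cdot>\<^bsub>E\<^esub> h" S] f h by simp
    qed (use f in auto)
    then show "K \<in> slice_topology E J S f" using Times_in_slice_topology[OF f] K' by simp
  qed
  then show ?thesis using category_slice by (simp add: site_def)
qed

text \<open>The passage from the slices, where the Hom presheaves live, back to coverings in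
  \<open>E\<close>.\<close>

lemma locally_slice:
  assumes "f \<in> Arr E" "Cod E f = S"
  shows "locally (slice E S) (slice_topology E J S) f Q \<longleftrightarrow> locally E J (Dom E f) (\<lambda>h. Q (f, h))"
  unfolding locally_def slice_arrows_over[OF assms] Times_in_slice_topology[OF assms] ..

end

section \<open>Cartesian arrows\<close>

abbreviation "TObj F \<equiv> Obj (Total F)"
abbreviation "TArr F \<equiv> Arr (Total F)"
abbreviation "TDom F \<equiv> Dom (Total F)"
abbreviation "TCod F \<equiv> Cod (Total F)"
abbreviation "TIdt F \<equiv> Idt (Total F)"
abbreviation "base_obj F \<equiv> on_obj (Proj F)"
abbreviation "base_arr F \<equiv> on_arr (Proj F)"

lemma is_functorD:
  assumes "is_functor A B u"
  shows "a \<in> Obj A \<Longrightarrow> on_obj u a \<in> Obj B"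
    "f \<in> Arr A \<Longrightarrow> on_arr u f \<in> Arr B"
    "f \<in> Arr A \<Longrightarrow> Dom B (on_arr u f) = on_obj u (Dom A f)"
    "f \<in> Arr A \<Longrightarrow> Cod B (on_arr u f) = on_obj u (Cod A f)"
    "a \<in> Obj A \<Longrightarrow> on_arr u (Idt A a) = Idt B (on_obj u a)"
    "\<lbrakk>f \<in> Arr A; g \<in> Arr A; Cod A f = Dom A g\<rbrakk>
      \<Longrightarrow> on_arr u (g \<cdot>\<^bsub>A\<^esub> f) = on_arr u g \<cdot>\<^bsub>B\<^esub> on_arr u f"
  using assms unfolding is_functor_def hom_def by auto

lemma is_functorI:
  assumes "\<And>a. a \<in> Obj A \<Longrightarrow> on_obj u a \<in> Obj B"
    "\<And>f. f \<in> Arr A \<Longrightarrow> on_arr u f \<in> Arr B"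
    "\<And>f. f \<in> Arr A \<Longrightarrow> Dom B (on_arr u f) = on_obj u (Dom A f)"
    "\<And>f. f \<in> Arr A \<Longrightarrow> Cod B (on_arr u f) = on_obj u (Cod A f)"
    "\<And>a. a \<in> Obj A \<Longrightarrow> on_arr u (Idt A a) = Idt B (on_obj u a)"
    "\<And>f g. \<lbrakk>f \<in> Arr A; g \<in> Arr A; Cod A f = Dom A g\<rbrakk>
      \<Longrightarrow> on_arr u (g \<cdot>\<^bsub>A\<^esub> f) = on_arr u g \<cdot>\<^bsub>B\<^esub> on_arr u f"
  shows "is_functor A B u"
  unfolding is_functor_def hom_def using assms by simp

locale fibration_over = base: category E
  for E :: "('o, 'm) precategory" +
  fixes F :: "('o, 'm, 'x, 'y) fibration"
  assumes is_fibration: "is_fibration E F"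
begin

sublocale total: category "Total F"
  using is_fibration by (simp add: is_fibration_def)

lemma Proj_functor: "is_functor (Total F) E (Proj F)"
  using is_fibration by (simp add: is_fibration_def)

lemmas Proj_simps [simp] = is_functorD[OF Proj_functor]

lemma ex_cartesian:
  assumes "x \<in> TObj F" "f \<in> Arr E" "Cod E f = base_obj F x"
  obtains c where "is_cartesian E F c" "c \<in> TArr F" "TCod F c = x" "base_arr F c = f"
    "base_obj F (TDom F c) = Dom E f"
proof -
  obtain c where c: "is_cartesian E F c" "TCod F c = x" "base_arr F c = f"
    using assms is_fibration by (auto simp: is_fibration_def)
  then have "c \<in> TArr F" by (simp add: is_cartesian_def)
  with c that show thesis by (metis Proj_simps(3))
qed

lemma cartesian_Arr: "is_cartesian E F c \<Longrightarrow> c \<in> TArr F"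
  by (simp add: is_cartesian_def)

lemma is_cartesianI:
  assumes c: "c \<in> TArr F"
    and ex: "\<And>g h. \<lbrakk>g \<in> TArr F; TCod F g = TCod F c; h \<in> Arr E; Dom E h = base_obj F (TDom F g);
        Cod E h = base_obj F (TDom F c); base_arr F g = base_arr F c \<cdot>\<^bsub>E\<^esub> h\<rbrakk>
      \<Longrightarrow> \<exists>k\<in>TArr F. TDom F k = TDom F g \<and> TCod F k = TDom F c \<and> base_arr F k = h \<and>
          c \<cdot>\<^bsub>Total F\<^esub> k = g"
    and un: "\<And>k k'. \<lbrakk>k \<in> TArr F; k' \<in> TArr F; TDom F k = TDom F k'; TCod F k = TDom F c;
        TCod F k' = TDom F c; base_arr F k = base_arr F k';
        c \<cdot>\<^bsub>Total F\<^esub> k = c \<cdot>\<^bsub>Total F\<^esub> k'\<rbrakk> \<Longrightarrow> k = k'"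
  shows "is_cartesian E F c"
  unfolding is_cartesian_def
proof (intro conjI allI ballI impI c)
  fix z g h assume "g \<in> hom (Total F) z (TCod F c)"
    "h \<in> hom E (base_obj F z) (base_obj F (TDom F c))" "base_arr F g = base_arr F c \<cdot>\<^bsub>E\<^esub> h"
  then obtain k where "k \<in> TArr F" "TDom F k = z" "TCod F k = TDom F c" "base_arr F k = h"
    "c \<cdot>\<^bsub>Total F\<^esub> k = g"
    using ex[of g h] by (auto simp: hom_def)
  then show "\<exists>!k. k \<in> hom (Total F) z (TDom F c) \<and> base_arr F k = h \<and> c \<cdot>\<^bsub>Total F\<^esub> k = g"
    by (intro ex1I[of _ k] conjI) (auto simp: hom_def intro: un)
qed

lemma cartesian_factor:
  assumes "is_cartesian E F c" "g \<in> TArr F" "TCod F g = TCod F c" "h \<in> Arr E"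
    "Dom E h = base_obj F (TDom F g)" "Cod E h = base_obj F (TDom F c)"
    "base_arr F g = base_arr F c \<cdot>\<^bsub>E\<^esub> h"
  obtains k where "k \<in> TArr F" "TDom F k = TDom F g" "TCod F k = TDom F c" "base_arr F k = h"
    "c \<cdot>\<^bsub>Total F\<^esub> k = g"
proof -
  have "\<exists>!k. k \<in> hom (Total F) (TDom F g) (TDom F c) \<and> base_arr F k = h \<and> c \<cdot>\<^bsub>Total F\<^esub> k = g"
    using assms unfolding is_cartesian_def hom_def by simp
  then show thesis using that by (auto simp: hom_def)
qed

lemma cartesian_cancel:
  assumes c: "is_cartesian E F c" and k: "k \<in> TArr F" "k' \<in> TArr F" "TDom F k = TDom F k'"
    "TCod F k = TDom F c" "TCod F k' = TDom F c" "base_arr F k = base_arr F k'"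
    "c \<cdot>\<^bsub>Total F\<^esub> k = c \<cdot>\<^bsub>Total F\<^esub> k'"
  shows "k = k'"
proof -
  note c' = cartesian_Arr[OF c]
  have "\<exists>!j. j \<in> hom (Total F) (TDom F k') (TDom F c) \<and> base_arr F j = base_arr F k' \<and>
      c \<cdot>\<^bsub>Total F\<^esub> j = c \<cdot>\<^bsub>Total F\<^esub> k'"
    using c unfolding is_cartesian_def
    by (elim conjE allE[of _ "TDom F k'"] ballE[of _ _ "c \<cdot>\<^bsub>Total F\<^esub> k'"]
        ballE[of _ _ "base_arr F k'"] impE) (use c' k in \<open>auto simp: hom_def\<close>)
  then show ?thesis using k by (auto simp: hom_def)
qed

lemma cartesian_comp:
  assumes c: "is_cartesian E F c" and d: "is_cartesian E F d" and cd: "TCod F d = TDom F c"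
  shows "is_cartesian E F (c \<cdot>\<^bsub>Total F\<^esub> d)"
proof (rule is_cartesianI)
  note c' [simp] = cartesian_Arr[OF c] and d' [simp] = cartesian_Arr[OF d]
  show "c \<cdot>\<^bsub>Total F\<^esub> d \<in> TArr F" using cd by simp
  fix g h assume g: "g \<in> TArr F" "TCod F g = TCod F (c \<cdot>\<^bsub>Total F\<^esub> d)" "h \<in> Arr E"
    "Dom E h = base_obj F (TDom F g)" "Cod E h = base_obj F (TDom F (c \<cdot>\<^bsub>Total F\<^esub> d))"
    "base_arr F g = base_arr F (c \<cdot>\<^bsub>Total F\<^esub> d) \<cdot>\<^bsub>E\<^esub> h"
  obtain k where k: "k \<in> TArr F" "TDom F k = TDom F g" "TCod F k = TDom F c"
    "base_arr F k = base_arr F d \<cdot>\<^bsub>E\<^esub> h" "c \<cdot>\<^bsub>Total F\<^esub> k = g"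
    using cartesian_factor[OF c, of g "base_arr F d \<cdot>\<^bsub>E\<^esub> h"] g cd by auto
  obtain j where j: "j \<in> TArr F" "TDom F j = TDom F k" "TCod F j = TDom F d"
    "base_arr F j = h" "d \<cdot>\<^bsub>Total F\<^esub> j = k"
    using cartesian_factor[OF d, of k h] g k cd by auto
  have "(c \<cdot>\<^bsub>Total F\<^esub> d) \<cdot>\<^bsub>Total F\<^esub> j = g" using j k cd by simp
  then show "\<exists>k\<in>TArr F. TDom F k = TDom F g \<and> TCod F k = TDom F (c \<cdot>\<^bsub>Total F\<^esub> d) \<and>
      base_arr F k = h \<and> (c \<cdot>\<^bsub>Total F\<^esub> d) \<cdot>\<^bsub>Total F\<^esub> k = g"
    using j k cd by (intro bexI[of _ j]) auto
next
  note c' [simp] = cartesian_Arr[OF c] and d' [simp] = cartesian_Arr[OF d]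
  fix k k' assume k: "k \<in> TArr F" "k' \<in> TArr F" "TDom F k = TDom F k'"
    "TCod F k = TDom F (c \<cdot>\<^bsub>Total F\<^esub> d)" "TCod F k' = TDom F (c \<cdot>\<^bsub>Total F\<^esub> d)"
    "base_arr F k = base_arr F k'"
    "(c \<cdot>\<^bsub>Total F\<^esub> d) \<cdot>\<^bsub>Total F\<^esub> k = (c \<cdot>\<^bsub>Total F\<^esub> d) \<cdot>\<^bsub>Total F\<^esub> k'"
  have dk: "d \<cdot>\<^bsub>Total F\<^esub> k = d \<cdot>\<^bsub>Total F\<^esub> k'"
    by (rule cartesian_cancel[OF c]) (use k cd in auto)
  show "k = k'" by (rule cartesian_cancel[OF d]) (use k cd dk in auto)
qed

text \<open>Composing with \<open>c\<close> turns a factorization problem for \<open>d\<close> into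
  one for the composite. That its solution solves the original problem follows because
  \<open>c\<close> is cancellable over a fixed base arrow.\<close>

lemma cartesian_cancel_left:
  assumes c: "is_cartesian E F c" and cd: "is_cartesian E F (c \<cdot>\<^bsub>Total F\<^esub> d)"
    and d' [simp]: "d \<in> TArr F" "TCod F d = TDom F c"
  shows "is_cartesian E F d"
proof (rule is_cartesianI[OF d'(1)])
  note c' [simp] = cartesian_Arr[OF c]
  fix g h assume g: "g \<in> TArr F" "TCod F g = TCod F d" "h \<in> Arr E"
    "Dom E h = base_obj F (TDom F g)" "Cod E h = base_obj F (TDom F d)"
    "base_arr F g = base_arr F d \<cdot>\<^bsub>E\<^esub> h"
  obtain k where k: "k \<in> TArr F" "TDom F k = TDom F g" "TCod F k = TDom F d"
    "base_arr F k = h" "(c \<cdot>\<^bsub>Total F\<^esub> d) \<cdot>\<^bsub>Total F\<^esub> k = c \<cdot>\<^bsub>Total F\<^esub> g"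
    using cartesian_factor[OF cd, of "c \<cdot>\<^bsub>Total F\<^esub> g" h] g by auto
  have "d \<cdot>\<^bsub>Total F\<^esub> k = g"
    by (rule cartesian_cancel[OF c]) (use g k in auto)
  then show "\<exists>k\<in>TArr F. TDom F k = TDom F g \<and> TCod F k = TDom F d \<and>
      base_arr F k = h \<and> d \<cdot>\<^bsub>Total F\<^esub> k = g"
    using k by blast
next
  note c' [simp] = cartesian_Arr[OF c]
  fix k k' assume k: "k \<in> TArr F" "k' \<in> TArr F" "TDom F k = TDom F k'"
    "TCod F k = TDom F d" "TCod F k' = TDom F d" "base_arr F k = base_arr F k'"
    "d \<cdot>\<^bsub>Total F\<^esub> k = d \<cdot>\<^bsub>Total F\<^esub> k'"
  show "k = k'" by (rule cartesian_cancel[OF cd]) (use k in auto)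
qed

lemma iso_cartesian:
  assumes "is_iso (Total F) c"
  shows "is_cartesian E F c"
proof -
  obtain d where c: "c \<in> TArr F" "d \<in> TArr F" "TDom F d = TCod F c" "TCod F d = TDom F c"
    "d \<cdot>\<^bsub>Total F\<^esub> c = TIdt F (TDom F c)" "c \<cdot>\<^bsub>Total F\<^esub> d = TIdt F (TCod F c)"
    using total.is_isoE[OF assms] .
  show ?thesis
  proof (rule is_cartesianI[OF c(1)])
    fix g h assume g: "g \<in> TArr F" "TCod F g = TCod F c" "h \<in> Arr E"
      "Dom E h = base_obj F (TDom F g)" "Cod E h = base_obj F (TDom F c)"
      "base_arr F g = base_arr F c \<cdot>\<^bsub>E\<^esub> h"
    have "base_arr F d \<cdot>\<^bsub>E\<^esub> base_arr F c = Idt E (base_obj F (TDom F c))"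
      using c Proj_simps(6)[of c d] by simp
    then have "(base_arr F d \<cdot>\<^bsub>E\<^esub> base_arr F c) \<cdot>\<^bsub>E\<^esub> h = h" using g by simp
    then have "base_arr F (d \<cdot>\<^bsub>Total F\<^esub> g) = h" using g c(1-4) by simp
    moreover have "c \<cdot>\<^bsub>Total F\<^esub> (d \<cdot>\<^bsub>Total F\<^esub> g) = (c \<cdot>\<^bsub>Total F\<^esub> d) \<cdot>\<^bsub>Total F\<^esub> g"
      using g c(1-4) by simp
    ultimately show "\<exists>k\<in>TArr F. TDom F k = TDom F g \<and> TCod F k = TDom F c \<and>
        base_arr F k = h \<and> c \<cdot>\<^bsub>Total F\<^esub> k = g"
      using c g by (intro bexI[of _ "d \<cdot>\<^bsub>Total F\<^esub> g"]) auto
  qed (use total.iso_cancel_left[OF assms] in auto)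
qed

text \<open>The inverse is the factorization of an identity through \<open>c\<close> over the
  inverse of the base arrow. The other composite is an identity because this becomes true after
  composing with \<open>c\<close>.\<close>

lemma cartesian_iso:
  assumes c: "is_cartesian E F c" and "is_iso E (base_arr F c)"
  shows "is_iso (Total F) c"
proof -
  note c' [simp] = cartesian_Arr[OF c]
  obtain h where h: "h \<in> Arr E" "Dom E h = base_obj F (TCod F c)" "Cod E h = base_obj F (TDom F c)"
    "h \<cdot>\<^bsub>E\<^esub> base_arr F c = Idt E (base_obj F (TDom F c))"
    "base_arr F c \<cdot>\<^bsub>E\<^esub> h = Idt E (base_obj F (TCod F c))"
    using base.is_isoE[OF assms(2)] by auto
  obtain k where k: "k \<in> TArr F" "TDom F k = TCod F c" "TCod F k = TDom F c"
    "base_arr F k = h" "c \<cdot>\<^bsub>Total F\<^esub> k = TIdt F (TCod F c)"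
    using cartesian_factor[OF c, of "TIdt F (TCod F c)" h] h by auto
  have "c \<cdot>\<^bsub>Total F\<^esub> (k \<cdot>\<^bsub>Total F\<^esub> c) = (c \<cdot>\<^bsub>Total F\<^esub> k) \<cdot>\<^bsub>Total F\<^esub> c" using k(1-4) by simp
  note ckc = this
  have "k \<cdot>\<^bsub>Total F\<^esub> c = TIdt F (TDom F c)"
    by (rule cartesian_cancel[OF c]) (use k h ckc in auto)
  then show ?thesis using k by (intro total.is_isoI[of _ k]) auto
qed

text \<open>Factoring \<open>c\<close> through \<open>d\<close> over an identity gives an arrow that
  is cartesian by \<open>cartesian_cancel_left\<close> and vertical, hence invertible. This is what
  frees later statements from chosen inverse images.\<close>

lemma cartesian_unique:
  assumes c: "is_cartesian E F c" and d: "is_cartesian E F d"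
    and cd: "TCod F c = TCod F d" "base_arr F c = base_arr F d"
  obtains i where "is_iso (Total F) i" "is_cartesian E F i" "i \<in> TArr F" "TDom F i = TDom F c"
    "TCod F i = TDom F d" "base_arr F i = Idt E (base_obj F (TDom F c))" "d \<cdot>\<^bsub>Total F\<^esub> i = c"
proof -
  note c' [simp] = cartesian_Arr[OF c] and d' [simp] = cartesian_Arr[OF d]
  have D: "base_obj F (TDom F c) = base_obj F (TDom F d)"
    using Proj_simps(3)[OF c'] Proj_simps(3)[OF d'] cd by metis
  obtain i where i: "i \<in> TArr F" "TDom F i = TDom F c" "TCod F i = TDom F d"
    "base_arr F i = Idt E (base_obj F (TDom F c))" "d \<cdot>\<^bsub>Total F\<^esub> i = c"
    using cartesian_factor[OF d, of c "Idt E (base_obj F (TDom F c))"] cd D by auto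
  have "is_cartesian E F i" using cartesian_cancel_left[OF d] i c by auto
  moreover from this have "is_iso (Total F) i"
    by (rule cartesian_iso) (simp add: i base.is_iso_Idt)
  ultimately show thesis using that i by blast
qed

lemma hom_fibre:
  "a \<in> hom (fibre E F S) x y \<longleftrightarrow>
    a \<in> TArr F \<and> TDom F a = x \<and> TCod F a = y \<and> base_arr F a = Idt E S"
  by (auto simp: fibre_def hom_def)

end

text \<open>The simplifier brackets composites to the right, after which \<open>g \<cdot> f\<close>
  is no longer a subterm of \<open>g \<cdot> (f \<cdot> e)\<close>. An equation for
  \<open>g \<cdot> f\<close> therefore has to be precomposed with \<open>e\<close> before it can be
  used for rewriting.\<close>

lemma (in category) comp_reassoc:
  "\<lbrakk>g \<cdot> f = k; e \<in> Arr C; f \<in> Arr C; g \<in> Arr C; Cod C e = Dom C f; Cod C f = Dom C g\<rbrakk>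
   \<Longrightarrow> g \<cdot> (f \<cdot> e) = k \<cdot> e"
  by (metis Comp_assoc_Arr)

locale cartesian_functor = src: fibration_over E F + tgt: fibration_over E G
  for E :: "('o, 'm) precategory" and F :: "('o, 'm, 'x, 'y) fibration"
    and G :: "('o, 'm, 'v, 'w) fibration" +
  fixes u :: "('x, 'y, 'v, 'w) functor_data"
  assumes is_cartesian_functor: "is_cartesian_functor E F G u"
begin

lemma is_functor: "is_functor (Total F) (Total G) u"
  using is_cartesian_functor by (simp add: is_cartesian_functor_def)

lemmas Fun_simps [simp] = is_functorD[OF is_functor]

lemma base_Fun [simp]:
  "x \<in> TObj F \<Longrightarrow> base_obj G (on_obj u x) = base_obj F x"
  "a \<in> TArr F \<Longrightarrow> base_arr G (on_arr u a) = base_arr F a"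
  using is_cartesian_functor by (simp_all add: is_cartesian_functor_def)

lemma cartesian_Fun: "is_cartesian E F c \<Longrightarrow> is_cartesian E G (on_arr u c)"
  using is_cartesian_functor by (simp add: is_cartesian_functor_def)

end

section \<open>The presheaf of morphisms between two objects of a fibre\<close>

context fibration_over
begin

lemma lift_simps [simp]:
  assumes "x \<in> TObj F" "f \<in> Arr E" "Cod E f = base_obj F x"
  shows "is_cartesian E F (lift E F f x)" "lift E F f x \<in> TArr F" "TCod F (lift E F f x) = x"
    "base_arr F (lift E F f x) = f" "TDom F (lift E F f x) = inverse_image E F f x"
proof -
  have "\<exists>c. is_cartesian E F c \<and> TCod F c = x \<and> base_arr F c = f"
    using ex_cartesian[OF assms] by metis
  from someI_ex[OF this]
  have *: "is_cartesian E F (lift E F f x) \<and> TCod F (lift E F f x) = x \<and>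
      base_arr F (lift E F f x) = f"
    by (simp add: lift_def)
  then show "is_cartesian E F (lift E F f x)" "TCod F (lift E F f x) = x"
    "base_arr F (lift E F f x) = f" by auto
  from * show "lift E F f x \<in> TArr F" by (simp add: cartesian_Arr)
  show "TDom F (lift E F f x) = inverse_image E F f x" by (simp add: inverse_image_def)
qed

lemma inverse_image_simps [simp]:
  assumes "x \<in> TObj F" "f \<in> Arr E" "Cod E f = base_obj F x"
  shows "inverse_image E F f x \<in> TObj F" "base_obj F (inverse_image E F f x) = Dom E f"
proof -
  note l = lift_simps[OF assms]
  show "inverse_image E F f x \<in> TObj F" using total.Dom_in_Obj[OF l(2)] l(5) by simp
  show "base_obj F (inverse_image E F f x) = Dom E f" using Proj_simps(3)[OF l(2)] l(4,5) by simp
qed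

lemma transition_simps [simp]:
  assumes x: "x \<in> TObj F" "f \<in> Arr E" "Cod E f = base_obj F x" and h: "h \<in> Arr E" "Cod E h = Dom E f"
  shows "transition E F f h x \<in> TArr F"
    "TDom F (transition E F f h x) = inverse_image E F (f \<cdot>\<^bsub>E\<^esub> h) x"
    "TCod F (transition E F f h x) = inverse_image E F f x"
    "base_arr F (transition E F f h x) = h"
    "lift E F f x \<cdot>\<^bsub>Total F\<^esub> transition E F f h x = lift E F (f \<cdot>\<^bsub>E\<^esub> h) x"
    "is_cartesian E F (transition E F f h x)"
proof -
  obtain k where k: "k \<in> TArr F" "TDom F k = inverse_image E F (f \<cdot>\<^bsub>E\<^esub> h) x"
    "TCod F k = inverse_image E F f x" "base_arr F k = h"
    "lift E F f x \<cdot>\<^bsub>Total F\<^esub> k = lift E F (f \<cdot>\<^bsub>E\<^esub> h) x"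
    using cartesian_factor[of "lift E F f x" "lift E F (f \<cdot>\<^bsub>E\<^esub> h) x" h] x h by auto
  have t: "transition E F f h x = k"
    unfolding transition_def
  proof (rule the_equality)
    fix j assume j: "j \<in> hom (Total F) (inverse_image E F (f \<cdot>\<^bsub>E\<^esub> h) x) (inverse_image E F f x) \<and>
      base_arr F j = h \<and> lift E F f x \<cdot>\<^bsub>Total F\<^esub> j = lift E F (f \<cdot>\<^bsub>E\<^esub> h) x"
    show "j = k"
      by (rule cartesian_cancel[of "lift E F f x"]) (use j k x in \<open>auto simp: hom_def\<close>)
  qed (use k in \<open>auto simp: hom_def\<close>)
  show "transition E F f h x \<in> TArr F"
    "TDom F (transition E F f h x) = inverse_image E F (f \<cdot>\<^bsub>E\<^esub> h) x"
    "TCod F (transition E F f h x) = inverse_image E F f x"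
    "base_arr F (transition E F f h x) = h"
    "lift E F f x \<cdot>\<^bsub>Total F\<^esub> transition E F f h x = lift E F (f \<cdot>\<^bsub>E\<^esub> h) x"
    using k t by auto
  show "is_cartesian E F (transition E F f h x)"
    by (rule cartesian_cancel_left[of "lift E F f x"]) (use k t x h in auto)
qed

lemma transition_unique:
  assumes x: "x \<in> TObj F" "f \<in> Arr E" "Cod E f = base_obj F x" and h: "h \<in> Arr E" "Cod E h = Dom E f"
    and k: "k \<in> TArr F" "TDom F k = inverse_image E F (f \<cdot>\<^bsub>E\<^esub> h) x"
    "TCod F k = inverse_image E F f x" "base_arr F k = h"
    "lift E F f x \<cdot>\<^bsub>Total F\<^esub> k = lift E F (f \<cdot>\<^bsub>E\<^esub> h) x"
  shows "transition E F f h x = k"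
  by (rule cartesian_cancel[of "lift E F f x"]) (use x h k in auto)

end

locale fibre_objects = fibration_over E F
  for E :: "('o, 'm) precategory" and F :: "('o, 'm, 'x, 'y) fibration" +
  fixes S :: 'o and x x' :: 'x
  assumes fibre_objects [simp]: "x \<in> TObj F" "x' \<in> TObj F" "base_obj F x = S" "base_obj F x' = S"
begin

lemma base_in_Obj [simp]: "S \<in> Obj E"
  using Proj_simps(1)[OF fibre_objects(1)] by simp

lemma Sec_Hom_presheaf:
  "\<phi> \<in> Sec (Hom_presheaf E F x x') f \<longleftrightarrow> \<phi> \<in> TArr F \<and> TDom F \<phi> = inverse_image E F f x \<and>
    TCod F \<phi> = inverse_image E F f x' \<and> base_arr F \<phi> = Idt E (Dom E f)"
  by (simp add: Hom_presheaf_def hom_fibre)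

text \<open>The transition arrow of \<open>x'\<close> is cartesian, so the equation has at most one
  vertical solution and the definite description in \<open>Res\<close> denotes it.\<close>

lemma Res_Hom_presheaf_unique:
  assumes f: "f \<in> Arr E" "Cod E f = S" and h: "h \<in> Arr E" "Cod E h = Dom E f"
    and \<phi>: "\<phi> \<in> Sec (Hom_presheaf E F x x') f" and \<psi>: "\<psi> \<in> Sec (Hom_presheaf E F x x') (f \<cdot>\<^bsub>E\<^esub> h)"
    and eq: "transition E F f h x' \<cdot>\<^bsub>Total F\<^esub> \<psi> = \<phi> \<cdot>\<^bsub>Total F\<^esub> transition E F f h x"
  shows "Res (Hom_presheaf E F x x') (f, h) \<phi> = \<psi>"
proof -
  have "(THE \<psi>. \<psi> \<in> hom (fibre E F (Dom E h))
         (inverse_image E F (f \<cdot>\<^bsub>E\<^esub> h) x) (inverse_image E F (f \<cdot>\<^bsub>E\<^esub> h) x') \<and>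
       transition E F f h x' \<cdot>\<^bsub>Total F\<^esub> \<psi> = \<phi> \<cdot>\<^bsub>Total F\<^esub> transition E F f h x) = \<psi>"
  proof (rule the_equality)
    fix j assume j: "j \<in> hom (fibre E F (Dom E h))
         (inverse_image E F (f \<cdot>\<^bsub>E\<^esub> h) x) (inverse_image E F (f \<cdot>\<^bsub>E\<^esub> h) x') \<and>
       transition E F f h x' \<cdot>\<^bsub>Total F\<^esub> j = \<phi> \<cdot>\<^bsub>Total F\<^esub> transition E F f h x"
    show "j = \<psi>"
      by (rule cartesian_cancel[of "transition E F f h x'"])
        (use j \<psi> eq f h in \<open>auto simp: hom_fibre Sec_Hom_presheaf\<close>)
  qed (use \<psi> eq f h in \<open>auto simp: hom_fibre Sec_Hom_presheaf\<close>)
  then show ?thesis by (simp add: Hom_presheaf_def)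
qed

lemma Res_Hom_presheaf:
  assumes f: "f \<in> Arr E" "Cod E f = S" and h: "h \<in> Arr E" "Cod E h = Dom E f"
    and \<phi>: "\<phi> \<in> Sec (Hom_presheaf E F x x') f"
  shows "Res (Hom_presheaf E F x x') (f, h) \<phi> \<in> Sec (Hom_presheaf E F x x') (f \<cdot>\<^bsub>E\<^esub> h)"
    "transition E F f h x' \<cdot>\<^bsub>Total F\<^esub> Res (Hom_presheaf E F x x') (f, h) \<phi> =
      \<phi> \<cdot>\<^bsub>Total F\<^esub> transition E F f h x"
proof -
  note \<phi>' = \<phi>[unfolded Sec_Hom_presheaf]
  obtain \<psi> where \<psi>: "\<psi> \<in> TArr F" "TDom F \<psi> = TDom F (\<phi> \<cdot>\<^bsub>Total F\<^esub> transition E F f h x)"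
    "TCod F \<psi> = TDom F (transition E F f h x')" "base_arr F \<psi> = Idt E (Dom E h)"
    "transition E F f h x' \<cdot>\<^bsub>Total F\<^esub> \<psi> = \<phi> \<cdot>\<^bsub>Total F\<^esub> transition E F f h x"
    by (rule cartesian_factor[of "transition E F f h x'" "\<phi> \<cdot>\<^bsub>Total F\<^esub> transition E F f h x"
          "Idt E (Dom E h)"]) (use f h \<phi>' in auto)
  then have Sec: "\<psi> \<in> Sec (Hom_presheaf E F x x') (f \<cdot>\<^bsub>E\<^esub> h)"
    using f h \<phi>' by (simp add: Sec_Hom_presheaf)
  note eq = Res_Hom_presheaf_unique[OF f h \<phi> Sec \<psi>(5)]
  show "Res (Hom_presheaf E F x x') (f, h) \<phi> \<in> Sec (Hom_presheaf E F x x') (f \<cdot>\<^bsub>E\<^esub> h)"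
    "transition E F f h x' \<cdot>\<^bsub>Total F\<^esub> Res (Hom_presheaf E F x x') (f, h) \<phi> =
      \<phi> \<cdot>\<^bsub>Total F\<^esub> transition E F f h x"
    unfolding eq by (fact Sec, fact \<psi>(5))
qed

text \<open>Cancelling the cartesian transition of \<open>x'\<close> removes the restricted arrows.
  What is left, agreement after composition with one cartesian arrow over \<open>h\<close>, can be
  stated without choices.\<close>

lemma Res_Hom_presheaf_eq_iff:
  assumes f: "f \<in> Arr E" "Cod E f = S" and h: "h \<in> Arr E" "Cod E h = Dom E f"
    and \<phi>: "\<phi> \<in> Sec (Hom_presheaf E F x x') f" and \<phi>': "\<phi>' \<in> Sec (Hom_presheaf E F x x') f"
  shows "Res (Hom_presheaf E F x x') (f, h) \<phi> = Res (Hom_presheaf E F x x') (f, h) \<phi>' \<longleftrightarrow>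
    \<phi> \<cdot>\<^bsub>Total F\<^esub> transition E F f h x = \<phi>' \<cdot>\<^bsub>Total F\<^esub> transition E F f h x"
proof
  assume "\<phi> \<cdot>\<^bsub>Total F\<^esub> transition E F f h x = \<phi>' \<cdot>\<^bsub>Total F\<^esub> transition E F f h x"
  then show "Res (Hom_presheaf E F x x') (f, h) \<phi> = Res (Hom_presheaf E F x x') (f, h) \<phi>'"
    using Res_Hom_presheaf[OF f h \<phi>'] by (intro Res_Hom_presheaf_unique[OF f h \<phi>]) simp_all
qed (use Res_Hom_presheaf(2)[OF f h \<phi>] Res_Hom_presheaf(2)[OF f h \<phi>'] in simp)

text \<open>Functoriality of restriction rests on the cocycle identity for transitions, the local
  fact \<open>t\<close>: both sides are factorizations of the same lift through the cartesian arrow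
  \<open>lift E F f y\<close>.\<close>

lemma is_presheaf_Hom: "is_presheaf (slice E S) (Hom_presheaf E F x x')"
  unfolding is_presheaf_def
proof (intro conjI ballI impI)
  fix a \<phi> assume a: "a \<in> Arr (slice E S)" and \<phi>: "\<phi> \<in> Sec (Hom_presheaf E F x x') (Cod (slice E S) a)"
  obtain f h where a_eq: "a = (f, h)" by (cases a)
  then have *: "f \<in> Arr E" "Cod E f = S" "h \<in> Arr E" "Cod E h = Dom E f" using a by simp_all
  show "Res (Hom_presheaf E F x x') a \<phi> \<in> Sec (Hom_presheaf E F x x') (Dom (slice E S) a)"
    using Res_Hom_presheaf(1)[OF *] \<phi> by (simp add: a_eq)
next
  fix f \<phi> assume "f \<in> Obj (slice E S)" and \<phi>: "\<phi> \<in> Sec (Hom_presheaf E F x x') f"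
  then have f: "f \<in> Arr E" "Cod E f = S" by auto
  note \<phi>' = \<phi>[unfolded Sec_Hom_presheaf]
  have t: "transition E F f (Idt E (Dom E f)) y = TIdt F (inverse_image E F f y)"
    if "y \<in> TObj F" "base_obj F y = S" for y
    by (rule transition_unique) (use f that in simp_all)
  have "Res (Hom_presheaf E F x x') (f, Idt E (Dom E f)) \<phi> = \<phi>"
    by (rule Res_Hom_presheaf_unique) (use f \<phi> \<phi>' t in simp_all)
  then show "Res (Hom_presheaf E F x x') (Idt (slice E S) f) \<phi> = \<phi>" by simp
next
  fix a b \<phi> assume a: "a \<in> Arr (slice E S)" and b: "b \<in> Arr (slice E S)"
    and ab: "Cod (slice E S) b = Dom (slice E S) a"
    and \<phi>: "\<phi> \<in> Sec (Hom_presheaf E F x x') (Cod (slice E S) a)"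
  obtain f h where a_eq: "a = (f, h)" by (cases a)
  then have f: "f \<in> Arr E" "Cod E f = S" and h: "h \<in> Arr E" "Cod E h = Dom E f" using a by simp_all
  obtain k where b_eq: "b = (f \<cdot>\<^bsub>E\<^esub> h, k)" using ab a_eq by (cases b) simp
  then have k: "k \<in> Arr E" "Cod E k = Dom E h" using b f h by simp_all
  have \<phi>: "\<phi> \<in> Sec (Hom_presheaf E F x x') f" using \<phi> a_eq by simp
  have t: "transition E F f (h \<cdot>\<^bsub>E\<^esub> k) y = transition E F f h y \<cdot>\<^bsub>Total F\<^esub> transition E F (f \<cdot>\<^bsub>E\<^esub> h) k y"
    if y: "y \<in> TObj F" "base_obj F y = S" for y
  proof (rule transition_unique)
    show "lift E F f y \<cdot>\<^bsub>Total F\<^esub> (transition E F f h y \<cdot>\<^bsub>Total F\<^esub> transition E F (f \<cdot>\<^bsub>E\<^esub> h) k y) =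
      lift E F (f \<cdot>\<^bsub>E\<^esub> (h \<cdot>\<^bsub>E\<^esub> k)) y"
      using total.comp_reassoc[OF transition_simps(5)[of y f h], of "transition E F (f \<cdot>\<^bsub>E\<^esub> h) k y"]
        transition_simps(5)[of y "f \<cdot>\<^bsub>E\<^esub> h" k] f h k y by simp
  qed (use f h k y in simp_all)
  define \<psi> where "\<psi> = Res (Hom_presheaf E F x x') (f, h) \<phi>"
  define \<chi> where "\<chi> = Res (Hom_presheaf E F x x') (f \<cdot>\<^bsub>E\<^esub> h, k) \<psi>"
  have \<psi>: "\<psi> \<in> Sec (Hom_presheaf E F x x') (f \<cdot>\<^bsub>E\<^esub> h)"
    "transition E F f h x' \<cdot>\<^bsub>Total F\<^esub> \<psi> = \<phi> \<cdot>\<^bsub>Total F\<^esub> transition E F f h x"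
    unfolding \<psi>_def using Res_Hom_presheaf[OF f h \<phi>] by auto
  have \<chi>: "\<chi> \<in> Sec (Hom_presheaf E F x x') ((f \<cdot>\<^bsub>E\<^esub> h) \<cdot>\<^bsub>E\<^esub> k)"
    "transition E F (f \<cdot>\<^bsub>E\<^esub> h) k x' \<cdot>\<^bsub>Total F\<^esub> \<chi> = \<psi> \<cdot>\<^bsub>Total F\<^esub> transition E F (f \<cdot>\<^bsub>E\<^esub> h) k x"
    unfolding \<chi>_def using Res_Hom_presheaf[of "f \<cdot>\<^bsub>E\<^esub> h" k \<psi>] f h k \<psi>(1) by auto
  have "Res (Hom_presheaf E F x x') (f, h \<cdot>\<^bsub>E\<^esub> k) \<phi> = \<chi>"
  proof (rule Res_Hom_presheaf_unique)
    show "transition E F f (h \<cdot>\<^bsub>E\<^esub> k) x' \<cdot>\<^bsub>Total F\<^esub> \<chi> = \<phi> \<cdot>\<^bsub>Total F\<^esub> transition E F f (h \<cdot>\<^bsub>E\<^esub> k) x"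
      using \<chi>[unfolded Sec_Hom_presheaf] \<psi>[unfolded Sec_Hom_presheaf] \<phi>[unfolded Sec_Hom_presheaf]
        total.comp_reassoc[OF \<psi>(2), of "transition E F (f \<cdot>\<^bsub>E\<^esub> h) k x"] t f h k
      by simp
  qed (use f h k \<phi> \<chi> in simp_all)
  then show "Res (Hom_presheaf E F x x') (a \<cdot>\<^bsub>slice E S\<^esub> b) \<phi> =
      Res (Hom_presheaf E F x x') b (Res (Hom_presheaf E F x x') a \<phi>)"
    by (simp add: a_eq b_eq \<chi>_def \<psi>_def)
qed

end

context cartesian_functor
begin

text \<open>Since \<open>u\<close> preserves cartesian arrows, the image of the lift at
  \<open>x\<close> and the lift at the image of \<open>x\<close> are cartesian over the same
  \<open>f\<close>; the comparison is the vertical isomorphism between their domains.\<close>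

lemma comparison_simps [simp]:
  assumes x: "x \<in> TObj F" "f \<in> Arr E" "Cod E f = base_obj F x"
  shows "comparison E F G u f x \<in> TArr G"
    "TDom G (comparison E F G u f x) = on_obj u (inverse_image E F f x)"
    "TCod G (comparison E F G u f x) = inverse_image E G f (on_obj u x)"
    "base_arr G (comparison E F G u f x) = Idt E (Dom E f)"
    "lift E G f (on_obj u x) \<cdot>\<^bsub>Total G\<^esub> comparison E F G u f x = on_arr u (lift E F f x)"
    "is_iso (Total G) (comparison E F G u f x)"
proof -
  obtain k where k: "k \<in> TArr G" "TDom G k = on_obj u (inverse_image E F f x)"
    "TCod G k = inverse_image E G f (on_obj u x)" "base_arr G k = Idt E (Dom E f)"
    "lift E G f (on_obj u x) \<cdot>\<^bsub>Total G\<^esub> k = on_arr u (lift E F f x)"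
    using tgt.cartesian_factor[of "lift E G f (on_obj u x)" "on_arr u (lift E F f x)" "Idt E (Dom E f)"] x
    by auto
  have t: "comparison E F G u f x = k"
    unfolding comparison_def
  proof (rule the_equality)
    fix j assume j: "j \<in> hom (fibre E G (Dom E f)) (on_obj u (inverse_image E F f x))
        (inverse_image E G f (on_obj u x)) \<and>
      lift E G f (on_obj u x) \<cdot>\<^bsub>Total G\<^esub> j = on_arr u (lift E F f x)"
    show "j = k"
      by (rule tgt.cartesian_cancel[of "lift E G f (on_obj u x)"])
        (use j k x in \<open>auto simp: tgt.hom_fibre\<close>)
  qed (use k in \<open>auto simp: tgt.hom_fibre\<close>)
  show "comparison E F G u f x \<in> TArr G"
    "TDom G (comparison E F G u f x) = on_obj u (inverse_image E F f x)"
    "TCod G (comparison E F G u f x) = inverse_image E G f (on_obj u x)"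
    "base_arr G (comparison E F G u f x) = Idt E (Dom E f)"
    "lift E G f (on_obj u x) \<cdot>\<^bsub>Total G\<^esub> comparison E F G u f x = on_arr u (lift E F f x)"
    using k t by auto
  have "is_cartesian E G k"
    by (rule tgt.cartesian_cancel_left[of "lift E G f (on_obj u x)"])
      (use k x cartesian_Fun[of "lift E F f x"] in auto)
  then show "is_iso (Total G) (comparison E F G u f x)"
    unfolding t by (rule tgt.cartesian_iso) (use k x in \<open>simp add: src.base.is_iso_Idt\<close>)
qed

text \<open>Composed with the cartesian lift of \<open>f\<close>, both sides become the image under
  \<open>u\<close> of the lift of \<open>f h\<close>.\<close>

lemma comparison_transition:
  assumes x: "x \<in> TObj F" "f \<in> Arr E" "Cod E f = base_obj F x" and h: "h \<in> Arr E" "Cod E h = Dom E f"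
  shows "transition E G f h (on_obj u x) \<cdot>\<^bsub>Total G\<^esub> comparison E F G u (f \<cdot>\<^bsub>E\<^esub> h) x =
    comparison E F G u f x \<cdot>\<^bsub>Total G\<^esub> on_arr u (transition E F f h x)"
proof (rule tgt.cartesian_cancel[of "lift E G f (on_obj u x)"])
  have "on_arr u (lift E F f x) \<cdot>\<^bsub>Total G\<^esub> on_arr u (transition E F f h x) = on_arr u (lift E F (f \<cdot>\<^bsub>E\<^esub> h) x)"
    using src.transition_simps(5)[of x f h] x h Fun_simps(6)[of "transition E F f h x" "lift E F f x"]
    by simp
  moreover have "lift E G f (on_obj u x) \<cdot>\<^bsub>Total G\<^esub> (transition E G f h (on_obj u x) \<cdot>\<^bsub>Total G\<^esub> comparison E F G u (f \<cdot>\<^bsub>E\<^esub> h) x) =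
      lift E G (f \<cdot>\<^bsub>E\<^esub> h) (on_obj u x) \<cdot>\<^bsub>Total G\<^esub> comparison E F G u (f \<cdot>\<^bsub>E\<^esub> h) x"
    by (rule tgt.total.comp_reassoc) (use x h in simp_all)
  moreover have "lift E G f (on_obj u x) \<cdot>\<^bsub>Total G\<^esub> (comparison E F G u f x \<cdot>\<^bsub>Total G\<^esub> on_arr u (transition E F f h x)) =
      on_arr u (lift E F f x) \<cdot>\<^bsub>Total G\<^esub> on_arr u (transition E F f h x)"
    by (rule tgt.total.comp_reassoc) (use x h in simp_all)
  ultimately show "lift E G f (on_obj u x) \<cdot>\<^bsub>Total G\<^esub> (transition E G f h (on_obj u x) \<cdot>\<^bsub>Total G\<^esub> comparison E F G u (f \<cdot>\<^bsub>E\<^esub> h) x) =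
      lift E G f (on_obj u x) \<cdot>\<^bsub>Total G\<^esub> (comparison E F G u f x \<cdot>\<^bsub>Total G\<^esub> on_arr u (transition E F f h x))"
    using x h by simp
qed (use x h in simp_all)

end

locale cartesian_functor_at = cartesian_functor E F G u + src: fibre_objects E F S x x'
  for E :: "('o, 'm) precategory" and F :: "('o, 'm, 'x, 'y) fibration"
    and G :: "('o, 'm, 'v, 'w) fibration" and u S x x'
begin

sublocale tgt: fibre_objects E G S "on_obj u x" "on_obj u x'"
  by unfold_locales simp_all

lemma Hom_presheaf_map_unique:
  assumes f: "f \<in> Arr E" "Cod E f = S" and \<phi>: "\<phi> \<in> Sec (Hom_presheaf E F x x') f"
    and \<psi>: "\<psi> \<in> Sec (Hom_presheaf E G (on_obj u x) (on_obj u x')) f"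
    and eq: "\<psi> \<cdot>\<^bsub>Total G\<^esub> comparison E F G u f x = comparison E F G u f x' \<cdot>\<^bsub>Total G\<^esub> on_arr u \<phi>"
  shows "Hom_presheaf_map E F G u x x' f \<phi> = \<psi>"
  unfolding Hom_presheaf_map_def
proof (rule the_equality)
  fix j assume j: "j \<in> hom (fibre E G (Dom E f)) (inverse_image E G f (on_obj u x))
      (inverse_image E G f (on_obj u x')) \<and>
    j \<cdot>\<^bsub>Total G\<^esub> comparison E F G u f x = comparison E F G u f x' \<cdot>\<^bsub>Total G\<^esub> on_arr u \<phi>"
  show "j = \<psi>"
    by (rule tgt.total.iso_cancel_right[of "comparison E F G u f x"])
      (use j \<psi> eq f in \<open>auto simp: tgt.hom_fibre tgt.Sec_Hom_presheaf\<close>)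
qed (use \<psi> eq in \<open>auto simp: tgt.hom_fibre tgt.Sec_Hom_presheaf\<close>)

text \<open>The value is the conjugate of \<open>on_arr u \<phi>\<close> by the comparison
  isomorphisms.\<close>

lemma Hom_presheaf_map:
  assumes f: "f \<in> Arr E" "Cod E f = S" and \<phi>: "\<phi> \<in> Sec (Hom_presheaf E F x x') f"
  shows "Hom_presheaf_map E F G u x x' f \<phi> \<in> Sec (Hom_presheaf E G (on_obj u x) (on_obj u x')) f"
    "Hom_presheaf_map E F G u x x' f \<phi> \<cdot>\<^bsub>Total G\<^esub> comparison E F G u f x =
      comparison E F G u f x' \<cdot>\<^bsub>Total G\<^esub> on_arr u \<phi>"
proof -
  note \<phi>' = \<phi>[unfolded src.Sec_Hom_presheaf]
  have "is_iso (Total G) (comparison E F G u f x)" using f by simp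
  then obtain k where k: "k \<in> TArr G" "TDom G k = inverse_image E G f (on_obj u x)"
    "TCod G k = on_obj u (inverse_image E F f x)"
    "k \<cdot>\<^bsub>Total G\<^esub> comparison E F G u f x = TIdt G (on_obj u (inverse_image E F f x))"
    "comparison E F G u f x \<cdot>\<^bsub>Total G\<^esub> k = TIdt G (inverse_image E G f (on_obj u x))"
    by (rule tgt.total.is_isoE) (use f in auto)
  \<comment> \<open>The inverse of a vertical isomorphism is vertical, since its base arrow composes
    with an identity to an identity.\<close>
  have bk: "base_arr G k = Idt E (Dom E f)"
    using tgt.Proj_simps(6)[of "comparison E F G u f x" k] k f tgt.Proj_simps(3)[OF k(1)] by simp
  define \<psi> where "\<psi> = comparison E F G u f x' \<cdot>\<^bsub>Total G\<^esub> (on_arr u \<phi> \<cdot>\<^bsub>Total G\<^esub> k)"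
  have Sec: "\<psi> \<in> Sec (Hom_presheaf E G (on_obj u x) (on_obj u x')) f"
    using k f \<phi>' bk by (simp add: tgt.Sec_Hom_presheaf \<psi>_def)
  have eq: "\<psi> \<cdot>\<^bsub>Total G\<^esub> comparison E F G u f x = comparison E F G u f x' \<cdot>\<^bsub>Total G\<^esub> on_arr u \<phi>"
    using k f \<phi>' by (simp add: \<psi>_def)
  note eq' = Hom_presheaf_map_unique[OF f \<phi> Sec eq]
  show "Hom_presheaf_map E F G u x x' f \<phi> \<in> Sec (Hom_presheaf E G (on_obj u x) (on_obj u x')) f"
    "Hom_presheaf_map E F G u x x' f \<phi> \<cdot>\<^bsub>Total G\<^esub> comparison E F G u f x =
      comparison E F G u f x' \<cdot>\<^bsub>Total G\<^esub> on_arr u \<phi>"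
    unfolding eq' by (fact Sec, fact eq)
qed

text \<open>Composing with the invertible comparison at \<open>f h\<close> moves the naturality
  square to the image of \<open>u\<close>, where it follows from
  \<open>comparison_transition\<close> and from the square defining restriction in
  \<open>F\<close>.\<close>

lemma is_presheaf_map_Hom:
  "is_presheaf_map (slice E S) (Hom_presheaf E F x x') (Hom_presheaf E G (on_obj u x) (on_obj u x'))
    (Hom_presheaf_map E F G u x x')"
  unfolding is_presheaf_map_def
proof (intro conjI ballI)
  fix f \<phi> assume "f \<in> Obj (slice E S)" "\<phi> \<in> Sec (Hom_presheaf E F x x') f"
  then show "Hom_presheaf_map E F G u x x' f \<phi> \<in> Sec (Hom_presheaf E G (on_obj u x) (on_obj u x')) f"
    by (intro Hom_presheaf_map(1)) auto
next
  fix a \<phi> assume a: "a \<in> Arr (slice E S)" and \<phi>: "\<phi> \<in> Sec (Hom_presheaf E F x x') (Cod (slice E S) a)"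
  obtain f h where a_eq: "a = (f, h)" by (cases a)
  then have f: "f \<in> Arr E" "Cod E f = S" and h: "h \<in> Arr E" "Cod E h = Dom E f" using a by simp_all
  have fh: "f \<cdot>\<^bsub>E\<^esub> h \<in> Arr E" "Cod E (f \<cdot>\<^bsub>E\<^esub> h) = S" using f h by simp_all
  have \<phi>: "\<phi> \<in> Sec (Hom_presheaf E F x x') f" using \<phi> a_eq by simp
  note res = src.Res_Hom_presheaf[OF f h \<phi>]
  note m\<phi> = Hom_presheaf_map[OF f \<phi>] and m\<psi> = Hom_presheaf_map[OF fh res(1)]
  let ?R = "Res (Hom_presheaf E F x x') (f, h) \<phi>" and ?m = "Hom_presheaf_map E F G u x x'"
    and ?t = "transition E F f h" and ?t' = "\<lambda>x. transition E G f h (on_obj u x)"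
    and ?k = "comparison E F G u"
  note s = res(1)[unfolded src.Sec_Hom_presheaf] \<phi>[unfolded src.Sec_Hom_presheaf]
    m\<phi>(1)[unfolded tgt.Sec_Hom_presheaf] m\<psi>(1)[unfolded tgt.Sec_Hom_presheaf]
  \<comment> \<open>The image under \<open>u\<close> of the square that defines the restriction of
    \<phi>.\<close>
  have u: "on_arr u (?t x') \<cdot>\<^bsub>Total G\<^esub> on_arr u ?R = on_arr u \<phi> \<cdot>\<^bsub>Total G\<^esub> on_arr u (?t x)"
    using arg_cong[OF res(2), of "on_arr u"] f h s by simp
  have "?t' x' \<cdot>\<^bsub>Total G\<^esub> ?m (f \<cdot>\<^bsub>E\<^esub> h) ?R = ?m f \<phi> \<cdot>\<^bsub>Total G\<^esub> ?t' x"
  proof (rule tgt.total.iso_cancel_right[of "?k (f \<cdot>\<^bsub>E\<^esub> h) x"])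
    have "(?t' x' \<cdot>\<^bsub>Total G\<^esub> ?m (f \<cdot>\<^bsub>E\<^esub> h) ?R) \<cdot>\<^bsub>Total G\<^esub> ?k (f \<cdot>\<^bsub>E\<^esub> h) x =
        ?t' x' \<cdot>\<^bsub>Total G\<^esub> (?k (f \<cdot>\<^bsub>E\<^esub> h) x' \<cdot>\<^bsub>Total G\<^esub> on_arr u ?R)"
      using f h s m\<psi>(2) by simp
    also have "\<dots> = ?k f x' \<cdot>\<^bsub>Total G\<^esub> (on_arr u (?t x') \<cdot>\<^bsub>Total G\<^esub> on_arr u ?R)"
      using f h s tgt.total.comp_reassoc[OF comparison_transition[of x' f h], of "on_arr u ?R"] by simp
    also have "\<dots> = (?k f x' \<cdot>\<^bsub>Total G\<^esub> on_arr u \<phi>) \<cdot>\<^bsub>Total G\<^esub> on_arr u (?t x)"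
      unfolding u using f h s by simp
    also have "\<dots> = ?m f \<phi> \<cdot>\<^bsub>Total G\<^esub> (?k f x \<cdot>\<^bsub>Total G\<^esub> on_arr u (?t x))"
      unfolding m\<phi>(2)[symmetric] using f h s by simp
    also have "\<dots> = (?m f \<phi> \<cdot>\<^bsub>Total G\<^esub> ?t' x) \<cdot>\<^bsub>Total G\<^esub> ?k (f \<cdot>\<^bsub>E\<^esub> h) x"
      using f h s comparison_transition[of x f h] by simp
    finally show "(?t' x' \<cdot>\<^bsub>Total G\<^esub> ?m (f \<cdot>\<^bsub>E\<^esub> h) ?R) \<cdot>\<^bsub>Total G\<^esub> ?k (f \<cdot>\<^bsub>E\<^esub> h) x =
      (?m f \<phi> \<cdot>\<^bsub>Total G\<^esub> ?t' x) \<cdot>\<^bsub>Total G\<^esub> ?k (f \<cdot>\<^bsub>E\<^esub> h) x" .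
  qed (use f h s in simp_all)
  then have "Res (Hom_presheaf E G (on_obj u x) (on_obj u x')) (f, h) (?m f \<phi>) = ?m (f \<cdot>\<^bsub>E\<^esub> h) ?R"
    by (intro tgt.Res_Hom_presheaf_unique[OF f h m\<phi>(1) m\<psi>(1)])
  then show "?m (Dom (slice E S) a) (Res (Hom_presheaf E F x x') a \<phi>) =
      Res (Hom_presheaf E G (on_obj u x) (on_obj u x')) a (?m (Cod (slice E S) a) \<phi>)"
    by (simp add: a_eq)
qed

end

section \<open>Bicovering maps without chosen inverse images\<close>

text \<open>One cartesian arrow over \<open>h\<close> is as good as any other, since two of them
  differ by an isomorphism; \<open>equal_afterD\<close> passes from one to all.\<close>

definition equal_after ::
  "('o, 'm) precategory \<Rightarrow> ('o, 'm, 'x, 'y) fibration \<Rightarrow> 'y \<Rightarrow> 'y \<Rightarrow> 'm \<Rightarrow> bool" where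
  "equal_after E F a b h \<longleftrightarrow> (\<exists>c. is_cartesian E F c \<and> TCod F c = TDom F a \<and>
    base_arr F c = h \<and> a \<cdot>\<^bsub>Total F\<^esub> c = b \<cdot>\<^bsub>Total F\<^esub> c)"

text \<open>Only the domain \<open>x\<close> is pulled back. The codomain stays fixed, so that
  \<open>w\<close> may lie over any arrow of \<open>E\<close>.\<close>

definition lifts_after ::
  "('o, 'm) precategory \<Rightarrow> ('o, 'm, 'x, 'y) fibration \<Rightarrow> ('o, 'm, 'v, 'w) fibration
   \<Rightarrow> ('x, 'y, 'v, 'w) functor_data \<Rightarrow> 'x \<Rightarrow> 'x \<Rightarrow> 'w \<Rightarrow> 'm \<Rightarrow> bool" where
  "lifts_after E F G u x x' w h \<longleftrightarrow> (\<exists>c a. is_cartesian E F c \<and> TCod F c = x \<and> base_arr F c = h \<and>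
    a \<in> TArr F \<and> TDom F a = TDom F c \<and> TCod F a = x' \<and> on_arr u a = w \<cdot>\<^bsub>Total G\<^esub> on_arr u c)"

text \<open>A cartesian arrow from the image of \<open>x\<close> exhibits that image as an inverse
  image of \<open>y\<close> along \<open>f\<close>; this replaces an isomorphism with a chosen
  inverse image.\<close>

definition reached_along ::
  "('o, 'm) precategory \<Rightarrow> ('o, 'm, 'x, 'y) fibration \<Rightarrow> ('o, 'm, 'v, 'w) fibration
   \<Rightarrow> ('x, 'y, 'v, 'w) functor_data \<Rightarrow> 'v \<Rightarrow> 'm \<Rightarrow> bool" where
  "reached_along E F G u y f \<longleftrightarrow> (\<exists>x\<in>TObj F. \<exists>d. is_cartesian E G d \<and> TDom G d = on_obj u x \<and>
    TCod G d = y \<and> base_arr G d = f)"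

definition locally_faithful ::
  "('o, 'm) precategory \<Rightarrow> ('o \<Rightarrow> 'm set set) \<Rightarrow> ('o, 'm, 'x, 'y) fibration
   \<Rightarrow> ('x, 'y, 'v, 'w) functor_data \<Rightarrow> bool" where
  "locally_faithful E J F u \<longleftrightarrow> (\<forall>a\<in>TArr F. \<forall>b\<in>TArr F. TDom F a = TDom F b \<and> TCod F a = TCod F b \<and>
    base_arr F a = base_arr F b \<and> on_arr u a = on_arr u b \<longrightarrow>
    locally E J (base_obj F (TDom F a)) (equal_after E F a b))"

definition locally_full ::
  "('o, 'm) precategory \<Rightarrow> ('o \<Rightarrow> 'm set set) \<Rightarrow> ('o, 'm, 'x, 'y) fibration
   \<Rightarrow> ('o, 'm, 'v, 'w) fibration \<Rightarrow> ('x, 'y, 'v, 'w) functor_data \<Rightarrow> bool" where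
  "locally_full E J F G u \<longleftrightarrow> (\<forall>x\<in>TObj F. \<forall>x'\<in>TObj F. \<forall>w\<in>hom (Total G) (on_obj u x) (on_obj u x').
    locally E J (base_obj F x) (lifts_after E F G u x x' w))"

definition locally_essentially_surjective ::
  "('o, 'm) precategory \<Rightarrow> ('o \<Rightarrow> 'm set set) \<Rightarrow> ('o, 'm, 'x, 'y) fibration
   \<Rightarrow> ('o, 'm, 'v, 'w) fibration \<Rightarrow> ('x, 'y, 'v, 'w) functor_data \<Rightarrow> bool" where
  "locally_essentially_surjective E J F G u \<longleftrightarrow>
    (\<forall>y\<in>TObj G. locally E J (base_obj G y) (reached_along E F G u y))"

lemma locally_faithfulD:
  "\<lbrakk>locally_faithful E J F u; a \<in> TArr F; b \<in> TArr F; TDom F a = TDom F b; TCod F a = TCod F b;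
    base_arr F a = base_arr F b; on_arr u a = on_arr u b\<rbrakk>
   \<Longrightarrow> locally E J (base_obj F (TDom F a)) (equal_after E F a b)"
  by (simp add: locally_faithful_def)

lemma locally_fullD:
  "\<lbrakk>locally_full E J F G u; x \<in> TObj F; x' \<in> TObj F; w \<in> TArr G; TDom G w = on_obj u x;
    TCod G w = on_obj u x'\<rbrakk>
   \<Longrightarrow> locally E J (base_obj F x) (lifts_after E F G u x x' w)"
  by (simp add: locally_full_def hom_def)

context fibration_over
begin

lemma equal_afterI:
  assumes "is_cartesian E F c" "TCod F c = TDom F a" "a \<cdot>\<^bsub>Total F\<^esub> c = b \<cdot>\<^bsub>Total F\<^esub> c"
    "base_arr F c = h"
  shows "equal_after E F a b h"
  using assms by (auto simp: equal_after_def)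

text \<open>The given cartesian arrow factors through the one witnessing \<open>equal_after\<close>,
  and the equation is precomposed with the factor.\<close>

lemma equal_afterD:
  assumes "equal_after E F a b (base_arr F c)" "is_cartesian E F c" "TCod F c = TDom F a"
    and ab: "a \<in> TArr F" "b \<in> TArr F" "TDom F a = TDom F b"
  shows "a \<cdot>\<^bsub>Total F\<^esub> c = b \<cdot>\<^bsub>Total F\<^esub> c"
proof -
  obtain d where d: "is_cartesian E F d" "TCod F d = TDom F a" "base_arr F d = base_arr F c"
    "a \<cdot>\<^bsub>Total F\<^esub> d = b \<cdot>\<^bsub>Total F\<^esub> d"
    using assms by (auto simp: equal_after_def)
  obtain i where i: "i \<in> TArr F" "TCod F i = TDom F d" "d \<cdot>\<^bsub>Total F\<^esub> i = c"
    using cartesian_unique[OF assms(2) d(1)] assms d by metis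
  show ?thesis
    using total.comp_reassoc[OF d(4), of i] i ab d cartesian_Arr[OF d(1)] by simp
qed

lemma precomp_closed_equal_after:
  assumes ab: "a \<in> TArr F" "b \<in> TArr F" "TDom F a = TDom F b"
  shows "precomp_closed E (base_obj F (TDom F a)) (equal_after E F a b)"
proof (rule precomp_closedI)
  fix f h assume f: "f \<in> Arr E" "equal_after E F a b f" and h: "h \<in> Arr E" "Cod E h = Dom E f"
  then obtain c where c: "is_cartesian E F c" "TCod F c = TDom F a" "base_arr F c = f"
    "a \<cdot>\<^bsub>Total F\<^esub> c = b \<cdot>\<^bsub>Total F\<^esub> c"
    by (auto simp: equal_after_def)
  note c' = cartesian_Arr[OF c(1)]
  have "base_obj F (TDom F c) = Dom E f" using Proj_simps(3)[OF c'] c by simp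
  then obtain d where d: "is_cartesian E F d" "d \<in> TArr F" "TCod F d = TDom F c" "base_arr F d = h"
    using ex_cartesian[of "TDom F c" h] c' h by auto
  show "equal_after E F a b (f \<cdot>\<^bsub>E\<^esub> h)"
    using total.comp_reassoc[OF c(4), of d] c c' d ab cartesian_comp[OF c(1) d(1)] by (intro equal_afterI[of "c \<cdot>\<^bsub>Total F\<^esub> d"]) auto
qed

end

context cartesian_functor
begin

lemma lifts_afterI:
  assumes "is_cartesian E F c" "TCod F c = x" "base_arr F c = h" "a \<in> TArr F" "TDom F a = TDom F c"
    "TCod F a = x'" "on_arr u a = w \<cdot>\<^bsub>Total G\<^esub> on_arr u c"
  shows "lifts_after E F G u x x' w h"
  using assms by (auto simp: lifts_after_def)

text \<open>The cartesian arrow can be prescribed: it factors as \<open>d \<cdot> i\<close> through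
  the witnessing one, and the lift is precomposed with \<open>i\<close>.\<close>

lemma lifts_afterE:
  assumes "lifts_after E F G u x x' w (base_arr F c)" "is_cartesian E F c" "TCod F c = x"
    and w: "w \<in> TArr G" "TDom G w = on_obj u x"
  obtains a where "a \<in> TArr F" "TDom F a = TDom F c" "TCod F a = x'"
    "on_arr u a = w \<cdot>\<^bsub>Total G\<^esub> on_arr u c"
proof -
  obtain d a where d: "is_cartesian E F d" "TCod F d = x" "base_arr F d = base_arr F c"
    "a \<in> TArr F" "TDom F a = TDom F d" "TCod F a = x'" "on_arr u a = w \<cdot>\<^bsub>Total G\<^esub> on_arr u d"
    using assms by (auto simp: lifts_after_def)
  obtain i where i: "i \<in> TArr F" "TDom F i = TDom F c" "TCod F i = TDom F d" "d \<cdot>\<^bsub>Total F\<^esub> i = c"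
    using src.cartesian_unique[OF assms(2) d(1)] assms d by metis
  show thesis
  proof (rule that[of "a \<cdot>\<^bsub>Total F\<^esub> i"])
    show "on_arr u (a \<cdot>\<^bsub>Total F\<^esub> i) = w \<cdot>\<^bsub>Total G\<^esub> on_arr u c"
      using i(1-3) d src.cartesian_Arr[OF d(1)] w by (simp flip: i(4))
  qed (use i d in auto)
qed

lemma precomp_closed_lifts_after:
  assumes w: "w \<in> TArr G" "TDom G w = on_obj u x"
  shows "precomp_closed E (base_obj F x) (lifts_after E F G u x x' w)"
proof (rule precomp_closedI)
  fix f h assume f: "f \<in> Arr E" "lifts_after E F G u x x' w f" and h: "h \<in> Arr E" "Cod E h = Dom E f"
  then obtain c a where c: "is_cartesian E F c" "TCod F c = x" "base_arr F c = f"
    "a \<in> TArr F" "TDom F a = TDom F c" "TCod F a = x'" "on_arr u a = w \<cdot>\<^bsub>Total G\<^esub> on_arr u c"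
    by (auto simp: lifts_after_def)
  note c' = src.cartesian_Arr[OF c(1)]
  have "base_obj F (TDom F c) = Dom E f" using src.Proj_simps(3)[OF c'] c by simp
  then obtain d where d: "is_cartesian E F d" "d \<in> TArr F" "TCod F d = TDom F c" "base_arr F d = h"
    using src.ex_cartesian[of "TDom F c" h] c' h by auto
  show "lifts_after E F G u x x' w (f \<cdot>\<^bsub>E\<^esub> h)"
    using c c' d w src.cartesian_comp[OF c(1) d(1)]
    by (intro lifts_afterI[of "c \<cdot>\<^bsub>Total F\<^esub> d" _ _ "a \<cdot>\<^bsub>Total F\<^esub> d"]) auto
qed

lemma precomp_closed_reached_along:
  "precomp_closed E (base_obj G y) (reached_along E F G u y)"
proof (rule precomp_closedI)
  fix f h assume f: "f \<in> Arr E" "reached_along E F G u y f" and h: "h \<in> Arr E" "Cod E h = Dom E f"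
  then obtain x d where d: "x \<in> TObj F" "is_cartesian E G d" "TDom G d = on_obj u x"
    "TCod G d = y" "base_arr G d = f"
    by (auto simp: reached_along_def)
  note d' = tgt.cartesian_Arr[OF d(2)]
  have "base_obj F x = Dom E f" using tgt.Proj_simps(3)[OF d'] d by simp
  then obtain c where c: "is_cartesian E F c" "c \<in> TArr F" "TCod F c = x" "base_arr F c = h"
    using src.ex_cartesian[of x h] d h by auto
  have "is_cartesian E G (d \<cdot>\<^bsub>Total G\<^esub> on_arr u c)"
    using tgt.cartesian_comp[OF d(2) cartesian_Fun[OF c(1)]] c d by simp
  then show "reached_along E F G u y (f \<cdot>\<^bsub>E\<^esub> h)"
    unfolding reached_along_def using c d d'
    by (intro bexI[of _ "TDom F c"] exI[of _ "d \<cdot>\<^bsub>Total G\<^esub> on_arr u c"]) auto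
qed

end

text \<open>The factorization of an arrow into a vertical and a cartesian one. The Hom presheaves
  only see vertical arrows, and this lemma reduces the others to them.\<close>

lemma (in fibration_over) vertical_factor:
  assumes a: "a \<in> TArr F" and c: "is_cartesian E F c" "TCod F c = TCod F a" "base_arr F c = base_arr F a"
  obtains b where "b \<in> TArr F" "TDom F b = TDom F a" "TCod F b = TDom F c"
    "base_arr F b = Idt E (base_obj F (TDom F a))" "c \<cdot>\<^bsub>Total F\<^esub> b = a"
proof -
  note c' = cartesian_Arr[OF c(1)]
  have "base_obj F (TDom F c) = base_obj F (TDom F a)"
    using Proj_simps(3)[OF c'] Proj_simps(3)[OF a] c by simp
  then show thesis
    using cartesian_factor[OF c(1) a, of "Idt E (base_obj F (TDom F a))"] a c c' that by auto
qed

section \<open>Comparison with the Hom presheaves\<close>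

locale site_functor = site E J + cartesian_functor E F G u
  for E :: "('o, 'm) precategory" and J and F :: "('o, 'm, 'x, 'y) fibration"
    and G :: "('o, 'm, 'v, 'w) fibration" and u
begin

text \<open>The comparisons are invertible, so two sections have the same image exactly when
  \<open>u\<close> identifies them; and two restrictions are equal exactly when the sections agree
  after a transition, which is a cartesian arrow over \<open>h\<close>.\<close>

lemma Hom_locally_injective_iff:
  assumes x: "x \<in> TObj F" "x' \<in> TObj F" "base_obj F x = S" "base_obj F x' = S"
  shows "locally_injective (slice E S) (slice_topology E J S) (Hom_presheaf E F x x')
      (Hom_presheaf_map E F G u x x') \<longleftrightarrow>
    (\<forall>f\<in>Arr E. Cod E f = S \<longrightarrow> (\<forall>\<phi>\<in>Sec (Hom_presheaf E F x x') f. \<forall>\<phi>'\<in>Sec (Hom_presheaf E F x x') f.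
       on_arr u \<phi> = on_arr u \<phi>' \<longrightarrow> locally E J (Dom E f) (equal_after E F \<phi> \<phi>')))"
proof -
  interpret at: cartesian_functor_at E F G u S x x' by unfold_locales (fact x)+
  have eq: "Hom_presheaf_map E F G u x x' f \<phi> = Hom_presheaf_map E F G u x x' f \<phi>' \<longleftrightarrow> on_arr u \<phi> = on_arr u \<phi>'"
    if f: "f \<in> Arr E" "Cod E f = S" and \<phi>: "\<phi> \<in> Sec (Hom_presheaf E F x x') f" "\<phi>' \<in> Sec (Hom_presheaf E F x x') f"
    for f \<phi> \<phi>'
  proof
    assume *: "Hom_presheaf_map E F G u x x' f \<phi> = Hom_presheaf_map E F G u x x' f \<phi>'"
    show "on_arr u \<phi> = on_arr u \<phi>'"
    proof (rule tgt.total.iso_cancel_left[of "comparison E F G u f x'"])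
      show "comparison E F G u f x' \<cdot>\<^bsub>Total G\<^esub> on_arr u \<phi> = comparison E F G u f x' \<cdot>\<^bsub>Total G\<^esub> on_arr u \<phi>'"
        using at.Hom_presheaf_map(2)[OF f \<phi>(1)] at.Hom_presheaf_map(2)[OF f \<phi>(2)] * by simp
    qed (use f x \<phi>[unfolded at.src.Sec_Hom_presheaf] in auto)
  next
    assume "on_arr u \<phi> = on_arr u \<phi>'"
    then show "Hom_presheaf_map E F G u x x' f \<phi> = Hom_presheaf_map E F G u x x' f \<phi>'"
      using at.Hom_presheaf_map[OF f \<phi>(2)] by (intro at.Hom_presheaf_map_unique[OF f \<phi>(1)]) simp_all
  qed
  have loc: "locally (slice E S) (slice_topology E J S) f (\<lambda>a. Res (Hom_presheaf E F x x') a \<phi> = Res (Hom_presheaf E F x x') a \<phi>')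
      \<longleftrightarrow> locally E J (Dom E f) (equal_after E F \<phi> \<phi>')"
    if f: "f \<in> Arr E" "Cod E f = S" and \<phi>: "\<phi> \<in> Sec (Hom_presheaf E F x x') f" "\<phi>' \<in> Sec (Hom_presheaf E F x x') f"
    for f \<phi> \<phi>'
    unfolding locally_slice[OF f]
  proof (rule locally_cong)
    note \<phi>' = \<phi>[unfolded at.src.Sec_Hom_presheaf]
    fix h assume h: "h \<in> Arr E" "Cod E h = Dom E f"
    note t = src.transition_simps[of x f h] 
    have "\<phi> \<cdot>\<^bsub>Total F\<^esub> transition E F f h x = \<phi>' \<cdot>\<^bsub>Total F\<^esub> transition E F f h x \<longleftrightarrow> equal_after E F \<phi> \<phi>' h"
    proof
      assume "\<phi> \<cdot>\<^bsub>Total F\<^esub> transition E F f h x = \<phi>' \<cdot>\<^bsub>Total F\<^esub> transition E F f h x"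
      then show "equal_after E F \<phi> \<phi>' h"
        using t x f h \<phi>' by (intro src.equal_afterI[of "transition E F f h x"]) auto
    next
      assume "equal_after E F \<phi> \<phi>' h"
      then show "\<phi> \<cdot>\<^bsub>Total F\<^esub> transition E F f h x = \<phi>' \<cdot>\<^bsub>Total F\<^esub> transition E F f h x"
        using t x f h \<phi>' by (intro src.equal_afterD) auto
    qed
    then show "(Res (Hom_presheaf E F x x') (f, h) \<phi> = Res (Hom_presheaf E F x x') (f, h) \<phi>') =
        equal_after E F \<phi> \<phi>' h"
      using at.src.Res_Hom_presheaf_eq_iff[OF f h \<phi>] by simp
  qed
  show ?thesis
    unfolding locally_injective_def using eq loc by auto
qed

text \<open>Conjugation by the comparisons makes a section \<open>q\<close> of the target presheaf
  into an arrow \<open>w\<close> between images of \<open>u\<close>. A preimage of a restriction of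
  \<open>q\<close>, composed with the transition of \<open>x'\<close>, is then a lift as in
  \<open>lifts_after\<close>.\<close>

lemma Hom_locally_surjective_iff:
  assumes x: "x \<in> TObj F" "x' \<in> TObj F" "base_obj F x = S" "base_obj F x' = S"
  shows "locally_surjective (slice E S) (slice_topology E J S) (Hom_presheaf E F x x')
      (Hom_presheaf E G (on_obj u x) (on_obj u x')) (Hom_presheaf_map E F G u x x') \<longleftrightarrow>
    (\<forall>f\<in>Arr E. Cod E f = S \<longrightarrow> (\<forall>w\<in>TArr G. TDom G w = on_obj u (inverse_image E F f x) \<and>
       TCod G w = on_obj u (inverse_image E F f x') \<and> base_arr G w = Idt E (Dom E f) \<longrightarrow>
       locally E J (Dom E f) (lifts_after E F G u (inverse_image E F f x) (inverse_image E F f x') w)))"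
proof -
  interpret at: cartesian_functor_at E F G u S x x' by unfold_locales (fact x)+
  let ?P = "Hom_presheaf E F x x'" and ?Q = "Hom_presheaf E G (on_obj u x) (on_obj u x')"
    and ?m = "Hom_presheaf_map E F G u x x'" and ?k = "comparison E F G u"
  have loc: "locally (slice E S) (slice_topology E J S) f
      (\<lambda>a. \<exists>p\<in>Sec ?P (Dom (slice E S) a). ?m (Dom (slice E S) a) p = Res ?Q a q) \<longleftrightarrow>
      locally E J (Dom E f) (lifts_after E F G u (inverse_image E F f x) (inverse_image E F f x') w)"
    if f: "f \<in> Arr E" "Cod E f = S" and q: "q \<in> Sec ?Q f" and w: "w \<in> TArr G"
      "TDom G w = on_obj u (inverse_image E F f x)" "TCod G w = on_obj u (inverse_image E F f x')"
      "base_arr G w = Idt E (Dom E f)"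
      and qw: "q \<cdot>\<^bsub>Total G\<^esub> ?k f x = ?k f x' \<cdot>\<^bsub>Total G\<^esub> w" for f q w
    unfolding locally_slice[OF f]
  proof (rule locally_cong)
    fix h assume h: "h \<in> Arr E" "Cod E h = Dom E f"
    note q' = q[unfolded at.tgt.Sec_Hom_presheaf]
    have fh: "f \<cdot>\<^bsub>E\<^esub> h \<in> Arr E" "Cod E (f \<cdot>\<^bsub>E\<^esub> h) = S" using f h by simp_all
    let ?t = "transition E F f h" and ?t' = "\<lambda>x. transition E G f h (on_obj u x)"
    \<comment> \<open>The cartesian transition at the image of \<open>x'\<close> and the invertible
      comparisons are cancelled in turn; the remaining equation mentions only transitions of
      \<open>F\<close>.\<close>
    have key: "?m (f \<cdot>\<^bsub>E\<^esub> h) p = Res ?Q (f, h) q \<longleftrightarrow>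
        on_arr u (?t x' \<cdot>\<^bsub>Total F\<^esub> p) = w \<cdot>\<^bsub>Total G\<^esub> on_arr u (?t x)"
      if p: "p \<in> Sec ?P (f \<cdot>\<^bsub>E\<^esub> h)" for p
    proof -
      note p' = p[unfolded at.src.Sec_Hom_presheaf]
      note m = at.Hom_presheaf_map[OF fh p]
      note m' = m(1)[unfolded at.tgt.Sec_Hom_presheaf]
      note r = at.tgt.Res_Hom_presheaf[OF f h q]
      note r' = r(1)[unfolded at.tgt.Sec_Hom_presheaf]
      have "?m (f \<cdot>\<^bsub>E\<^esub> h) p = Res ?Q (f, h) q \<longleftrightarrow>
          ?t' x' \<cdot>\<^bsub>Total G\<^esub> ?m (f \<cdot>\<^bsub>E\<^esub> h) p = q \<cdot>\<^bsub>Total G\<^esub> ?t' x"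
        using r(2) at.tgt.Res_Hom_presheaf_unique[OF f h q m(1)] by metis
      also have "\<dots> \<longleftrightarrow> (?t' x' \<cdot>\<^bsub>Total G\<^esub> ?m (f \<cdot>\<^bsub>E\<^esub> h) p) \<cdot>\<^bsub>Total G\<^esub> ?k (f \<cdot>\<^bsub>E\<^esub> h) x =
          (q \<cdot>\<^bsub>Total G\<^esub> ?t' x) \<cdot>\<^bsub>Total G\<^esub> ?k (f \<cdot>\<^bsub>E\<^esub> h) x"
      proof
        assume "(?t' x' \<cdot>\<^bsub>Total G\<^esub> ?m (f \<cdot>\<^bsub>E\<^esub> h) p) \<cdot>\<^bsub>Total G\<^esub> ?k (f \<cdot>\<^bsub>E\<^esub> h) x =
          (q \<cdot>\<^bsub>Total G\<^esub> ?t' x) \<cdot>\<^bsub>Total G\<^esub> ?k (f \<cdot>\<^bsub>E\<^esub> h) x"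
        then show "?t' x' \<cdot>\<^bsub>Total G\<^esub> ?m (f \<cdot>\<^bsub>E\<^esub> h) p = q \<cdot>\<^bsub>Total G\<^esub> ?t' x"
          by (rule tgt.total.iso_cancel_right[rotated -1]) (use f h x q' m' in simp_all)
      qed simp
      also have "(?t' x' \<cdot>\<^bsub>Total G\<^esub> ?m (f \<cdot>\<^bsub>E\<^esub> h) p) \<cdot>\<^bsub>Total G\<^esub> ?k (f \<cdot>\<^bsub>E\<^esub> h) x =
          ?t' x' \<cdot>\<^bsub>Total G\<^esub> (?k (f \<cdot>\<^bsub>E\<^esub> h) x' \<cdot>\<^bsub>Total G\<^esub> on_arr u p)"
        using f h x m' m(2) by simp
      also have "\<dots> = ?k f x' \<cdot>\<^bsub>Total G\<^esub> on_arr u (?t x' \<cdot>\<^bsub>Total F\<^esub> p)"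
        using f h x p' tgt.total.comp_reassoc[OF comparison_transition[of x' f h], of "on_arr u p"] by simp
      also have "(q \<cdot>\<^bsub>Total G\<^esub> ?t' x) \<cdot>\<^bsub>Total G\<^esub> ?k (f \<cdot>\<^bsub>E\<^esub> h) x =
          (q \<cdot>\<^bsub>Total G\<^esub> ?k f x) \<cdot>\<^bsub>Total G\<^esub> on_arr u (?t x)"
        using f h x q' comparison_transition[of x f h] by simp
      also have "\<dots> = ?k f x' \<cdot>\<^bsub>Total G\<^esub> (w \<cdot>\<^bsub>Total G\<^esub> on_arr u (?t x))"
        unfolding qw using f h x w by simp
      also have "(?k f x' \<cdot>\<^bsub>Total G\<^esub> on_arr u (?t x' \<cdot>\<^bsub>Total F\<^esub> p) = ?k f x' \<cdot>\<^bsub>Total G\<^esub> (w \<cdot>\<^bsub>Total G\<^esub> on_arr u (?t x))) \<longleftrightarrow>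
          on_arr u (?t x' \<cdot>\<^bsub>Total F\<^esub> p) = w \<cdot>\<^bsub>Total G\<^esub> on_arr u (?t x)"
      proof
        assume "?k f x' \<cdot>\<^bsub>Total G\<^esub> on_arr u (?t x' \<cdot>\<^bsub>Total F\<^esub> p) = ?k f x' \<cdot>\<^bsub>Total G\<^esub> (w \<cdot>\<^bsub>Total G\<^esub> on_arr u (?t x))"
        then show "on_arr u (?t x' \<cdot>\<^bsub>Total F\<^esub> p) = w \<cdot>\<^bsub>Total G\<^esub> on_arr u (?t x)"
          by (rule tgt.total.iso_cancel_left[rotated -1]) (use f h x w p' in simp_all)
      qed simp
      finally show ?thesis .
    qed
    have "(\<exists>p\<in>Sec ?P (f \<cdot>\<^bsub>E\<^esub> h). ?m (f \<cdot>\<^bsub>E\<^esub> h) p = Res ?Q (f, h) q) \<longleftrightarrow>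
        lifts_after E F G u (inverse_image E F f x) (inverse_image E F f x') w h"
    proof
      assume "\<exists>p\<in>Sec ?P (f \<cdot>\<^bsub>E\<^esub> h). ?m (f \<cdot>\<^bsub>E\<^esub> h) p = Res ?Q (f, h) q"
      then obtain p where p: "p \<in> Sec ?P (f \<cdot>\<^bsub>E\<^esub> h)"
        "on_arr u (?t x' \<cdot>\<^bsub>Total F\<^esub> p) = w \<cdot>\<^bsub>Total G\<^esub> on_arr u (?t x)"
        using key by blast
      note p' = p(1)[unfolded at.src.Sec_Hom_presheaf]
      show "lifts_after E F G u (inverse_image E F f x) (inverse_image E F f x') w h"
        by (rule lifts_afterI[of "?t x" _ _ "?t x' \<cdot>\<^bsub>Total F\<^esub> p"]) (use p' p(2) f h x in simp_all)
    next
      assume "lifts_after E F G u (inverse_image E F f x) (inverse_image E F f x') w h"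
      then have l: "lifts_after E F G u (inverse_image E F f x) (inverse_image E F f x') w (base_arr F (?t x))"
        using f h x by simp
      obtain a where a: "a \<in> TArr F" "TDom F a = TDom F (?t x)" "TCod F a = inverse_image E F f x'"
        "on_arr u a = w \<cdot>\<^bsub>Total G\<^esub> on_arr u (?t x)"
        by (rule lifts_afterE[OF l]) (use f h x w in simp_all)
      have ba: "base_arr F a = h"
        using arg_cong[OF a(4), of "base_arr G"] a(1) w f h x by simp
      \<comment> \<open>The lift lies over \<open>h\<close>, as does the transition into the inverse
        image of \<open>x'\<close>; its vertical part is the required section.\<close>
      obtain p where p: "p \<in> TArr F" "TDom F p = TDom F a" "TCod F p = TDom F (?t x')"
        "base_arr F p = Idt E (base_obj F (TDom F a))" "?t x' \<cdot>\<^bsub>Total F\<^esub> p = a"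
        by (rule src.vertical_factor[OF a(1), of "?t x'"]) (use f h x a ba in simp_all)
      have "p \<in> Sec ?P (f \<cdot>\<^bsub>E\<^esub> h)"
        using p a f h x by (simp add: at.src.Sec_Hom_presheaf)
      then show "\<exists>p\<in>Sec ?P (f \<cdot>\<^bsub>E\<^esub> h). ?m (f \<cdot>\<^bsub>E\<^esub> h) p = Res ?Q (f, h) q"
        using key[of p] p(5) a(4) by auto
    qed
    then show "(\<exists>p\<in>Sec ?P (Dom (slice E S) (f, h)). ?m (Dom (slice E S) (f, h)) p = Res ?Q (f, h) q) =
        lifts_after E F G u (inverse_image E F f x) (inverse_image E F f x') w h"
      by simp
  qed
  show ?thesis
  proof (intro iffI ballI impI)
    fix f w assume *: "locally_surjective (slice E S) (slice_topology E J S) ?P ?Q ?m"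
      and f: "f \<in> Arr E" "Cod E f = S" and "w \<in> TArr G" "TDom G w = on_obj u (inverse_image E F f x) \<and>
       TCod G w = on_obj u (inverse_image E F f x') \<and> base_arr G w = Idt E (Dom E f)"
    then have w: "w \<in> TArr G"
      "TDom G w = on_obj u (inverse_image E F f x)" "TCod G w = on_obj u (inverse_image E F f x')"
      "base_arr G w = Idt E (Dom E f)" by auto
    have "is_iso (Total G) (?k f x)" using f x by simp
    then obtain k where k: "k \<in> TArr G" "TDom G k = inverse_image E G f (on_obj u x)"
      "TCod G k = on_obj u (inverse_image E F f x)"
      "k \<cdot>\<^bsub>Total G\<^esub> ?k f x = TIdt G (on_obj u (inverse_image E F f x))"
      "?k f x \<cdot>\<^bsub>Total G\<^esub> k = TIdt G (inverse_image E G f (on_obj u x))"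
      by (rule tgt.total.is_isoE) (use f x in auto)
    have bk: "base_arr G k = Idt E (Dom E f)"
      using tgt.Proj_simps(6)[of "?k f x" k] k f x tgt.Proj_simps(3)[OF k(1)] by simp
    \<comment> \<open>The section that corresponds to \<open>w\<close> under conjugation by the
      comparisons.\<close>
    define q where "q = ?k f x' \<cdot>\<^bsub>Total G\<^esub> (w \<cdot>\<^bsub>Total G\<^esub> k)"
    have q: "q \<in> Sec ?Q f"
      using w k bk f x by (simp add: at.tgt.Sec_Hom_presheaf q_def)
    have "q \<cdot>\<^bsub>Total G\<^esub> ?k f x = ?k f x' \<cdot>\<^bsub>Total G\<^esub> w"
      using w k f x by (simp add: q_def)
    from loc[OF f q w this]
    show "locally E J (Dom E f) (lifts_after E F G u (inverse_image E F f x) (inverse_image E F f x') w)"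
      using * f q by (simp add: locally_surjective_def)
  next
    assume *: "\<forall>f\<in>Arr E. Cod E f = S \<longrightarrow> (\<forall>w\<in>TArr G. TDom G w = on_obj u (inverse_image E F f x) \<and>
       TCod G w = on_obj u (inverse_image E F f x') \<and> base_arr G w = Idt E (Dom E f) \<longrightarrow>
       locally E J (Dom E f) (lifts_after E F G u (inverse_image E F f x) (inverse_image E F f x') w))"
    show "locally_surjective (slice E S) (slice_topology E J S) ?P ?Q ?m"
      unfolding locally_surjective_def
    proof (intro ballI)
      fix f q assume "f \<in> Obj (slice E S)" and q: "q \<in> Sec ?Q f"
      then have f: "f \<in> Arr E" "Cod E f = S" by auto
      note q' = q[unfolded at.tgt.Sec_Hom_presheaf]
      have "is_iso (Total G) (?k f x')" using f x by simp
      then obtain k where k: "k \<in> TArr G" "TDom G k = inverse_image E G f (on_obj u x')"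
        "TCod G k = on_obj u (inverse_image E F f x')"
        "k \<cdot>\<^bsub>Total G\<^esub> ?k f x' = TIdt G (on_obj u (inverse_image E F f x'))"
        "?k f x' \<cdot>\<^bsub>Total G\<^esub> k = TIdt G (inverse_image E G f (on_obj u x'))"
        by (rule tgt.total.is_isoE) (use f x in auto)
      have bk: "base_arr G k = Idt E (Dom E f)"
        using tgt.Proj_simps(6)[of "?k f x'" k] k f x tgt.Proj_simps(3)[OF k(1)] by simp
      \<comment> \<open>Conjugation in the opposite direction.\<close>
      define w where "w = k \<cdot>\<^bsub>Total G\<^esub> (q \<cdot>\<^bsub>Total G\<^esub> ?k f x)"
      have w: "w \<in> TArr G"
        "TDom G w = on_obj u (inverse_image E F f x)" "TCod G w = on_obj u (inverse_image E F f x')"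
        "base_arr G w = Idt E (Dom E f)"
        using k bk q' f x by (simp_all add: w_def)
      have "?k f x' \<cdot>\<^bsub>Total G\<^esub> w = q \<cdot>\<^bsub>Total G\<^esub> ?k f x"
        using tgt.total.comp_reassoc[OF k(5), of "q \<cdot>\<^bsub>Total G\<^esub> ?k f x"] k q' f x by (simp add: w_def)
      from loc[OF f q w this[symmetric]]
      show "locally (slice E S) (slice_topology E J S) f
          (\<lambda>a. \<exists>p\<in>Sec ?P (Dom (slice E S) a). ?m (Dom (slice E S) a) p = Res ?Q a q)"
        using * f w by simp
    qed
  qed
qed

end

context site_functor
begin

text \<open>From left to right the presheaves are a special case. Conversely, a parallel pair is
  made vertical by splitting off a cartesian arrow over the common base arrow, and then carried to
  the inverse images along an identity, where it consists of sections.\<close>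

lemma locally_faithful_iff:
  "locally_faithful E J F u \<longleftrightarrow> (\<forall>S\<in>Obj E. \<forall>x\<in>Obj (fibre E F S). \<forall>x'\<in>Obj (fibre E F S).
     locally_injective (slice E S) (slice_topology E J S) (Hom_presheaf E F x x')
       (Hom_presheaf_map E F G u x x'))" (is "_ \<longleftrightarrow> ?R")
proof
  assume faithful: "locally_faithful E J F u"
  show ?R
  proof (intro ballI)
    fix S x x' assume "S \<in> Obj E" and "x \<in> Obj (fibre E F S)" "x' \<in> Obj (fibre E F S)"
    then have x: "x \<in> TObj F" "x' \<in> TObj F" "base_obj F x = S" "base_obj F x' = S"
      by (auto simp: fibre_def)
    interpret at: fibre_objects E F S x x' by unfold_locales (fact x)+
    show "locally_injective (slice E S) (slice_topology E J S) (Hom_presheaf E F x x')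
       (Hom_presheaf_map E F G u x x')"
      unfolding Hom_locally_injective_iff[OF x]
    proof (intro ballI impI)
      fix f \<phi> \<phi>' assume f: "f \<in> Arr E" "Cod E f = S" and \<phi>: "\<phi> \<in> Sec (Hom_presheaf E F x x') f"
        "\<phi>' \<in> Sec (Hom_presheaf E F x x') f" and u: "on_arr u \<phi> = on_arr u \<phi>'"
      note \<phi>' = \<phi>[unfolded at.Sec_Hom_presheaf]
      have "base_obj F (TDom F \<phi>) = Dom E f" using \<phi>' f x by simp
      then show "locally E J (Dom E f) (equal_after E F \<phi> \<phi>')"
        using locally_faithfulD[OF faithful, of \<phi> \<phi>'] \<phi>' u by simp
    qed
  qed
next
  assume inj: ?R
  show "locally_faithful E J F u"
    unfolding locally_faithful_def
  proof (intro ballI impI, elim conjE)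
    fix a b assume ab: "a \<in> TArr F" "b \<in> TArr F" "TDom F a = TDom F b" "TCod F a = TCod F b"
      "base_arr F a = base_arr F b" "on_arr u a = on_arr u b"
    define S x where "S = base_obj F (TDom F a)" and "x = TDom F a"
    have S: "S \<in> Obj E" and x: "x \<in> TObj F" "base_obj F x = S" using ab by (auto simp: S_def x_def)
    \<comment> \<open>Both \<open>a\<close> and \<open>b\<close> factor through this cartesian
      arrow; its image is cartesian, so the vertical parts are identified by \<open>u\<close>
      too.\<close>
    obtain c where c: "is_cartesian E F c" "c \<in> TArr F" "TCod F c = TCod F a"
      "base_arr F c = base_arr F a" "base_obj F (TDom F c) = Dom E (base_arr F a)"
      using src.ex_cartesian[of "TCod F a" "base_arr F a"] ab by auto
    define x' where "x' = TDom F c"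
    have x': "x' \<in> TObj F" "base_obj F x' = S" using c ab by (auto simp: x'_def S_def)
    obtain a' where a': "a' \<in> TArr F" "TDom F a' = x" "TCod F a' = x'" "base_arr F a' = Idt E S"
      "c \<cdot>\<^bsub>Total F\<^esub> a' = a"
      using src.vertical_factor[OF ab(1) c(1,3,4)] by (metis S_def x_def x'_def)
    obtain b' where b': "b' \<in> TArr F" "TDom F b' = x" "TCod F b' = x'" "base_arr F b' = Idt E S"
      "c \<cdot>\<^bsub>Total F\<^esub> b' = b"
      using src.vertical_factor[OF ab(2) c(1)] c(3,4) ab(3-5) by (metis S_def x_def x'_def)
    have u': "on_arr u a' = on_arr u b'"
    proof (rule tgt.cartesian_cancel[OF cartesian_Fun[OF c(1)]])
      show "on_arr u c \<cdot>\<^bsub>Total G\<^esub> on_arr u a' = on_arr u c \<cdot>\<^bsub>Total G\<^esub> on_arr u b'"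
        using ab(6) a' b' c(2) x'_def Fun_simps(6)[of a' c] Fun_simps(6)[of b' c] by simp
    qed (use a' b' c x'_def in simp_all)
    \<comment> \<open>Sections over the identity of \<open>S\<close> run between the chosen inverse
      images along it, which are isomorphic but not equal to \<open>x\<close> and \<open>x'\<close>.
      These lifts carry arrows from one place to the other.\<close>
    let ?l = "lift E F (Idt E S) x" and ?l' = "lift E F (Idt E S) x'"
    interpret at: fibre_objects E F S x x' by unfold_locales (fact x x')+
    obtain \<phi> where \<phi>: "\<phi> \<in> TArr F" "TDom F \<phi> = TDom F ?l" "TCod F \<phi> = TDom F ?l'"
      "base_arr F \<phi> = Idt E S" "?l' \<cdot>\<^bsub>Total F\<^esub> \<phi> = a' \<cdot>\<^bsub>Total F\<^esub> ?l"
      using src.vertical_factor[of "a' \<cdot>\<^bsub>Total F\<^esub> ?l" ?l'] a' S x x' by auto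
    obtain \<phi>' where \<phi>': "\<phi>' \<in> TArr F" "TDom F \<phi>' = TDom F ?l" "TCod F \<phi>' = TDom F ?l'"
      "base_arr F \<phi>' = Idt E S" "?l' \<cdot>\<^bsub>Total F\<^esub> \<phi>' = b' \<cdot>\<^bsub>Total F\<^esub> ?l"
      using src.vertical_factor[of "b' \<cdot>\<^bsub>Total F\<^esub> ?l" ?l'] b' S x x' by auto
    have "on_arr u \<phi> = on_arr u \<phi>'"
    proof (rule tgt.cartesian_cancel[OF cartesian_Fun[of ?l']])
      show "on_arr u ?l' \<cdot>\<^bsub>Total G\<^esub> on_arr u \<phi> = on_arr u ?l' \<cdot>\<^bsub>Total G\<^esub> on_arr u \<phi>'"
        using Fun_simps(6)[of \<phi> ?l'] Fun_simps(6)[of \<phi>' ?l'] u' \<phi> \<phi>' S x x' a' b' by simp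
    qed (use \<phi> \<phi>' S x x' in simp_all)
    moreover have "\<phi> \<in> Sec (Hom_presheaf E F x x') (Idt E S)" "\<phi>' \<in> Sec (Hom_presheaf E F x x') (Idt E S)"
      using \<phi> \<phi>' S x x' by (simp_all add: at.Sec_Hom_presheaf)
    moreover have "locally_injective (slice E S) (slice_topology E J S) (Hom_presheaf E F x x')
        (Hom_presheaf_map E F G u x x')"
      using inj S x x' by (simp add: fibre_def)
    ultimately have loc: "locally E J S (equal_after E F \<phi> \<phi>')"
      using Hom_locally_injective_iff[of x x' S, THEN iffD1, rule_format, of "Idt E S" \<phi> \<phi>'] S x x' by simp
    have "locally E J S (equal_after E F a b)"
    proof (rule locally_mono[OF S loc])
      show "precomp_closed E S (equal_after E F a b)"
        using src.precomp_closed_equal_after[of a b] ab S_def by simp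
      fix h assume h: "equal_after E F \<phi> \<phi>' h"
      then obtain d where d: "is_cartesian E F d" "TCod F d = TDom F \<phi>" "base_arr F d = h"
        "\<phi> \<cdot>\<^bsub>Total F\<^esub> d = \<phi>' \<cdot>\<^bsub>Total F\<^esub> d"
        by (auto simp: equal_after_def)
      note d' = src.cartesian_Arr[OF d(1)]
      have h': "h \<in> Arr E" "Cod E h = S"
        using d' d(2) src.Proj_simps(4)[OF d'] \<phi>(2) x S by (auto simp: d(3)[symmetric])
      have "a' \<cdot>\<^bsub>Total F\<^esub> (?l \<cdot>\<^bsub>Total F\<^esub> d) = ?l' \<cdot>\<^bsub>Total F\<^esub> (\<phi> \<cdot>\<^bsub>Total F\<^esub> d)"
        using src.total.comp_reassoc[OF \<phi>(5), of d] d(1-3) d' a' \<phi>(1-4) S x x' by simp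
      also have "\<dots> = b' \<cdot>\<^bsub>Total F\<^esub> (?l \<cdot>\<^bsub>Total F\<^esub> d)"
        unfolding d(4) using src.total.comp_reassoc[OF \<phi>'(5), of d] d(1-3) d' b' \<phi>(1,2) \<phi>'(1-4) S x x' by simp
      finally have "c \<cdot>\<^bsub>Total F\<^esub> (a' \<cdot>\<^bsub>Total F\<^esub> (?l \<cdot>\<^bsub>Total F\<^esub> d)) = c \<cdot>\<^bsub>Total F\<^esub> (b' \<cdot>\<^bsub>Total F\<^esub> (?l \<cdot>\<^bsub>Total F\<^esub> d))"
        by simp
      then have "a \<cdot>\<^bsub>Total F\<^esub> (?l \<cdot>\<^bsub>Total F\<^esub> d) = b \<cdot>\<^bsub>Total F\<^esub> (?l \<cdot>\<^bsub>Total F\<^esub> d)"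
        using src.total.comp_reassoc[OF a'(5), of "?l \<cdot>\<^bsub>Total F\<^esub> d"] src.total.comp_reassoc[OF b'(5), of "?l \<cdot>\<^bsub>Total F\<^esub> d"]
          d d' a'(1-4) b'(1-4) c x'_def \<phi> S x by simp
      moreover have "is_cartesian E F (?l \<cdot>\<^bsub>Total F\<^esub> d)"
        by (rule src.cartesian_comp) (use d S x \<phi> in simp_all)
      ultimately show "equal_after E F a b h"
        by (intro src.equal_afterI[of "?l \<cdot>\<^bsub>Total F\<^esub> d"]) (use d d' \<phi> S x h' x_def in simp_all)
    qed
    then show "locally E J (base_obj F (TDom F a)) (equal_after E F a b)" by (simp add: S_def)
  qed
qed

text \<open>The reduction is that of \<open>locally_faithful_iff\<close>: the vertical part of
  \<open>w\<close>, carried to the inverse images along an identity, is lifted locally, and the lift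
  is composed back with the two cartesian arrows.\<close>

lemma locally_full_iff:
  "locally_full E J F G u \<longleftrightarrow> (\<forall>S\<in>Obj E. \<forall>x\<in>Obj (fibre E F S). \<forall>x'\<in>Obj (fibre E F S).
     locally_surjective (slice E S) (slice_topology E J S) (Hom_presheaf E F x x')
       (Hom_presheaf E G (on_obj u x) (on_obj u x')) (Hom_presheaf_map E F G u x x'))" (is "_ \<longleftrightarrow> ?R")
proof
  assume full: "locally_full E J F G u"
  show ?R
  proof (intro ballI)
    fix S x x' assume "S \<in> Obj E" and "x \<in> Obj (fibre E F S)" "x' \<in> Obj (fibre E F S)"
    then have x: "x \<in> TObj F" "x' \<in> TObj F" "base_obj F x = S" "base_obj F x' = S"
      by (auto simp: fibre_def)
    show "locally_surjective (slice E S) (slice_topology E J S) (Hom_presheaf E F x x')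
       (Hom_presheaf E G (on_obj u x) (on_obj u x')) (Hom_presheaf_map E F G u x x')"
      unfolding Hom_locally_surjective_iff[OF x]
    proof (intro ballI impI, elim conjE)
      fix f w assume f: "f \<in> Arr E" "Cod E f = S" and w: "w \<in> TArr G"
        "TDom G w = on_obj u (inverse_image E F f x)" "TCod G w = on_obj u (inverse_image E F f x')"
      have "inverse_image E F f x \<in> TObj F" "inverse_image E F f x' \<in> TObj F"
        "base_obj F (inverse_image E F f x) = Dom E f" using f x by simp_all
      then show "locally E J (Dom E f) (lifts_after E F G u (inverse_image E F f x) (inverse_image E F f x') w)"
        using locally_fullD[OF full _ _ w] by metis
    qed
  qed
next
  assume surj: ?R
  show "locally_full E J F G u"
    unfolding locally_full_def
  proof (intro ballI)
    fix x x'' w assume x: "x \<in> TObj F" and x'': "x'' \<in> TObj F"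
      and "w \<in> hom (Total G) (on_obj u x) (on_obj u x'')"
    then have w: "w \<in> TArr G" "TDom G w = on_obj u x" "TCod G w = on_obj u x''" by (auto simp: hom_def)
    define S where "S = base_obj F x"
    have S: "S \<in> Obj E" "base_obj F x = S" using x by (auto simp: S_def)
    have bw: "Cod E (base_arr G w) = base_obj F x''" "Dom E (base_arr G w) = S"
      using w x x'' S by simp_all
    obtain c where c: "is_cartesian E F c" "c \<in> TArr F" "TCod F c = x''"
      "base_arr F c = base_arr G w" "base_obj F (TDom F c) = Dom E (base_arr G w)"
      using src.ex_cartesian[of x'' "base_arr G w"] w x'' bw by auto
    define x' where "x' = TDom F c"
    have x': "x' \<in> TObj F" "base_obj F x' = S" using c bw by (auto simp: x'_def)
    obtain w' where w': "w' \<in> TArr G" "TDom G w' = on_obj u x" "TCod G w' = on_obj u x'"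
      "base_arr G w' = Idt E S" "on_arr u c \<cdot>\<^bsub>Total G\<^esub> w' = w"
      using tgt.vertical_factor[OF w(1) cartesian_Fun[OF c(1)]] c w x S x'_def by auto
    let ?l = "lift E F (Idt E S) x" and ?l' = "lift E F (Idt E S) x'"
    \<comment> \<open>The vertical part \<open>w'\<close> carried along the images of the two lifts;
      this is the arrow to which local surjectivity applies.\<close>
    obtain v where v: "v \<in> TArr G" "TDom G v = on_obj u (TDom F ?l)" "TCod G v = on_obj u (TDom F ?l')"
      "base_arr G v = Idt E S" "on_arr u ?l' \<cdot>\<^bsub>Total G\<^esub> v = w' \<cdot>\<^bsub>Total G\<^esub> on_arr u ?l"
      using tgt.vertical_factor[of "w' \<cdot>\<^bsub>Total G\<^esub> on_arr u ?l" "on_arr u ?l'"] cartesian_Fun[of ?l'] w' S x x' by auto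
    have "locally_surjective (slice E S) (slice_topology E J S) (Hom_presheaf E F x x')
       (Hom_presheaf E G (on_obj u x) (on_obj u x')) (Hom_presheaf_map E F G u x x')"
      using surj S x x' by (simp add: fibre_def)
    then have loc: "locally E J S (lifts_after E F G u (TDom F ?l) (TDom F ?l') v)"
      using Hom_locally_surjective_iff[of x x' S, THEN iffD1, rule_format, of "Idt E S" v] S x x' v by simp
    have "locally E J S (lifts_after E F G u x x'' w)"
    proof (rule locally_mono[OF S(1) loc])
      show "precomp_closed E S (lifts_after E F G u x x'' w)"
        using precomp_closed_lifts_after[OF w(1,2)] by (simp add: S_def)
      fix h assume "lifts_after E F G u (TDom F ?l) (TDom F ?l') v h"
      then obtain d a where d: "is_cartesian E F d" "TCod F d = TDom F ?l" "base_arr F d = h"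
        "a \<in> TArr F" "TDom F a = TDom F d" "TCod F a = TDom F ?l'"
        "on_arr u a = v \<cdot>\<^bsub>Total G\<^esub> on_arr u d"
        by (auto simp: lifts_after_def)
      note d' = src.cartesian_Arr[OF d(1)]
      have h': "h \<in> Arr E" "Cod E h = S"
        using d' d(2) src.Proj_simps(4)[OF d'] x S by (auto simp: d(3)[symmetric])
      show "lifts_after E F G u x x'' w h"
      proof (rule lifts_afterI[of "?l \<cdot>\<^bsub>Total F\<^esub> d" _ _ "c \<cdot>\<^bsub>Total F\<^esub> (?l' \<cdot>\<^bsub>Total F\<^esub> a)"])
        show "is_cartesian E F (?l \<cdot>\<^bsub>Total F\<^esub> d)"
          by (rule src.cartesian_comp) (use d S x in simp_all)
        have "on_arr u (c \<cdot>\<^bsub>Total F\<^esub> (?l' \<cdot>\<^bsub>Total F\<^esub> a)) =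
            on_arr u c \<cdot>\<^bsub>Total G\<^esub> (on_arr u ?l' \<cdot>\<^bsub>Total G\<^esub> (v \<cdot>\<^bsub>Total G\<^esub> on_arr u d))"
          using d d' c x'_def S x x' by simp
        also have "\<dots> = on_arr u c \<cdot>\<^bsub>Total G\<^esub> (w' \<cdot>\<^bsub>Total G\<^esub> (on_arr u ?l \<cdot>\<^bsub>Total G\<^esub> on_arr u d))"
          using tgt.total.comp_reassoc[OF v(5), of "on_arr u d"] v w' d d' S x x' by simp
        also have "\<dots> = w \<cdot>\<^bsub>Total G\<^esub> on_arr u (?l \<cdot>\<^bsub>Total F\<^esub> d)"
          using tgt.total.comp_reassoc[OF w'(5), of "on_arr u ?l \<cdot>\<^bsub>Total G\<^esub> on_arr u d"] w' c x'_def d d' S x x' by simp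
        finally show "on_arr u (c \<cdot>\<^bsub>Total F\<^esub> (?l' \<cdot>\<^bsub>Total F\<^esub> a)) = w \<cdot>\<^bsub>Total G\<^esub> on_arr u (?l \<cdot>\<^bsub>Total F\<^esub> d)" .
      qed (use d d' S x x' c x'_def h' in simp_all)
    qed
    then show "locally E J (base_obj F x) (lifts_after E F G u x x'' w)" by (simp add: S_def)
  qed
qed

text \<open>An isomorphism onto the chosen inverse image composes with the lift to a cartesian
  arrow; conversely two cartesian arrows over \<open>f\<close> into \<open>y\<close> differ by a
  vertical isomorphism.\<close>

lemma isomorphic_fibre_iff:
  assumes y: "y \<in> TObj G" "base_obj G y = S" and f: "f \<in> Arr E" "Cod E f = S"
  shows "(\<exists>x\<in>Obj (fibre E F (Dom E f)). isomorphic (fibre E G (Dom E f)) (on_obj u x) (inverse_image E G f y))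
    \<longleftrightarrow> reached_along E F G u y f"
proof
  assume "\<exists>x\<in>Obj (fibre E F (Dom E f)). isomorphic (fibre E G (Dom E f)) (on_obj u x) (inverse_image E G f y)"
  then obtain x i where x: "x \<in> TObj F" "base_obj F x = Dom E f"
    and i: "i \<in> hom (fibre E G (Dom E f)) (on_obj u x) (inverse_image E G f y)"
      "is_iso (fibre E G (Dom E f)) i"
    by (auto simp: isomorphic_def fibre_def)
  note i' = i(1)[unfolded tgt.hom_fibre]
  have "is_iso (Total G) i"
    using i by (auto simp: is_iso_def fibre_def hom_def)
  then have "is_cartesian E G (lift E G f y \<cdot>\<^bsub>Total G\<^esub> i)"
    by (intro tgt.cartesian_comp[OF _ tgt.iso_cartesian]) (use y f i' in simp_all)
  then show "reached_along E F G u y f"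
    unfolding reached_along_def using x y f i'
    by (intro bexI[of _ x] exI[of _ "lift E G f y \<cdot>\<^bsub>Total G\<^esub> i"]) auto
next
  assume "reached_along E F G u y f"
  then obtain x d where d: "x \<in> TObj F" "is_cartesian E G d" "TDom G d = on_obj u x"
    "TCod G d = y" "base_arr G d = f"
    by (auto simp: reached_along_def)
  note d' = tgt.cartesian_Arr[OF d(2)]
  have x: "base_obj F x = Dom E f" using tgt.Proj_simps(3)[OF d'] d by simp
  obtain i where i: "is_iso (Total G) i" "i \<in> TArr G" "TDom G i = on_obj u x"
    "TCod G i = inverse_image E G f y" "base_arr G i = Idt E (Dom E f)"
    using tgt.cartesian_unique[OF d(2), of "lift E G f y"] d y f x by auto
  obtain j where j: "j \<in> TArr G" "TDom G j = TCod G i" "TCod G j = TDom G i"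
    "j \<cdot>\<^bsub>Total G\<^esub> i = TIdt G (TDom G i)" "i \<cdot>\<^bsub>Total G\<^esub> j = TIdt G (TCod G i)"
    using tgt.total.is_isoE[OF i(1)] by metis
  \<comment> \<open>An isomorphism of the total category is one of the fibre only if its inverse is
    vertical as well.\<close>
  have "base_arr G j = Idt E (Dom E f)"
    using tgt.Proj_simps(6)[of i j] j i x d tgt.Proj_simps(4)[OF j(1)] tgt.Proj_simps(3)[OF j(1)] f y by simp
  then have "is_iso (fibre E G (Dom E f)) i"
    using i j by (auto simp: is_iso_def fibre_def hom_def)
  then have "isomorphic (fibre E G (Dom E f)) (on_obj u x) (inverse_image E G f y)"
    unfolding isomorphic_def using i by (intro bexI[of _ i]) (auto simp: tgt.hom_fibre)
  then show "\<exists>x\<in>Obj (fibre E F (Dom E f)). isomorphic (fibre E G (Dom E f)) (on_obj u x) (inverse_image E G f y)"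
    using d x by (intro bexI[of _ x]) (auto simp: fibre_def)
qed

text \<open>On each slice the sheafification criterion splits condition (i) into local injectivity
  and local surjectivity, which are local faithfulness and local fullness of
  \<open>u\<close>.\<close>

theorem is_bicovering_iff:
  "is_bicovering E J F G u \<longleftrightarrow> locally_faithful E J F u \<and> locally_full E J F G u \<and>
    locally_essentially_surjective E J F G u"
proof -
  have hom: "iso_after_sheafification (slice E S) (slice_topology E J S) (Hom_presheaf E F x x')
      (Hom_presheaf E G (on_obj u x) (on_obj u x')) (Hom_presheaf_map E F G u x x') \<longleftrightarrow>
    locally_injective (slice E S) (slice_topology E J S) (Hom_presheaf E F x x')
       (Hom_presheaf_map E F G u x x') \<and>
    locally_surjective (slice E S) (slice_topology E J S) (Hom_presheaf E F x x')
       (Hom_presheaf E G (on_obj u x) (on_obj u x')) (Hom_presheaf_map E F G u x x')"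
    if "x \<in> Obj (fibre E F S)" "x' \<in> Obj (fibre E F S)" for S x x'
  proof -
    have x: "x \<in> TObj F" "x' \<in> TObj F" "base_obj F x = S" "base_obj F x' = S"
      using that by (auto simp: fibre_def)
    interpret at: cartesian_functor_at E F G u S x x' by unfold_locales (fact x)+
    show ?thesis
      by (rule site.iso_after_sheafification_iff[OF site_slice at.src.is_presheaf_Hom
            at.tgt.is_presheaf_Hom at.is_presheaf_map_Hom])
  qed
  have ess: "locally_essentially_surjective E J F G u \<longleftrightarrow> (\<forall>S\<in>Obj E. \<forall>y\<in>Obj (fibre E G S).
       {f \<in> Arr E. Cod E f = S \<and> (\<exists>x\<in>Obj (fibre E F (Dom E f)).
             isomorphic (fibre E G (Dom E f)) (on_obj u x) (inverse_image E G f y))} \<in> J S)"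
    (is "_ \<longleftrightarrow> ?R")
  proof -
    have "{f \<in> Arr E. Cod E f = S \<and> (\<exists>x\<in>Obj (fibre E F (Dom E f)).
        isomorphic (fibre E G (Dom E f)) (on_obj u x) (inverse_image E G f y))} =
      {f \<in> Arr E. Cod E f = S \<and> reached_along E F G u y f}"
      if "y \<in> TObj G" "base_obj G y = S" for S y
      using isomorphic_fibre_iff[OF that] by blast
    then have "?R \<longleftrightarrow> (\<forall>S\<in>Obj E. \<forall>y\<in>Obj (fibre E G S). locally E J S (reached_along E F G u y))"
      unfolding locally_def by (simp add: fibre_def)
    also have "\<dots> \<longleftrightarrow> locally_essentially_surjective E J F G u"
      unfolding locally_essentially_surjective_def by (auto simp: fibre_def)
    finally show ?thesis by simp
  qed
  show ?thesis
    unfolding is_bicovering_def locally_faithful_iff locally_full_iff ess using hom by auto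
qed

end

section \<open>Two out of three\<close>

text \<open>The form of transitivity used in the diagram chases: over each arrow of the first
  covering a second one is found, given by a property \<open>R\<close> that may depend on the
  objects chosen there.\<close>

lemma (in site) locally_bind:
  assumes S: "S \<in> Obj E" and Q: "locally E J S Q" and Q': "precomp_closed E S Q'"
    and step: "\<And>f. \<lbrakk>f \<in> Arr E; Cod E f = S; Q f\<rbrakk>
      \<Longrightarrow> \<exists>R. locally E J (Dom E f) R \<and>
        (\<forall>h\<in>Arr E. Cod E h = Dom E f \<and> R h \<longrightarrow> Q' (f \<cdot>\<^bsub>E\<^esub> h))"
  shows "locally E J S Q'"
proof (rule locally_trans[OF S Q Q'])
  fix f assume f: "f \<in> Arr E" "Cod E f = S" "Q f"
  then obtain R where R: "locally E J (Dom E f) R"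
    "\<And>h. \<lbrakk>h \<in> Arr E; Cod E h = Dom E f; R h\<rbrakk> \<Longrightarrow> Q' (f \<cdot>\<^bsub>E\<^esub> h)"
    using step by blast
  show "locally E J (Dom E f) (\<lambda>h. Q' (f \<cdot>\<^bsub>E\<^esub> h))"
    by (rule locally_mono[OF _ R(1)]) (use f R(2) stable_pull[of f Q'] Q' in auto)
qed

lemma locally_essentially_surjectiveD:
  "\<lbrakk>locally_essentially_surjective E J F G u; y \<in> TObj G\<rbrakk>
   \<Longrightarrow> locally E J (base_obj G y) (reached_along E F G u y)"
  by (simp add: locally_essentially_surjective_def)

lemma (in cartesian_functor) reached_alongE:
  assumes "reached_along E F G u y f"
  obtains x d where "x \<in> TObj F" "is_cartesian E G d" "d \<in> TArr G" "TDom G d = on_obj u x"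
    "TCod G d = y" "base_arr G d = f" "base_obj F x = Dom E f"
proof -
  obtain x d where d: "x \<in> TObj F" "is_cartesian E G d" "TDom G d = on_obj u x"
    "TCod G d = y" "base_arr G d = f"
    using assms by (auto simp: reached_along_def)
  note d' = tgt.cartesian_Arr[OF d(2)]
  show thesis using that[OF d(1,2) d' d(3-5)] tgt.Proj_simps(3)[OF d'] d by simp
qed

lemma (in cartesian_functor) reached_alongI:
  "\<lbrakk>x \<in> TObj F; is_cartesian E G d; TDom G d = on_obj u x; TCod G d = y; base_arr G d = f\<rbrakk>
   \<Longrightarrow> reached_along E F G u y f"
  by (auto simp: reached_along_def)

context site_functor
begin

text \<open>Up to a cartesian factor, \<open>a\<close> is a vertical arrow \<open>k\<close> whose image is invertible. Lifting the
  inverse of the image gives, locally, a right inverse \<open>l\<close> of \<open>k\<close>; it is also a left inverse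
  locally, because \<open>u\<close> is locally faithful.\<close>

lemma locally_cartesian:
  assumes faithful: "locally_faithful E J F u" and full: "locally_full E J F G u"
    and a: "a \<in> TArr F" and ua: "is_cartesian E G (on_arr u a)"
  shows "locally E J (base_obj F (TDom F a))
    (\<lambda>h. \<forall>c. is_cartesian E F c \<and> TCod F c = TDom F a \<and> base_arr F c = h \<longrightarrow>
       is_cartesian E F (a \<cdot>\<^bsub>Total F\<^esub> c))" (is "locally E J ?S ?Q")
proof -
  define x where "x = TDom F a"
  define S where "S = base_obj F x"
  have S [simp]: "S \<in> Obj E" "x \<in> TObj F" "base_obj F x = S" using a by (auto simp: S_def x_def)
  obtain c where c: "is_cartesian E F c" "c \<in> TArr F" "TCod F c = TCod F a"
    "base_arr F c = base_arr F a" "base_obj F (TDom F c) = S"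
    using src.ex_cartesian[of "TCod F a" "base_arr F a"] a S_def x_def by auto
  define y where "y = TDom F c"
  have y [simp]: "y \<in> TObj F" "base_obj F y = S" using c by (auto simp: y_def)
  obtain k where k: "k \<in> TArr F" "TDom F k = x" "TCod F k = y" "base_arr F k = Idt E S"
    "c \<cdot>\<^bsub>Total F\<^esub> k = a"
    using src.vertical_factor[OF a c(1,3,4)] S_def x_def y_def by metis
  have "is_cartesian E G (on_arr u k)"
    by (rule tgt.cartesian_cancel_left[OF cartesian_Fun[OF c(1)]])
      (use ua c k y_def Fun_simps(6)[of k c] in simp_all)
  then have uk: "is_iso (Total G) (on_arr u k)"
    by (rule tgt.cartesian_iso) (use k in \<open>simp add: is_iso_Idt\<close>)
  \<comment> \<open>Only this composite is kept: the lift of \<open>j\<close> will be a right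
    inverse, and that it is a left inverse will come from faithfulness.\<close>
  obtain j where j: "j \<in> TArr G" "TDom G j = on_obj u y" "TCod G j = on_obj u x"
    "on_arr u k \<cdot>\<^bsub>Total G\<^esub> j = TIdt G (on_obj u y)"
    using tgt.total.is_isoE[OF uk] k by (metis Fun_simps(3,4))
  \<comment> \<open>A cartesian arrow \<open>e\<close> over \<open>f h\<close> factors through one
    over \<open>f\<close>, and the factor is again cartesian.\<close>
  have closed: "precomp_closed E S ?Q"
  proof (rule precomp_closedI, intro allI impI, elim conjE)
    fix f h e assume f: "f \<in> Arr E" "Cod E f = S" and h: "h \<in> Arr E" "Cod E h = Dom E f"
      and Q: "\<forall>c. is_cartesian E F c \<and> TCod F c = TDom F a \<and> base_arr F c = f \<longrightarrow>
       is_cartesian E F (a \<cdot>\<^bsub>Total F\<^esub> c)"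
      and e: "is_cartesian E F e" "TCod F e = TDom F a" "base_arr F e = f \<cdot>\<^bsub>E\<^esub> h"
    obtain c where c: "is_cartesian E F c" "c \<in> TArr F" "TCod F c = x" "base_arr F c = f"
      "base_obj F (TDom F c) = Dom E f"
      using src.ex_cartesian[of x f] f by auto
    note e' = src.cartesian_Arr[OF e(1)]
    have "base_obj F (TDom F e) = Dom E h" using src.Proj_simps(3)[OF e'] e f h by simp
    then obtain d where d: "d \<in> TArr F" "TDom F d = TDom F e" "TCod F d = TDom F c" "c \<cdot>\<^bsub>Total F\<^esub> d = e"
      using src.cartesian_factor[OF c(1) e', of h] e c h f x_def by auto
    have "is_cartesian E F (a \<cdot>\<^bsub>Total F\<^esub> c)" using Q c x_def by simp
    moreover have "is_cartesian E F d" by (rule src.cartesian_cancel_left[OF c(1)]) (use d e in simp_all)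
    ultimately have "is_cartesian E F ((a \<cdot>\<^bsub>Total F\<^esub> c) \<cdot>\<^bsub>Total F\<^esub> d)"
      by (rule src.cartesian_comp) (use a c d x_def in simp)
    then show "is_cartesian E F (a \<cdot>\<^bsub>Total F\<^esub> e)" using a c d x_def by simp
  qed
  have "locally E J S (lifts_after E F G u y x j)"
    using locally_fullD[OF full y(1) S(2) j(1-3)] by simp
  \<comment> \<open>With \<open>d\<close> cartesian over \<open>h\<close>, the equation
    \<open>k l = d\<close> says that \<open>l\<close> induces a section of the inverse image of
    \<open>k\<close> along \<open>h\<close>. The lift of \<open>j\<close> satisfies it only after
    applying \<open>u\<close>, whence one more refinement.\<close>
  moreover have "precomp_closed E S (\<lambda>h. \<exists>d l. is_cartesian E F d \<and> TCod F d = y \<and> base_arr F d = h \<and>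
      l \<in> TArr F \<and> TDom F l = TDom F d \<and> TCod F l = x \<and> k \<cdot>\<^bsub>Total F\<^esub> l = d)"
  proof (rule precomp_closedI, elim exE conjE)
    fix f h d l assume f: "f \<in> Arr E" "Cod E f = S" and h: "h \<in> Arr E" "Cod E h = Dom E f"
      and d: "is_cartesian E F d" "TCod F d = y" "base_arr F d = f"
      and l: "l \<in> TArr F" "TDom F l = TDom F d" "TCod F l = x" "k \<cdot>\<^bsub>Total F\<^esub> l = d"
    note d' = src.cartesian_Arr[OF d(1)]
    have "base_obj F (TDom F d) = Dom E f" using src.Proj_simps(3)[OF d'] d by simp
    then obtain e where e: "is_cartesian E F e" "e \<in> TArr F" "TCod F e = TDom F d" "base_arr F e = h"
      using src.ex_cartesian[of "TDom F d" h] d' h by auto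
    show "\<exists>d l. is_cartesian E F d \<and> TCod F d = y \<and> base_arr F d = f \<cdot>\<^bsub>E\<^esub> h \<and>
      l \<in> TArr F \<and> TDom F l = TDom F d \<and> TCod F l = x \<and> k \<cdot>\<^bsub>Total F\<^esub> l = d"
      using src.cartesian_comp[OF d(1) e(1)] e d d' l(1-3) k(1-4) src.total.comp_reassoc[OF l(4), of e]
      by (intro exI[of _ "d \<cdot>\<^bsub>Total F\<^esub> e"] exI[of _ "l \<cdot>\<^bsub>Total F\<^esub> e"]) simp
  qed
  ultimately have "locally E J S (\<lambda>h. \<exists>d l. is_cartesian E F d \<and> TCod F d = y \<and> base_arr F d = h \<and>
      l \<in> TArr F \<and> TDom F l = TDom F d \<and> TCod F l = x \<and> k \<cdot>\<^bsub>Total F\<^esub> l = d)"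
  proof (rule locally_bind[OF S(1)])
    fix f assume f: "f \<in> Arr E" "Cod E f = S" and "lifts_after E F G u y x j f"
    then obtain d l where d: "is_cartesian E F d" "TCod F d = y" "base_arr F d = f"
      and l: "l \<in> TArr F" "TDom F l = TDom F d" "TCod F l = x"
      "on_arr u l = j \<cdot>\<^bsub>Total G\<^esub> on_arr u d"
      by (auto simp: lifts_after_def)
    note d' = src.cartesian_Arr[OF d(1)]
    have bd: "base_obj F (TDom F d) = Dom E f" using src.Proj_simps(3)[OF d'] d by simp
    have ukl: "on_arr u (k \<cdot>\<^bsub>Total F\<^esub> l) = on_arr u d"
      using tgt.total.comp_reassoc[OF j(4), of "on_arr u d"] l k d d' j by simp
    have "k \<cdot>\<^bsub>Total F\<^esub> l \<in> TArr F" using l k by simp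
    then have "base_arr F (k \<cdot>\<^bsub>Total F\<^esub> l) = base_arr F d" using base_Fun(2) ukl d' by metis
    then have "locally E J (Dom E f) (equal_after E F (k \<cdot>\<^bsub>Total F\<^esub> l) d)"
      using locally_faithfulD[OF faithful _ _ _ _ _ ukl] l k d d' bd f(1,2) by simp
    moreover have "\<exists>d l. is_cartesian E F d \<and> TCod F d = y \<and> base_arr F d = f \<cdot>\<^bsub>E\<^esub> h \<and>
        l \<in> TArr F \<and> TDom F l = TDom F d \<and> TCod F l = x \<and> k \<cdot>\<^bsub>Total F\<^esub> l = d"
      if "equal_after E F (k \<cdot>\<^bsub>Total F\<^esub> l) d h" for h
    proof -
      obtain e where e: "is_cartesian E F e" "TCod F e = TDom F d" "base_arr F e = h"
        "(k \<cdot>\<^bsub>Total F\<^esub> l) \<cdot>\<^bsub>Total F\<^esub> e = d \<cdot>\<^bsub>Total F\<^esub> e"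
        using \<open>equal_after E F (k \<cdot>\<^bsub>Total F\<^esub> l) d h\<close> l k by (auto simp: equal_after_def)
      note e' = src.cartesian_Arr[OF e(1)]
      show ?thesis
        using src.cartesian_comp[OF d(1) e(1)] e e' d d' l k
        by (intro exI[of _ "d \<cdot>\<^bsub>Total F\<^esub> e"] exI[of _ "l \<cdot>\<^bsub>Total F\<^esub> e"]) auto
    qed
    ultimately show "\<exists>R. locally E J (Dom E f) R \<and> (\<forall>h\<in>Arr E. Cod E h = Dom E f \<and> R h \<longrightarrow>
      (\<exists>d l. is_cartesian E F d \<and> TCod F d = y \<and> base_arr F d = f \<cdot>\<^bsub>E\<^esub> h \<and>
        l \<in> TArr F \<and> TDom F l = TDom F d \<and> TCod F l = x \<and> k \<cdot>\<^bsub>Total F\<^esub> l = d))"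
      by blast
  qed
  then have "locally E J S ?Q"
  proof (rule locally_bind[OF S(1) _ closed], elim exE conjE)
    fix f d l assume f: "f \<in> Arr E" "Cod E f = S"
      and d: "is_cartesian E F d" "TCod F d = y" "base_arr F d = f"
      and l: "l \<in> TArr F" "TDom F l = TDom F d" "TCod F l = x" "k \<cdot>\<^bsub>Total F\<^esub> l = d"
    note d' = src.cartesian_Arr[OF d(1)]
    have bd: "base_obj F (TDom F d) = Dom E f" using src.Proj_simps(3)[OF d'] d by simp
    obtain cx where cx: "is_cartesian E F cx" "cx \<in> TArr F" "TCod F cx = x" "base_arr F cx = f"
      "base_obj F (TDom F cx) = Dom E f"
      using src.ex_cartesian[of x f] f by auto
    \<comment> \<open>The inverse image of \<open>k\<close> along \<open>f\<close>. That
      \<open>l\<close> is locally inverse to it on the other side means that \<open>l n\<close> and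
      \<open>cx\<close> become equal; after applying \<open>u\<close> they are equal because the
      image of \<open>k\<close> is invertible.\<close>
    obtain n where n: "n \<in> TArr F" "TDom F n = TDom F cx" "TCod F n = TDom F d"
      "base_arr F n = Idt E (Dom E f)" "d \<cdot>\<^bsub>Total F\<^esub> n = k \<cdot>\<^bsub>Total F\<^esub> cx"
      using src.vertical_factor[of "k \<cdot>\<^bsub>Total F\<^esub> cx" d] k cx d f by auto
    have bl: "base_arr F l = f"
    proof -
      have "base_arr F (k \<cdot>\<^bsub>Total F\<^esub> l) = base_arr F l" using k(1-4) l(1-3) src.Proj_simps(4)[OF l(1)] by simp
      then show ?thesis using l(4) d(3) by simp
    qed
    have u: "on_arr u (l \<cdot>\<^bsub>Total F\<^esub> n) = on_arr u cx"
    proof (rule tgt.total.iso_cancel_left[OF uk])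
      have "k \<cdot>\<^bsub>Total F\<^esub> (l \<cdot>\<^bsub>Total F\<^esub> n) = k \<cdot>\<^bsub>Total F\<^esub> cx"
        using src.total.comp_reassoc[OF l(4), of n] n l k(1-4) by simp
      then have "on_arr u (k \<cdot>\<^bsub>Total F\<^esub> (l \<cdot>\<^bsub>Total F\<^esub> n)) = on_arr u (k \<cdot>\<^bsub>Total F\<^esub> cx)" by simp
      then show "on_arr u k \<cdot>\<^bsub>Total G\<^esub> on_arr u (l \<cdot>\<^bsub>Total F\<^esub> n) = on_arr u k \<cdot>\<^bsub>Total G\<^esub> on_arr u cx"
        using n l(1-3) k(1-4) cx by simp
    qed (use n l(1-3) k(1-4) cx in simp_all)
    have loc: "locally E J (Dom E f) (equal_after E F (l \<cdot>\<^bsub>Total F\<^esub> n) cx)"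
      using locally_faithfulD[OF faithful _ _ _ _ _ u] l(1-3) n(1-4) cx bl f by simp
    show "\<exists>R. locally E J (Dom E f) R \<and> (\<forall>h\<in>Arr E. Cod E h = Dom E f \<and> R h \<longrightarrow>
      (\<forall>c. is_cartesian E F c \<and> TCod F c = TDom F a \<and> base_arr F c = f \<cdot>\<^bsub>E\<^esub> h \<longrightarrow>
         is_cartesian E F (a \<cdot>\<^bsub>Total F\<^esub> c)))"
    proof (intro exI[of _ "equal_after E F (l \<cdot>\<^bsub>Total F\<^esub> n) cx"] conjI loc ballI impI allI, elim conjE)
      fix h g assume h: "h \<in> Arr E" "Cod E h = Dom E f" "equal_after E F (l \<cdot>\<^bsub>Total F\<^esub> n) cx h"
        and g: "is_cartesian E F g" "TCod F g = TDom F a" "base_arr F g = f \<cdot>\<^bsub>E\<^esub> h"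
      note g' = src.cartesian_Arr[OF g(1)]
      have bg: "base_obj F (TDom F g) = Dom E h" using src.Proj_simps(3)[OF g'] g f h by simp
      obtain e where e: "e \<in> TArr F" "TDom F e = TDom F g" "TCod F e = TDom F cx"
        "base_arr F e = h" "cx \<cdot>\<^bsub>Total F\<^esub> e = g"
        using src.cartesian_factor[OF cx(1) g', of h] g cx x_def bg h by auto
      have ce: "is_cartesian E F e" by (rule src.cartesian_cancel_left[OF cx(1)]) (use e g in simp_all)
      have lne: "l \<cdot>\<^bsub>Total F\<^esub> (n \<cdot>\<^bsub>Total F\<^esub> e) = g"
        using src.equal_afterD[of "l \<cdot>\<^bsub>Total F\<^esub> n" cx e] h ce e l(1-3) n(1-4) cx by simp
      obtain e2 where e2: "is_cartesian E F e2" "e2 \<in> TArr F" "TCod F e2 = TDom F d"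
        "base_arr F e2 = h" "base_obj F (TDom F e2) = Dom E h"
        using src.ex_cartesian[of "TDom F d" h] h bd d' by auto
      \<comment> \<open>\<open>n'\<close> and the following \<open>m'\<close> are the arrows that
        \<open>n\<close> and \<open>l\<close> induce over \<open>h\<close>. They turn out to be
        mutually inverse, so \<open>n'\<close> is cartesian, and composing with \<open>e2\<close>,
        \<open>d\<close> and \<open>c\<close> shows that \<open>a g\<close> is cartesian.\<close>
      obtain n' where n': "n' \<in> TArr F" "TDom F n' = TDom F g" "TCod F n' = TDom F e2"
        "base_arr F n' = Idt E (Dom E h)" "e2 \<cdot>\<^bsub>Total F\<^esub> n' = n \<cdot>\<^bsub>Total F\<^esub> e"
        using src.vertical_factor[of "n \<cdot>\<^bsub>Total F\<^esub> e" e2] e2 n(1-4) e bg h by auto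
      obtain m' where m': "m' \<in> TArr F" "TDom F m' = TDom F e2" "TCod F m' = TDom F g"
        "base_arr F m' = Idt E (Dom E h)" "g \<cdot>\<^bsub>Total F\<^esub> m' = l \<cdot>\<^bsub>Total F\<^esub> e2"
        using src.vertical_factor[of "l \<cdot>\<^bsub>Total F\<^esub> e2" g] e2 l(1-3) bl g h x_def by auto
      have "m' \<cdot>\<^bsub>Total F\<^esub> n' = TIdt F (TDom F g)"
      proof (rule src.cartesian_cancel[OF g(1)])
        show "g \<cdot>\<^bsub>Total F\<^esub> (m' \<cdot>\<^bsub>Total F\<^esub> n') = g \<cdot>\<^bsub>Total F\<^esub> TIdt F (TDom F g)"
          using src.total.comp_reassoc[OF m'(5), of n'] n' m'(1-4) g' l(1-3) e2 lne by simp
      qed (use m' n' g' bg h in simp_all)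
      moreover have "n' \<cdot>\<^bsub>Total F\<^esub> m' = TIdt F (TDom F e2)"
      proof (rule src.cartesian_cancel[OF e2(1)])
        \<comment> \<open>Composed with the cartesian arrow \<open>d\<close>, both sides become
          \<open>k l e2\<close>.\<close>
        have "n \<cdot>\<^bsub>Total F\<^esub> (e \<cdot>\<^bsub>Total F\<^esub> m') = e2"
        proof (rule src.cartesian_cancel[OF d(1)])
          have "d \<cdot>\<^bsub>Total F\<^esub> (n \<cdot>\<^bsub>Total F\<^esub> (e \<cdot>\<^bsub>Total F\<^esub> m')) = k \<cdot>\<^bsub>Total F\<^esub> (cx \<cdot>\<^bsub>Total F\<^esub> (e \<cdot>\<^bsub>Total F\<^esub> m'))"
            using src.total.comp_reassoc[OF n(5), of "e \<cdot>\<^bsub>Total F\<^esub> m'"] n(1-4) d' e m'(1-4) k(1-4) cx by simp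
          also have "\<dots> = k \<cdot>\<^bsub>Total F\<^esub> (l \<cdot>\<^bsub>Total F\<^esub> e2)"
            using src.total.comp_reassoc[OF e(5), of m'] e m' cx by simp
          also have "\<dots> = d \<cdot>\<^bsub>Total F\<^esub> e2"
            using src.total.comp_reassoc[OF l(4), of e2] e2 l k(1-4) by simp
          finally show "d \<cdot>\<^bsub>Total F\<^esub> (n \<cdot>\<^bsub>Total F\<^esub> (e \<cdot>\<^bsub>Total F\<^esub> m')) = d \<cdot>\<^bsub>Total F\<^esub> e2" .
        qed (use n e m' e2 h in simp_all)
        then show "e2 \<cdot>\<^bsub>Total F\<^esub> (n' \<cdot>\<^bsub>Total F\<^esub> m') = e2 \<cdot>\<^bsub>Total F\<^esub> TIdt F (TDom F e2)"
          using src.total.comp_reassoc[OF n'(5), of m'] n'(1-4) m' e2 n(1-4) e by simp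
      qed (use m' n' e2 h in simp_all)
      ultimately have "is_iso (Total F) n'"
        using n' m' by (intro src.total.is_isoI[of _ m']) simp_all
      then have "is_cartesian E F (e2 \<cdot>\<^bsub>Total F\<^esub> n')"
        by (intro src.cartesian_comp[OF e2(1)] src.iso_cartesian) (use n' in simp_all)
      then have "is_cartesian E F (d \<cdot>\<^bsub>Total F\<^esub> (n \<cdot>\<^bsub>Total F\<^esub> e))"
        unfolding n'(5) by (intro src.cartesian_comp[OF d(1)]) (use n e in simp_all)
      then have "is_cartesian E F (k \<cdot>\<^bsub>Total F\<^esub> g)"
        using src.total.comp_reassoc[OF n(5), of e] n(1-4) e d' k(1-4) cx by simp
      then have "is_cartesian E F (c \<cdot>\<^bsub>Total F\<^esub> (k \<cdot>\<^bsub>Total F\<^esub> g))"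
        by (intro src.cartesian_comp[OF c(1)]) (use k g g' x_def y_def in simp_all)
      then show "is_cartesian E F (a \<cdot>\<^bsub>Total F\<^esub> g)"
        using src.total.comp_reassoc[OF k(5), of g] k(1-4) c y_def g g' x_def by simp
    qed
  qed
  then show ?thesis by (simp add: S_def x_def)
qed

text \<open>Under global hypotheses each local property holds along every arrow, so the maximal
  sieve serves as covering. Surjectivity on objects is meant strictly, as it holds for isomorphisms
  and for the source functor of paths.\<close>

lemma bicovering_of_equivalence:
  assumes faithful: "\<And>a b. \<lbrakk>a \<in> TArr F; b \<in> TArr F; TDom F a = TDom F b; TCod F a = TCod F b;
      base_arr F a = base_arr F b; on_arr u a = on_arr u b\<rbrakk> \<Longrightarrow> a = b"
    and full: "\<And>x x' w. \<lbrakk>x \<in> TObj F; x' \<in> TObj F; w \<in> TArr G; TDom G w = on_obj u x;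
      TCod G w = on_obj u x'\<rbrakk> \<Longrightarrow> \<exists>a\<in>TArr F. TDom F a = x \<and> TCod F a = x' \<and> on_arr u a = w"
    and surj: "\<And>y. y \<in> TObj G \<Longrightarrow> \<exists>x\<in>TObj F. on_obj u x = y"
  shows "is_bicovering E J F G u"
  unfolding is_bicovering_iff
proof (intro conjI)
  show "locally_faithful E J F u"
    unfolding locally_faithful_def
  proof (intro ballI impI, elim conjE)
    fix a b assume ab: "a \<in> TArr F" "b \<in> TArr F" "TDom F a = TDom F b" "TCod F a = TCod F b"
      "base_arr F a = base_arr F b" "on_arr u a = on_arr u b"
    then have "a = b" by (rule faithful)
    show "locally E J (base_obj F (TDom F a)) (equal_after E F a b)"
    proof (rule locally_all)
      fix f assume "f \<in> Arr E" "Cod E f = base_obj F (TDom F a)"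
      then obtain c where "is_cartesian E F c" "TCod F c = TDom F a" "base_arr F c = f"
        using src.ex_cartesian[of "TDom F a" f] ab(1) by auto
      then show "equal_after E F a b f"
        using \<open>a = b\<close> by (intro src.equal_afterI[of c]) simp_all
    qed (use ab in simp)
  qed
  show "locally_full E J F G u"
    unfolding locally_full_def
  proof (intro ballI locally_all)
    fix x x' w f assume x: "x \<in> TObj F" "x' \<in> TObj F" and "w \<in> hom (Total G) (on_obj u x) (on_obj u x')"
      and f: "f \<in> Arr E" "Cod E f = base_obj F x"
    then obtain a where a: "a \<in> TArr F" "TDom F a = x" "TCod F a = x'" "on_arr u a = w"
      using full[of x x' w] by (auto simp: hom_def)
    obtain c where c: "is_cartesian E F c" "c \<in> TArr F" "TCod F c = x" "base_arr F c = f"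
      using src.ex_cartesian[of x f] f x by auto
    show "lifts_after E F G u x x' w f"
      by (rule lifts_afterI[of c _ _ "a \<cdot>\<^bsub>Total F\<^esub> c"]) (use a c in auto)
  qed simp
  show "locally_essentially_surjective E J F G u"
    unfolding locally_essentially_surjective_def
  proof (intro ballI locally_all)
    fix y f assume y: "y \<in> TObj G" "f \<in> Arr E" "Cod E f = base_obj G y"
    then obtain c where c: "is_cartesian E G c" "c \<in> TArr G" "TCod G c = y" "base_arr G c = f"
      using tgt.ex_cartesian[of y f] by auto
    then obtain x where "x \<in> TObj F" "on_obj u x = TDom G c" using surj[of "TDom G c"] by auto
    with c show "reached_along E F G u y f" by (intro reached_alongI[of x c]) auto
  qed simp
qed

end

text \<open>Only agreement with the composite on the carriers is demanded of \<open>w\<close>. This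
  admits the composites of \<open>Fib E\<close>, which are restricted to the carriers, and allows
  functor data to be exchanged for data with the same values there.\<close>

locale functor_triangle =
  U: site_functor E J F G u + V: site_functor E J G H v + W: site_functor E J F H w
  for E :: "('o, 'm) precategory" and J and F :: "('o, 'm, 'x, 'y) fibration"
    and G :: "('o, 'm, 'v, 'w) fibration" and H :: "('o, 'm, 'p, 'q) fibration" and u v w +
  assumes on_obj_comp [simp]: "x \<in> TObj F \<Longrightarrow> on_obj w x = on_obj v (on_obj u x)"
    and on_arr_comp [simp]: "a \<in> TArr F \<Longrightarrow> on_arr w a = on_arr v (on_arr u a)"
begin

text \<open>Faithfulness of \<open>v\<close> makes the images under \<open>u\<close> agree after a
  cartesian \<open>c\<close>, and faithfulness of \<open>u\<close> is then applied to the composites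
  of \<open>a\<close> and \<open>b\<close> with \<open>c\<close>.\<close>

lemma comp_faithful:
  assumes "locally_faithful E J F u" "locally_faithful E J G v"
  shows "locally_faithful E J F w"
  unfolding locally_faithful_def
proof (intro ballI impI, elim conjE)
  fix a b assume ab: "a \<in> TArr F" "b \<in> TArr F" "TDom F a = TDom F b" "TCod F a = TCod F b"
    "base_arr F a = base_arr F b" "on_arr w a = on_arr w b"
  then have "locally E J (base_obj G (TDom G (on_arr u a))) (equal_after E G (on_arr u a) (on_arr u b))"
    by (intro locally_faithfulD[OF assms(2)]) simp_all
  then have "locally E J (base_obj F (TDom F a)) (equal_after E G (on_arr u a) (on_arr u b))"
    using ab by simp
  then show "locally E J (base_obj F (TDom F a)) (equal_after E F a b)"
  proof (rule U.locally_bind[rotated])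
    fix f assume f: "f \<in> Arr E" "Cod E f = base_obj F (TDom F a)"
      "equal_after E G (on_arr u a) (on_arr u b) f"
    obtain c where c: "is_cartesian E F c" "c \<in> TArr F" "TCod F c = TDom F a" "base_arr F c = f"
      "base_obj F (TDom F c) = Dom E f"
      using U.src.ex_cartesian[of "TDom F a" f] f ab by auto
    have "on_arr u a \<cdot>\<^bsub>Total G\<^esub> on_arr u c = on_arr u b \<cdot>\<^bsub>Total G\<^esub> on_arr u c"
      using f c ab U.cartesian_Fun[OF c(1)] by (intro U.tgt.equal_afterD) simp_all
    then have loc: "locally E J (Dom E f) (equal_after E F (a \<cdot>\<^bsub>Total F\<^esub> c) (b \<cdot>\<^bsub>Total F\<^esub> c))"
      using locally_faithfulD[OF assms(1), of "a \<cdot>\<^bsub>Total F\<^esub> c" "b \<cdot>\<^bsub>Total F\<^esub> c"] ab c by simp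
    have "equal_after E F a b (f \<cdot>\<^bsub>E\<^esub> h)" if "equal_after E F (a \<cdot>\<^bsub>Total F\<^esub> c) (b \<cdot>\<^bsub>Total F\<^esub> c) h" for h
    proof -
      obtain d where d: "is_cartesian E F d" "TCod F d = TDom F c" "base_arr F d = h"
        "(a \<cdot>\<^bsub>Total F\<^esub> c) \<cdot>\<^bsub>Total F\<^esub> d = (b \<cdot>\<^bsub>Total F\<^esub> c) \<cdot>\<^bsub>Total F\<^esub> d"
        using \<open>equal_after E F _ _ h\<close> ab c by (auto simp: equal_after_def)
      then show ?thesis
        using U.src.cartesian_comp[OF c(1) d(1)] U.src.cartesian_Arr[OF d(1)] ab c
        by (intro U.src.equal_afterI[of "c \<cdot>\<^bsub>Total F\<^esub> d"]) simp_all
    qed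
    with loc show "\<exists>R. locally E J (Dom E f) R \<and>
        (\<forall>h\<in>Arr E. Cod E h = Dom E f \<and> R h \<longrightarrow> equal_after E F a b (f \<cdot>\<^bsub>E\<^esub> h))"
      by blast
  qed (use ab U.src.precomp_closed_equal_after in auto)
qed

text \<open>An arrow is lifted through \<open>v\<close> on a covering and the result through
  \<open>u\<close> on a second one; the cartesian arrows used for the two liftings compose.\<close>

lemma comp_full:
  assumes "locally_full E J F G u" "locally_full E J G H v"
  shows "locally_full E J F H w"
  unfolding locally_full_def
proof (intro ballI)
  fix x x' k assume x: "x \<in> TObj F" "x' \<in> TObj F" and "k \<in> hom (Total H) (on_obj w x) (on_obj w x')"
  then have k: "k \<in> TArr H" "TDom H k = on_obj v (on_obj u x)" "TCod H k = on_obj v (on_obj u x')"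
    by (auto simp: hom_def)
  have "locally E J (base_obj F x) (lifts_after E G H v (on_obj u x) (on_obj u x') k)"
    using locally_fullD[OF assms(2) _ _ k] x by simp
  then show "locally E J (base_obj F x) (lifts_after E F H w x x' k)"
  proof (rule U.locally_bind[rotated])
    show "precomp_closed E (base_obj F x) (lifts_after E F H w x x' k)"
      using W.precomp_closed_lifts_after k x by simp
    fix f assume f: "f \<in> Arr E" "Cod E f = base_obj F x"
      "lifts_after E G H v (on_obj u x) (on_obj u x') k f"
    obtain c where c: "is_cartesian E F c" "c \<in> TArr F" "TCod F c = x" "base_arr F c = f"
      "base_obj F (TDom F c) = Dom E f"
      using U.src.ex_cartesian[of x f] f x by auto
    have l: "lifts_after E G H v (on_obj u x) (on_obj u x') k (base_arr G (on_arr u c))" using f c by simp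
    obtain a where a: "a \<in> TArr G" "TDom G a = on_obj u (TDom F c)" "TCod G a = on_obj u x'"
      "on_arr v a = k \<cdot>\<^bsub>Total H\<^esub> on_arr v (on_arr u c)"
      by (rule V.lifts_afterE[OF l U.cartesian_Fun[OF c(1)]]) (use c k in simp_all)
    have loc: "locally E J (Dom E f) (lifts_after E F G u (TDom F c) x' a)"
      using locally_fullD[OF assms(1) _ x(2) a(1-3)] c by simp
    have "lifts_after E F H w x x' k (f \<cdot>\<^bsub>E\<^esub> h)" if "lifts_after E F G u (TDom F c) x' a h" for h
    proof -
      obtain d e where d: "is_cartesian E F d" "TCod F d = TDom F c" "base_arr F d = h"
        "e \<in> TArr F" "TDom F e = TDom F d" "TCod F e = x'" "on_arr u e = a \<cdot>\<^bsub>Total G\<^esub> on_arr u d"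
        using \<open>lifts_after _ _ _ _ _ _ _ h\<close> by (auto simp: lifts_after_def)
      note d' = U.src.cartesian_Arr[OF d(1)]
      show ?thesis
        by (rule W.lifts_afterI[of "c \<cdot>\<^bsub>Total F\<^esub> d" _ _ e])
          (use d d' c a k x U.src.cartesian_comp[OF c(1) d(1)] in simp_all)
    qed
    with loc show "\<exists>R. locally E J (Dom E f) R \<and>
        (\<forall>h\<in>Arr E. Cod E h = Dom E f \<and> R h \<longrightarrow> lifts_after E F H w x x' k (f \<cdot>\<^bsub>E\<^esub> h))"
      by blast
  qed (use x in simp)
qed

lemma comp_essentially_surjective:
  assumes "locally_essentially_surjective E J F G u" "locally_essentially_surjective E J G H v"
  shows "locally_essentially_surjective E J F H w"
  unfolding locally_essentially_surjective_def
proof (intro ballI)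
  fix z assume z: "z \<in> TObj H"
  show "locally E J (base_obj H z) (reached_along E F H w z)"
  proof (rule U.locally_bind[OF _ locally_essentially_surjectiveD[OF assms(2) z] W.precomp_closed_reached_along])
    fix f assume f: "f \<in> Arr E" "reached_along E G H v z f"
    obtain y d where d: "y \<in> TObj G" "is_cartesian E H d" "d \<in> TArr H" "TDom H d = on_obj v y"
      "TCod H d = z" "base_arr H d = f" "base_obj G y = Dom E f"
      using V.reached_alongE[OF f(2)] .
    have "reached_along E F H w z (f \<cdot>\<^bsub>E\<^esub> h)" if hh: "reached_along E F G u y h" for h
    proof -
      obtain x e where e: "x \<in> TObj F" "is_cartesian E G e" "e \<in> TArr G" "TDom G e = on_obj u x"
        "TCod G e = y" "base_arr G e = h"
        using U.reached_alongE[OF hh] .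
      show ?thesis
        using e d V.tgt.cartesian_comp[OF d(2) V.cartesian_Fun[OF e(2)]]
        by (intro W.reached_alongI[of x "d \<cdot>\<^bsub>Total H\<^esub> on_arr v e"]) simp_all
    qed
    then show "\<exists>R. locally E J (Dom E f) R \<and>
        (\<forall>h\<in>Arr E. Cod E h = Dom E f \<and> R h \<longrightarrow> reached_along E F H w z (f \<cdot>\<^bsub>E\<^esub> h))"
      using locally_essentially_surjectiveD[OF assms(1) d(1)] d(7) by auto
  qed (use z in simp)
qed

lemma cancel_left_faithful:
  assumes "locally_faithful E J F w"
  shows "locally_faithful E J F u"
  using assms unfolding locally_faithful_def by auto

text \<open>The image of \<open>k\<close> under \<open>v\<close> is lifted through \<open>w\<close>.
  The image of this lift under \<open>u\<close> and the restriction of \<open>k\<close> agree after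
  \<open>v\<close>, hence locally, since \<open>v\<close> is locally faithful.\<close>

lemma cancel_left_full:
  assumes "locally_faithful E J G v" "locally_full E J F H w"
  shows "locally_full E J F G u"
  unfolding locally_full_def
proof (intro ballI)
  fix x x' k assume x: "x \<in> TObj F" "x' \<in> TObj F" and "k \<in> hom (Total G) (on_obj u x) (on_obj u x')"
  then have k: "k \<in> TArr G" "TDom G k = on_obj u x" "TCod G k = on_obj u x'"
    by (auto simp: hom_def)
  have "locally E J (base_obj F x) (lifts_after E F H w x x' (on_arr v k))"
    using locally_fullD[OF assms(2) x, of "on_arr v k"] x k by simp
  then show "locally E J (base_obj F x) (lifts_after E F G u x x' k)"
  proof (rule U.locally_bind[rotated])
    show "precomp_closed E (base_obj F x) (lifts_after E F G u x x' k)"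
      using U.precomp_closed_lifts_after k x by simp
    fix f assume f: "f \<in> Arr E" "Cod E f = base_obj F x" "lifts_after E F H w x x' (on_arr v k) f"
    then obtain c a where c: "is_cartesian E F c" "TCod F c = x" "base_arr F c = f"
      and a: "a \<in> TArr F" "TDom F a = TDom F c" "TCod F a = x'"
      "on_arr w a = on_arr v k \<cdot>\<^bsub>Total H\<^esub> on_arr w c"
      by (auto simp: lifts_after_def)
    note c' = U.src.cartesian_Arr[OF c(1)]
    have bc: "base_obj F (TDom F c) = Dom E f" using U.src.Proj_simps(3)[OF c'] c by simp
    have eq: "on_arr v (on_arr u a) = on_arr v (k \<cdot>\<^bsub>Total G\<^esub> on_arr u c)"
      using a c c' k by simp
    have "base_arr G (on_arr u a) = base_arr G (k \<cdot>\<^bsub>Total G\<^esub> on_arr u c)"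
      using arg_cong[OF eq, of "base_arr H"] a c c' k by simp
    then have loc: "locally E J (Dom E f) (equal_after E G (on_arr u a) (k \<cdot>\<^bsub>Total G\<^esub> on_arr u c))"
      using locally_faithfulD[OF assms(1) _ _ _ _ _ eq] a c c' k bc by simp
    have "lifts_after E F G u x x' k (f \<cdot>\<^bsub>E\<^esub> h)"
      if h: "h \<in> Arr E" "Cod E h = Dom E f" "equal_after E G (on_arr u a) (k \<cdot>\<^bsub>Total G\<^esub> on_arr u c) h" for h
    proof -
      obtain d where d: "is_cartesian E F d" "d \<in> TArr F" "TCod F d = TDom F c" "base_arr F d = h"
        using U.src.ex_cartesian[of "TDom F c" h] h c' bc by auto
      have "on_arr u a \<cdot>\<^bsub>Total G\<^esub> on_arr u d = (k \<cdot>\<^bsub>Total G\<^esub> on_arr u c) \<cdot>\<^bsub>Total G\<^esub> on_arr u d"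
        using h d a c c' k U.cartesian_Fun[OF d(1)] by (intro U.tgt.equal_afterD) simp_all
      then show ?thesis
        by (intro U.lifts_afterI[of "c \<cdot>\<^bsub>Total F\<^esub> d" _ _ "a \<cdot>\<^bsub>Total F\<^esub> d"])
          (use d c c' a(1-3) k U.src.cartesian_comp[OF c(1) d(1)] in simp_all)
    qed
    with loc show "\<exists>R. locally E J (Dom E f) R \<and>
        (\<forall>h\<in>Arr E. Cod E h = Dom E f \<and> R h \<longrightarrow> lifts_after E F G u x x' k (f \<cdot>\<^bsub>E\<^esub> h))"
      by blast
  qed (use x in simp)
qed

text \<open>A cartesian arrow that reaches the image of \<open>y\<close> from an object in the image
  of \<open>w\<close> lifts locally through \<open>v\<close> to an arrow into \<open>y\<close>.
  Lifting does not preserve cartesianness by itself; \<open>locally_cartesian\<close> supplies it on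
  a third refinement.\<close>

lemma cancel_left_essentially_surjective:
  assumes v: "locally_faithful E J G v" "locally_full E J G H v"
    and w: "locally_essentially_surjective E J F H w"
  shows "locally_essentially_surjective E J F G u"
  unfolding locally_essentially_surjective_def
proof (intro ballI)
  fix y assume y: "y \<in> TObj G"
  have "locally E J (base_obj H (on_obj v y)) (reached_along E F H w (on_obj v y))"
    using locally_essentially_surjectiveD[OF w, of "on_obj v y"] y by simp
  then have "locally E J (base_obj G y) (reached_along E F H w (on_obj v y))" using y by simp
  then show "locally E J (base_obj G y) (reached_along E F G u y)"
  proof (rule U.locally_bind[OF _ _ U.precomp_closed_reached_along, rotated])
    fix f assume f: "f \<in> Arr E" "Cod E f = base_obj G y" "reached_along E F H w (on_obj v y) f"
    obtain x e where "x \<in> TObj F" "is_cartesian E H e" "e \<in> TArr H"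
      "TDom H e = on_obj w x" "TCod H e = on_obj v y" "base_arr H e = f" "base_obj F x = Dom E f"
      using W.reached_alongE[OF f(3)] .
    then have e: "x \<in> TObj F" "is_cartesian E H e" "e \<in> TArr H"
      "TDom H e = on_obj v (on_obj u x)" "TCod H e = on_obj v y" "base_arr H e = f" "base_obj F x = Dom E f"
      by simp_all
    have "locally E J (Dom E f) (\<lambda>h. reached_along E F G u y (f \<cdot>\<^bsub>E\<^esub> h))"
    proof (rule U.locally_bind)
      show "locally E J (Dom E f) (lifts_after E G H v (on_obj u x) y e)"
        using locally_fullD[OF v(2) _ y e(3-5)] e by simp
      show "precomp_closed E (Dom E f) (\<lambda>h. reached_along E F G u y (f \<cdot>\<^bsub>E\<^esub> h))"
        using U.stable_pull[of f] U.precomp_closed_reached_along[of y] f by simp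
      fix g assume g: "g \<in> Arr E" "Cod E g = Dom E f" "lifts_after E G H v (on_obj u x) y e g"
      obtain c where c: "is_cartesian E F c" "c \<in> TArr F" "TCod F c = x" "base_arr F c = g"
        "base_obj F (TDom F c) = Dom E g"
        using U.src.ex_cartesian[of x g] g e by auto
      have l: "lifts_after E G H v (on_obj u x) y e (base_arr G (on_arr u c))" using g c by simp
      obtain a where a: "a \<in> TArr G" "TDom G a = on_obj u (TDom F c)" "TCod G a = y"
        "on_arr v a = e \<cdot>\<^bsub>Total H\<^esub> on_arr v (on_arr u c)"
        by (rule V.lifts_afterE[OF l U.cartesian_Fun[OF c(1)]]) (use c e in simp_all)
      have "is_cartesian E H (on_arr v a)"
        unfolding a(4)
        by (rule V.tgt.cartesian_comp[OF e(2) V.cartesian_Fun[OF U.cartesian_Fun[OF c(1)]]]) (use c e in simp)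
      from V.locally_cartesian[OF v a(1) this]
      have loc: "locally E J (Dom E g) (\<lambda>h. \<forall>c. is_cartesian E G c \<and> TCod G c = TDom G a \<and> base_arr G c = h \<longrightarrow>
          is_cartesian E G (a \<cdot>\<^bsub>Total G\<^esub> c))"
        using a c by simp
      have ba: "base_arr G a = f \<cdot>\<^bsub>E\<^esub> g"
        using arg_cong[OF a(4), of "base_arr H"] a(1) e c by simp
      have "reached_along E F G u y (f \<cdot>\<^bsub>E\<^esub> (g \<cdot>\<^bsub>E\<^esub> h))"
        if h: "h \<in> Arr E" "Cod E h = Dom E g" "\<forall>c. is_cartesian E G c \<and> TCod G c = TDom G a \<and> base_arr G c = h \<longrightarrow>
          is_cartesian E G (a \<cdot>\<^bsub>Total G\<^esub> c)" for h
      proof -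
        obtain d where d: "is_cartesian E F d" "d \<in> TArr F" "TCod F d = TDom F c" "base_arr F d = h"
          using U.src.ex_cartesian[of "TDom F c" h] h c by auto
        have "is_cartesian E G (a \<cdot>\<^bsub>Total G\<^esub> on_arr u d)"
          using h(3) d U.cartesian_Fun[OF d(1)] a by simp
        then show ?thesis
          by (intro U.reached_alongI[of "TDom F d" "a \<cdot>\<^bsub>Total G\<^esub> on_arr u d"])
            (use d(1-4) a ba f(1,2) g(1,2) h(1,2) in simp_all)
      qed
      with loc show "\<exists>R. locally E J (Dom E g) R \<and>
        (\<forall>h\<in>Arr E. Cod E h = Dom E g \<and> R h \<longrightarrow> reached_along E F G u y (f \<cdot>\<^bsub>E\<^esub> (g \<cdot>\<^bsub>E\<^esub> h)))"
        by blast
    qed (use f in simp)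
    then show "\<exists>R. locally E J (Dom E f) R \<and>
        (\<forall>h\<in>Arr E. Cod E h = Dom E f \<and> R h \<longrightarrow> reached_along E F G u y (f \<cdot>\<^bsub>E\<^esub> h))"
      by blast
  qed (use y in simp)
qed

text \<open>Arrows of \<open>G\<close> have to be transported to \<open>F\<close> first: locally
  their ends are in the image of \<open>u\<close> up to inverse image, and then, by fullness, so are
  the arrows. There the faithfulness of \<open>w\<close> applies.\<close>

lemma cancel_right_faithful:
  assumes u: "locally_full E J F G u" "locally_essentially_surjective E J F G u"
    and w: "locally_faithful E J F w"
  shows "locally_faithful E J G v"
  unfolding locally_faithful_def
proof (intro ballI impI, elim conjE)
  fix a b assume ab: "a \<in> TArr G" "b \<in> TArr G" "TDom G a = TDom G b" "TCod G a = TCod G b"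
    "base_arr G a = base_arr G b" "on_arr v a = on_arr v b"
  define y where "y = TDom G a"
  define S where "S = base_obj G y"
  have S [simp]: "S \<in> Obj E" "y \<in> TObj G" "base_obj G y = S" using ab by (auto simp: S_def y_def)
  obtain c where c: "is_cartesian E G c" "c \<in> TArr G" "TCod G c = TCod G a"
    "base_arr G c = base_arr G a" "base_obj G (TDom G c) = S"
    using U.tgt.ex_cartesian[of "TCod G a" "base_arr G a"] ab S_def y_def by auto
  define y' where "y' = TDom G c"
  have y' [simp]: "y' \<in> TObj G" "base_obj G y' = S" using c by (auto simp: y'_def)
  obtain a' where a': "a' \<in> TArr G" "TDom G a' = y" "TCod G a' = y'" "base_arr G a' = Idt E S"
    "c \<cdot>\<^bsub>Total G\<^esub> a' = a"
    using U.tgt.vertical_factor[OF ab(1) c(1,3,4)] by (metis S_def y_def y'_def)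
  obtain b' where b': "b' \<in> TArr G" "TDom G b' = y" "TCod G b' = y'" "base_arr G b' = Idt E S"
    "c \<cdot>\<^bsub>Total G\<^esub> b' = b"
    using U.tgt.vertical_factor[OF ab(2) c(1)] c(3,4) ab(3-5) by (metis S_def y_def y'_def)
  have vab: "on_arr v a' = on_arr v b'"
  proof (rule V.tgt.cartesian_cancel[OF V.cartesian_Fun[OF c(1)]])
    show "on_arr v c \<cdot>\<^bsub>Total H\<^esub> on_arr v a' = on_arr v c \<cdot>\<^bsub>Total H\<^esub> on_arr v b'"
      using ab(6) a' b' c(2) y'_def V.Fun_simps(6)[of a' c] V.Fun_simps(6)[of b' c] by simp
  qed (use a' b' c y'_def in simp_all)
  have closed: "precomp_closed E S (equal_after E G a b)"
    using U.tgt.precomp_closed_equal_after[of a b] ab S_def y_def by simp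
  \<comment> \<open>One arrow \<open>f\<close> has to reach both ends, which is possible because
    \<open>y\<close> and \<open>y'\<close> lie over the same object; the factorization of
    \<open>a\<close> and \<open>b\<close> through \<open>c\<close> was made for this.\<close>
  have "locally E J S (\<lambda>f. reached_along E F G u y f \<and> reached_along E F G u y' f)"
    using locally_essentially_surjectiveD[OF u(2) S(2)] locally_essentially_surjectiveD[OF u(2) y'(1)]
    by (intro U.locally_conj) simp_all
  then have "locally E J S (equal_after E G a b)"
  proof (rule U.locally_bind[OF S(1) _ closed])
    fix f assume f: "f \<in> Arr E" "Cod E f = S"
      "reached_along E F G u y f \<and> reached_along E F G u y' f"
    obtain x d where d: "x \<in> TObj F" "is_cartesian E G d" "d \<in> TArr G" "TDom G d = on_obj u x"
      "TCod G d = y" "base_arr G d = f" "base_obj F x = Dom E f"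
      using U.reached_alongE[OF conjunct1[OF f(3)]] .
    obtain x' d' where d': "x' \<in> TObj F" "is_cartesian E G d'" "d' \<in> TArr G" "TDom G d' = on_obj u x'"
      "TCod G d' = y'" "base_arr G d' = f" "base_obj F x' = Dom E f"
      using U.reached_alongE[OF conjunct2[OF f(3)]] .
    \<comment> \<open>The inverse images of \<open>a'\<close> and, next, of \<open>b'\<close> along
      \<open>f\<close>, formed with \<open>d\<close> and \<open>d'\<close> so that they run between
      objects in the image of \<open>u\<close>.\<close>
    obtain a2 where a2: "a2 \<in> TArr G" "TDom G a2 = on_obj u x" "TCod G a2 = on_obj u x'"
      "base_arr G a2 = Idt E (Dom E f)" "d' \<cdot>\<^bsub>Total G\<^esub> a2 = a' \<cdot>\<^bsub>Total G\<^esub> d"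
      using U.tgt.vertical_factor[of "a' \<cdot>\<^bsub>Total G\<^esub> d" d'] a' d d' f by auto
    obtain b2 where b2: "b2 \<in> TArr G" "TDom G b2 = on_obj u x" "TCod G b2 = on_obj u x'"
      "base_arr G b2 = Idt E (Dom E f)" "d' \<cdot>\<^bsub>Total G\<^esub> b2 = b' \<cdot>\<^bsub>Total G\<^esub> d"
      using U.tgt.vertical_factor[of "b' \<cdot>\<^bsub>Total G\<^esub> d" d'] b' d d' f by auto
    have v2: "on_arr v a2 = on_arr v b2"
    proof (rule V.tgt.cartesian_cancel[OF V.cartesian_Fun[OF d'(2)]])
      show "on_arr v d' \<cdot>\<^bsub>Total H\<^esub> on_arr v a2 = on_arr v d' \<cdot>\<^bsub>Total H\<^esub> on_arr v b2"
        using vab a2 b2 a' b' d d' V.Fun_simps(6)[of a2 d'] V.Fun_simps(6)[of b2 d'] by simp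
    qed (use a2 b2 d' d in simp_all)
    have "locally E J (Dom E f) (\<lambda>h. equal_after E G a b (f \<cdot>\<^bsub>E\<^esub> h))"
    proof (rule U.locally_bind)
      show "locally E J (Dom E f) (\<lambda>g. lifts_after E F G u x x' a2 g \<and> lifts_after E F G u x x' b2 g)"
        using locally_fullD[OF u(1) d(1) d'(1) a2(1-3)] locally_fullD[OF u(1) d(1) d'(1) b2(1-3)] d f
        by (intro U.locally_conj) simp_all
      show "precomp_closed E (Dom E f) (\<lambda>h. equal_after E G a b (f \<cdot>\<^bsub>E\<^esub> h))"
        using U.stable_pull[of f] closed f by simp
      fix g assume g: "g \<in> Arr E" "Cod E g = Dom E f"
        "lifts_after E F G u x x' a2 g \<and> lifts_after E F G u x x' b2 g"
      obtain e where e: "is_cartesian E F e" "e \<in> TArr F" "TCod F e = x" "base_arr F e = g"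
        "base_obj F (TDom F e) = Dom E g"
        using U.src.ex_cartesian[of x g] g d by auto
      obtain \<alpha> where \<alpha>: "\<alpha> \<in> TArr F" "TDom F \<alpha> = TDom F e" "TCod F \<alpha> = x'"
        "on_arr u \<alpha> = a2 \<cdot>\<^bsub>Total G\<^esub> on_arr u e"
        by (rule U.lifts_afterE[of x x' a2 e]) (use g e a2 in simp_all)
      obtain \<beta> where \<beta>: "\<beta> \<in> TArr F" "TDom F \<beta> = TDom F e" "TCod F \<beta> = x'"
        "on_arr u \<beta> = b2 \<cdot>\<^bsub>Total G\<^esub> on_arr u e"
        by (rule U.lifts_afterE[of x x' b2 e]) (use g e b2 in simp_all)
      have w\<alpha>\<beta>: "on_arr w \<alpha> = on_arr w \<beta>" using \<alpha> \<beta> v2 a2 b2 e by simp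
      have "base_arr F \<alpha> = base_arr F \<beta>"
        using W.base_Fun(2)[OF \<alpha>(1)] W.base_Fun(2)[OF \<beta>(1)] w\<alpha>\<beta> by metis
      then have loc: "locally E J (Dom E g) (equal_after E F \<alpha> \<beta>)"
        using locally_faithfulD[OF w _ _ _ _ _ w\<alpha>\<beta>] \<alpha> \<beta> e by simp
      have "equal_after E G a b (f \<cdot>\<^bsub>E\<^esub> (g \<cdot>\<^bsub>E\<^esub> h))" if h: "equal_after E F \<alpha> \<beta> h" "h \<in> Arr E" "Cod E h = Dom E g" for h
      proof -
        obtain i where i: "is_cartesian E F i" "TCod F i = TDom F e" "base_arr F i = h"
          "\<alpha> \<cdot>\<^bsub>Total F\<^esub> i = \<beta> \<cdot>\<^bsub>Total F\<^esub> i"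
          using h \<alpha> by (auto simp: equal_after_def)
        note i' = U.src.cartesian_Arr[OF i(1)]
        define t where "t = on_arr u (e \<cdot>\<^bsub>Total F\<^esub> i)"
        have t: "is_cartesian E G t" "t \<in> TArr G" "TCod G t = on_obj u x" "base_arr G t = g \<cdot>\<^bsub>E\<^esub> h"
          unfolding t_def using U.cartesian_Fun[OF U.src.cartesian_comp[OF e(1) i(1)]] e i i' by simp_all
        have "a2 \<cdot>\<^bsub>Total G\<^esub> t = on_arr u (\<alpha> \<cdot>\<^bsub>Total F\<^esub> i)" "b2 \<cdot>\<^bsub>Total G\<^esub> t = on_arr u (\<beta> \<cdot>\<^bsub>Total F\<^esub> i)"
          using \<alpha> \<beta> a2 b2 e i(1-3) i' by (simp_all add: t_def)
        then have "d' \<cdot>\<^bsub>Total G\<^esub> (a2 \<cdot>\<^bsub>Total G\<^esub> t) = d' \<cdot>\<^bsub>Total G\<^esub> (b2 \<cdot>\<^bsub>Total G\<^esub> t)" using i(4) by simp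
        then have "a' \<cdot>\<^bsub>Total G\<^esub> (d \<cdot>\<^bsub>Total G\<^esub> t) = b' \<cdot>\<^bsub>Total G\<^esub> (d \<cdot>\<^bsub>Total G\<^esub> t)"
          using U.tgt.total.comp_reassoc[OF a2(5), of t] U.tgt.total.comp_reassoc[OF b2(5), of t]
            a2(1-4) b2(1-4) t d d' a' b' by simp
        then have "c \<cdot>\<^bsub>Total G\<^esub> (a' \<cdot>\<^bsub>Total G\<^esub> (d \<cdot>\<^bsub>Total G\<^esub> t)) = c \<cdot>\<^bsub>Total G\<^esub> (b' \<cdot>\<^bsub>Total G\<^esub> (d \<cdot>\<^bsub>Total G\<^esub> t))" by simp
        then have "a \<cdot>\<^bsub>Total G\<^esub> (d \<cdot>\<^bsub>Total G\<^esub> t) = b \<cdot>\<^bsub>Total G\<^esub> (d \<cdot>\<^bsub>Total G\<^esub> t)"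
          using U.tgt.total.comp_reassoc[OF a'(5), of "d \<cdot>\<^bsub>Total G\<^esub> t"]
            U.tgt.total.comp_reassoc[OF b'(5), of "d \<cdot>\<^bsub>Total G\<^esub> t"] a'(1-4) b'(1-4) t d c y'_def by simp
        moreover have "is_cartesian E G (d \<cdot>\<^bsub>Total G\<^esub> t)"
          by (rule U.tgt.cartesian_comp) (use d t in simp_all)
        ultimately show ?thesis
          by (intro U.tgt.equal_afterI[of "d \<cdot>\<^bsub>Total G\<^esub> t"]) (use d t y_def in simp_all)
      qed
      with loc show "\<exists>R. locally E J (Dom E g) R \<and>
        (\<forall>h\<in>Arr E. Cod E h = Dom E g \<and> R h \<longrightarrow> equal_after E G a b (f \<cdot>\<^bsub>E\<^esub> (g \<cdot>\<^bsub>E\<^esub> h)))"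
        by blast
    qed (use f in simp)
    then show "\<exists>R. locally E J (Dom E f) R \<and>
        (\<forall>h\<in>Arr E. Cod E h = Dom E f \<and> R h \<longrightarrow> equal_after E G a b (f \<cdot>\<^bsub>E\<^esub> h))"
      by blast
  qed
  then show "locally E J (base_obj G (TDom G a)) (equal_after E G a b)" by (simp add: S_def y_def)
qed

text \<open>Both ends of the vertical part of \<open>k\<close> are locally reached from
  \<open>F\<close>. The arrow it induces between the images of the reached objects lifts through
  \<open>w\<close>, and \<open>u\<close> of the lift is composed back with the cartesian arrows
  \<open>d'\<close> and \<open>c\<close>.\<close>

lemma cancel_right_full:
  assumes u: "locally_essentially_surjective E J F G u" and w: "locally_full E J F H w"
  shows "locally_full E J G H v"
  unfolding locally_full_def
proof (intro ballI)
  fix y z k assume y: "y \<in> TObj G" and z: "z \<in> TObj G" and "k \<in> hom (Total H) (on_obj v y) (on_obj v z)"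
  then have k: "k \<in> TArr H" "TDom H k = on_obj v y" "TCod H k = on_obj v z"
    by (auto simp: hom_def)
  define S where "S = base_obj G y"
  have S [simp]: "S \<in> Obj E" "base_obj G y = S" using y by (auto simp: S_def)
  have bk: "base_arr H k \<in> Arr E" "Dom E (base_arr H k) = S" "Cod E (base_arr H k) = base_obj G z"
    using k y z S by simp_all
  obtain c where c: "is_cartesian E G c" "c \<in> TArr G" "TCod G c = z"
    "base_arr G c = base_arr H k" "base_obj G (TDom G c) = S"
    using U.tgt.ex_cartesian[of z "base_arr H k"] z bk by metis
  define y' where "y' = TDom G c"
  have y' [simp]: "y' \<in> TObj G" "base_obj G y' = S" using c by (auto simp: y'_def)
  obtain k1 where k1: "k1 \<in> TArr H" "TDom H k1 = on_obj v y" "TCod H k1 = on_obj v y'"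
    "base_arr H k1 = Idt E S" "on_arr v c \<cdot>\<^bsub>Total H\<^esub> k1 = k"
    using V.tgt.vertical_factor[OF k(1) V.cartesian_Fun[OF c(1)]] c k y y'_def by auto
  have closed: "precomp_closed E S (lifts_after E G H v y z k)"
    using V.precomp_closed_lifts_after[OF k(1,2)] by simp
  have "locally E J S (\<lambda>f. reached_along E F G u y f \<and> reached_along E F G u y' f)"
    using locally_essentially_surjectiveD[OF u y] locally_essentially_surjectiveD[OF u y'(1)]
    by (intro U.locally_conj) simp_all
  then have "locally E J S (lifts_after E G H v y z k)"
  proof (rule U.locally_bind[OF S(1) _ closed])
    fix f assume f: "f \<in> Arr E" "Cod E f = S"
      "reached_along E F G u y f \<and> reached_along E F G u y' f"
    obtain x d where d: "x \<in> TObj F" "is_cartesian E G d" "d \<in> TArr G" "TDom G d = on_obj u x"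
      "TCod G d = y" "base_arr G d = f" "base_obj F x = Dom E f"
      using U.reached_alongE[OF conjunct1[OF f(3)]] .
    obtain x' d' where d': "x' \<in> TObj F" "is_cartesian E G d'" "d' \<in> TArr G" "TDom G d' = on_obj u x'"
      "TCod G d' = y'" "base_arr G d' = f" "base_obj F x' = Dom E f"
      using U.reached_alongE[OF conjunct2[OF f(3)]] .
    \<comment> \<open>The inverse image of \<open>k1\<close> along \<open>f\<close>, formed with the
      images of \<open>d\<close> and \<open>d'\<close>; its ends are images under \<open>w\<close>
      of objects of \<open>F\<close>.\<close>
    obtain k2 where k2: "k2 \<in> TArr H" "TDom H k2 = on_obj v (on_obj u x)"
      "TCod H k2 = on_obj v (on_obj u x')"
      "on_arr v d' \<cdot>\<^bsub>Total H\<^esub> k2 = k1 \<cdot>\<^bsub>Total H\<^esub> on_arr v d"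
      using V.tgt.vertical_factor[of "k1 \<cdot>\<^bsub>Total H\<^esub> on_arr v d" "on_arr v d'"] V.cartesian_Fun[OF d'(2)]
        k1 d d' f by auto
    have loc: "locally E J (Dom E f) (lifts_after E F H w x x' k2)"
      using locally_fullD[OF w d(1) d'(1), of k2] k2 d d' by simp
    have "lifts_after E G H v y z k (f \<cdot>\<^bsub>E\<^esub> h)" if hh: "lifts_after E F H w x x' k2 h" for h
    proof -
      obtain e \<alpha> where e: "is_cartesian E F e" "TCod F e = x" "base_arr F e = h"
        and \<alpha>: "\<alpha> \<in> TArr F" "TDom F \<alpha> = TDom F e" "TCod F \<alpha> = x'"
        "on_arr w \<alpha> = k2 \<cdot>\<^bsub>Total H\<^esub> on_arr w e"
        using hh unfolding lifts_after_def by blast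
      note e' = U.src.cartesian_Arr[OF e(1)]
      define t where "t = on_arr v (on_arr u e)"
      have t: "t \<in> TArr H" "TCod H t = on_obj v (on_obj u x)" using e e' by (simp_all add: t_def)
      show ?thesis
      proof (rule V.lifts_afterI[of "d \<cdot>\<^bsub>Total G\<^esub> on_arr u e" _ _ "c \<cdot>\<^bsub>Total G\<^esub> (d' \<cdot>\<^bsub>Total G\<^esub> on_arr u \<alpha>)"])
        show "is_cartesian E G (d \<cdot>\<^bsub>Total G\<^esub> on_arr u e)"
          by (rule U.tgt.cartesian_comp[OF d(2) U.cartesian_Fun[OF e(1)]]) (use d e e' in simp)
        have "on_arr v (c \<cdot>\<^bsub>Total G\<^esub> (d' \<cdot>\<^bsub>Total G\<^esub> on_arr u \<alpha>)) =
            on_arr v c \<cdot>\<^bsub>Total H\<^esub> (on_arr v d' \<cdot>\<^bsub>Total H\<^esub> (k2 \<cdot>\<^bsub>Total H\<^esub> t))"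
          using c d' y'_def \<alpha> e e' by (simp add: t_def)
        also have "\<dots> = on_arr v c \<cdot>\<^bsub>Total H\<^esub> (k1 \<cdot>\<^bsub>Total H\<^esub> (on_arr v d \<cdot>\<^bsub>Total H\<^esub> t))"
          using V.tgt.total.comp_reassoc[OF k2(4), of t] k2(1-3) k1 d d' t y'_def by simp
        also have "\<dots> = k \<cdot>\<^bsub>Total H\<^esub> (on_arr v d \<cdot>\<^bsub>Total H\<^esub> t)"
          using V.tgt.total.comp_reassoc[OF k1(5), of "on_arr v d \<cdot>\<^bsub>Total H\<^esub> t"] k1(1-4) c d t y'_def by simp
        also have "\<dots> = k \<cdot>\<^bsub>Total H\<^esub> on_arr v (d \<cdot>\<^bsub>Total G\<^esub> on_arr u e)"
          using d e e' by (simp add: t_def)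
        finally show "on_arr v (c \<cdot>\<^bsub>Total G\<^esub> (d' \<cdot>\<^bsub>Total G\<^esub> on_arr u \<alpha>)) =
          k \<cdot>\<^bsub>Total H\<^esub> on_arr v (d \<cdot>\<^bsub>Total G\<^esub> on_arr u e)" .
      qed (use d d' c e e' \<alpha> y'_def in simp_all)
    qed
    with loc show "\<exists>R. locally E J (Dom E f) R \<and>
        (\<forall>h\<in>Arr E. Cod E h = Dom E f \<and> R h \<longrightarrow> lifts_after E G H v y z k (f \<cdot>\<^bsub>E\<^esub> h))"
      by blast
  qed
  then show "locally E J (base_obj G y) (lifts_after E G H v y z k)" by simp
qed

lemma cancel_right_essentially_surjective:
  assumes "locally_essentially_surjective E J F H w"
  shows "locally_essentially_surjective E J G H v"
  unfolding locally_essentially_surjective_def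
proof (intro ballI)
  fix z assume z: "z \<in> TObj H"
  show "locally E J (base_obj H z) (reached_along E G H v z)"
  proof (rule U.locally_mono[OF _ locally_essentially_surjectiveD[OF assms z] V.precomp_closed_reached_along])
    fix f assume "reached_along E F H w z f"
    then obtain x d where "x \<in> TObj F" "is_cartesian E H d" "TDom H d = on_obj v (on_obj u x)"
      "TCod H d = z" "base_arr H d = f"
      by (auto simp: reached_along_def)
    then show "reached_along E G H v z f" by (intro V.reached_alongI[of "on_obj u x" d]) simp_all
  qed (use z in simp)
qed

theorem bicovering_comp:
  "\<lbrakk>is_bicovering E J F G u; is_bicovering E J G H v\<rbrakk> \<Longrightarrow> is_bicovering E J F H w"
  unfolding U.is_bicovering_iff V.is_bicovering_iff W.is_bicovering_iff
  using comp_faithful comp_full comp_essentially_surjective by blast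

theorem bicovering_cancel_left:
  "\<lbrakk>is_bicovering E J G H v; is_bicovering E J F H w\<rbrakk> \<Longrightarrow> is_bicovering E J F G u"
  unfolding U.is_bicovering_iff V.is_bicovering_iff W.is_bicovering_iff
  using cancel_left_faithful cancel_left_full cancel_left_essentially_surjective by blast

theorem bicovering_cancel_right:
  "\<lbrakk>is_bicovering E J F G u; is_bicovering E J F H w\<rbrakk> \<Longrightarrow> is_bicovering E J G H v"
  unfolding U.is_bicovering_iff V.is_bicovering_iff W.is_bicovering_iff
  using cancel_right_faithful cancel_right_full cancel_right_essentially_surjective by blast

end

section \<open>The category of fibrations\<close>

lemma Fib_simps [simp]:
  "Obj (Fib E) = {F. is_fibration E F}" "Dom (Fib E) = Src" "Cod (Fib E) = Tgt"
  by (simp_all add: Fib_def)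

text \<open>Arrows of \<open>Fib E\<close> must be \<open>undefined\<close> off the carriers. The
  restriction is built in here, so that functors can be given by formulas valid on the carriers
  only.\<close>

definition fib_arrow ::
  "('o, 'm, 'x, 'y) fibration \<Rightarrow> ('o, 'm, 'x, 'y) fibration \<Rightarrow> ('x \<Rightarrow> 'x) \<Rightarrow> ('y \<Rightarrow> 'y)
   \<Rightarrow> ('o, 'm, 'x, 'y) fibration_arrow" where
  "fib_arrow F G \<omega> \<alpha> = \<lparr>Src = F, Tgt = G,
     Fun = \<lparr>on_obj = restrict \<omega> (TObj F), on_arr = restrict \<alpha> (TArr F)\<rparr>\<rparr>"

lemma fib_arrow_simps [simp]:
  "Src (fib_arrow F G \<omega> \<alpha>) = F" "Tgt (fib_arrow F G \<omega> \<alpha>) = G"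
  "x \<in> TObj F \<Longrightarrow> on_obj (Fun (fib_arrow F G \<omega> \<alpha>)) x = \<omega> x"
  "a \<in> TArr F \<Longrightarrow> on_arr (Fun (fib_arrow F G \<omega> \<alpha>)) a = \<alpha> a"
  by (simp_all add: fib_arrow_def)

lemma Fib_Idt: "Idt (Fib E) F = fib_arrow F F (\<lambda>x. x) (\<lambda>a. a)"
  by (simp add: Fib_def fib_arrow_def)

lemma Fib_Comp: "v \<cdot>\<^bsub>Fib E\<^esub> u = fib_arrow (Src u) (Tgt v)
    (\<lambda>x. on_obj (Fun v) (on_obj (Fun u) x)) (\<lambda>a. on_arr (Fun v) (on_arr (Fun u) a))"
  by (simp add: Fib_def fib_arrow_def)

lemma cartesian_functorI:
  assumes F: "fibration_over E F" and G: "fibration_over E G" and "is_functor (Total F) (Total G) u"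
    "\<And>x. x \<in> TObj F \<Longrightarrow> base_obj G (on_obj u x) = base_obj F x"
    "\<And>a. a \<in> TArr F \<Longrightarrow> base_arr G (on_arr u a) = base_arr F a"
    "\<And>c. is_cartesian E F c \<Longrightarrow> is_cartesian E G (on_arr u c)"
  shows "cartesian_functor E F G u"
  using assms by (simp add: cartesian_functor_def cartesian_functor_axioms_def is_cartesian_functor_def)

text \<open>Needed because the functor underlying an arrow of \<open>Fib E\<close> is a restriction
  of the functor that was constructed, equal to it on the carriers only.\<close>

lemma cartesian_functor_cong:
  assumes "cartesian_functor E F G u" "\<And>x. x \<in> TObj F \<Longrightarrow> on_obj u' x = on_obj u x"
    "\<And>a. a \<in> TArr F \<Longrightarrow> on_arr u' a = on_arr u a"
  shows "cartesian_functor E F G u'"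
proof -
  interpret cartesian_functor E F G u by (rule assms)
  show ?thesis
  proof (rule cartesian_functorI)
    show "is_functor (Total F) (Total G) u'"
      by (rule is_functorI) (simp_all add: assms(2,3))
    show "is_cartesian E G (on_arr u' c)" if "is_cartesian E F c" for c
      using cartesian_Fun[OF that] src.cartesian_Arr[OF that] by (simp add: assms(3))
  qed (simp_all add: assms(2,3) src.fibration_over_axioms tgt.fibration_over_axioms)
qed

lemma cartesian_functor_comp:
  assumes "cartesian_functor E F G u" "cartesian_functor E G H v"
  shows "cartesian_functor E F H
    \<lparr>on_obj = \<lambda>x. on_obj v (on_obj u x), on_arr = \<lambda>a. on_arr v (on_arr u a)\<rparr>"
proof -
  interpret u: cartesian_functor E F G u by (rule assms)
  interpret v: cartesian_functor E G H v by (rule assms)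
  show ?thesis
    by (rule cartesian_functorI)
      (auto intro!: is_functorI u.cartesian_Fun v.cartesian_Fun
        simp: u.src.fibration_over_axioms v.tgt.fibration_over_axioms)
qed

lemma functor_iso:
  assumes "category A" "category B" "is_functor A B u" "is_iso A a"
  shows "is_iso B (on_arr u a)"
proof -
  interpret A: category A by (rule assms)
  interpret B: category B by (rule assms)
  note u [simp] = is_functorD[OF assms(3)]
  obtain b where b: "a \<in> Arr A" "b \<in> Arr A" "Dom A b = Cod A a" "Cod A b = Dom A a"
    "b \<cdot>\<^bsub>A\<^esub> a = Idt A (Dom A a)" "a \<cdot>\<^bsub>A\<^esub> b = Idt A (Cod A a)"
    using A.is_isoE[OF assms(4)] .
  show ?thesis
    by (rule B.is_isoI[of _ "on_arr u b"])
      (use b u(6)[of a b] u(6)[of b a] in simp_all)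
qed

lemma isofibrationE:
  assumes "is_isofibration A B p" "a \<in> Obj A" "is_iso B \<beta>" "Dom B \<beta> = on_obj p a"
  obtains \<alpha> where "is_iso A \<alpha>" "Dom A \<alpha> = a" "on_arr p \<alpha> = \<beta>"
  using assms by (auto simp: is_isofibration_def)

locale fibrations = category E for E :: "('u, 'u) precategory"
begin

lemma fibration_over_iff: "fibration_over E F \<longleftrightarrow> is_fibration E F"
  by (simp add: fibration_over_def fibration_over_axioms_def category_axioms)

lemma Fib_ArrD:
  assumes "u \<in> Arr (Fib E)"
  shows "cartesian_functor E (Src u) (Tgt u) (Fun u)"
  using assms
  by (simp add: Fib_def cartesian_functor_def cartesian_functor_axioms_def fibration_over_iff)

lemma Fib_homD:
  assumes "u \<in> hom (Fib E) F G"
  shows "cartesian_functor E F G (Fun u)"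
  using assms Fib_ArrD[of u] by (auto simp: hom_def)

lemma fib_arrow_in_hom:
  assumes "cartesian_functor E F G \<lparr>on_obj = \<omega>, on_arr = \<alpha>\<rparr>"
  shows "fib_arrow F G \<omega> \<alpha> \<in> hom (Fib E) F G"
proof -
  have "cartesian_functor E F G (Fun (fib_arrow F G \<omega> \<alpha>))"
    by (rule cartesian_functor_cong[OF assms]) simp_all
  then show ?thesis
    by (simp add: Fib_def hom_def cartesian_functor_def cartesian_functor_axioms_def fibration_over_def
        fibration_over_axioms_def) (simp add: fib_arrow_def)
qed

lemma Fib_arrow_eqI:
  assumes "u \<in> Arr (Fib E)" "u' \<in> Arr (Fib E)" "Src u = Src u'" "Tgt u = Tgt u'"
    and "\<And>x. x \<in> TObj (Src u) \<Longrightarrow> on_obj (Fun u) x = on_obj (Fun u') x"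
    and "\<And>a. a \<in> TArr (Src u) \<Longrightarrow> on_arr (Fun u) a = on_arr (Fun u') a"
  shows "u = u'"
proof -
  have e: "on_obj (Fun u) \<in> extensional (TObj (Src u))" "on_arr (Fun u) \<in> extensional (TArr (Src u))"
    "on_obj (Fun u') \<in> extensional (TObj (Src u))" "on_arr (Fun u') \<in> extensional (TArr (Src u))"
    using assms(1-3) by (simp_all add: Fib_def)
  have "on_obj (Fun u) = on_obj (Fun u')" by (rule extensionalityI[OF e(1,3) assms(5)])
  moreover have "on_arr (Fun u) = on_arr (Fun u')" by (rule extensionalityI[OF e(2,4) assms(6)])
  ultimately show ?thesis using assms(3,4) by simp
qed

lemma Idt_functor:
  assumes "is_fibration E F"
  shows "cartesian_functor E F F \<lparr>on_obj = \<lambda>x. x, on_arr = \<lambda>a. a\<rparr>"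
proof -
  interpret fibration_over E F using assms by (simp add: fibration_over_iff)
  show ?thesis
    by (rule cartesian_functorI) (auto intro!: is_functorI simp: fibration_over_axioms)
qed

lemma Comp_in_hom_Fib:
  assumes "u \<in> hom (Fib E) F G" "v \<in> hom (Fib E) G H"
  shows "v \<cdot>\<^bsub>Fib E\<^esub> u \<in> hom (Fib E) F H"
  using fib_arrow_in_hom[OF cartesian_functor_comp[OF Fib_homD[OF assms(1)] Fib_homD[OF assms(2)]]]
    assms by (simp add: Fib_Comp hom_def)

lemma category_Fib: "category (Fib E)"
proof (rule category.intro)
  fix f assume f: "f \<in> Arr (Fib E)"
  then show "Dom (Fib E) f \<in> Obj (Fib E)" "Cod (Fib E) f \<in> Obj (Fib E)" by (simp_all add: Fib_def)
next
  fix F assume "F \<in> Obj (Fib E)"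
  then show "Idt (Fib E) F \<in> hom (Fib E) F F"
    unfolding Fib_Idt by (intro fib_arrow_in_hom Idt_functor) simp
next
  show "g \<cdot>\<^bsub>Fib E\<^esub> f \<in> hom (Fib E) a c" if "f \<in> hom (Fib E) a b" "g \<in> hom (Fib E) b c" for a b c f g
    by (rule Comp_in_hom_Fib[OF that])
next
  fix f a b assume f: "f \<in> hom (Fib E) a b"
  interpret f: cartesian_functor E a b "Fun f" by (rule Fib_homD[OF f])
  have ida: "Idt (Fib E) a \<in> hom (Fib E) a a"
    unfolding Fib_Idt by (intro fib_arrow_in_hom Idt_functor f.src.is_fibration)
  have idb: "Idt (Fib E) b \<in> hom (Fib E) b b"
    unfolding Fib_Idt by (intro fib_arrow_in_hom Idt_functor f.tgt.is_fibration)
  show "f \<cdot>\<^bsub>Fib E\<^esub> Idt (Fib E) a = f"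
    by (rule Fib_arrow_eqI)
      (use f Comp_in_hom_Fib[OF ida f] in \<open>simp_all add: hom_def Fib_Comp Fib_Idt\<close>)
  show "Idt (Fib E) b \<cdot>\<^bsub>Fib E\<^esub> f = f"
    by (rule Fib_arrow_eqI)
      (use f Comp_in_hom_Fib[OF f idb] in \<open>simp_all add: hom_def Fib_Comp Fib_Idt\<close>)
next
  fix f a b g c h d
  assume f: "f \<in> hom (Fib E) a b" and g: "g \<in> hom (Fib E) b c" and h: "h \<in> hom (Fib E) c d"
  interpret f: cartesian_functor E a b "Fun f" by (rule Fib_homD[OF f])
  interpret g: cartesian_functor E b c "Fun g" by (rule Fib_homD[OF g])
  show "h \<cdot>\<^bsub>Fib E\<^esub> g \<cdot>\<^bsub>Fib E\<^esub> f = h \<cdot>\<^bsub>Fib E\<^esub> (g \<cdot>\<^bsub>Fib E\<^esub> f)"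
    by (rule Fib_arrow_eqI)
      (use f g h Comp_in_hom_Fib[OF f Comp_in_hom_Fib[OF g h]] Comp_in_hom_Fib[OF Comp_in_hom_Fib[OF f g] h]
        in \<open>simp_all add: hom_def Fib_Comp\<close>)
qed

sublocale Fib: category "Fib E" by (rule category_Fib)

lemma Fib_Comp_simps [simp]:
  "x \<in> TObj (Src u) \<Longrightarrow> on_obj (Fun (v \<cdot>\<^bsub>Fib E\<^esub> u)) x = on_obj (Fun v) (on_obj (Fun u) x)"
  "a \<in> TArr (Src u) \<Longrightarrow> on_arr (Fun (v \<cdot>\<^bsub>Fib E\<^esub> u)) a = on_arr (Fun v) (on_arr (Fun u) a)"
  "Src (v \<cdot>\<^bsub>Fib E\<^esub> u) = Src u" "Tgt (v \<cdot>\<^bsub>Fib E\<^esub> u) = Tgt v"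
  by (simp_all add: Fib_Comp)

lemma Fib_isoE:
  assumes "is_iso (Fib E) u"
  obtains v where "u \<in> Arr (Fib E)" "v \<in> Arr (Fib E)" "Src v = Tgt u" "Tgt v = Src u"
    "\<And>x. x \<in> TObj (Src u) \<Longrightarrow> on_obj (Fun v) (on_obj (Fun u) x) = x"
    "\<And>a. a \<in> TArr (Src u) \<Longrightarrow> on_arr (Fun v) (on_arr (Fun u) a) = a"
    "\<And>x. x \<in> TObj (Tgt u) \<Longrightarrow> on_obj (Fun u) (on_obj (Fun v) x) = x"
    "\<And>a. a \<in> TArr (Tgt u) \<Longrightarrow> on_arr (Fun u) (on_arr (Fun v) a) = a"
proof -
  obtain v where v: "u \<in> Arr (Fib E)" "v \<in> Arr (Fib E)" "Src v = Tgt u" "Tgt v = Src u"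
    "v \<cdot>\<^bsub>Fib E\<^esub> u = Idt (Fib E) (Src u)" "u \<cdot>\<^bsub>Fib E\<^esub> v = Idt (Fib E) (Tgt u)"
    using Fib.is_isoE[OF assms] by auto
  show thesis
  proof (rule that[OF v(1-4)])
    fix x assume x: "x \<in> TObj (Src u)"
    show "on_obj (Fun v) (on_obj (Fun u) x) = x"
      using Fib_Comp_simps(1)[OF x, of v] x unfolding v(5) by (simp add: Fib_Idt)
  next
    fix a assume a: "a \<in> TArr (Src u)"
    show "on_arr (Fun v) (on_arr (Fun u) a) = a"
      using Fib_Comp_simps(2)[OF a, of v] a unfolding v(5) by (simp add: Fib_Idt)
  next
    fix x assume x: "x \<in> TObj (Tgt u)"
    then have x': "x \<in> TObj (Src v)" using v by simp
    show "on_obj (Fun u) (on_obj (Fun v) x) = x"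
      using Fib_Comp_simps(1)[OF x', of u] x unfolding v(6) by (simp add: Fib_Idt)
  next
    fix a assume a: "a \<in> TArr (Tgt u)"
    then have a': "a \<in> TArr (Src v)" using v by simp
    show "on_arr (Fun u) (on_arr (Fun v) a) = a"
      using Fib_Comp_simps(2)[OF a', of u] a unfolding v(6) by (simp add: Fib_Idt)
  qed
qed

section \<open>Isofibrations\<close>

lemma iso_is_isofibration:
  assumes "is_iso (Fib E) u"
  shows "u \<in> isofibrations E"
proof -
  obtain v where v: "u \<in> Arr (Fib E)" "v \<in> Arr (Fib E)" "Src v = Tgt u" "Tgt v = Src u"
    "\<And>x. x \<in> TObj (Src u) \<Longrightarrow> on_obj (Fun v) (on_obj (Fun u) x) = x"
    "\<And>a. a \<in> TArr (Tgt u) \<Longrightarrow> on_arr (Fun u) (on_arr (Fun v) a) = a"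
    using Fib_isoE[OF assms] by metis
  interpret u: cartesian_functor E "Src u" "Tgt u" "Fun u" by (rule Fib_ArrD[OF v(1)])
  interpret v: cartesian_functor E "Tgt u" "Src u" "Fun v" using Fib_ArrD[OF v(2)] v(3,4) by simp
  have "is_isofibration (Total (Src u)) (Total (Tgt u)) (Fun u)"
    unfolding is_isofibration_def
  proof (intro ballI allI impI, elim conjE)
    fix a \<beta> assume a: "a \<in> TObj (Src u)" and \<beta>: "is_iso (Total (Tgt u)) \<beta>"
      "TDom (Tgt u) \<beta> = on_obj (Fun u) a"
    have "\<beta> \<in> TArr (Tgt u)" using \<beta> by (simp add: is_iso_def)
    moreover have "is_iso (Total (Src u)) (on_arr (Fun v) \<beta>)"
      by (rule functor_iso[OF _ _ v.is_functor \<beta>(1)]) unfold_locales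
    ultimately show "\<exists>\<alpha>. is_iso (Total (Src u)) \<alpha> \<and> TDom (Src u) \<alpha> = a \<and> on_arr (Fun u) \<alpha> = \<beta>"
      using v a \<beta> by (intro exI[of _ "on_arr (Fun v) \<beta>"]) simp
  qed
  then show ?thesis using v(1) by (simp add: isofibrations_def)
qed

lemma isofibration_comp:
  assumes "u \<in> isofibrations E" "v \<in> isofibrations E" "Tgt u = Src v"
  shows "v \<cdot>\<^bsub>Fib E\<^esub> u \<in> isofibrations E"
proof -
  have uv: "u \<in> Arr (Fib E)" "v \<in> Arr (Fib E)"
    "is_isofibration (Total (Src u)) (Total (Tgt u)) (Fun u)"
    "is_isofibration (Total (Tgt u)) (Total (Tgt v)) (Fun v)"
    using assms by (auto simp: isofibrations_def)
  interpret u: cartesian_functor E "Src u" "Tgt u" "Fun u" by (rule Fib_ArrD[OF uv(1)])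
  interpret v: cartesian_functor E "Tgt u" "Tgt v" "Fun v" using Fib_ArrD[OF uv(2)] assms(3) by simp
  have "is_isofibration (Total (Src u)) (Total (Tgt v)) (Fun (v \<cdot>\<^bsub>Fib E\<^esub> u))"
    unfolding is_isofibration_def
  proof (intro ballI allI impI, elim conjE)
    fix a \<gamma> assume a: "a \<in> TObj (Src u)" and \<gamma>: "is_iso (Total (Tgt v)) \<gamma>"
      "TDom (Tgt v) \<gamma> = on_obj (Fun (v \<cdot>\<^bsub>Fib E\<^esub> u)) a"
    obtain \<beta> where \<beta>: "is_iso (Total (Tgt u)) \<beta>" "TDom (Tgt u) \<beta> = on_obj (Fun u) a" "on_arr (Fun v) \<beta> = \<gamma>"
      by (rule isofibrationE[OF uv(4) _ \<gamma>(1), of "on_obj (Fun u) a"]) (use a \<gamma> in simp_all)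
    obtain \<alpha> where \<alpha>: "is_iso (Total (Src u)) \<alpha>" "TDom (Src u) \<alpha> = a" "on_arr (Fun u) \<alpha> = \<beta>"
      by (rule isofibrationE[OF uv(3) a \<beta>(1,2)])
    have "\<alpha> \<in> TArr (Src u)" using \<alpha>(1) by (simp add: is_iso_def)
    then show "\<exists>\<alpha>. is_iso (Total (Src u)) \<alpha> \<and> TDom (Src u) \<alpha> = a \<and> on_arr (Fun (v \<cdot>\<^bsub>Fib E\<^esub> u)) \<alpha> = \<gamma>"
      using \<alpha> \<beta> by (intro exI[of _ \<alpha>]) simp
  qed
  then show ?thesis using uv(1,2) assms(3) by (simp add: isofibrations_def)
qed

section \<open>The terminal fibration\<close>

definition base_fibration :: "('u, 'u, 'u, 'u) fibration" where
  "base_fibration = \<lparr>Total = E, Proj = \<lparr>on_obj = \<lambda>x. x, on_arr = \<lambda>a. a\<rparr>\<rparr>"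

lemma base_fibration_simps [simp]:
  "Total base_fibration = E" "Proj base_fibration = \<lparr>on_obj = \<lambda>x. x, on_arr = \<lambda>a. a\<rparr>"
  by (simp_all add: base_fibration_def)

lemma base_fibration_cartesian: "is_cartesian E base_fibration c \<longleftrightarrow> c \<in> Arr E"
  by (auto simp: is_cartesian_def hom_def)

lemma is_fibration_base: "is_fibration E base_fibration"
  unfolding is_fibration_def base_fibration_cartesian
  by (auto simp: category_axioms intro!: is_functorI)

lemma Proj_cartesian_functor:
  assumes "is_fibration E F"
  shows "cartesian_functor E F base_fibration (Proj F)"
proof -
  interpret fibration_over E F using assms by (simp add: fibration_over_iff)
  show ?thesis
  proof (rule cartesian_functorI)
    show "fibration_over E base_fibration" by (simp add: fibration_over_iff is_fibration_base)
    show "is_cartesian E base_fibration (base_arr F c)" if "is_cartesian E F c" for c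
      using cartesian_Arr[OF that] by (simp add: base_fibration_cartesian)
  qed (use fibration_over_axioms Proj_functor in simp_all)
qed

abbreviation "to_base F \<equiv> fib_arrow F base_fibration (base_obj F) (base_arr F)"

lemma to_base_in_hom: "is_fibration E F \<Longrightarrow> to_base F \<in> hom (Fib E) F base_fibration"
  by (rule fib_arrow_in_hom, rule cartesian_functor_cong[OF Proj_cartesian_functor]) simp_all

lemma to_base_unique:
  assumes "u \<in> hom (Fib E) F base_fibration"
  shows "u = to_base F"
proof -
  interpret cartesian_functor E F base_fibration "Fun u" by (rule Fib_homD[OF assms])
  show ?thesis
    by (rule Fib_arrow_eqI)
      (use assms to_base_in_hom[OF src.is_fibration] base_Fun in \<open>simp_all add: hom_def\<close>)
qed

lemma terminal_base: "is_terminal (Fib E) base_fibration"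
  unfolding is_terminal_def
  using is_fibration_base to_base_in_hom to_base_unique by (metis Fib_simps(1) mem_Collect_eq)

text \<open>Cartesian lifts prescribe the codomain, isofibrations the domain. So the inverse of
  \<beta> is lifted to a cartesian arrow, which is invertible, and its inverse lies over
  \<beta>.\<close>

lemma to_base_isofibration:
  assumes "is_fibration E F"
  shows "to_base F \<in> isofibrations E"
proof -
  interpret fibration_over E F using assms by (simp add: fibration_over_iff)
  have "is_isofibration (Total F) E (Fun (to_base F))"
    unfolding is_isofibration_def
  proof (intro ballI allI impI, elim conjE)
    fix a \<beta> assume a: "a \<in> TObj F" and \<beta>: "is_iso E \<beta>" "Dom E \<beta> = on_obj (Fun (to_base F)) a"
    obtain \<gamma> where \<gamma>: "\<beta> \<in> Arr E" "\<gamma> \<in> Arr E" "Dom E \<gamma> = Cod E \<beta>" "Cod E \<gamma> = Dom E \<beta>"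
      "\<gamma> \<cdot>\<^bsub>E\<^esub> \<beta> = Idt E (Dom E \<beta>)" "\<beta> \<cdot>\<^bsub>E\<^esub> \<gamma> = Idt E (Cod E \<beta>)" "is_iso E \<gamma>"
      using is_isoE[OF \<beta>(1)] .
    obtain c where c: "is_cartesian E F c" "c \<in> TArr F" "TCod F c = a" "base_arr F c = \<gamma>"
      using ex_cartesian[of a \<gamma>] a \<gamma> \<beta> by auto
    have "is_iso (Total F) c" using cartesian_iso c \<gamma> by simp
    then obtain \<alpha> where \<alpha>: "\<alpha> \<in> TArr F" "TDom F \<alpha> = a" "TCod F \<alpha> = TDom F c"
      "\<alpha> \<cdot>\<^bsub>Total F\<^esub> c = TIdt F (TDom F c)" "is_iso (Total F) \<alpha>"
      using total.is_isoE[of c] c(3) by metis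
    have "base_arr F \<alpha> = \<beta>"
    proof (rule iso_cancel_right[OF \<gamma>(7)])
      have "base_arr F \<alpha> \<cdot>\<^bsub>E\<^esub> \<gamma> = base_arr F (\<alpha> \<cdot>\<^bsub>Total F\<^esub> c)" using \<alpha>(1-3) c by simp
      also have "\<dots> = Idt E (Dom E \<gamma>)" using \<alpha>(4) c Proj_simps(3)[OF c(2)] by simp
      finally show "base_arr F \<alpha> \<cdot>\<^bsub>E\<^esub> \<gamma> = \<beta> \<cdot>\<^bsub>E\<^esub> \<gamma>" using \<gamma> by simp
    qed (use \<alpha> \<gamma> \<beta> a in simp_all)
    then show "\<exists>\<alpha>. is_iso (Total F) \<alpha> \<and> TDom F \<alpha> = a \<and> on_arr (Fun (to_base F)) \<alpha> = \<beta>"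
      using \<alpha> by (intro exI[of _ \<alpha>]) simp
  qed
  then show ?thesis using to_base_in_hom[OF assms] by (simp add: isofibrations_def hom_def)
qed

text \<open>An arbitrary terminal object is isomorphic to the constructed one, and arrows into the
  latter are projections of fibrations.\<close>

lemma terminal_isofibration:
  assumes "is_terminal (Fib E) t" "u \<in> hom (Fib E) F t"
  shows "u \<in> isofibrations E"
proof -
  have t: "t \<in> Obj (Fib E)" using assms by (simp add: is_terminal_def)
  obtain i where i: "i \<in> hom (Fib E) base_fibration t"
    using assms is_fibration_base by (auto simp: is_terminal_def)
  have j: "to_base t \<in> hom (Fib E) t base_fibration" using to_base_in_hom t by simp
  have "Idt (Fib E) t \<in> hom (Fib E) t t" "i \<cdot>\<^bsub>Fib E\<^esub> to_base t \<in> hom (Fib E) t t"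
    using t i j Fib.Idt_in_hom Fib.Comp_in_hom by auto
  then have 1: "i \<cdot>\<^bsub>Fib E\<^esub> to_base t = Idt (Fib E) t"
    using assms(1) t unfolding is_terminal_def by blast
  have "Idt (Fib E) base_fibration \<in> hom (Fib E) base_fibration base_fibration"
    using is_fibration_base by (intro Fib.Idt_in_hom) simp
  moreover have "to_base t \<cdot>\<^bsub>Fib E\<^esub> i \<in> hom (Fib E) base_fibration base_fibration"
    using i j Fib.Comp_in_hom by auto
  ultimately have 2: "to_base t \<cdot>\<^bsub>Fib E\<^esub> i = Idt (Fib E) base_fibration"
    using to_base_unique by metis
  have iso: "is_iso (Fib E) i"
    using i j 1 2 by (intro Fib.is_isoI[of _ "to_base t"]) (auto simp: hom_def)
  have F: "is_fibration E F" using Fib.hom_Obj(1)[OF assms(2)] by simp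
  have "i \<cdot>\<^bsub>Fib E\<^esub> to_base F \<in> hom (Fib E) F t"
    using i to_base_in_hom[OF F] Fib.Comp_in_hom by auto
  then have "u = i \<cdot>\<^bsub>Fib E\<^esub> to_base F"
    using assms F unfolding is_terminal_def by (metis Fib_simps(1) mem_Collect_eq)
  moreover have "Src i = base_fibration" using i by (simp add: hom_def)
  ultimately show ?thesis
    using isofibration_comp[OF to_base_isofibration[OF F] iso_is_isofibration[OF iso]] by simp
qed

end

section \<open>Pullbacks of isofibrations\<close>

text \<open>Total categories have their objects and arrows in \<open>'u\<close>, so pairs are coded by elements of
  \<open>'u\<close>.\<close>

definition pairing :: "'u \<times> 'u \<Rightarrow> 'u" where
  "pairing = (SOME f. bij f)"

abbreviation pr :: "'u \<Rightarrow> 'u \<Rightarrow> 'u" where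
  "pr a b \<equiv> pairing (a, b)"

definition left :: "'u \<Rightarrow> 'u" where
  "left z = fst (inv pairing z)"

definition right :: "'u \<Rightarrow> 'u" where
  "right z = snd (inv pairing z)"

text \<open>An infinite set has as many pairs as elements. With a bijection every element of
  \<open>'u\<close> is a pair, so that equality can be tested on components throughout.\<close>

lemma bij_pairing: "bij (pairing :: 'u::infinite \<times> 'u \<Rightarrow> 'u)"
proof -
  have "\<exists>f. bij_betw f (UNIV \<times> UNIV :: ('u \<times> 'u) set) (UNIV :: 'u set)"
    unfolding card_of_ordIso by (rule card_of_Times_same_infinite[OF infinite_UNIV])
  then have "\<exists>f :: 'u \<times> 'u \<Rightarrow> 'u. bij f" by simp
  then show ?thesis unfolding pairing_def by (rule someI_ex)
qed

lemma pairing_simps [simp]: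
  fixes a b z :: "'u::infinite"
  shows "left (pr a b) = a" "right (pr a b) = b" "pr (left z) (right z) = z"
  using bij_pairing[where ?'u = 'u]
  by (simp_all add: left_def right_def bij_is_inj bij_is_surj surj_f_inv_f)

lemma pairing_eqI:
  fixes z z' :: "'u::infinite"
  shows "left z = left z' \<Longrightarrow> right z = right z' \<Longrightarrow> z = z'"
  by (metis pairing_simps(3))

lemma pr_eq_iff [simp]:
  fixes a b a' b' :: "'u::infinite"
  shows "pr a b = pr a' b' \<longleftrightarrow> a = a' \<and> b = b'"
  by (metis pairing_simps(1,2))

text \<open>The projection to \<open>E\<close> is read off the right component; on the carriers the
  left one gives the same value (\<open>base_left\<close>).\<close>

definition fibre_product ::
  "('u, 'u, 'u, 'u) fibration \<Rightarrow> ('u, 'u, 'u, 'u) fibration \<Rightarrow> ('u, 'u, 'u, 'u) functor_data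
   \<Rightarrow> ('u, 'u, 'u, 'u) functor_data \<Rightarrow> ('u, 'u, 'u, 'u) fibration" where
  "fibre_product A C p v =
    \<lparr>Total =
      \<lparr>Obj = {z. left z \<in> TObj A \<and> right z \<in> TObj C \<and> on_obj p (left z) = on_obj v (right z)},
       Arr = {z. left z \<in> TArr A \<and> right z \<in> TArr C \<and> on_arr p (left z) = on_arr v (right z)},
       Dom = (\<lambda>z. pr (TDom A (left z)) (TDom C (right z))),
       Cod = (\<lambda>z. pr (TCod A (left z)) (TCod C (right z))),
       Idt = (\<lambda>z. pr (TIdt A (left z)) (TIdt C (right z))),
       Comp = (\<lambda>z w. pr (left z \<cdot>\<^bsub>Total A\<^esub> left w) (right z \<cdot>\<^bsub>Total C\<^esub> right w))\<rparr>,
     Proj = \<lparr>on_obj = (\<lambda>z. base_obj C (right z)), on_arr = (\<lambda>z. base_arr C (right z))\<rparr>\<rparr>"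

lemma fibre_product_simps [simp]:
  "z \<in> TObj (fibre_product A C p v) \<longleftrightarrow>
    left z \<in> TObj A \<and> right z \<in> TObj C \<and> on_obj p (left z) = on_obj v (right z)"
  "z \<in> TArr (fibre_product A C p v) \<longleftrightarrow>
    left z \<in> TArr A \<and> right z \<in> TArr C \<and> on_arr p (left z) = on_arr v (right z)"
  "TDom (fibre_product A C p v) z = pr (TDom A (left z)) (TDom C (right z))"
  "TCod (fibre_product A C p v) z = pr (TCod A (left z)) (TCod C (right z))"
  "TIdt (fibre_product A C p v) z = pr (TIdt A (left z)) (TIdt C (right z))"
  "z \<cdot>\<^bsub>Total (fibre_product A C p v)\<^esub> w =
    pr (left z \<cdot>\<^bsub>Total A\<^esub> left w) (right z \<cdot>\<^bsub>Total C\<^esub> right w)"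
  "base_obj (fibre_product A C p v) z = base_obj C (right z)"
  "base_arr (fibre_product A C p v) z = base_arr C (right z)"
  by (simp_all add: fibre_product_def)

locale isofibration_pullback = P: cartesian_functor E A B p + V: cartesian_functor E C B v
  for E :: "('u::infinite, 'u) precategory" and A B C :: "('u, 'u, 'u, 'u) fibration"
    and p v +
  assumes isofibration: "is_isofibration (Total A) (Total B) p"
begin

abbreviation "D \<equiv> fibre_product A C p v"

lemma category_fibre_product: "category (Total D)"
proof (rule category.intro)
  fix f assume f: "f \<in> TArr D"
  then have f': "left f \<in> TArr A" "right f \<in> TArr C" "on_arr p (left f) = on_arr v (right f)" by auto
  show "TDom D f \<in> TObj D"
    using P.Fun_simps(3)[OF f'(1)] V.Fun_simps(3)[OF f'(2)] f' by simp
  show "TCod D f \<in> TObj D"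
    using P.Fun_simps(4)[OF f'(1)] V.Fun_simps(4)[OF f'(2)] f' by simp
next
  fix a assume "a \<in> TObj D"
  then show "TIdt D a \<in> hom (Total D) a a" by (simp add: hom_def)
next
  fix f g a b c assume "f \<in> hom (Total D) a b" "g \<in> hom (Total D) b c"
  then show "g \<cdot>\<^bsub>Total D\<^esub> f \<in> hom (Total D) a c" by (auto simp: hom_def)
next
  fix f a b assume "f \<in> hom (Total D) a b"
  then show "f \<cdot>\<^bsub>Total D\<^esub> TIdt D a = f" "TIdt D b \<cdot>\<^bsub>Total D\<^esub> f = f"
    by (auto simp: hom_def)
next
  fix f g h a b c d
  assume "f \<in> hom (Total D) a b" "g \<in> hom (Total D) b c" "h \<in> hom (Total D) c d"
  then show "h \<cdot>\<^bsub>Total D\<^esub> g \<cdot>\<^bsub>Total D\<^esub> f = h \<cdot>\<^bsub>Total D\<^esub> (g \<cdot>\<^bsub>Total D\<^esub> f)"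
    by (auto simp: hom_def)
qed

lemma base_left:
  "z \<in> TObj D \<Longrightarrow> base_obj A (left z) = base_obj C (right z)"
  "w \<in> TArr D \<Longrightarrow> base_arr A (left w) = base_arr C (right w)"
  using P.base_Fun V.base_Fun by (metis fibre_product_simps(1), metis fibre_product_simps(2))

text \<open>A factorization problem is solved in each component. The two solutions form an arrow of
  the fibre product because their images agree after composition with \<open>on_arr p a\<close>,
  which is cartesian.\<close>

lemma cartesian_pair:
  assumes a: "is_cartesian E A a" and c: "is_cartesian E C c" and ac: "on_arr p a = on_arr v c"
  shows "is_cartesian E D (pr a c)"
proof -
  note a' = P.src.cartesian_Arr[OF a] and c' = V.src.cartesian_Arr[OF c]
  have bac: "base_arr A a = base_arr C c" using P.base_Fun(2)[OF a'] V.base_Fun(2)[OF c'] ac by simp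
  have pd: "on_obj p (TDom A a) = on_obj v (TDom C c)"
    using P.Fun_simps(3)[OF a'] V.Fun_simps(3)[OF c'] ac by simp
  show ?thesis
    unfolding is_cartesian_def
  proof (intro conjI allI ballI impI)
    show "pr a c \<in> TArr D" using a' c' ac by simp
    fix z g h assume g: "g \<in> hom (Total D) z (TCod D (pr a c))"
      and h: "h \<in> hom E (base_obj D z) (base_obj D (TDom D (pr a c)))"
      and gh: "base_arr D g = base_arr D (pr a c) \<cdot>\<^bsub>E\<^esub> h"
    have g': "left g \<in> TArr A" "right g \<in> TArr C" "on_arr p (left g) = on_arr v (right g)"
      "TDom A (left g) = left z" "TDom C (right g) = right z"
      "TCod A (left g) = TCod A a" "TCod C (right g) = TCod C c"
      using g by (auto simp: hom_def)
    have bg: "base_arr A (left g) = base_arr C (right g)"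
      using P.base_Fun(2)[OF g'(1)] V.base_Fun(2)[OF g'(2)] g'(3) by simp
    have bz: "base_obj A (left z) = base_obj C (right z)"
      using P.src.Proj_simps(3)[OF g'(1)] V.src.Proj_simps(3)[OF g'(2)] bg g' by simp
    have bd: "base_obj A (TDom A a) = base_obj C (TDom C c)"
      using P.src.Proj_simps(3)[OF a'] V.src.Proj_simps(3)[OF c'] bac by simp
    have h': "h \<in> Arr E" "Dom E h = base_obj C (right z)" "Cod E h = base_obj C (TDom C c)"
      using h by (simp_all add: hom_def)
    obtain k where k: "k \<in> TArr A" "TDom A k = left z" "TCod A k = TDom A a" "base_arr A k = h"
      "a \<cdot>\<^bsub>Total A\<^esub> k = left g"
      using P.src.cartesian_factor[OF a g'(1), of h] g' h' gh bg bac bz bd by auto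
    obtain l where l: "l \<in> TArr C" "TDom C l = right z" "TCod C l = TDom C c" "base_arr C l = h"
      "c \<cdot>\<^bsub>Total C\<^esub> l = right g"
      using V.src.cartesian_factor[OF c g'(2), of h] g' h' gh by auto
    have kl: "on_arr p k = on_arr v l"
    proof (rule P.tgt.cartesian_cancel[OF P.cartesian_Fun[OF a]])
      show "on_arr p a \<cdot>\<^bsub>Total B\<^esub> on_arr p k = on_arr p a \<cdot>\<^bsub>Total B\<^esub> on_arr v l"
        using P.Fun_simps(6)[of k a] V.Fun_simps(6)[of l c] k l a' c' ac g' by simp
      have "on_obj p (left z) = on_obj v (right z)"
        using P.Fun_simps(3)[OF g'(1)] V.Fun_simps(3)[OF g'(2)] g' by simp
      then show "TDom B (on_arr p k) = TDom B (on_arr v l)" using k l by simp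
    qed (use k l a' pd in simp_all)
    show "\<exists>!k. k \<in> hom (Total D) z (TDom D (pr a c)) \<and> base_arr D k = h \<and>
        pr a c \<cdot>\<^bsub>Total D\<^esub> k = g"
    proof (rule ex1I[of _ "pr k l"])
      show "pr k l \<in> hom (Total D) z (TDom D (pr a c)) \<and> base_arr D (pr k l) = h \<and>
          pr a c \<cdot>\<^bsub>Total D\<^esub> pr k l = g"
        using k l kl by (simp add: hom_def)
      fix j assume j: "j \<in> hom (Total D) z (TDom D (pr a c)) \<and> base_arr D j = h \<and>
        pr a c \<cdot>\<^bsub>Total D\<^esub> j = g"
      then have j': "left j \<in> TArr A" "right j \<in> TArr C" "on_arr p (left j) = on_arr v (right j)"
        "TDom A (left j) = left z" "TDom C (right j) = right z"
        "TCod A (left j) = TDom A a" "TCod C (right j) = TDom C c" "base_arr C (right j) = h"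
        "a \<cdot>\<^bsub>Total A\<^esub> left j = left g" "c \<cdot>\<^bsub>Total C\<^esub> right j = right g"
        by (auto simp: hom_def)
      have "base_arr A (left j) = h"
        using P.base_Fun(2)[OF j'(1)] V.base_Fun(2)[OF j'(2)] j' by simp
      then have "left j = k" by - (rule P.src.cartesian_cancel[OF a], use j' k in simp_all)
      moreover have "right j = l" by (rule V.src.cartesian_cancel[OF c]) (use j' l in simp_all)
      ultimately show "j = pr k l" by - (rule pairing_eqI, simp_all)
    qed
  qed
qed

text \<open>Cartesian lifts in \<open>A\<close> and \<open>C\<close> have images in \<open>B\<close> that agree only up to a vertical
  isomorphism; lifting it along the isofibration corrects the lift in \<open>A\<close>.\<close>

lemma ex_cartesian_pair:
  assumes z: "z \<in> TObj D" and f: "f \<in> Arr E" "Cod E f = base_obj D z"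
  obtains a c where "is_cartesian E A a" "is_cartesian E C c" "on_arr p a = on_arr v c"
    "TCod A a = left z" "TCod C c = right z" "base_arr C c = f"
proof -
  have z': "left z \<in> TObj A" "right z \<in> TObj C" "on_obj p (left z) = on_obj v (right z)" using z by auto
  obtain c where c: "is_cartesian E C c" "c \<in> TArr C" "TCod C c = right z" "base_arr C c = f"
    using V.src.ex_cartesian[of "right z" f] z' f by auto
  obtain a where a: "is_cartesian E A a" "a \<in> TArr A" "TCod A a = left z" "base_arr A a = f"
    using P.src.ex_cartesian[of "left z" f] z' f base_left(1)[OF z] by auto
  obtain i where i: "is_iso (Total B) i" "i \<in> TArr B" "TDom B i = on_obj p (TDom A a)"
    "TCod B i = on_obj v (TDom C c)" "on_arr v c \<cdot>\<^bsub>Total B\<^esub> i = on_arr p a"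
    using P.tgt.cartesian_unique[OF P.cartesian_Fun[OF a(1)] V.cartesian_Fun[OF c(1)]] a c z' by auto
  obtain \<alpha> where \<alpha>: "is_iso (Total A) \<alpha>" "TDom A \<alpha> = TDom A a" "on_arr p \<alpha> = i"
    by (rule isofibrationE[OF isofibration _ i(1), of "TDom A a"]) (use a i in simp_all)
  \<comment> \<open>The lift \<alpha> starts at the domain of \<open>a\<close>, as isofibrations
    prescribe it; the inverse of \<alpha> is the arrow that can be composed with
    \<open>a\<close>.\<close>
  obtain \<beta> where \<beta>: "\<alpha> \<in> TArr A" "\<beta> \<in> TArr A" "TDom A \<beta> = TCod A \<alpha>" "TCod A \<beta> = TDom A \<alpha>"
    "\<beta> \<cdot>\<^bsub>Total A\<^esub> \<alpha> = TIdt A (TDom A \<alpha>)" "\<alpha> \<cdot>\<^bsub>Total A\<^esub> \<beta> = TIdt A (TCod A \<alpha>)" "is_iso (Total A) \<beta>"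
    using P.src.total.is_isoE[OF \<alpha>(1)] .
  have "on_arr p (a \<cdot>\<^bsub>Total A\<^esub> \<beta>) = on_arr v c"
  proof (rule P.tgt.total.iso_cancel_right[OF i(1)])
    have "on_arr p (a \<cdot>\<^bsub>Total A\<^esub> \<beta>) \<cdot>\<^bsub>Total B\<^esub> i = on_arr p (a \<cdot>\<^bsub>Total A\<^esub> (\<beta> \<cdot>\<^bsub>Total A\<^esub> \<alpha>))"
      using P.Fun_simps(6)[of \<alpha> "a \<cdot>\<^bsub>Total A\<^esub> \<beta>"] \<alpha> \<beta>(1-4) a by simp
    also have "\<dots> = on_arr p a" unfolding \<beta>(5) using \<alpha> a by simp
    finally show "on_arr p (a \<cdot>\<^bsub>Total A\<^esub> \<beta>) \<cdot>\<^bsub>Total B\<^esub> i = on_arr v c \<cdot>\<^bsub>Total B\<^esub> i" using i by simp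
    show "TDom B (on_arr p (a \<cdot>\<^bsub>Total A\<^esub> \<beta>)) = TCod B i"
      using a \<alpha> \<beta>(1-4) P.Fun_simps(4)[OF \<beta>(1)] by simp
  qed (use a c i \<alpha> \<beta>(1-4) in simp_all)
  moreover have "is_cartesian E A (a \<cdot>\<^bsub>Total A\<^esub> \<beta>)"
    by (rule P.src.cartesian_comp[OF a(1) P.src.iso_cartesian[OF \<beta>(7)]]) (use \<alpha> \<beta> in simp)
  ultimately show thesis using that[of "a \<cdot>\<^bsub>Total A\<^esub> \<beta>" c] a c \<alpha> \<beta>(1-4) by simp
qed

lemma is_fibration_fibre_product: "is_fibration E D"
  unfolding is_fibration_def
proof (intro conjI ballI impI)
  show "category (Total D)" by (rule category_fibre_product)
  show "is_functor (Total D) E (Proj D)"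
    by (rule is_functorI) simp_all
  fix z f assume "z \<in> TObj D" "f \<in> Arr E" "Cod E f = base_obj D z"
  then obtain a c where ac: "is_cartesian E A a" "is_cartesian E C c" "on_arr p a = on_arr v c"
    "TCod A a = left z" "TCod C c = right z" "base_arr C c = f"
    using ex_cartesian_pair by metis
  then show "\<exists>c. is_cartesian E D c \<and> TCod D c = z \<and> base_arr D c = f"
    using cartesian_pair[OF ac(1-3)] by (intro exI[of _ "pr a c"]) simp
qed

sublocale D: fibration_over E D
  by unfold_locales (rule is_fibration_fibre_product)

section \<open>The projections of the fibre product\<close>

lemma is_functor_left: "is_functor (Total D) (Total A) \<lparr>on_obj = left, on_arr = left\<rparr>"
  and is_functor_right: "is_functor (Total D) (Total C) \<lparr>on_obj = right, on_arr = right\<rparr>"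
  by (rule is_functorI; simp)+

text \<open>A cartesian arrow differs by an isomorphism from the pair of cartesian arrows over the
  same base arrow, and the components of that isomorphism are isomorphisms.\<close>

lemma cartesian_components:
  assumes d: "is_cartesian E D d"
  shows "is_cartesian E A (left d)" "is_cartesian E C (right d)"
proof -
  have d': "d \<in> TArr D" by (rule D.cartesian_Arr[OF d])
  then have d'': "left d \<in> TArr A" "right d \<in> TArr C" by simp_all
  obtain a c where ac: "is_cartesian E A a" "is_cartesian E C c" "on_arr p a = on_arr v c"
    "TCod A a = left (TCod D d)" "TCod C c = right (TCod D d)" "base_arr C c = base_arr D d"
    by (rule ex_cartesian_pair[of "TCod D d" "base_arr D d"])
      (use D.total.Cod_in_Obj[OF d'] d'' in simp_all)
  obtain i where i: "is_iso (Total D) i" "i \<in> TArr D" "TCod D i = TDom D (pr a c)"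
    "pr a c \<cdot>\<^bsub>Total D\<^esub> i = d"
    using D.cartesian_unique[OF d cartesian_pair[OF ac(1-3)]] ac(4-6) by auto
  have iA: "is_iso (Total A) (left i)"
    using functor_iso[OF D.total.category_axioms P.src.total.category_axioms is_functor_left i(1)] by simp
  have iC: "is_iso (Total C) (right i)"
    using functor_iso[OF D.total.category_axioms V.src.total.category_axioms is_functor_right i(1)] by simp
  have "left d = a \<cdot>\<^bsub>Total A\<^esub> left i" "right d = c \<cdot>\<^bsub>Total C\<^esub> right i" using i(4) by auto
  moreover have "TCod A (left i) = TDom A a" "TCod C (right i) = TDom C c" using i(3) by auto
  ultimately show "is_cartesian E A (left d)" "is_cartesian E C (right d)"
    using P.src.cartesian_comp[OF ac(1) P.src.iso_cartesian[OF iA]]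
      V.src.cartesian_comp[OF ac(2) V.src.iso_cartesian[OF iC]] by simp_all
qed

lemma left_cartesian_functor: "cartesian_functor E D A \<lparr>on_obj = left, on_arr = left\<rparr>"
  by (rule cartesian_functorI)
    (use is_functor_left base_left cartesian_components D.fibration_over_axioms
      P.src.fibration_over_axioms in auto)

lemma right_cartesian_functor: "cartesian_functor E D C \<lparr>on_obj = right, on_arr = right\<rparr>"
  by (rule cartesian_functorI)
    (use is_functor_right cartesian_components D.fibration_over_axioms
      V.src.fibration_over_axioms in auto)

lemma pair_cartesian_functor:
  assumes f: "cartesian_functor E X A f" and g: "cartesian_functor E X C g"
    and "\<And>x. x \<in> TObj X \<Longrightarrow> on_obj p (on_obj f x) = on_obj v (on_obj g x)"
    and "\<And>a. a \<in> TArr X \<Longrightarrow> on_arr p (on_arr f a) = on_arr v (on_arr g a)"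
  shows "cartesian_functor E X D
    \<lparr>on_obj = \<lambda>x. pr (on_obj f x) (on_obj g x), on_arr = \<lambda>a. pr (on_arr f a) (on_arr g a)\<rparr>"
proof -
  interpret f: cartesian_functor E X A f by (rule f)
  interpret g: cartesian_functor E X C g by (rule g)
  show ?thesis
  proof (rule cartesian_functorI)
    show "is_functor (Total X) (Total D)
      \<lparr>on_obj = \<lambda>x. pr (on_obj f x) (on_obj g x), on_arr = \<lambda>a. pr (on_arr f a) (on_arr g a)\<rparr>"
      by (rule is_functorI) (simp_all add: assms(3,4))
    fix c assume c: "is_cartesian E X c"
    show "is_cartesian E D (on_arr \<lparr>on_obj = \<lambda>x. pr (on_obj f x) (on_obj g x),
        on_arr = \<lambda>a. pr (on_arr f a) (on_arr g a)\<rparr> c)"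
      using cartesian_pair[OF f.cartesian_Fun[OF c] g.cartesian_Fun[OF c]]
        assms(4)[OF f.src.cartesian_Arr[OF c]] by simp
  qed (simp_all add: f.src.fibration_over_axioms D.fibration_over_axioms)
qed

text \<open>The image of \<gamma> in \<open>B\<close> is lifted to an isomorphism of
  \<open>A\<close>. Paired with \<gamma> it is invertible because the two inverses also have the
  same image in \<open>B\<close>.\<close>

lemma right_isofibration: "is_isofibration (Total D) (Total C) \<lparr>on_obj = right, on_arr = right\<rparr>"
  unfolding is_isofibration_def
proof (intro ballI allI impI, elim conjE)
  fix z \<gamma> assume z: "z \<in> TObj D" and \<gamma>: "is_iso (Total C) \<gamma>"
    "TDom C \<gamma> = on_obj \<lparr>on_obj = right, on_arr = right\<rparr> z"
  have iso: "is_iso (Total B) (on_arr v \<gamma>)"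
    by (rule functor_iso[OF V.src.total.category_axioms P.tgt.total.category_axioms V.is_functor \<gamma>(1)])
  obtain \<delta> where \<delta>: "\<gamma> \<in> TArr C" "\<delta> \<in> TArr C" "TDom C \<delta> = TCod C \<gamma>" "TCod C \<delta> = TDom C \<gamma>"
    "\<delta> \<cdot>\<^bsub>Total C\<^esub> \<gamma> = TIdt C (TDom C \<gamma>)" "\<gamma> \<cdot>\<^bsub>Total C\<^esub> \<delta> = TIdt C (TCod C \<gamma>)"
    using V.src.total.is_isoE[OF \<gamma>(1)] .
  obtain \<alpha> where \<alpha>: "is_iso (Total A) \<alpha>" "TDom A \<alpha> = left z" "on_arr p \<alpha> = on_arr v \<gamma>"
    by (rule isofibrationE[OF isofibration _ iso, of "left z"]) (use z \<gamma> \<delta> in simp_all)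
  obtain \<beta> where \<beta>: "\<alpha> \<in> TArr A" "\<beta> \<in> TArr A" "TDom A \<beta> = TCod A \<alpha>" "TCod A \<beta> = TDom A \<alpha>"
    "\<beta> \<cdot>\<^bsub>Total A\<^esub> \<alpha> = TIdt A (TDom A \<alpha>)" "\<alpha> \<cdot>\<^bsub>Total A\<^esub> \<beta> = TIdt A (TCod A \<alpha>)"
    using P.src.total.is_isoE[OF \<alpha>(1)] .
  have codp: "on_obj p (TCod A \<alpha>) = on_obj v (TCod C \<gamma>)"
    using P.Fun_simps(4)[OF \<beta>(1)] V.Fun_simps(4)[OF \<delta>(1)] \<alpha>(3) by simp
  have "on_arr p \<beta> = on_arr v \<delta>"
  proof (rule P.tgt.total.iso_cancel_left[OF iso])
    show "on_arr v \<gamma> \<cdot>\<^bsub>Total B\<^esub> on_arr p \<beta> = on_arr v \<gamma> \<cdot>\<^bsub>Total B\<^esub> on_arr v \<delta>"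
      using P.Fun_simps(6)[of \<beta> \<alpha>] V.Fun_simps(6)[of \<delta> \<gamma>] \<alpha> \<beta> \<delta> codp by simp
  qed (use \<alpha> \<beta>(1-4) \<delta>(1-4) z \<gamma> in simp_all)
  then have "is_iso (Total D) (pr \<alpha> \<gamma>)"
    using \<alpha> \<beta> \<delta> by (intro D.total.is_isoI[of _ "pr \<beta> \<delta>"]) simp_all
  then show "\<exists>\<alpha>. is_iso (Total D) \<alpha> \<and> TDom D \<alpha> = z \<and>
      on_arr \<lparr>on_obj = right, on_arr = right\<rparr> \<alpha> = \<gamma>"
    using \<alpha> \<gamma> by (intro exI[of _ "pr \<alpha> \<gamma>"]) simp
qed

end

section \<open>Bicovering isofibrations under pullback\<close>

locale bicovering_pullback = site E J + isofibration_pullback E A B C p v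
  for E :: "('u::infinite, 'u) precategory" and J A B C p v +
  assumes bicovering: "is_bicovering E J A B p"
begin

text \<open>Each property is that of \<open>p\<close> at the left component, since the right
  component is already under control. Cartesian arrows with equal images in \<open>B\<close>, from
  \<open>ex_cartesian_pair\<close>, carry the result to the fibre product.\<close>

lemma right_bicovering: "is_bicovering E J D C \<lparr>on_obj = right, on_arr = right\<rparr>"
proof -
  interpret p: site_functor E J A B p by unfold_locales
  interpret R: cartesian_functor E D C "\<lparr>on_obj = right, on_arr = right\<rparr>"
    by (rule right_cartesian_functor)
  interpret r: site_functor E J D C "\<lparr>on_obj = right, on_arr = right\<rparr>" by unfold_locales
  have p: "locally_faithful E J A p" "locally_full E J A B p" "locally_essentially_surjective E J A B p"
    using bicovering by (simp_all add: p.is_bicovering_iff)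
  have "locally_faithful E J D \<lparr>on_obj = right, on_arr = right\<rparr>"
    unfolding locally_faithful_def
  proof (intro ballI impI, elim conjE)
    fix a b assume a: "a \<in> TArr D" and b: "b \<in> TArr D" and d: "TDom D a = TDom D b"
      and c: "TCod D a = TCod D b" and e: "base_arr D a = base_arr D b"
      and "on_arr \<lparr>on_obj = right, on_arr = right\<rparr> a = on_arr \<lparr>on_obj = right, on_arr = right\<rparr> b"
    then have r: "right a = right b" by simp
    have ab: "left a \<in> TArr A" "left b \<in> TArr A" "TDom A (left a) = TDom A (left b)"
      "TCod A (left a) = TCod A (left b)" "on_arr p (left a) = on_arr p (left b)"
      using a b d c r by simp_all
    have "base_arr A (left a) = base_arr A (left b)" using base_left(2)[OF a] base_left(2)[OF b] e by simp
    from locally_faithfulD[OF p(1) ab(1-4) this ab(5)]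
    have "locally E J (base_obj D (TDom D a)) (equal_after E A (left a) (left b))"
      using base_left(1)[of "TDom D a"] a D.total.Dom_in_Obj[OF a] by simp
    then show "locally E J (base_obj D (TDom D a)) (equal_after E D a b)"
    proof (rule locally_mono[rotated])
      show "precomp_closed E (base_obj D (TDom D a)) (equal_after E D a b)"
        by (rule D.precomp_closed_equal_after[OF a b d])
      fix f assume f: "f \<in> Arr E" "Cod E f = base_obj D (TDom D a)" "equal_after E A (left a) (left b) f"
      obtain k l where kl: "is_cartesian E A k" "is_cartesian E C l" "on_arr p k = on_arr v l"
        "TCod A k = left (TDom D a)" "TCod C l = right (TDom D a)" "base_arr C l = f"
        by (rule ex_cartesian_pair[OF D.total.Dom_in_Obj[OF a] f(1,2)])
      have bk: "base_arr A k = f"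
        using P.base_Fun(2)[OF P.src.cartesian_Arr[OF kl(1)]]
          V.base_Fun(2)[OF V.src.cartesian_Arr[OF kl(2)]] kl by simp
      have "left a \<cdot>\<^bsub>Total A\<^esub> k = left b \<cdot>\<^bsub>Total A\<^esub> k"
        by (rule P.src.equal_afterD) (use f ab kl bk in simp_all)
      then show "equal_after E D a b f"
        by (intro D.equal_afterI[OF cartesian_pair[OF kl(1-3)]]) (use kl r in simp_all)
    qed (use D.total.Dom_in_Obj[OF a] in \<open>auto intro: V.src.Proj_simps(1)\<close>)
  qed
  moreover have "locally_full E J D C \<lparr>on_obj = right, on_arr = right\<rparr>"
    unfolding locally_full_def
  proof (intro ballI)
    fix x x' w assume x: "x \<in> TObj D" and x': "x' \<in> TObj D"
      and "w \<in> hom (Total C) (on_obj \<lparr>on_obj = right, on_arr = right\<rparr> x)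
        (on_obj \<lparr>on_obj = right, on_arr = right\<rparr> x')"
    then have w: "w \<in> TArr C" "TDom C w = right x" "TCod C w = right x'" by (auto simp: hom_def)
    have "locally E J (base_obj A (left x)) (lifts_after E A B p (left x) (left x') (on_arr v w))"
      by (rule locally_fullD[OF p(2)]) (use x x' w in simp_all)
    then have "locally E J (base_obj D x) (lifts_after E A B p (left x) (left x') (on_arr v w))"
      using base_left(1)[OF x] by simp
    then show "locally E J (base_obj D x)
        (lifts_after E D C \<lparr>on_obj = right, on_arr = right\<rparr> x x' w)"
    proof (rule locally_mono[rotated])
      show "precomp_closed E (base_obj D x)
          (lifts_after E D C \<lparr>on_obj = right, on_arr = right\<rparr> x x' w)"
        by (rule R.precomp_closed_lifts_after) (use w in simp_all)
      fix f assume f: "f \<in> Arr E" "Cod E f = base_obj D x"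
        "lifts_after E A B p (left x) (left x') (on_arr v w) f"
      obtain k l where kl: "is_cartesian E A k" "is_cartesian E C l" "on_arr p k = on_arr v l"
        "TCod A k = left x" "TCod C l = right x" "base_arr C l = f"
        by (rule ex_cartesian_pair[OF x f(1,2)])
      note k' = P.src.cartesian_Arr[OF kl(1)] and l' = V.src.cartesian_Arr[OF kl(2)]
      have bk: "base_arr A k = f" using P.base_Fun(2)[OF k'] V.base_Fun(2)[OF l'] kl by simp
      have la: "lifts_after E A B p (left x) (left x') (on_arr v w) (base_arr A k)" using f bk by simp
      obtain a where a: "a \<in> TArr A" "TDom A a = TDom A k" "TCod A a = left x'"
        "on_arr p a = on_arr v w \<cdot>\<^bsub>Total B\<^esub> on_arr p k"
        by (rule P.lifts_afterE[OF la kl(1,4)]) (use w x in simp_all)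
      have pa: "on_arr p a = on_arr v (w \<cdot>\<^bsub>Total C\<^esub> l)" using a(4) kl w l' by simp
      show "lifts_after E D C \<lparr>on_obj = right, on_arr = right\<rparr> x x' w f"
        by (rule R.lifts_afterI[OF cartesian_pair[OF kl(1-3)], of _ _ "pr a (w \<cdot>\<^bsub>Total C\<^esub> l)"])
          (use kl a(1-3) pa w l' in simp_all)
    qed (use D.Proj_simps(1)[OF x] in simp)
  qed
  moreover have "locally_essentially_surjective E J D C \<lparr>on_obj = right, on_arr = right\<rparr>"
    unfolding locally_essentially_surjective_def
  proof (intro ballI)
    fix y assume y: "y \<in> TObj C"
    have "locally E J (base_obj C y) (reached_along E A B p (on_obj v y))"
      using locally_essentially_surjectiveD[OF p(3), of "on_obj v y"] y by simp
    then show "locally E J (base_obj C y) (reached_along E D C \<lparr>on_obj = right, on_arr = right\<rparr> y)"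
    proof (rule locally_mono[OF _ _ R.precomp_closed_reached_along, rotated])
      fix f assume f: "f \<in> Arr E" "Cod E f = base_obj C y" "reached_along E A B p (on_obj v y) f"
      obtain x d where d: "x \<in> TObj A" "is_cartesian E B d" "d \<in> TArr B" "TDom B d = on_obj p x"
        "TCod B d = on_obj v y" "base_arr B d = f"
        using P.reached_alongE[OF f(3)] by metis
      obtain c where c: "is_cartesian E C c" "c \<in> TArr C" "TCod C c = y" "base_arr C c = f"
        using V.src.ex_cartesian[of y f] f y by auto
      \<comment> \<open>Two inverse images of the same object of \<open>B\<close>, one in the image
        of \<open>p\<close> and one in the image of \<open>v\<close>. Lifting \<open>i\<close> moves
        \<open>x\<close> to an object whose image under \<open>p\<close> is equal to that of
        \<open>TDom C c\<close>, hence to the left component of an object of the fibre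
        product.\<close>
      obtain i where i: "is_iso (Total B) i" "TDom B i = on_obj p x" "TCod B i = on_obj v (TDom C c)"
        using P.tgt.cartesian_unique[OF d(2) V.cartesian_Fun[OF c(1)]] c d by auto
      obtain \<alpha> where \<alpha>: "is_iso (Total A) \<alpha>" "TDom A \<alpha> = x" "on_arr p \<alpha> = i"
        using isofibrationE[OF isofibration d(1) i(1,2)] .
      have \<alpha>': "\<alpha> \<in> TArr A" using \<alpha>(1) by (simp add: is_iso_def)
      show "reached_along E D C \<lparr>on_obj = right, on_arr = right\<rparr> y f"
        by (rule R.reached_alongI[of "pr (TCod A \<alpha>) (TDom C c)" c])
          (use c \<alpha> \<alpha>' i P.Fun_simps(4)[OF \<alpha>'] in simp_all)
    qed (use y in simp)
  qed
  ultimately show ?thesis by (simp add: r.is_bicovering_iff)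
qed

end

section \<open>Path objects\<close>

definition vertical_iso :: "('o, 'm) precategory \<Rightarrow> ('o, 'm, 'x, 'y) fibration \<Rightarrow> 'y \<Rightarrow> bool" where
  "vertical_iso E F \<theta> \<longleftrightarrow> is_iso (Total F) \<theta> \<and> base_arr F \<theta> = Idt E (base_obj F (TDom F \<theta>))"

definition inverse_arrow :: "('o, 'm) precategory \<Rightarrow> 'm \<Rightarrow> 'm" where
  "inverse_arrow C f = (SOME g. g \<in> hom C (Cod C f) (Dom C f) \<and>
     g \<cdot>\<^bsub>C\<^esub> f = Idt C (Dom C f) \<and> f \<cdot>\<^bsub>C\<^esub> g = Idt C (Cod C f))"

lemma (in category) inverse_arrow:
  assumes "is_iso C f"
  shows "f \<in> Arr C" "inverse_arrow C f \<in> Arr C" "Dom C (inverse_arrow C f) = Cod C f"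
    "Cod C (inverse_arrow C f) = Dom C f" "inverse_arrow C f \<cdot> f = Idt C (Dom C f)"
    "f \<cdot> inverse_arrow C f = Idt C (Cod C f)" "is_iso C (inverse_arrow C f)"
proof -
  have "\<exists>g. g \<in> hom C (Cod C f) (Dom C f) \<and> g \<cdot> f = Idt C (Dom C f) \<and> f \<cdot> g = Idt C (Cod C f)"
    using assms by (auto simp: is_iso_def)
  from someI_ex[OF this]
  have *: "inverse_arrow C f \<in> hom C (Cod C f) (Dom C f) \<and>
      inverse_arrow C f \<cdot> f = Idt C (Dom C f) \<and> f \<cdot> inverse_arrow C f = Idt C (Cod C f)"
    by (simp add: inverse_arrow_def)
  show "f \<in> Arr C" using assms by (simp add: is_iso_def)
  with * show "inverse_arrow C f \<in> Arr C" "Dom C (inverse_arrow C f) = Cod C f"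
    "Cod C (inverse_arrow C f) = Dom C f" "inverse_arrow C f \<cdot> f = Idt C (Dom C f)"
    "f \<cdot> inverse_arrow C f = Idt C (Cod C f)" "is_iso C (inverse_arrow C f)"
    by (auto simp: hom_def intro!: is_isoI[of "inverse_arrow C f" f])
qed

text \<open>An arrow from \<open>\<theta>\<close> to \<open>\<theta>'\<close> is coded as \<open>(\<theta>, (a, \<theta>'))\<close> with \<open>a\<close> an arrow between the domains:
  the arrow between the codomains that completes the square is determined by these data.\<close>

abbreviation mid :: "'u \<Rightarrow> 'u" where
  "mid z \<equiv> left (right z)"

definition path_fibration :: "('u, 'u) precategory \<Rightarrow> ('u, 'u, 'u, 'u) fibration \<Rightarrow>
    ('u, 'u, 'u, 'u) fibration" where
  "path_fibration E F =
    \<lparr>Total =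
      \<lparr>Obj = {\<theta>. vertical_iso E F \<theta>},
       Arr = {z. vertical_iso E F (left z) \<and> vertical_iso E F (right (right z)) \<and> mid z \<in> TArr F \<and>
         TDom F (mid z) = TDom F (left z) \<and> TCod F (mid z) = TDom F (right (right z))},
       Dom = left,
       Cod = (\<lambda>z. right (right z)),
       Idt = (\<lambda>\<theta>. pr \<theta> (pr (TIdt F (TDom F \<theta>)) \<theta>)),
       Comp = (\<lambda>z w. pr (left w) (pr (mid z \<cdot>\<^bsub>Total F\<^esub> mid w) (right (right z))))\<rparr>,
     Proj = \<lparr>on_obj = (\<lambda>\<theta>. base_obj F (TDom F \<theta>)), on_arr = (\<lambda>z. base_arr F (mid z))\<rparr>\<rparr>"

lemma path_fibration_simps [simp]:
  "\<theta> \<in> TObj (path_fibration E F) \<longleftrightarrow> vertical_iso E F \<theta>"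
  "z \<in> TArr (path_fibration E F) \<longleftrightarrow> vertical_iso E F (left z) \<and>
    vertical_iso E F (right (right z)) \<and> mid z \<in> TArr F \<and>
    TDom F (mid z) = TDom F (left z) \<and> TCod F (mid z) = TDom F (right (right z))"
  "TDom (path_fibration E F) z = left z"
  "TCod (path_fibration E F) z = right (right z)"
  "TIdt (path_fibration E F) \<theta> = pr \<theta> (pr (TIdt F (TDom F \<theta>)) \<theta>)"
  "z \<cdot>\<^bsub>Total (path_fibration E F)\<^esub> w = pr (left w) (pr (mid z \<cdot>\<^bsub>Total F\<^esub> mid w) (right (right z)))"
  "base_obj (path_fibration E F) \<theta> = base_obj F (TDom F \<theta>)"
  "base_arr (path_fibration E F) z = base_arr F (mid z)"
  by (simp_all add: path_fibration_def)

text \<open>The fourth side of the square, obtained by conjugating the middle arrow with the paths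
  at its two ends.\<close>

definition target_arrow :: "('u, 'u, 'u, 'u) fibration \<Rightarrow> 'u \<Rightarrow> 'u" where
  "target_arrow F z = right (right z) \<cdot>\<^bsub>Total F\<^esub> (mid z \<cdot>\<^bsub>Total F\<^esub> inverse_arrow (Total F) (left z))"

definition path_source :: "('u, 'u, 'u, 'u) fibration \<Rightarrow> ('u, 'u, 'u, 'u) functor_data" where
  "path_source F = \<lparr>on_obj = TDom F, on_arr = mid\<rparr>"

definition path_target :: "('u, 'u, 'u, 'u) fibration \<Rightarrow> ('u, 'u, 'u, 'u) functor_data" where
  "path_target F = \<lparr>on_obj = TCod F, on_arr = target_arrow F\<rparr>"

definition constant_path :: "('u, 'u, 'u, 'u) fibration \<Rightarrow> ('u, 'u, 'u, 'u) functor_data" where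
  "constant_path F = \<lparr>on_obj = TIdt F, on_arr = (\<lambda>a. pr (TIdt F (TDom F a)) (pr a (TIdt F (TCod F a))))\<rparr>"

lemma path_functor_simps [simp]:
  "on_obj (path_source F) = TDom F" "on_arr (path_source F) = mid"
  "on_obj (path_target F) = TCod F" "on_arr (path_target F) = target_arrow F"
  "on_obj (constant_path F) = TIdt F"
  "on_arr (constant_path F) a = pr (TIdt F (TDom F a)) (pr a (TIdt F (TCod F a)))"
  by (simp_all add: path_source_def path_target_def constant_path_def)

locale path_object = fibration_over E F
  for E :: "('u::infinite, 'u) precategory" and F :: "('u, 'u, 'u, 'u) fibration"
begin

abbreviation "H \<equiv> path_fibration E F"

lemma vertical_isoD:
  assumes "vertical_iso E F \<theta>"
  shows "is_iso (Total F) \<theta>" "\<theta> \<in> TArr F" "TDom F \<theta> \<in> TObj F" "TCod F \<theta> \<in> TObj F"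
    "base_obj F (TCod F \<theta>) = base_obj F (TDom F \<theta>)" "base_arr F \<theta> = Idt E (base_obj F (TDom F \<theta>))"
proof -
  show 1: "is_iso (Total F) \<theta>" and 2: "base_arr F \<theta> = Idt E (base_obj F (TDom F \<theta>))"
    using assms by (auto simp: vertical_iso_def)
  from 1 show 3: "\<theta> \<in> TArr F" by (simp add: is_iso_def)
  then show "TDom F \<theta> \<in> TObj F" "TCod F \<theta> \<in> TObj F" by simp_all
  show "base_obj F (TCod F \<theta>) = base_obj F (TDom F \<theta>)"
    using Proj_simps(4)[OF 3] 2 3 by simp
qed

lemma inverse_vertical:
  assumes "vertical_iso E F \<theta>"
  shows "inverse_arrow (Total F) \<theta> \<in> TArr F" "TDom F (inverse_arrow (Total F) \<theta>) = TCod F \<theta>"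
    "TCod F (inverse_arrow (Total F) \<theta>) = TDom F \<theta>"
    "inverse_arrow (Total F) \<theta> \<cdot>\<^bsub>Total F\<^esub> \<theta> = TIdt F (TDom F \<theta>)"
    "\<theta> \<cdot>\<^bsub>Total F\<^esub> inverse_arrow (Total F) \<theta> = TIdt F (TCod F \<theta>)"
    "is_iso (Total F) (inverse_arrow (Total F) \<theta>)"
    "base_arr F (inverse_arrow (Total F) \<theta>) = Idt E (base_obj F (TDom F \<theta>))"
proof -
  note v = vertical_isoD[OF assms]
  note i = total.inverse_arrow[OF v(1)]
  show "inverse_arrow (Total F) \<theta> \<in> TArr F" "TDom F (inverse_arrow (Total F) \<theta>) = TCod F \<theta>"
    "TCod F (inverse_arrow (Total F) \<theta>) = TDom F \<theta>"
    "inverse_arrow (Total F) \<theta> \<cdot>\<^bsub>Total F\<^esub> \<theta> = TIdt F (TDom F \<theta>)"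
    "\<theta> \<cdot>\<^bsub>Total F\<^esub> inverse_arrow (Total F) \<theta> = TIdt F (TCod F \<theta>)"
    "is_iso (Total F) (inverse_arrow (Total F) \<theta>)" by (rule i)+
  show "base_arr F (inverse_arrow (Total F) \<theta>) = Idt E (base_obj F (TDom F \<theta>))"
    using Proj_simps(6)[of \<theta> "inverse_arrow (Total F) \<theta>"] i v Proj_simps(3)[OF i(2)] by simp
qed

lemma vertical_iso_Idt [simp]: "x \<in> TObj F \<Longrightarrow> vertical_iso E F (TIdt F x)"
  by (simp add: vertical_iso_def total.is_iso_Idt)

lemma category_path: "category (Total H)"
proof (rule category.intro)
  show "TDom H f \<in> TObj H" "TCod H f \<in> TObj H" if "f \<in> TArr H" for f using that by auto
next
  fix a assume "a \<in> TObj H"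
  then show "TIdt H a \<in> hom (Total H) a a" using vertical_isoD[of a] by (simp add: hom_def)
next
  fix f g a b c assume "f \<in> hom (Total H) a b" "g \<in> hom (Total H) b c"
  then show "g \<cdot>\<^bsub>Total H\<^esub> f \<in> hom (Total H) a c" by (auto simp: hom_def)
next
  fix f a b assume "f \<in> hom (Total H) a b"
  then show "f \<cdot>\<^bsub>Total H\<^esub> TIdt H a = f" "TIdt H b \<cdot>\<^bsub>Total H\<^esub> f = f"
    by (auto simp: hom_def)
next
  fix f g h a b c d
  assume "f \<in> hom (Total H) a b" "g \<in> hom (Total H) b c" "h \<in> hom (Total H) c d"
  then show "h \<cdot>\<^bsub>Total H\<^esub> g \<cdot>\<^bsub>Total H\<^esub> f = h \<cdot>\<^bsub>Total H\<^esub> (g \<cdot>\<^bsub>Total H\<^esub> f)"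
    by (auto simp: hom_def)
qed

text \<open>An arrow of paths with given ends is nothing but its middle component, so factorizations
  of arrows of paths are factorizations of middle components.\<close>

lemma path_cartesianI:
  assumes z: "z \<in> TArr H" and m: "is_cartesian E F (mid z)"
  shows "is_cartesian E H z"
  unfolding is_cartesian_def
proof (intro conjI allI ballI impI z)
  fix y g h assume g: "g \<in> hom (Total H) y (TCod H z)"
    and h: "h \<in> hom E (base_obj H y) (base_obj H (TDom H z))"
    and gh: "base_arr H g = base_arr H z \<cdot>\<^bsub>E\<^esub> h"
  have g': "vertical_iso E F y" "mid g \<in> TArr F" "TDom F (mid g) = TDom F y"
    "TCod F (mid g) = TDom F (right (right z))" "left g = y" "right (right g) = right (right z)"
    using g by (auto simp: hom_def)
  have z': "vertical_iso E F (left z)" "vertical_iso E F (right (right z))" "mid z \<in> TArr F"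
    "TDom F (mid z) = TDom F (left z)" "TCod F (mid z) = TDom F (right (right z))"
    using z by auto
  obtain k where k: "k \<in> TArr F" "TDom F k = TDom F y" "TCod F k = TDom F (left z)" "base_arr F k = h"
    "mid z \<cdot>\<^bsub>Total F\<^esub> k = mid g"
    using cartesian_factor[OF m g'(2), of h] g' z' h gh by (auto simp: hom_def)
  show "\<exists>!k. k \<in> hom (Total H) y (TDom H z) \<and> base_arr H k = h \<and> z \<cdot>\<^bsub>Total H\<^esub> k = g"
  proof (rule ex1I[of _ "pr y (pr k (left z))"])
    have "pr y (pr (mid g) (right (right z))) = g"
      by - (rule pairing_eqI, simp add: g', rule pairing_eqI, simp_all add: g')
    then show "pr y (pr k (left z)) \<in> hom (Total H) y (TDom H z) \<and> base_arr H (pr y (pr k (left z))) = h \<and>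
        z \<cdot>\<^bsub>Total H\<^esub> pr y (pr k (left z)) = g"
      using k g' z' by (simp add: hom_def)
    fix j assume j: "j \<in> hom (Total H) y (TDom H z) \<and> base_arr H j = h \<and> z \<cdot>\<^bsub>Total H\<^esub> j = g"
    then have j': "left j = y" "right (right j) = left z" "mid j \<in> TArr F" "TDom F (mid j) = TDom F y"
      "TCod F (mid j) = TDom F (left z)" "base_arr F (mid j) = h" "mid z \<cdot>\<^bsub>Total F\<^esub> mid j = mid g"
      by (auto simp: hom_def)
    have "mid j = k" by (rule cartesian_cancel[OF m]) (use j' k z' in simp_all)
    then show "j = pr y (pr k (left z))"
      by - (rule pairing_eqI, simp add: j', rule pairing_eqI, simp_all add: j')
  qed
qed

lemma is_functor_path_Proj: "is_functor (Total H) E (Proj H)"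
proof (rule is_functorI)
  fix a assume a: "a \<in> TObj H"
  then show "base_obj H a \<in> Obj E" using vertical_isoD[of a] by simp
  show "base_arr H (TIdt H a) = Idt E (base_obj H a)" using a vertical_isoD[of a] by simp
qed auto

lemma ex_path_cartesian:
  assumes \<theta>: "vertical_iso E F \<theta>" and f: "f \<in> Arr E" "Cod E f = base_obj F (TDom F \<theta>)"
  obtains z where "z \<in> TArr H" "is_cartesian E H z" "is_cartesian E F (mid z)" "TCod H z = \<theta>" "base_arr H z = f"
proof -
  obtain c where c: "is_cartesian E F c" "c \<in> TArr F" "TCod F c = TDom F \<theta>" "base_arr F c = f"
    using ex_cartesian[of "TDom F \<theta>" f] f vertical_isoD[OF \<theta>] by auto
  \<comment> \<open>The constant path serves as domain of the lift: an arrow of paths constrains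
    only the sources of the paths, so any path starting at \<open>TDom F c\<close> would do.\<close>
  have "pr (TIdt F (TDom F c)) (pr c \<theta>) \<in> TArr H" using c \<theta> by simp
  then show thesis
    using that[of "pr (TIdt F (TDom F c)) (pr c \<theta>)"] path_cartesianI c by simp
qed

lemma is_fibration_path: "is_fibration E H"
  unfolding is_fibration_def
proof (intro conjI ballI impI)
  fix \<theta> f assume "\<theta> \<in> TObj H" "f \<in> Arr E" "Cod E f = base_obj H \<theta>"
  then show "\<exists>c. is_cartesian E H c \<and> TCod H c = \<theta> \<and> base_arr H c = f"
    using ex_path_cartesian[of \<theta> f] by simp metis
qed (fact category_path is_functor_path_Proj)+

sublocale path: fibration_over E H
  by unfold_locales (rule is_fibration_path)

lemma is_functor_path_source: "is_functor (Total H) (Total F) (path_source F)"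
proof (rule is_functorI)
  show "on_obj (path_source F) a \<in> TObj F" if "a \<in> TObj H" for a using that vertical_isoD[of a] by simp
qed auto

text \<open>A cartesian arrow of paths differs by an isomorphism from the lift built in
  \<open>ex_path_cartesian\<close>, whose middle component is cartesian.\<close>

lemma path_cartesian_mid:
  assumes z: "is_cartesian E H z"
  shows "is_cartesian E F (mid z)"
proof -
  have z': "z \<in> TArr H" by (rule path.cartesian_Arr[OF z])
  obtain w where w: "w \<in> TArr H" "is_cartesian E H w" "is_cartesian E F (mid w)" "TCod H w = TCod H z"
    "base_arr H w = base_arr H z"
    by (rule ex_path_cartesian[of "TCod H z" "base_arr H z"]) (use z' in simp_all)
  obtain i where i: "is_iso (Total H) i" "i \<in> TArr H" "TCod H i = TDom H w" "w \<cdot>\<^bsub>Total H\<^esub> i = z"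
    using path.cartesian_unique[OF z w(2)] w(4,5) by metis
  have "is_iso (Total F) (mid i)"
    using functor_iso[OF category_path total.category_axioms is_functor_path_source i(1)] by simp
  moreover have "mid z = mid w \<cdot>\<^bsub>Total F\<^esub> mid i" using i(4) by auto
  moreover have "TCod F (mid i) = TDom F (mid w)" using i w by simp
  ultimately show ?thesis using cartesian_comp[OF w(3) iso_cartesian] by simp
qed

lemma path_source_functor: "cartesian_functor E H F (path_source F)"
  by (rule cartesian_functorI)
    (use is_functor_path_source path_cartesian_mid path.fibration_over_axioms fibration_over_axioms in auto)

lemma target_arrow:
  assumes z: "z \<in> TArr H"
  shows "target_arrow F z \<in> TArr F" "TDom F (target_arrow F z) = TCod F (left z)"
    "TCod F (target_arrow F z) = TCod F (right (right z))" "base_arr F (target_arrow F z) = base_arr F (mid z)"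
proof -
  have z': "vertical_iso E F (left z)" "vertical_iso E F (right (right z))" "mid z \<in> TArr F"
    "TDom F (mid z) = TDom F (left z)" "TCod F (mid z) = TDom F (right (right z))"
    using z by auto
  note l = vertical_isoD[OF z'(1)] inverse_vertical[OF z'(1)] and r = vertical_isoD[OF z'(2)]
  show "target_arrow F z \<in> TArr F" "TDom F (target_arrow F z) = TCod F (left z)"
    "TCod F (target_arrow F z) = TCod F (right (right z))" "base_arr F (target_arrow F z) = base_arr F (mid z)"
    using l(2,7-9,13) r(2,6) z'(3-5) by (simp_all add: target_arrow_def)
qed

text \<open>Composites are preserved because the path in the middle cancels its inverse; cartesian
  arrows are preserved because the middle component is cartesian and is composed with
  isomorphisms.\<close>

lemma path_target_functor: "cartesian_functor E H F (path_target F)"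
proof (rule cartesian_functorI)
  show "is_functor (Total H) (Total F) (path_target F)"
  proof (rule is_functorI)
    fix a assume a: "a \<in> TObj H"
    then have v: "vertical_iso E F a" by simp
    show "on_obj (path_target F) a \<in> TObj F" using vertical_isoD[OF v] by simp
    show "on_arr (path_target F) (TIdt H a) = TIdt F (on_obj (path_target F) a)"
      using vertical_isoD[OF v] inverse_vertical[OF v] by (simp add: target_arrow_def)
  next
    fix f g assume f: "f \<in> TArr H" and g: "g \<in> TArr H" and fg: "TCod H f = TDom H g"
    have f': "vertical_iso E F (left f)" "vertical_iso E F (right (right f))" "mid f \<in> TArr F"
      "TDom F (mid f) = TDom F (left f)" "TCod F (mid f) = TDom F (right (right f))"
      using f by auto
    have g': "left g = right (right f)" "vertical_iso E F (right (right g))" "mid g \<in> TArr F"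
      "TDom F (mid g) = TDom F (right (right f))" "TCod F (mid g) = TDom F (right (right g))"
      using g fg by auto
    note vf = inverse_vertical[OF f'(1)] and vm = vertical_isoD[OF f'(2)] inverse_vertical[OF f'(2)]
      and vg = vertical_isoD[OF g'(2)]
    \<comment> \<open>The path at which \<open>f\<close> ends and \<open>g\<close> begins occurs
      once inverted and once not.\<close>
    have "inverse_arrow (Total F) (right (right f)) \<cdot>\<^bsub>Total F\<^esub> (right (right f) \<cdot>\<^bsub>Total F\<^esub>
        (mid f \<cdot>\<^bsub>Total F\<^esub> inverse_arrow (Total F) (left f))) =
        mid f \<cdot>\<^bsub>Total F\<^esub> inverse_arrow (Total F) (left f)"
      using total.comp_reassoc[OF vm(10), of "mid f \<cdot>\<^bsub>Total F\<^esub> inverse_arrow (Total F) (left f)"]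
        vm(2,7-9) f'(3-5) vf(1-3) by simp
    then show "on_arr (path_target F) (g \<cdot>\<^bsub>Total H\<^esub> f) =
        on_arr (path_target F) g \<cdot>\<^bsub>Total F\<^esub> on_arr (path_target F) f"
      using vf(1-3) vm(2,7-9) vg(2) f'(3-5) g'(3-5) by (simp add: target_arrow_def g'(1))
  qed (use target_arrow in simp_all)
next
  show "base_obj F (on_obj (path_target F) x) = base_obj H x" if "x \<in> TObj H" for x
    using that vertical_isoD[of x] by simp
  fix c assume c: "is_cartesian E H c"
  have c': "c \<in> TArr H" by (rule path.cartesian_Arr[OF c])
  have z': "vertical_iso E F (left c)" "vertical_iso E F (right (right c))" "mid c \<in> TArr F"
    "TDom F (mid c) = TDom F (left c)" "TCod F (mid c) = TDom F (right (right c))"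
    using c' by auto
  note l = inverse_vertical[OF z'(1)] and r = vertical_isoD[OF z'(2)]
  have "is_cartesian E F (mid c \<cdot>\<^bsub>Total F\<^esub> inverse_arrow (Total F) (left c))"
    by (rule cartesian_comp[OF path_cartesian_mid[OF c] iso_cartesian[OF l(6)]]) (use l z' in simp)
  then show "is_cartesian E F (on_arr (path_target F) c)"
    unfolding path_functor_simps target_arrow_def
    by (intro cartesian_comp[OF iso_cartesian[OF r(1)]]) (use l z' in simp_all)
qed (use target_arrow path.fibration_over_axioms fibration_over_axioms in simp_all)

lemma constant_path_functor: "cartesian_functor E F H (constant_path F)"
proof (rule cartesian_functorI)
  show "is_functor (Total F) (Total H) (constant_path F)"
    by (rule is_functorI) simp_all
  show "is_cartesian E H (on_arr (constant_path F) c)" if "is_cartesian E F c" for c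
    using cartesian_Arr[OF that] that by (intro path_cartesianI) simp_all
qed (simp_all add: path.fibration_over_axioms fibration_over_axioms)

lemma target_constant: "a \<in> TArr F \<Longrightarrow> target_arrow F (on_arr (constant_path F) a) = a"
proof -
  assume a: "a \<in> TArr F"
  then have v: "vertical_iso E F (TIdt F (TDom F a))" by simp
  note i = inverse_vertical[OF v]
  have "inverse_arrow (Total F) (TIdt F (TDom F a)) = TIdt F (TDom F a)"
    using i(1,2,4) a by simp
  then show "target_arrow F (on_arr (constant_path F) a) = a" using a by (simp add: target_arrow_def)
qed

text \<open>Between two given paths, arrows correspond bijectively to arrows between their sources,
  by the very coding of arrows; and each object is the source of its constant path.\<close>

lemma path_source_bicovering:
  assumes "site E J"
  shows "is_bicovering E J H F (path_source F)"
proof -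
  interpret site E J by (rule assms)
  interpret s: cartesian_functor E H F "path_source F" by (rule path_source_functor)
  interpret s: site_functor E J H F "path_source F" by unfold_locales
  show ?thesis
  proof (rule s.bicovering_of_equivalence)
    fix a b assume "TDom H a = TDom H b" "TCod H a = TCod H b" "on_arr (path_source F) a = on_arr (path_source F) b"
    then show "a = b" by - (rule pairing_eqI, simp, rule pairing_eqI, simp_all)
  next
    fix x x' w assume "x \<in> TObj H" "x' \<in> TObj H" "w \<in> TArr F" "TDom F w = on_obj (path_source F) x"
      "TCod F w = on_obj (path_source F) x'"
    then show "\<exists>a\<in>TArr H. TDom H a = x \<and> TCod H a = x' \<and> on_arr (path_source F) a = w"
      by (intro bexI[of _ "pr x (pr w x')"]) simp_all
  next
    fix y assume "y \<in> TObj F"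
    then show "\<exists>x\<in>TObj H. on_obj (path_source F) x = y" by (intro bexI[of _ "TIdt F y"]) simp_all
  qed
qed

text \<open>Isomorphisms out of the two ends of a path transport the path: it is conjugated by them.
  Verticality of the result holds since the two isomorphisms have the same base arrow.\<close>

lemma path_isofibration:
  "is_isofibration (Total H) (Total (fibre_product F F (Proj F) (Proj F)))
    \<lparr>on_obj = \<lambda>\<theta>. pr (TDom F \<theta>) (TCod F \<theta>), on_arr = \<lambda>z. pr (mid z) (target_arrow F z)\<rparr>"
  (is "is_isofibration _ (Total ?Q) ?k")
  unfolding is_isofibration_def
proof (intro ballI allI impI, elim conjE)
  fix \<theta> \<xi> assume "\<theta> \<in> TObj H" and \<xi>: "is_iso (Total ?Q) \<xi>" "TDom ?Q \<xi> = on_obj ?k \<theta>"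
  then have \<theta>: "vertical_iso E F \<theta>" by simp
  note v = vertical_isoD[OF \<theta>] and vi = inverse_vertical[OF \<theta>]
  have iso: "is_iso (Total F) (left \<xi>)" "is_iso (Total F) (right \<xi>)" "base_arr F (left \<xi>) = base_arr F (right \<xi>)"
    using \<xi>(1) unfolding is_iso_def by (force simp: hom_def)+
  have dom: "TDom F (left \<xi>) = TDom F \<theta>" "TDom F (right \<xi>) = TCod F \<theta>" using \<xi>(2) by simp_all
  define \<beta> where "\<beta> = inverse_arrow (Total F) (left \<xi>)"
  note l = total.inverse_arrow[OF iso(1), folded \<beta>_def] and r = total.inverse_arrow[OF iso(2)]
  \<comment> \<open>The only choice: \<open>right \<xi>\<close> has to become the fourth side of the
    square with sides \<theta> and \<open>left \<xi>\<close>.\<close>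
  define \<theta>' where "\<theta>' = right \<xi> \<cdot>\<^bsub>Total F\<^esub> (\<theta> \<cdot>\<^bsub>Total F\<^esub> \<beta>)"
  have \<theta>': "\<theta>' \<in> TArr F" "TDom F \<theta>' = TCod F (left \<xi>)" "TCod F \<theta>' = TCod F (right \<xi>)"
    using l r dom v by (simp_all add: \<theta>'_def)
  have "is_iso (Total F) \<theta>'"
    unfolding \<theta>'_def
    by (intro total.is_iso_Comp) (use l r dom v iso in simp_all)
  moreover have "base_arr F \<theta>' = Idt E (base_obj F (TDom F \<theta>'))"
  proof -
    have "base_arr F \<theta>' = base_arr F (left \<xi>) \<cdot>\<^bsub>E\<^esub> base_arr F \<beta>"
      using l r dom v by (simp add: \<theta>'_def iso(3))
    also have "\<dots> = base_arr F (TIdt F (TCod F (left \<xi>)))"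
      unfolding l(6)[symmetric] using l(1-4) by simp
    finally show ?thesis using l \<theta>' by simp
  qed
  ultimately have v': "vertical_iso E F \<theta>'" by (simp add: vertical_iso_def)
  have "is_iso (Total H) (pr \<theta> (pr (left \<xi>) \<theta>'))"
    by (rule path.total.is_isoI[of _ "pr \<theta>' (pr \<beta> \<theta>)"]) (use l \<theta> v' \<theta>' dom in simp_all)
  moreover have "target_arrow F (pr \<theta> (pr (left \<xi>) \<theta>')) = right \<xi>"
  proof -
    have "\<beta> \<cdot>\<^bsub>Total F\<^esub> (left \<xi> \<cdot>\<^bsub>Total F\<^esub> inverse_arrow (Total F) \<theta>) = inverse_arrow (Total F) \<theta>"
      using total.comp_reassoc[OF l(5), of "inverse_arrow (Total F) \<theta>"] l(1-4) vi dom by simp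
    then show ?thesis
      using l(1-4) r(1) v vi dom by (simp add: target_arrow_def \<theta>'_def)
  qed
  ultimately show "\<exists>\<alpha>. is_iso (Total H) \<alpha> \<and> TDom H \<alpha> = \<theta> \<and> on_arr ?k \<alpha> = \<xi>"
    by (intro exI[of _ "pr \<theta> (pr (left \<xi>) \<theta>')"]) simp
qed

end

section \<open>Brown's axioms\<close>

context category
begin

lemma is_pullbackD:
  assumes "is_pullback C p v v' p'"
  shows "p \<in> Arr C" "v \<in> Arr C" "v' \<in> Arr C" "p' \<in> Arr C" "Cod C p = Cod C v"
    "Cod C v' = Dom C p" "Cod C p' = Dom C v" "Dom C v' = Dom C p'" "p \<cdot> v' = v \<cdot> p'"
  using assms by (auto simp: is_pullback_def)

lemma pullback_factor:
  assumes "is_pullback C p v v' p'" "f \<in> hom C x (Dom C p)" "g \<in> hom C x (Dom C v)" "p \<cdot> f = v \<cdot> g"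
  obtains k where "k \<in> hom C x (Dom C v')" "v' \<cdot> k = f" "p' \<cdot> k = g"
  using assms unfolding is_pullback_def by metis

lemma pullback_cancel:
  assumes pb: "is_pullback C p v v' p'" and k: "k \<in> hom C x (Dom C v')" "k' \<in> hom C x (Dom C v')"
    and eq: "v' \<cdot> k = v' \<cdot> k'" "p' \<cdot> k = p' \<cdot> k'"
  shows "k = k'"
proof -
  note d = is_pullbackD[OF pb]
  have "v' \<cdot> k \<in> hom C x (Dom C p)" "p' \<cdot> k \<in> hom C x (Dom C v)"
    using d k by (auto simp: hom_def)
  moreover have "p \<cdot> (v' \<cdot> k) = v \<cdot> (p' \<cdot> k)"
    using comp_reassoc[OF d(9), of k] d k by (simp add: hom_def)
  ultimately have "\<exists>!j. j \<in> hom C x (Dom C v') \<and> v' \<cdot> j = v' \<cdot> k \<and> p' \<cdot> j = p' \<cdot> k"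
    using pb unfolding is_pullback_def by blast
  then show ?thesis using k eq by metis
qed

text \<open>The stability axioms concern every pullback square, while properties are proved for one
  construction; precomposition with this isomorphism passes from one to the other.\<close>

lemma pullback_iso:
  assumes 1: "is_pullback C p v v1 p1" and 2: "is_pullback C p v v2 p2"
  obtains i where "is_iso C i" "i \<in> hom C (Dom C p2) (Dom C p1)" "p2 = p1 \<cdot> i"
proof -
  note d1 = is_pullbackD[OF 1] and d2 = is_pullbackD[OF 2]
  obtain i where i: "i \<in> hom C (Dom C v2) (Dom C v1)" "v1 \<cdot> i = v2" "p1 \<cdot> i = p2"
    by (rule pullback_factor[OF 1, of v2 "Dom C v2" p2]) (use d2 in \<open>simp_all add: hom_def\<close>)
  obtain j where j: "j \<in> hom C (Dom C v1) (Dom C v2)" "v2 \<cdot> j = v1" "p2 \<cdot> j = p1"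
    by (rule pullback_factor[OF 2, of v1 "Dom C v1" p1]) (use d1 in \<open>simp_all add: hom_def\<close>)
  note h = homD[OF i(1)] homD[OF j(1)]
  have "i \<cdot> j = Idt C (Dom C v1)"
  proof (rule pullback_cancel[OF 1, of _ "Dom C v1"])
    show "v1 \<cdot> (i \<cdot> j) = v1 \<cdot> Idt C (Dom C v1)"
      using comp_reassoc[OF i(2), of j] h d1(3) j(2) by simp
    show "p1 \<cdot> (i \<cdot> j) = p1 \<cdot> Idt C (Dom C v1)"
      using comp_reassoc[OF i(3), of j] h d1(4,8) j(3) by simp
  qed (use h d1(3) in \<open>simp_all add: hom_def\<close>)
  moreover have "j \<cdot> i = Idt C (Dom C v2)"
  proof (rule pullback_cancel[OF 2, of _ "Dom C v2"])
    show "v2 \<cdot> (j \<cdot> i) = v2 \<cdot> Idt C (Dom C v2)"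
      using comp_reassoc[OF j(2), of i] h d2(3) i(2) by simp
    show "p2 \<cdot> (j \<cdot> i) = p2 \<cdot> Idt C (Dom C v2)"
      using comp_reassoc[OF j(3), of i] h d2(4,8) i(3) by simp
  qed (use h d2(3) in \<open>simp_all add: hom_def\<close>)
  ultimately have "is_iso C i" using h by (intro is_isoI[of i j]) simp_all
  then show thesis
  proof (rule that)
    show "i \<in> hom C (Dom C p2) (Dom C p1)" using i(1) unfolding d1(8) d2(8) .
    show "p2 = p1 \<cdot> i" using i(3) by (rule sym)
  qed
qed

text \<open>A product of two objects without an indexed family, which suits both pullbacks over the
  terminal object and the induction for finite products.\<close>

definition binary_product :: "'o \<Rightarrow> 'o \<Rightarrow> 'o \<Rightarrow> 'm \<Rightarrow> 'm \<Rightarrow> bool" where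
  "binary_product a b q l r \<longleftrightarrow> l \<in> hom C q a \<and> r \<in> hom C q b \<and>
    (\<forall>x. \<forall>f\<in>hom C x a. \<forall>g\<in>hom C x b. \<exists>!k. k \<in> hom C x q \<and> l \<cdot> k = f \<and> r \<cdot> k = g)"

text \<open>Over a terminal object every pair of arrows makes the square commute.\<close>

lemma binary_product_of_pullback:
  assumes t: "is_terminal C t" and p: "p \<in> hom C a t" "q \<in> hom C b t" and pb: "is_pullback C p q l r"
  shows "binary_product a b (Dom C l) l r"
proof -
  note d = is_pullbackD[OF pb] and p' = homD[OF p(1)] and q' = homD[OF p(2)]
  have "\<exists>!k. k \<in> hom C x (Dom C l) \<and> l \<cdot> k = f \<and> r \<cdot> k = g"
    if f: "f \<in> hom C x a" and g: "g \<in> hom C x b" for x f g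
  proof -
    have "p \<cdot> f \<in> hom C x t" "q \<cdot> g \<in> hom C x t" using Comp_in_hom f g p by auto
    moreover have "x \<in> Obj C" using hom_Obj(1)[OF f] .
    ultimately have "p \<cdot> f = q \<cdot> g" using t unfolding is_terminal_def by blast
    then show ?thesis
      using pb f g p' q' unfolding is_pullback_def by blast
  qed
  then show ?thesis using d p' q' by (simp add: binary_product_def hom_def)
qed

lemma is_product_factor:
  assumes "is_product C I X P \<pi>" "a \<in> Obj C" "\<And>i. i \<in> I \<Longrightarrow> f i \<in> hom C a (X i)"
  shows "\<exists>!k. k \<in> hom C a P \<and> (\<forall>i\<in>I. \<pi> i \<cdot> k = f i)"
  using assms unfolding is_product_def by blast

lemma finite_products:
  assumes t: "is_terminal C t"
    and bin: "\<And>a b. \<lbrakk>a \<in> Obj C; b \<in> Obj C\<rbrakk> \<Longrightarrow> \<exists>q l r. binary_product a b q l r"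
    and X: "\<And>i. i < n \<Longrightarrow> X i \<in> Obj C"
  shows "\<exists>P \<pi>. is_product C {..<n::nat} X P \<pi>"
  using X
proof (induction n)
  case 0
  then show ?case using t by (auto simp: is_product_def is_terminal_def)
next
  case (Suc n)
  then obtain P \<pi> where P: "is_product C {..<n} X P \<pi>" by fastforce
  then have PO: "P \<in> Obj C" and \<pi>: "\<And>i. i < n \<Longrightarrow> \<pi> i \<in> hom C P (X i)"
    by (auto simp: is_product_def)
  obtain q l r where q: "binary_product P (X n) q l r" using bin[OF PO] Suc.prems by blast
  then have l: "l \<in> hom C q P" and r: "r \<in> hom C q (X n)"
    and q_univ: "\<And>x f g. \<lbrakk>f \<in> hom C x P; g \<in> hom C x (X n)\<rbrakk>
      \<Longrightarrow> \<exists>!k. k \<in> hom C x q \<and> l \<cdot> k = f \<and> r \<cdot> k = g"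
    by (auto simp: binary_product_def)
  define \<rho> where "\<rho> = (\<lambda>i. if i < n then \<pi> i \<cdot> l else r)"
  have "is_product C {..<Suc n} X q \<rho>"
    unfolding is_product_def
  proof (intro conjI ballI allI impI)
    show "q \<in> Obj C" using hom_Obj(1)[OF l] .
    show "\<rho> i \<in> hom C q (X i)" if "i \<in> {..<Suc n}" for i
      using that Comp_in_hom[OF l \<pi>] r by (auto simp: \<rho>_def less_Suc_eq)
    fix a f assume a: "a \<in> Obj C" and f: "\<forall>i\<in>{..<Suc n}. f i \<in> hom C a (X i)"
    have "\<exists>!k. k \<in> hom C a P \<and> (\<forall>i\<in>{..<n}. \<pi> i \<cdot> k = f i)"
      by (rule is_product_factor[OF P a]) (use f in simp)
    then obtain k1 where k1: "k1 \<in> hom C a P" "\<And>i. i < n \<Longrightarrow> \<pi> i \<cdot> k1 = f i"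
      and k1_unique: "\<And>k. \<lbrakk>k \<in> hom C a P; \<And>i. i < n \<Longrightarrow> \<pi> i \<cdot> k = f i\<rbrakk> \<Longrightarrow> k = k1"
      unfolding Ball_def lessThan_iff by metis
    have fn: "f n \<in> hom C a (X n)" using f by simp
    obtain k where k: "k \<in> hom C a q" "l \<cdot> k = k1" "r \<cdot> k = f n"
      and k_unique: "\<And>k'. \<lbrakk>k' \<in> hom C a q; l \<cdot> k' = k1; r \<cdot> k' = f n\<rbrakk> \<Longrightarrow> k' = k"
      using q_univ[OF k1(1) fn] by metis
    have assoc: "(\<pi> i \<cdot> l) \<cdot> j = \<pi> i \<cdot> (l \<cdot> j)" if "i < n" "j \<in> hom C a q" for i j
      using Comp_assoc[OF that(2) l \<pi>[OF that(1)]] .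
    show "\<exists>!k. k \<in> hom C a q \<and> (\<forall>i\<in>{..<Suc n}. \<rho> i \<cdot> k = f i)"
    proof (rule ex1I[of _ k])
      show "k \<in> hom C a q \<and> (\<forall>i\<in>{..<Suc n}. \<rho> i \<cdot> k = f i)"
        using k k1 assoc[OF _ k(1)] by (auto simp: \<rho>_def less_Suc_eq)
      fix j assume j: "j \<in> hom C a q \<and> (\<forall>i\<in>{..<Suc n}. \<rho> i \<cdot> j = f i)"
      then have "\<pi> i \<cdot> (l \<cdot> j) = f i" if "i < n" for i
        using assoc[OF that, of j] that by (auto simp: \<rho>_def dest!: bspec[of _ _ i])
      moreover have "l \<cdot> j \<in> hom C a P" using Comp_in_hom[OF _ l] j by blast
      ultimately have "l \<cdot> j = k1" using k1_unique by blast
      moreover have "r \<cdot> j = f n" using j by (auto simp: \<rho>_def dest!: bspec[of _ _ n])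
      ultimately show "j = k" using k_unique j by blast
    qed
  qed
  then show ?case by blast
qed

text \<open>The diagonal axiom starts from an arbitrary product of \<open>b\<close> with itself;
  this compares it with a constructed one.\<close>

lemma binary_product_iso:
  assumes q: "binary_product b b q l r" and P: "is_product C {..<2::nat} (\<lambda>_. b) P \<pi>"
  obtains j where "is_iso C j" "j \<in> hom C q P" "\<pi> 0 \<cdot> j = l" "\<pi> 1 \<cdot> j = r"
proof -
  have l: "l \<in> hom C q b" and r: "r \<in> hom C q b"
    and q_univ: "\<And>x f g. \<lbrakk>f \<in> hom C x b; g \<in> hom C x b\<rbrakk>
      \<Longrightarrow> \<exists>!k. k \<in> hom C x q \<and> l \<cdot> k = f \<and> r \<cdot> k = g"
    using q by (auto simp: binary_product_def)
  have \<pi>: "\<pi> 0 \<in> hom C P b" "\<pi> 1 \<in> hom C P b"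
    and univ: "\<And>a f g. \<lbrakk>f \<in> hom C a b; g \<in> hom C a b\<rbrakk>
      \<Longrightarrow> \<exists>!k. k \<in> hom C a P \<and> \<pi> 0 \<cdot> k = f \<and> \<pi> 1 \<cdot> k = g"
  proof -
    show "\<pi> 0 \<in> hom C P b" "\<pi> 1 \<in> hom C P b" using P by (auto simp: is_product_def)
    fix a f g assume f: "f \<in> hom C a b" and g: "g \<in> hom C a b"
    have all: "(\<forall>i\<in>{..<2::nat}. R i) \<longleftrightarrow> R 0 \<and> R 1" for R
      by (auto simp: less_2_cases_iff)
    have "\<exists>!k. k \<in> hom C a P \<and> (\<forall>i\<in>{..<2}. \<pi> i \<cdot> k = (if i = 0 then f else g))"
      by (rule is_product_factor[OF P hom_Obj(1)[OF f]]) (use f g in simp)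
    then show "\<exists>!k. k \<in> hom C a P \<and> \<pi> 0 \<cdot> k = f \<and> \<pi> 1 \<cdot> k = g" unfolding all by simp
  qed
  obtain j where j: "j \<in> hom C q P" "\<pi> 0 \<cdot> j = l" "\<pi> 1 \<cdot> j = r" using univ[OF l r] by blast
  obtain i where i: "i \<in> hom C P q" "l \<cdot> i = \<pi> 0" "r \<cdot> i = \<pi> 1" using q_univ[OF \<pi>] by blast
  have PO: "P \<in> Obj C" "q \<in> Obj C" using hom_Obj[OF j(1)] by auto
  have "j \<cdot> i = Idt C P"
  proof -
    have "j \<cdot> i \<in> hom C P P" "Idt C P \<in> hom C P P" using Comp_in_hom i j Idt_in_hom PO by auto
    moreover have "\<pi> 0 \<cdot> (j \<cdot> i) = \<pi> 0" "\<pi> 1 \<cdot> (j \<cdot> i) = \<pi> 1"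
      using Comp_assoc[OF i(1) j(1) \<pi>(1)] Comp_assoc[OF i(1) j(1) \<pi>(2)] i j by simp_all
    moreover have "\<pi> 0 \<cdot> Idt C P = \<pi> 0" "\<pi> 1 \<cdot> Idt C P = \<pi> 1" using Comp_Idt_right \<pi> by auto
    ultimately show ?thesis using univ[OF \<pi>] by blast
  qed
  moreover have "i \<cdot> j = Idt C q"
  proof -
    have "i \<cdot> j \<in> hom C q q" "Idt C q \<in> hom C q q" using Comp_in_hom i j Idt_in_hom PO by auto
    moreover have "l \<cdot> (i \<cdot> j) = l" "r \<cdot> (i \<cdot> j) = r"
      using Comp_assoc[OF j(1) i(1) l] Comp_assoc[OF j(1) i(1) r] i j by simp_all
    moreover have "l \<cdot> Idt C q = l" "r \<cdot> Idt C q = r" using Comp_Idt_right l r by auto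
    ultimately show ?thesis using q_univ[OF l r] by blast
  qed
  ultimately have "is_iso C j" using i j by (intro is_isoI[of j i]) (auto simp: hom_def)
  then show thesis using that j by blast
qed

end

text \<open>The functors enter the construction only through the two carrier sets, so their values
  off the carriers do not matter. This allows \<open>Proj\<close> in place of the restricted functor
  of \<open>to_base\<close>.\<close>

lemma fibre_product_cong:
  assumes "\<And>x. x \<in> TObj A \<Longrightarrow> on_obj p x = on_obj p' x" "\<And>a. a \<in> TArr A \<Longrightarrow> on_arr p a = on_arr p' a"
    "\<And>x. x \<in> TObj C \<Longrightarrow> on_obj v x = on_obj v' x" "\<And>a. a \<in> TArr C \<Longrightarrow> on_arr v a = on_arr v' a"
  shows "fibre_product A C p v = fibre_product A C p' v'"
  using assms unfolding fibre_product_def by (auto intro!: Collect_cong)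

lemma is_isofibration_cong:
  assumes "\<And>x. x \<in> Obj A \<Longrightarrow> on_obj p x = on_obj p' x" "\<And>a. a \<in> Arr A \<Longrightarrow> on_arr p a = on_arr p' a"
  shows "is_isofibration A B p \<longleftrightarrow> is_isofibration A B p'"
proof -
  have "is_iso A \<alpha> \<and> Dom A \<alpha> = a \<and> on_arr p \<alpha> = \<beta> \<longleftrightarrow> is_iso A \<alpha> \<and> Dom A \<alpha> = a \<and> on_arr p' \<alpha> = \<beta>"
    for a \<alpha> \<beta> using assms(2) by (auto simp: is_iso_def)
  then show ?thesis using assms(1) by (simp add: is_isofibration_def)
qed

context fibrations
begin

lemma in_isofibrationsI:
  assumes "u \<in> hom (Fib E) F G" "is_isofibration (Total F) (Total G) (Fun u)"
  shows "u \<in> isofibrations E"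
  using assms by (auto simp: isofibrations_def hom_def)

end

section \<open>The axioms for bicovering maps and isofibrations\<close>

locale fibrations_on_site = site E J + fibrations E
  for E :: "('u::infinite, 'u) precategory" and J
begin

lemma site_functorI: "u \<in> hom (Fib E) F G \<Longrightarrow> site_functor E J F G (Fun u)"
  by (intro site_functor.intro site_axioms Fib_homD)

lemma in_bicovering_maps:
  "u \<in> hom (Fib E) F G \<Longrightarrow> u \<in> bicovering_maps E J \<longleftrightarrow> is_bicovering E J F G (Fun u)"
  by (auto simp: bicovering_maps_def hom_def)

lemma functor_triangleI:
  assumes "u \<in> hom (Fib E) F G" "v \<in> hom (Fib E) G H"
  shows "functor_triangle E J F G H (Fun u) (Fun v) (Fun (v \<cdot>\<^bsub>Fib E\<^esub> u))"
proof -
  have "Src u = F" using assms by (simp add: hom_def)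
  then show ?thesis
    using site_functorI[OF assms(1)] site_functorI[OF assms(2)]
      site_functorI[OF Comp_in_hom_Fib[OF assms]]
    by (intro functor_triangle.intro functor_triangle_axioms.intro) auto
qed

lemma bicovering_maps_comp:
  assumes "u \<in> hom (Fib E) F G" "v \<in> hom (Fib E) G H" "u \<in> bicovering_maps E J" "v \<in> bicovering_maps E J"
  shows "v \<cdot>\<^bsub>Fib E\<^esub> u \<in> bicovering_maps E J"
  using functor_triangle.bicovering_comp[OF functor_triangleI[OF assms(1,2)]] assms(3,4)
    in_bicovering_maps assms(1,2) Comp_in_hom_Fib[OF assms(1,2)] by blast

lemma bicovering_maps_cancel_left:
  assumes "u \<in> hom (Fib E) F G" "v \<in> hom (Fib E) G H" "v \<in> bicovering_maps E J"
    "v \<cdot>\<^bsub>Fib E\<^esub> u \<in> bicovering_maps E J"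
  shows "u \<in> bicovering_maps E J"
  using functor_triangle.bicovering_cancel_left[OF functor_triangleI[OF assms(1,2)]] assms(3,4)
    in_bicovering_maps assms(1,2) Comp_in_hom_Fib[OF assms(1,2)] by blast

lemma bicovering_maps_cancel_right:
  assumes "u \<in> hom (Fib E) F G" "v \<in> hom (Fib E) G H" "u \<in> bicovering_maps E J"
    "v \<cdot>\<^bsub>Fib E\<^esub> u \<in> bicovering_maps E J"
  shows "v \<in> bicovering_maps E J"
  using functor_triangle.bicovering_cancel_right[OF functor_triangleI[OF assms(1,2)]] assms(3,4)
    in_bicovering_maps assms(1,2) Comp_in_hom_Fib[OF assms(1,2)] by blast

lemma iso_is_bicovering:
  assumes "is_iso (Fib E) u"
  shows "u \<in> bicovering_maps E J"
proof -
  obtain v where v: "u \<in> Arr (Fib E)" "v \<in> Arr (Fib E)" "Src v = Tgt u" "Tgt v = Src u"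
    "\<And>x. x \<in> TObj (Src u) \<Longrightarrow> on_obj (Fun v) (on_obj (Fun u) x) = x"
    "\<And>a. a \<in> TArr (Src u) \<Longrightarrow> on_arr (Fun v) (on_arr (Fun u) a) = a"
    "\<And>x. x \<in> TObj (Tgt u) \<Longrightarrow> on_obj (Fun u) (on_obj (Fun v) x) = x"
    "\<And>a. a \<in> TArr (Tgt u) \<Longrightarrow> on_arr (Fun u) (on_arr (Fun v) a) = a"
    using Fib_isoE[OF assms] by metis
  have u: "u \<in> hom (Fib E) (Src u) (Tgt u)" using v by (simp add: hom_def)
  interpret u: site_functor E J "Src u" "Tgt u" "Fun u" by (rule site_functorI[OF u])
  interpret v: cartesian_functor E "Tgt u" "Src u" "Fun v" using Fib_ArrD[OF v(2)] v(3,4) by simp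
  have "is_bicovering E J (Src u) (Tgt u) (Fun u)"
  proof (rule u.bicovering_of_equivalence)
    show "a = b" if "a \<in> TArr (Src u)" "b \<in> TArr (Src u)" "on_arr (Fun u) a = on_arr (Fun u) b" for a b
      using v(6) that by metis
    fix x x' w assume "x \<in> TObj (Src u)" "x' \<in> TObj (Src u)" "w \<in> TArr (Tgt u)"
      "TDom (Tgt u) w = on_obj (Fun u) x" "TCod (Tgt u) w = on_obj (Fun u) x'"
    then show "\<exists>a\<in>TArr (Src u). TDom (Src u) a = x \<and> TCod (Src u) a = x' \<and> on_arr (Fun u) a = w"
      using v by (intro bexI[of _ "on_arr (Fun v) w"]) simp_all
  next
    fix y assume "y \<in> TObj (Tgt u)"
    then show "\<exists>x\<in>TObj (Src u). on_obj (Fun u) x = y"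
      using v by (intro bexI[of _ "on_obj (Fun v) y"]) simp_all
  qed
  then show ?thesis using in_bicovering_maps[OF u] by simp
qed

text \<open>A triangle in \<open>functor_triangle\<close> commutes only on the carriers, so
  \<open>u'\<close> counts as the composite of \<open>u\<close> with an identity, and stability
  under composition applies.\<close>

lemma is_bicovering_cong:
  fixes F G :: "('u, 'u, 'u, 'u) fibration"
  assumes u: "cartesian_functor E F G u" and "is_bicovering E J F G u"
    and "\<And>x. x \<in> TObj F \<Longrightarrow> on_obj u' x = on_obj u x" "\<And>a. a \<in> TArr F \<Longrightarrow> on_arr u' a = on_arr u a"
  shows "is_bicovering E J F G u'"
proof -
  interpret u: cartesian_functor E F G u by (rule u)
  let ?i = "Idt (Fib E) F"
  have i: "?i \<in> hom (Fib E) F F" using u.src.is_fibration by (intro Fib.Idt_in_hom) simp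
  have u': "cartesian_functor E F G u'" by (rule cartesian_functor_cong[OF u]) (use assms(3,4) in auto)
  interpret functor_triangle E J F F G "Fun ?i" u u'
    using site_functorI[OF i] site_functor.intro[OF site_axioms u] site_functor.intro[OF site_axioms u'] assms(3,4)
    by (intro functor_triangle.intro functor_triangle_axioms.intro) (simp_all add: Fib_Idt)
  have "is_iso (Fib E) ?i" using u.src.is_fibration by (intro Fib.is_iso_Idt) simp
  then show ?thesis
    using bicovering_comp assms(2) iso_is_bicovering in_bicovering_maps[OF i] by blast
qed

text \<open>Two cartesian functors that agree in \<open>B\<close> pair to a cartesian functor,
  because a pair of cartesian arrows is cartesian; uniqueness holds since a pair is determined by
  its components.\<close>

lemma pullback_of_isofibration:
  assumes p: "p \<in> isofibrations E" and v: "v \<in> Arr (Fib E)" and pv: "Tgt v = Tgt p"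
  defines "Q \<equiv> fibre_product (Src p) (Src v) (Fun p) (Fun v)"
  shows "is_pullback (Fib E) p v (fib_arrow Q (Src p) left left) (fib_arrow Q (Src v) right right)"
    and "fib_arrow Q (Src v) right right \<in> isofibrations E"
    and "p \<in> bicovering_maps E J \<Longrightarrow> fib_arrow Q (Src v) right right \<in> bicovering_maps E J"
proof -
  have p': "p \<in> Arr (Fib E)" "is_isofibration (Total (Src p)) (Total (Tgt p)) (Fun p)"
    using p by (auto simp: isofibrations_def)
  interpret P: cartesian_functor E "Src p" "Tgt p" "Fun p" by (rule Fib_ArrD[OF p'(1)])
  interpret V: cartesian_functor E "Src v" "Tgt p" "Fun v" using Fib_ArrD[OF v] pv by simp
  interpret isofibration_pullback E "Src p" "Tgt p" "Src v" "Fun p" "Fun v"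
    by unfold_locales (fact p'(2))
  have l: "fib_arrow Q (Src p) left left \<in> hom (Fib E) Q (Src p)"
    unfolding Q_def by (rule fib_arrow_in_hom[OF left_cartesian_functor])
  have r: "fib_arrow Q (Src v) right right \<in> hom (Fib E) Q (Src v)"
    unfolding Q_def by (rule fib_arrow_in_hom[OF right_cartesian_functor])
  have ph: "p \<in> hom (Fib E) (Src p) (Tgt p)" and vh: "v \<in> hom (Fib E) (Src v) (Tgt p)"
    using p'(1) v pv by (simp_all add: hom_def)
  show "is_pullback (Fib E) p v (fib_arrow Q (Src p) left left) (fib_arrow Q (Src v) right right)"
    unfolding is_pullback_def
  proof (intro conjI allI ballI impI)
    show "p \<cdot>\<^bsub>Fib E\<^esub> fib_arrow Q (Src p) left left = v \<cdot>\<^bsub>Fib E\<^esub> fib_arrow Q (Src v) right right"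
      by (rule Fib_arrow_eqI)
        (use homD[OF Comp_in_hom_Fib[OF l ph]] homD[OF Comp_in_hom_Fib[OF r vh]] pv in \<open>simp_all add: Q_def\<close>)
    fix X f g assume "f \<in> hom (Fib E) X (Dom (Fib E) p)" "g \<in> hom (Fib E) X (Dom (Fib E) v)"
      and eq: "p \<cdot>\<^bsub>Fib E\<^esub> f = v \<cdot>\<^bsub>Fib E\<^esub> g"
    then have f: "f \<in> hom (Fib E) X (Src p)" and g: "g \<in> hom (Fib E) X (Src v)" by simp_all
    interpret f: cartesian_functor E X "Src p" "Fun f" by (rule Fib_homD[OF f])
    interpret g: cartesian_functor E X "Src v" "Fun g" by (rule Fib_homD[OF g])
    have fX: "Src f = X" and gX: "Src g = X" using f g by (auto simp: hom_def)
    have eo: "on_obj (Fun p) (on_obj (Fun f) x) = on_obj (Fun v) (on_obj (Fun g) x)" if "x \<in> TObj X" for x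
      using Fib_Comp_simps(1)[of x f p] Fib_Comp_simps(1)[of x g v] that fX gX eq by simp
    have ea: "on_arr (Fun p) (on_arr (Fun f) a) = on_arr (Fun v) (on_arr (Fun g) a)" if "a \<in> TArr X" for a
      using Fib_Comp_simps(2)[of a f p] Fib_Comp_simps(2)[of a g v] that fX gX eq by simp
    define k where "k = fib_arrow X Q (\<lambda>x. pr (on_obj (Fun f) x) (on_obj (Fun g) x))
        (\<lambda>a. pr (on_arr (Fun f) a) (on_arr (Fun g) a))"
    have k: "k \<in> hom (Fib E) X Q"
      unfolding k_def Q_def
      by (rule fib_arrow_in_hom[OF pair_cartesian_functor[OF Fib_homD[OF f] Fib_homD[OF g] eo ea]])
    show "\<exists>!k. k \<in> hom (Fib E) X (Dom (Fib E) (fib_arrow Q (Src p) left left)) \<and>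
        fib_arrow Q (Src p) left left \<cdot>\<^bsub>Fib E\<^esub> k = f \<and> fib_arrow Q (Src v) right right \<cdot>\<^bsub>Fib E\<^esub> k = g"
    proof (rule ex1I[of _ k])
      have "fib_arrow Q (Src p) left left \<cdot>\<^bsub>Fib E\<^esub> k = f"
        by (rule Fib_arrow_eqI)
          (use homD[OF Comp_in_hom_Fib[OF k l]] homD[OF f] eo ea in \<open>simp_all add: k_def Q_def\<close>)
      moreover have "fib_arrow Q (Src v) right right \<cdot>\<^bsub>Fib E\<^esub> k = g"
        by (rule Fib_arrow_eqI)
          (use homD[OF Comp_in_hom_Fib[OF k r]] homD[OF g] eo ea in \<open>simp_all add: k_def Q_def\<close>)
      ultimately show "k \<in> hom (Fib E) X (Dom (Fib E) (fib_arrow Q (Src p) left left)) \<and>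
        fib_arrow Q (Src p) left left \<cdot>\<^bsub>Fib E\<^esub> k = f \<and> fib_arrow Q (Src v) right right \<cdot>\<^bsub>Fib E\<^esub> k = g"
        using k by simp
    next
      fix j assume j: "j \<in> hom (Fib E) X (Dom (Fib E) (fib_arrow Q (Src p) left left)) \<and>
        fib_arrow Q (Src p) left left \<cdot>\<^bsub>Fib E\<^esub> j = f \<and> fib_arrow Q (Src v) right right \<cdot>\<^bsub>Fib E\<^esub> j = g"
      then have jh: "j \<in> hom (Fib E) X Q" and jl: "fib_arrow Q (Src p) left left \<cdot>\<^bsub>Fib E\<^esub> j = f"
        and jr: "fib_arrow Q (Src v) right right \<cdot>\<^bsub>Fib E\<^esub> j = g" by simp_all
      interpret j: cartesian_functor E X Q "Fun j" by (rule Fib_homD[OF jh])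
      have sj: "Src j = X" using jh by (simp add: hom_def)
      have jo: "left (on_obj (Fun j) x) = on_obj (Fun f) x" "right (on_obj (Fun j) x) = on_obj (Fun g) x"
        if x: "x \<in> TObj X" for x
        using Fib_Comp_simps(1)[of x j "fib_arrow Q (Src p) left left"]
          Fib_Comp_simps(1)[of x j "fib_arrow Q (Src v) right right"] x sj jl jr by simp_all
      have ja: "left (on_arr (Fun j) x) = on_arr (Fun f) x" "right (on_arr (Fun j) x) = on_arr (Fun g) x"
        if x: "x \<in> TArr X" for x
        using Fib_Comp_simps(2)[of x j "fib_arrow Q (Src p) left left"]
          Fib_Comp_simps(2)[of x j "fib_arrow Q (Src v) right right"] x sj jl jr by simp_all
      have "on_obj (Fun j) x = on_obj (Fun k) x" if "x \<in> TObj X" for x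
        by (rule pairing_eqI) (use jo[OF that] that in \<open>simp_all add: k_def\<close>)
      moreover have "on_arr (Fun j) x = on_arr (Fun k) x" if "x \<in> TArr X" for x
        by (rule pairing_eqI) (use ja[OF that] that in \<open>simp_all add: k_def\<close>)
      ultimately show "j = k"
        by (intro Fib_arrow_eqI) (use homD[OF jh] homD[OF k] in simp_all)
    qed
  qed (use p'(1) v pv homD[OF l] homD[OF r] in simp_all)
  show "fib_arrow Q (Src v) right right \<in> isofibrations E"
    by (rule in_isofibrationsI[OF r])
      (use right_isofibration[folded Q_def] is_isofibration_cong[of "Total Q" "\<lparr>on_obj = right, on_arr = right\<rparr>"
          "Fun (fib_arrow Q (Src v) right right)"] in simp)
  assume pb: "p \<in> bicovering_maps E J"
  interpret bicovering_pullback E J "Src p" "Tgt p" "Src v" "Fun p" "Fun v"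
    by unfold_locales (use pb in \<open>simp add: bicovering_maps_def\<close>)
  have "is_bicovering E J Q (Src v) (Fun (fib_arrow Q (Src v) right right))"
    by (rule is_bicovering_cong[OF right_cartesian_functor[folded Q_def] right_bicovering[folded Q_def]]) simp_all
  then show "fib_arrow Q (Src v) right right \<in> bicovering_maps E J"
    using in_bicovering_maps[OF r] by simp
qed

lemma binary_product_Fib:
  assumes A: "is_fibration E A" and B: "is_fibration E B"
  defines "Q \<equiv> fibre_product A B (Proj A) (Proj B)"
  shows "Fib.binary_product A B Q (fib_arrow Q A left left) (fib_arrow Q B right right)"
proof -
  have "fibre_product A B (Fun (to_base A)) (Fun (to_base B)) = Q"
    unfolding Q_def by (rule fibre_product_cong) simp_all
  then have "is_pullback (Fib E) (to_base A) (to_base B) (fib_arrow Q A left left) (fib_arrow Q B right right)"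
    using pullback_of_isofibration(1)[OF to_base_isofibration[OF A], of "to_base B"]
      homD[OF to_base_in_hom[OF B]] by simp
  from Fib.binary_product_of_pullback[OF terminal_base to_base_in_hom[OF A] to_base_in_hom[OF B] this]
  show ?thesis by simp
qed

text \<open>The constant path functor is bicovering by cancellation: the source functor is
  bicovering and retracts it to an identity. The second factor is the isofibration onto the
  constructed product followed by an isomorphism to \<open>P\<close>.\<close>

lemma diagonal_factorization:
  assumes b: "is_fibration E b" and P: "is_product (Fib E) {..<2::nat} (\<lambda>_. b) P \<pi>"
    and d: "d \<in> hom (Fib E) b P" "\<And>i. i < 2 \<Longrightarrow> \<pi> i \<cdot>\<^bsub>Fib E\<^esub> d = Idt (Fib E) b"
  shows "\<exists>b' s q. s \<in> hom (Fib E) b b' \<and> q \<in> hom (Fib E) b' P \<and> s \<in> bicovering_maps E J \<and>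
    q \<in> isofibrations E \<and> q \<cdot>\<^bsub>Fib E\<^esub> s = d"
proof -
  interpret path_object E b using b by (simp add: path_object_def fibration_over_iff)
  define Q where "Q = fibre_product b b (Proj b) (Proj b)"
  let ?l = "fib_arrow Q b left left" and ?r = "fib_arrow Q b right right"
  have Q: "Fib.binary_product b b Q ?l ?r"
    unfolding Q_def by (rule binary_product_Fib[OF b b])
  then have l: "?l \<in> hom (Fib E) Q b" and r: "?r \<in> hom (Fib E) Q b"
    by (auto simp: Fib.binary_product_def)
  obtain j where j: "is_iso (Fib E) j" "j \<in> hom (Fib E) Q P" "\<pi> 0 \<cdot>\<^bsub>Fib E\<^esub> j = ?l" "\<pi> 1 \<cdot>\<^bsub>Fib E\<^esub> j = ?r"
    using Fib.binary_product_iso[OF Q P] .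
  have \<pi>: "\<pi> 0 \<in> hom (Fib E) P b" "\<pi> 1 \<in> hom (Fib E) P b" using P by (auto simp: is_product_def)
  define s where "s = fib_arrow b H (on_obj (constant_path b)) (on_arr (constant_path b))"
  define e where "e = fib_arrow H b (on_obj (path_source b)) (on_arr (path_source b))"
  \<comment> \<open>Source and target together; composed with the constant paths, both components
    are identities, so that the result is a diagonal.\<close>
  define \<kappa> where "\<kappa> = fib_arrow H Q (\<lambda>\<theta>. pr (TDom b \<theta>) (TCod b \<theta>)) (\<lambda>z. pr (mid z) (target_arrow b z))"
  have s: "s \<in> hom (Fib E) b H"
    unfolding s_def by (rule fib_arrow_in_hom, rule cartesian_functor_cong[OF constant_path_functor]) simp_all
  have e: "e \<in> hom (Fib E) H b"
    unfolding e_def by (rule fib_arrow_in_hom, rule cartesian_functor_cong[OF path_source_functor]) simp_all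
  interpret base_proj: cartesian_functor E b base_fibration "Proj b" by (rule Proj_cartesian_functor[OF b])
  interpret sq: isofibration_pullback E b base_fibration b "Proj b" "Proj b"
  proof unfold_locales
    have "is_isofibration (Total b) (Total base_fibration) (Fun (to_base b))"
      using to_base_isofibration[OF b] by (simp add: isofibrations_def)
    then show "is_isofibration (Total b) (Total base_fibration) (Proj b)"
      by (subst is_isofibration_cong[of _ _ "Fun (to_base b)"]) simp_all
  qed
  interpret src: cartesian_functor E H b "path_source b" by (rule path_source_functor)
  interpret tgt: cartesian_functor E H b "path_target b" by (rule path_target_functor)
  have \<kappa>: "\<kappa> \<in> hom (Fib E) H Q"
    unfolding \<kappa>_def Q_def
    by (rule fib_arrow_in_hom, rule cartesian_functor_cong[OF sq.pair_cartesian_functor[OF path_source_functor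
          path_target_functor]])
      (use src.base_Fun tgt.base_Fun in simp_all)
  have es: "e \<cdot>\<^bsub>Fib E\<^esub> s = Idt (Fib E) b"
    by (rule Fib_arrow_eqI)
      (use homD[OF Comp_in_hom_Fib[OF s e]] homD[OF Fib.Idt_in_hom[of b]] b in \<open>simp_all add: s_def e_def Fib_Idt\<close>)
  have "is_bicovering E J H b (Fun e)"
    by (rule is_bicovering_cong[OF path_source_functor path_source_bicovering[OF site_axioms]])
      (simp_all add: e_def)
  then have "e \<in> bicovering_maps E J" using in_bicovering_maps[OF e] by simp
  moreover have "e \<cdot>\<^bsub>Fib E\<^esub> s \<in> bicovering_maps E J"
    unfolding es using b by (intro iso_is_bicovering Fib.is_iso_Idt) simp
  ultimately have sW: "s \<in> bicovering_maps E J" by (rule bicovering_maps_cancel_left[OF s e])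
  have "is_isofibration (Total H) (Total Q) (Fun \<kappa>)"
    using path_isofibration[folded Q_def]
    by (subst is_isofibration_cong) (simp_all add: \<kappa>_def)
  then have \<kappa>F: "\<kappa> \<in> isofibrations E" by (rule in_isofibrationsI[OF \<kappa>])
  have Tk: "Tgt \<kappa> = Src j" using j \<kappa> by (simp add: hom_def)
  have jF: "j \<cdot>\<^bsub>Fib E\<^esub> \<kappa> \<in> isofibrations E"
    by (rule isofibration_comp[OF \<kappa>F iso_is_isofibration[OF j(1)] Tk])
  have \<kappa>s: "\<kappa> \<cdot>\<^bsub>Fib E\<^esub> s \<in> hom (Fib E) b Q" by (rule Comp_in_hom_Fib[OF s \<kappa>])
  have tc: "target_arrow b (pr (TIdt b (TDom b a)) (pr a (TIdt b (TCod b a)))) = a" if "a \<in> TArr b" for a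
    using target_constant[OF that] by simp
  have l\<kappa>s: "?l \<cdot>\<^bsub>Fib E\<^esub> (\<kappa> \<cdot>\<^bsub>Fib E\<^esub> s) = Idt (Fib E) b"
    by (rule Fib_arrow_eqI)
      (use homD[OF Comp_in_hom_Fib[OF \<kappa>s l]] homD[OF Fib.Idt_in_hom[of b]] b in
        \<open>simp_all add: s_def \<kappa>_def Q_def Fib_Idt tc\<close>)
  have r\<kappa>s: "?r \<cdot>\<^bsub>Fib E\<^esub> (\<kappa> \<cdot>\<^bsub>Fib E\<^esub> s) = Idt (Fib E) b"
    by (rule Fib_arrow_eqI)
      (use homD[OF Comp_in_hom_Fib[OF \<kappa>s r]] homD[OF Fib.Idt_in_hom[of b]] b in
        \<open>simp_all add: s_def \<kappa>_def Q_def Fib_Idt tc\<close>)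
  have q: "j \<cdot>\<^bsub>Fib E\<^esub> \<kappa> \<in> hom (Fib E) H P" by (rule Comp_in_hom_Fib[OF \<kappa> j(2)])
  have qs: "(j \<cdot>\<^bsub>Fib E\<^esub> \<kappa>) \<cdot>\<^bsub>Fib E\<^esub> s = j \<cdot>\<^bsub>Fib E\<^esub> (\<kappa> \<cdot>\<^bsub>Fib E\<^esub> s)"
    by (rule Fib.Comp_assoc[OF s \<kappa> j(2)])
  have qs': "(j \<cdot>\<^bsub>Fib E\<^esub> \<kappa>) \<cdot>\<^bsub>Fib E\<^esub> s \<in> hom (Fib E) b P" by (rule Comp_in_hom_Fib[OF s q])
  have "\<pi> i \<cdot>\<^bsub>Fib E\<^esub> ((j \<cdot>\<^bsub>Fib E\<^esub> \<kappa>) \<cdot>\<^bsub>Fib E\<^esub> s) = Idt (Fib E) b" if "i < 2" for i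
  proof -
    have "\<pi> 0 \<cdot>\<^bsub>Fib E\<^esub> ((j \<cdot>\<^bsub>Fib E\<^esub> \<kappa>) \<cdot>\<^bsub>Fib E\<^esub> s) = Idt (Fib E) b"
      using Fib.Comp_assoc[OF \<kappa>s j(2) \<pi>(1)] l\<kappa>s unfolding qs j(3) by simp
    moreover have "\<pi> 1 \<cdot>\<^bsub>Fib E\<^esub> ((j \<cdot>\<^bsub>Fib E\<^esub> \<kappa>) \<cdot>\<^bsub>Fib E\<^esub> s) = Idt (Fib E) b"
      using Fib.Comp_assoc[OF \<kappa>s j(2) \<pi>(2)] r\<kappa>s unfolding qs j(4) by simp
    ultimately show ?thesis using that by (auto simp: less_2_cases_iff)
  qed
  \<comment> \<open>Uniqueness of arrows into the product identifies the factorization with the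
    given diagonal \<open>d\<close>.\<close>
  moreover have "\<exists>!k. k \<in> hom (Fib E) b P \<and> (\<forall>i\<in>{..<2}. \<pi> i \<cdot>\<^bsub>Fib E\<^esub> k = Idt (Fib E) b)"
    by (rule Fib.is_product_factor[OF P]) (use b in \<open>simp_all add: Fib.Idt_in_hom\<close>)
  ultimately have "(j \<cdot>\<^bsub>Fib E\<^esub> \<kappa>) \<cdot>\<^bsub>Fib E\<^esub> s = d"
    using qs' d unfolding Ball_def lessThan_iff by blast
  then show ?thesis using s q sW jF by blast
qed

end

theorem proposition40:
  fixes E :: "('u::infinite, 'u) precategory" and J :: "'u \<Rightarrow> 'u set set"
  assumes "site E J"
  shows "category_of_fibrant_objects (Fib E) (bicovering_maps E J) (isofibrations E)"
proof -
  interpret site E J by (rule assms)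
  interpret fibrations_on_site E J by unfold_locales
  show ?thesis
  proof (intro category_of_fibrant_objects.intro category_Fib category_of_fibrant_objects_axioms.intro)
    show "bicovering_maps E J \<subseteq> Arr (Fib E)" "isofibrations E \<subseteq> Arr (Fib E)"
      by (auto simp: bicovering_maps_def isofibrations_def)
    show "\<exists>t. is_terminal (Fib E) t" using terminal_base by blast
    show "\<exists>P \<pi>. is_product (Fib E) {..<n} X P \<pi>" if "\<And>i. i < n \<Longrightarrow> X i \<in> Obj (Fib E)" for n :: nat and X
      by (rule Fib.finite_products[OF terminal_base])
        (use that in \<open>auto intro: binary_product_Fib\<close>)
    show "f \<in> bicovering_maps E J" "f \<in> isofibrations E" if "is_iso (Fib E) f" for f
      using iso_is_bicovering[OF that] iso_is_isofibration[OF that] by auto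
    show "g \<cdot>\<^bsub>Fib E\<^esub> f \<in> isofibrations E"
      if "f \<in> hom (Fib E) a b" "g \<in> hom (Fib E) b c" "f \<in> isofibrations E" "g \<in> isofibrations E" for f g a b c
      using isofibration_comp[OF that(3,4)] that(1,2) by (simp add: hom_def)
    show "\<exists>v' p'. is_pullback (Fib E) p v v' p'"
      if "p \<in> isofibrations E" "v \<in> Arr (Fib E)" "Cod (Fib E) v = Cod (Fib E) p" for p v
      using pullback_of_isofibration(1)[of p v] that by auto
    show pb: "p' \<in> isofibrations E" if pull: "is_pullback (Fib E) p v v' p'" and p: "p \<in> isofibrations E" for p v v' p'
    proof -
      note d = Fib.is_pullbackD[OF pull]
      have pv: "Tgt v = Tgt p" using d by simp
      \<comment> \<open>The given pullback differs from the strict fibre product by an isomorphism,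
        and isomorphisms are isofibrations.\<close>
      obtain i where "is_iso (Fib E) i" "i \<in> hom (Fib E) (Dom (Fib E) p')
          (Dom (Fib E) (fib_arrow (fibre_product (Src p) (Src v) (Fun p) (Fun v)) (Src v) right right))"
        "p' = fib_arrow (fibre_product (Src p) (Src v) (Fun p) (Fun v)) (Src v) right right \<cdot>\<^bsub>Fib E\<^esub> i"
        using Fib.pullback_iso[OF pullback_of_isofibration(1)[OF p d(2) pv] pull] .
      then show ?thesis
        using isofibration_comp[OF iso_is_isofibration pullback_of_isofibration(2)[OF p d(2) pv]]
        by (simp add: hom_def)
    qed
    show "p' \<in> bicovering_maps E J \<inter> isofibrations E"
      if pull: "is_pullback (Fib E) p v v' p'" and "p \<in> bicovering_maps E J \<inter> isofibrations E" for p v v' p'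
    proof -
      have p: "p \<in> isofibrations E" "p \<in> bicovering_maps E J" using that(2) by auto
      note d = Fib.is_pullbackD[OF pull]
      have pv: "Tgt v = Tgt p" using d by simp
      let ?r = "fib_arrow (fibre_product (Src p) (Src v) (Fun p) (Fun v)) (Src v) right right"
      obtain i where i: "is_iso (Fib E) i" "i \<in> hom (Fib E) (Dom (Fib E) p') (Dom (Fib E) ?r)"
        "p' = ?r \<cdot>\<^bsub>Fib E\<^esub> i"
        using Fib.pullback_iso[OF pullback_of_isofibration(1)[OF p(1) d(2) pv] pull] .
      have r: "?r \<in> bicovering_maps E J" by (rule pullback_of_isofibration(3)[OF p(1) d(2) pv p(2)])
      then have "?r \<in> hom (Fib E) (Dom (Fib E) ?r) (Src v)" by (simp add: bicovering_maps_def hom_def)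
      from bicovering_maps_comp[OF i(2) this iso_is_bicovering[OF i(1)] r]
      show ?thesis using pb[OF pull p(1)] i(3) by simp
    qed
    show "\<exists>b' s q. s \<in> hom (Fib E) b b' \<and> q \<in> hom (Fib E) b' P \<and> s \<in> bicovering_maps E J \<and>
        q \<in> isofibrations E \<and> q \<cdot>\<^bsub>Fib E\<^esub> s = d"
      if "b \<in> Obj (Fib E)" "is_product (Fib E) {..<2} (\<lambda>_. b) P \<pi>" "d \<in> hom (Fib E) b P"
        "\<And>i. i < (2::nat) \<Longrightarrow> \<pi> i \<cdot>\<^bsub>Fib E\<^esub> d = Idt (Fib E) b" for b P \<pi> d
      using diagonal_factorization[OF _ that(2,3,4)] that(1) by simp
  qed (fact bicovering_maps_comp bicovering_maps_cancel_left bicovering_maps_cancel_right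
      terminal_isofibration)+
qed

end
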